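(* Let $m\geq 1$ be an integer and let $\lambda$ be a partition of $m$ with parts $\lambda_1\geq\lambda_2\geq\cdots$. For $n\geq m+\lambda_1$, let $\pi_{\lambda,n}$ be the irreducible complex representation of the symmetric group $S_n$ corresponding to the partition $\lambda^{(n)}=(n-m,\lambda_1,\lambda_2,\ldots)$ of $n$, and let $\chi_{\lambda,n}\colon S_n\to\mathbb{C}$ be its character. Let $X_n$ be a uniformly distributed random permutation in $S_n$. Then the sequence $(\chi_{\lambda,n}(X_n))_{n\geq m+\lambda_1}$ converges in law, as $n\to+\infty$, to a spectral measure of the simple object $x_{\lambda,t}$ of the Deligne–Knop category $\mathcal{C}_t=\underline{\mathrm{Rep}}(S_t)$ over $\mathbb{C}(t)$ associated to the partition $\lambda$, relative to the invariant $i(M)=\dim_{\mathbb{C}(t)}\mathrm{Hom}_{\mathcal{C}_t}(1_t,M)$, where $1_t$ is the unit object of $\mathcal{C}_t$.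
   Context: Spectral measures. Let $\mathcal{C}$ be a symmetric monoidal category with a duality functor $D$, and let $i$ be a map from the set of isomorphism classes of objects of $\mathcal{C}$ to $\mathbb{C}$. A spectral measure of an object $M$ relative to $i$ is a positive measure $\mu$ on $\mathbb{C}$ such that $\int_{\mathbb{C}}z^a\bar z^b\,d\mu(z)=i(M^{\otimes a}\otimes D(M)^{\otimes b})$ for all integers $a,b\geq 0$. The category $\underline{\mathrm{Rep}}(S_t,K)$. Let $K$ be a field of characteristic zero and $t\in K$. Let $\mathcal{C}^0$ be the $K$-linear category whose objects are the finite sets, with $\mathrm{Hom}(X,Y)$ the $K$-vector space with basis the set partitions of $X\sqcup Y$ (into non-empty blocks). The composition is $K$-bilinear; for a partition $\alpha$ of $X\sqcup Y$ and a partition $\beta$ of $Y\sqcup Z$, it is given by $\beta\circ\alpha=t^{\gamma}\,\beta\odot\alpha$, where, letting $\sim$ be the smallest equivalence relation on $X\sqcup Y\sqcup Z$ containing $\alpha$ and $\beta$, $\beta\odot\alpha$ is the restriction of $\sim$ to $X\sqcup Z$ and $\gamma$ is the number of classes of $\sim$ contained in $Y$. The tensor product is $X\otimes Y=X\sqcup Y$ on objects and disjoint union of partitions on morphisms, with the obvious symmetry and associativity constraints; the unit is $\emptyset$. Every object of $\mathcal{C}^0$ is its own dual, and the transpose of $\alpha\in\mathrm{Hom}(X,Y)$ is the same partition viewed on $Y\sqcup X$. The category $\underline{\mathrm{Rep}}(S_t,K)$ is obtained from $\mathcal{C}^0$ by adding formal finite direct sums (with matrices as morphisms) and then images of idempotents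 (objects are pairs $(X,p)$ with $p\circ p=p$, and $\mathrm{Hom}((X,p),(Y,q))=q\circ\mathrm{Hom}(X,Y)\circ p$), with the induced tensor product and the duality $D(X,p)=(X,{}^tp)$. The image of a finite set $X$ is denoted $[X]$. For $K=\mathbb{C}(t)$ with $t$ the indeterminate, one writes $\underline{\mathrm{Rep}}(S_t)=\mathcal{C}_t$; it is a semisimple tensor category with unit object $1_t=[\emptyset]$. The object $x_{\lambda,t}$. Let $P=\mathrm{End}([\{1,\dots,m\}])$ and let $J\subset P$ be the two-sided ideal of sums of endomorphisms that factor through some $[Y]$ with $|Y|<m$. Sending $\sigma\in S_m$ to the partition of $\{1,\dots,m\}\sqcup\{1',\dots,m'\}$ with blocks $\{i,\sigma(i)'\}$ induces an isomorphism $K[S_m]\cong P/J$. If $t\notin\{0,1,\dots,2m-2\}$ (in particular if $t$ is the indeterminate of $K=\mathbb{C}(t)$), the ideal $J$ has an identity element $e$, which is a central idempotent of $P$, so that $P(1-e)\cong P/J\cong K[S_m]$. Let $c\in K[S_m]$ be a primitive idempotent such that $K[S_m]c$ is the irreducible representation of $S_m$ attached to $\lambda$, and let $c'\in P(1-e)$ be the corresponding idempotent. Then $x_{\lambda,t}=([\{1,\dots,m\}],c')$, which is well-defined up to isomorphism. *)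

theory Defs
  imports
    "HOL-Probability.Probability"
    "HOL-Library.Function_Algebras"
    "HOL-Library.Nat_Bijection"
    "HOL-Library.Disjoint_Sets"
    "HOL-Combinatorics.Permutations"
    "HOL-Computational_Algebra.Polynomial"
    "HOL-Computational_Algebra.Fraction_Field"
begin

section \<open>Spectral measures\<close>

text \<open>
  The data of a monoidal category with duality. The associativity, unit and symmetry constraints are
  not recorded: they only enter the definition of a spectral measure through the fact that
  the bracketing of a tensor product is irrelevant up to isomorphism.
\<close>

record ('o, 'm) tensor_cat =
  Obj :: "'o set"
  Hom :: "'o \<Rightarrow> 'o \<Rightarrow> 'm set"
  Ident :: "'o \<Rightarrow> 'm"
  Comp :: "'o \<Rightarrow> 'o \<Rightarrow> 'o \<Rightarrow> 'm \<Rightarrow> 'm \<Rightarrow> 'm"  \<comment> \<open>\<open>Comp C A B D g f\<close> is \<open>g \<circ> f\<close> for \<open>f : A \<rightarrow> B\<close>, \<open>g : B \<rightarrow> D\<close>\<close>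
  Unit :: "'o"
  Tensor :: "'o \<Rightarrow> 'o \<Rightarrow> 'o"
  Tensor_mor :: "'o \<Rightarrow> 'o \<Rightarrow> 'o \<Rightarrow> 'o \<Rightarrow> 'm \<Rightarrow> 'm \<Rightarrow> 'm"  \<comment> \<open>\<open>Tensor_mor C A A' B B' f g\<close> for \<open>f : A \<rightarrow> A'\<close>, \<open>g : B \<rightarrow> B'\<close>\<close>
  Dual :: "'o \<Rightarrow> 'o"
  Dual_mor :: "'m \<Rightarrow> 'm"

primrec tensor_pow :: "('o, 'm) tensor_cat \<Rightarrow> 'o \<Rightarrow> nat \<Rightarrow> 'o" where
  "tensor_pow C M 0 = Unit C"
| "tensor_pow C M (Suc a) = Tensor C M (tensor_pow C M a)"

definition spectral_measure ::
  "('o, 'm) tensor_cat \<Rightarrow> ('o \<Rightarrow> complex) \<Rightarrow> 'o \<Rightarrow> complex measure \<Rightarrow> bool" where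
  "spectral_measure C i M \<mu> \<longleftrightarrow>
     M \<in> Obj C \<and> sets \<mu> = sets borel \<and>
     (\<forall>a b. integrable \<mu> (\<lambda>z. z ^ a * cnj z ^ b) \<and>
            (\<integral>z. z ^ a * cnj z ^ b \<partial>\<mu>)
              = i (Tensor C (tensor_pow C M a) (tensor_pow C (Dual C M) b)))"

text \<open>Convergence in law; the library's \<open>weak_conv_m\<close> only covers measures on the real line.\<close>

definition converges_in_law :: "(nat \<Rightarrow> complex measure) \<Rightarrow> complex measure \<Rightarrow> bool" where
  "converges_in_law P \<mu> \<longleftrightarrow>
     (\<forall>f :: complex \<Rightarrow> real. continuous_on UNIV f \<and> bounded (range f) \<longrightarrow>
        (\<lambda>n. \<integral>z. f z \<partial>(P n)) \<longlonglongrightarrow> (\<integral>z. f z \<partial>\<mu>))"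


section \<open>Partition morphisms between finite sets\<close>

text \<open>
  Finite sets are finite subsets of \<^typ>\<open>nat\<close>, which serve as a universe closed, via
  \<^const>\<open>sum_encode\<close>, under disjoint unions.  A morphism \<open>X \<rightarrow> Y\<close> is a formal linear combination of
  partitions of \<open>X <+> Y\<close>, i.e. a coefficient function vanishing on everything else.
\<close>

type_synonym spart = "(nat + nat) set set"
type_synonym 'k mor0 = "spart \<Rightarrow> 'k"

definition sparts :: "nat set \<Rightarrow> nat set \<Rightarrow> spart set" where
  "sparts X Y = {\<alpha>. partition_on (X <+> Y) \<alpha>}"

definition hom0 :: "nat set \<Rightarrow> nat set \<Rightarrow> ('k::field) mor0 set" where
  "hom0 X Y = {f. \<forall>\<alpha>. \<alpha> \<notin> sparts X Y \<longrightarrow> f \<alpha> = 0}"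

definition basis0 :: "spart \<Rightarrow> ('k::field) mor0" where
  "basis0 \<alpha> = (\<lambda>\<beta>. if \<beta> = \<alpha> then 1 else 0)"

definition id0 :: "nat set \<Rightarrow> ('k::field) mor0" where
  "id0 X = basis0 ((\<lambda>x. {Inl x, Inr x}) ` X)"

text \<open>
  For \<open>\<alpha> \<in> sparts X Y\<close> and \<open>\<beta> \<in> sparts Y Z\<close>, the classes on \<open>X <+> (Y <+> Z)\<close> of the smallest
  equivalence relation containing both. The relation below is symmetric, and every point lies
  in a block of \<open>\<alpha>\<close> or \<open>\<beta>\<close>, so its transitive closure is that equivalence relation.
\<close>

definition same_block :: "'a set set \<Rightarrow> 'a rel" where
  "same_block P = {(u, v). \<exists>B\<in>P. u \<in> B \<and> v \<in> B}"

definition join_classes :: "spart \<Rightarrow> spart \<Rightarrow> (nat + (nat + nat)) set set" where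
  "join_classes \<alpha> \<beta> =
     (let P = (\<lambda>B. map_sum id Inl ` B) ` \<alpha> \<union> (\<lambda>B. Inr ` B) ` \<beta> in \<Union>P // (same_block P)\<^sup>+)"

text \<open>\<open>spart_comp \<alpha> \<beta>\<close> is \<open>\<beta> \<odot> \<alpha>\<close>, and \<open>loops \<alpha> \<beta>\<close> is the exponent \<open>\<gamma>\<close>.\<close>

definition spart_comp :: "spart \<Rightarrow> spart \<Rightarrow> spart" where
  "spart_comp \<alpha> \<beta> = (\<lambda>C. map_sum id Inr -` C) ` join_classes \<alpha> \<beta> - {{}}"

definition loops :: "spart \<Rightarrow> spart \<Rightarrow> nat" where
  "loops \<alpha> \<beta> = card {C \<in> join_classes \<alpha> \<beta>. C \<subseteq> range (Inr \<circ> Inl)}"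

definition comp0 ::
  "'k \<Rightarrow> nat set \<Rightarrow> nat set \<Rightarrow> nat set \<Rightarrow> ('k::field) mor0 \<Rightarrow> 'k mor0 \<Rightarrow> 'k mor0" where
  "comp0 t X Y Z g f =
     (\<lambda>\<delta>. \<Sum>\<alpha>\<in>sparts X Y. \<Sum>\<beta>\<in>sparts Y Z.
        if spart_comp \<alpha> \<beta> = \<delta> then g \<beta> * f \<alpha> * t ^ loops \<alpha> \<beta> else 0)"

definition dunion :: "nat set \<Rightarrow> nat set \<Rightarrow> nat set" where
  "dunion X Y = sum_encode ` (X <+> Y)"

definition spart_tensor :: "spart \<Rightarrow> spart \<Rightarrow> spart" where
  "spart_tensor \<alpha> \<beta> =
     (\<lambda>B. map_sum (sum_encode \<circ> Inl) (sum_encode \<circ> Inl) ` B) ` \<alpha> \<union>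
     (\<lambda>B. map_sum (sum_encode \<circ> Inr) (sum_encode \<circ> Inr) ` B) ` \<beta>"

definition tensor0 ::
  "nat set \<Rightarrow> nat set \<Rightarrow> nat set \<Rightarrow> nat set \<Rightarrow> ('k::field) mor0 \<Rightarrow> 'k mor0 \<Rightarrow> 'k mor0" where
  "tensor0 X X' Y Y' f g =
     (\<lambda>\<delta>. \<Sum>\<alpha>\<in>sparts X X'. \<Sum>\<beta>\<in>sparts Y Y'. if spart_tensor \<alpha> \<beta> = \<delta> then f \<alpha> * g \<beta> else 0)"

definition transpose0 :: "('k::field) mor0 \<Rightarrow> 'k mor0" where
  "transpose0 f = (\<lambda>\<alpha>. f ((\<lambda>B. case_sum Inr Inl ` B) ` \<alpha>))"


section \<open>The category Rep(S\_t, K)\<close>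

text \<open>
  Formal direct sums are lists of finite sets.  The entry \<open>F i j\<close> of a matrix \<open>F : Xs \<rightarrow> Ys\<close> is a
  morphism \<open>Xs ! j \<rightarrow> Ys ! i\<close>; entries out of range are \<open>0\<close>.
\<close>

type_synonym 'k morm = "nat \<Rightarrow> nat \<Rightarrow> 'k mor0"

definition homm :: "nat set list \<Rightarrow> nat set list \<Rightarrow> ('k::field) morm set" where
  "homm Xs Ys = {F. \<forall>i j. if i < length Ys \<and> j < length Xs
                          then F i j \<in> hom0 (Xs ! j) (Ys ! i) else F i j = 0}"

definition idm :: "nat set list \<Rightarrow> ('k::field) morm" where
  "idm Xs = (\<lambda>i j. if i = j \<and> i < length Xs then id0 (Xs ! i) else 0)"

definition compm ::
  "'k \<Rightarrow> nat set list \<Rightarrow> nat set list \<Rightarrow> nat set list \<Rightarrow> ('k::field) morm \<Rightarrow> 'k morm \<Rightarrow> 'k morm"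
  where
  "compm t Xs Ys Zs G F =
     (\<lambda>i j. if i < length Zs \<and> j < length Xs
            then \<Sum>k<length Ys. comp0 t (Xs ! j) (Ys ! k) (Zs ! i) (G i k) (F k j) else 0)"

text \<open>The summand \<open>dunion (Xs ! i) (Ys ! j)\<close> of the tensor product has index \<open>i * length Ys + j\<close>.\<close>

definition tensor_objm :: "nat set list \<Rightarrow> nat set list \<Rightarrow> nat set list" where
  "tensor_objm Xs Ys = map (\<lambda>(X, Y). dunion X Y) (List.product Xs Ys)"

definition tensorm ::
  "nat set list \<Rightarrow> nat set list \<Rightarrow> nat set list \<Rightarrow> nat set list \<Rightarrow>
     ('k::field) morm \<Rightarrow> 'k morm \<Rightarrow> 'k morm" where
  "tensorm Xs Xs' Ys Ys' F G =
     (\<lambda>r s. if r < length Xs' * length Ys' \<and> s < length Xs * length Ys then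
        (let i = r div length Ys'; i' = r mod length Ys'; j = s div length Ys; j' = s mod length Ys
         in tensor0 (Xs ! j) (Xs' ! i) (Ys ! j') (Ys' ! i') (F i j) (G i' j'))
      else 0)"

definition transposem :: "('k::field) morm \<Rightarrow> 'k morm" where
  "transposem F = (\<lambda>i j. transpose0 (F j i))"

type_synonym 'k rep_obj = "nat set list \<times> 'k morm"

definition Rep_S :: "'k::field \<Rightarrow> ('k rep_obj, 'k morm) tensor_cat" where
  "Rep_S t =
    \<lparr> Obj = {(Xs, p). (\<forall>X\<in>set Xs. finite X) \<and> p \<in> homm Xs Xs \<and> compm t Xs Xs Xs p p = p},
      Hom = (\<lambda>(Xs, p) (Ys, q).
               {compm t Xs Ys Ys q (compm t Xs Xs Ys f p) | f. f \<in> homm Xs Ys}),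
      Ident = snd,
      Comp = (\<lambda>A B D. compm t (fst A) (fst B) (fst D)),
      Unit = ([{}], idm [{}]),
      Tensor = (\<lambda>(Xs, p) (Ys, q). (tensor_objm Xs Ys, tensorm Xs Xs Ys Ys p q)),
      Tensor_mor = (\<lambda>A A' B B'. tensorm (fst A) (fst A') (fst B) (fst B')),
      Dual = (\<lambda>(Xs, p). (Xs, transposem p)),
      Dual_mor = transposem \<rparr>"

definition scale_mor :: "'k::field \<Rightarrow> 'k morm \<Rightarrow> 'k morm" where
  "scale_mor c F = (\<lambda>i j \<alpha>. c * F i j \<alpha>)"

lemma vector_space_scale_mor: "vector_space (scale_mor :: 'k::field \<Rightarrow> _)"
  by unfold_locales (auto simp: scale_mor_def fun_eq_iff algebra_simps)

definition dim_hom_unit :: "'k::field \<Rightarrow> 'k rep_obj \<Rightarrow> complex" where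
  "dim_hom_unit t M = of_nat (vector_space.dim scale_mor (Hom (Rep_S t) (Unit (Rep_S t)) M))"

definition indeterminate :: "complex poly fract" where
  "indeterminate = Fract [:0, 1:] 1"


section \<open>Representations of symmetric groups\<close>

text \<open>\<open>K[S\<^sub>n]\<close>, as functions on \<open>S\<^sub>n\<close> extended by \<open>0\<close>; note that \<open>*\<close> on functions is pointwise.\<close>

type_synonym 'k galg = "(nat \<Rightarrow> nat) \<Rightarrow> 'k"

definition Sym :: "nat \<Rightarrow> (nat \<Rightarrow> nat) set" where
  "Sym n = {\<sigma>. \<sigma> permutes {1..n}}"

definition grp_alg :: "nat \<Rightarrow> ('k::field) galg set" where
  "grp_alg n = {a. \<forall>\<sigma>. \<sigma> \<notin> Sym n \<longrightarrow> a \<sigma> = 0}"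

definition gmult :: "nat \<Rightarrow> ('k::field) galg \<Rightarrow> 'k galg \<Rightarrow> 'k galg" where
  "gmult n a b = (\<lambda>\<sigma>. if \<sigma> \<in> Sym n then \<Sum>\<tau>\<in>Sym n. a \<tau> * b (inv \<tau> \<circ> \<sigma>) else 0)"

definition gdelta :: "(nat \<Rightarrow> nat) \<Rightarrow> ('k::field) galg" where
  "gdelta \<sigma> = (\<lambda>\<tau>. if \<tau> = \<sigma> then 1 else 0)"

definition left_ideal :: "nat \<Rightarrow> ('k::field) galg \<Rightarrow> 'k galg set" where
  "left_ideal n c = {gmult n a c | a. a \<in> grp_alg n}"

definition module_iso :: "nat \<Rightarrow> ('k::field) galg set \<Rightarrow> 'k galg set \<Rightarrow> bool" where
  "module_iso n V W \<longleftrightarrow>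
     (\<exists>\<phi>. bij_betw \<phi> V W \<and> (\<forall>x\<in>V. \<forall>y\<in>V. \<phi> (x + y) = \<phi> x + \<phi> y) \<and>
          (\<forall>a\<in>grp_alg n. \<forall>x\<in>V. \<phi> (gmult n a x) = gmult n a (\<phi> x)))"

definition idempotent :: "nat \<Rightarrow> ('k::field) galg \<Rightarrow> bool" where
  "idempotent n c \<longleftrightarrow> c \<in> grp_alg n \<and> gmult n c c = c"

definition primitive_idempotent :: "nat \<Rightarrow> ('k::field) galg \<Rightarrow> bool" where
  "primitive_idempotent n c \<longleftrightarrow> idempotent n c \<and> c \<noteq> 0 \<and>
     (\<forall>d d'. idempotent n d \<and> idempotent n d' \<and> gmult n d d' = 0 \<and> gmult n d' d = 0 \<and> c = d + d'
        \<longrightarrow> d = 0 \<or> d' = 0)"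

text \<open>Integer partitions are weakly decreasing lists of positive parts.\<close>

definition int_partition :: "nat list \<Rightarrow> nat \<Rightarrow> bool" where
  "int_partition lam n \<longleftrightarrow> sorted_wrt (\<ge>) lam \<and> 0 \<notin> set lam \<and> sum_list lam = n"

text \<open>
  The irreducible representation attached to \<open>lam\<close> is the left ideal generated by the Young
  symmetrizer (row symmetrizer times column antisymmetrizer) of the tableau filled with
  \<open>1, \<dots>, n\<close> row by row. In this normalisation \<open>[n]\<close> gives the trivial representation.
\<close>

definition tab_entry :: "nat list \<Rightarrow> nat \<Rightarrow> nat \<Rightarrow> nat" where
  "tab_entry lam i j = sum_list (take i lam) + j + 1"

definition tab_row :: "nat list \<Rightarrow> nat \<Rightarrow> nat set" where
  "tab_row lam i = {tab_entry lam i j | j. i < length lam \<and> j < lam ! i}"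

definition tab_col :: "nat list \<Rightarrow> nat \<Rightarrow> nat set" where
  "tab_col lam j = {tab_entry lam i j | i. i < length lam \<and> j < lam ! i}"

definition row_sym :: "nat list \<Rightarrow> ('k::field) galg" where
  "row_sym lam =
     (\<lambda>\<sigma>. if \<sigma> \<in> Sym (sum_list lam) \<and> (\<forall>i. \<sigma> ` tab_row lam i = tab_row lam i) then 1 else 0)"

definition col_antisym :: "nat list \<Rightarrow> ('k::field) galg" where
  "col_antisym lam =
     (\<lambda>\<sigma>. if \<sigma> \<in> Sym (sum_list lam) \<and> (\<forall>j. \<sigma> ` tab_col lam j = tab_col lam j)
          then of_int (sign \<sigma>) else 0)"

definition irrep :: "nat list \<Rightarrow> ('k::field) galg set" where
  "irrep lam = left_ideal (sum_list lam) (gmult (sum_list lam) (row_sym lam) (col_antisym lam))"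

definition scale_galg :: "'k::field \<Rightarrow> 'k galg \<Rightarrow> 'k galg" where
  "scale_galg c a = (\<lambda>\<sigma>. c * a \<sigma>)"

lemma vector_space_scale_galg: "vector_space (scale_galg :: 'k::field \<Rightarrow> _)"
  by unfold_locales (auto simp: scale_galg_def fun_eq_iff algebra_simps)

definition trace_on :: "('k::field) galg set \<Rightarrow> ('k galg \<Rightarrow> 'k galg) \<Rightarrow> 'k" where
  "trace_on V f =
     (let B = (SOME B. B \<subseteq> V \<and> \<not> module.dependent scale_galg B \<and> module.span scale_galg B = V)
      in \<Sum>b\<in>B. module.representation scale_galg B (f b) b)"

definition irr_char :: "nat list \<Rightarrow> (nat \<Rightarrow> nat) \<Rightarrow> complex" where
  "irr_char lam \<sigma> = trace_on (irrep lam) (gmult (sum_list lam) (gdelta \<sigma>))"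

text \<open>
  A partition only if \<open>n \<ge> sum_list lam + hd lam\<close>; smaller \<open>n\<close> do not affect limits as \<open>n\<close> grows.
\<close>

definition padded :: "nat list \<Rightarrow> nat \<Rightarrow> nat list" where
  "padded lam n = (n - sum_list lam) # lam"


section \<open>The simple object attached to a partition\<close>

definition factoring_ideal :: "'k \<Rightarrow> nat \<Rightarrow> ('k::field) mor0 set" where
  "factoring_ideal t m =
     {sum_list fs | fs. set fs \<subseteq>
        {comp0 t {1..m} Y {1..m} g f | g f Y.
           finite Y \<and> card Y < m \<and> f \<in> hom0 {1..m} Y \<and> g \<in> hom0 Y {1..m}}}"

definition ideal_identity :: "'k \<Rightarrow> nat \<Rightarrow> ('k::field) mor0 \<Rightarrow> bool" where
  "ideal_identity t m e \<longleftrightarrow> e \<in> factoring_ideal t m \<and>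
     (\<forall>f\<in>factoring_ideal t m.
        comp0 t {1..m} {1..m} {1..m} e f = f \<and> comp0 t {1..m} {1..m} {1..m} f e = f)"

definition perm_part :: "nat \<Rightarrow> (nat \<Rightarrow> nat) \<Rightarrow> spart" where
  "perm_part m \<sigma> = (\<lambda>i. {Inl i, Inr (\<sigma> i)}) ` {1..m}"

definition galg_to_end :: "nat \<Rightarrow> ('k::field) galg \<Rightarrow> 'k mor0" where
  "galg_to_end m c = (\<lambda>\<alpha>. \<Sum>\<sigma>\<in>Sym m. c \<sigma> * basis0 (perm_part m \<sigma>) \<alpha>)"

text \<open>
  \<open>x\<close> is (a model of) \<open>x\<^sub>\<lambda>\<^sub>,\<^sub>t\<close>, for some choice of the primitive idempotent \<open>c\<close>.  The
  idempotent \<open>c'\<close> is the element of \<open>P(1 - e)\<close> with the same class as \<open>c\<close> in \<open>P/J\<close>.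
\<close>

definition is_simple_obj :: "'k::field \<Rightarrow> nat list \<Rightarrow> 'k rep_obj \<Rightarrow> bool" where
  "is_simple_obj t lam x \<longleftrightarrow>
     (let m = sum_list lam; M = {1..m} in
      \<exists>e c c'. ideal_identity t m e \<and>
        primitive_idempotent m c \<and> module_iso m (left_ideal m c) (irrep lam) \<and>
        c' \<in> {comp0 t M M M f (id0 M - e) | f. f \<in> hom0 M M} \<and>
        c' - galg_to_end m c \<in> factoring_ideal t m \<and>
        x = ([M], (\<lambda>i j. if i = 0 \<and> j = 0 then c' else 0)))"

end

theory Submission
 imports Defs "HOL-Combinatorics.Orbits" "HOL-Combinatorics.Combinatorics"
begin

text \<open>
Write \<open>m\<close> for the size of \<open>lam\<close>, \<open>M = {1..m}\<close>, and \<open>y\<close> for the Young symmetrizer of \<open>lam\<close>; then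
\<open>y * y = \<gamma> y\<close> for a nonzero integer \<open>\<gamma>\<close> (\<open>young_norm\<close>).  Characters and dimensions of invariants are
both expressed by one family of class functions on \<open>S\<^sub>n\<close>.  For a permutation \<open>\<sigma>\<close> of \<open>M\<close>, let \<open>Phi\<close>
count the injections \<open>x\<close> of \<open>M\<close> into \<open>{1..n}\<close> with \<open>g o x = x o \<sigma>\<close>, and let \<open>psi \<sigma> g\<close> be the
alternating sum of such counts over all ways to delete cycles of \<open>\<sigma>\<close>.  Put
\<open>Theta g = \<Sum>\<sigma>. y \<sigma> * psi \<sigma> g\<close>.

The key is \<open>sum_prod_psi\<close>: as soon as \<open>n \<ge> k m\<close>, the mean of \<open>psi \<sigma>\<^sub>1 \<cdots> psi \<sigma>\<^sub>k\<close> over \<open>S\<^sub>n\<close> does not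
depend on \<open>n\<close>.  It is the number of partitions of \<open>k\<close> disjoint copies of \<open>M\<close> that are stable under
\<open>(\<sigma>\<^sub>1, ..., \<sigma>\<^sub>k)\<close>, have at most one point of each copy in a block, and have no singleton block.  Indeed a
product of \<open>k\<close> counts \<open>Phi\<close> splits according to which points have the same image, each such pattern
contributes \<open>1\<close> on average by transitivity, and the alternating sum removes singletons.

Characters: let \<open>\<chi>\<close> be the character of the padded shape.  The means of \<open>\<chi>\<^sup>2\<close>, of \<open>(Theta / \<gamma>)\<^sup>2\<close> and of
\<open>\<chi> * Theta / \<gamma>\<close> are all \<open>1\<close>, so \<open>\<chi> = Theta / \<gamma>\<close> for \<open>n \<ge> 2 m\<close> (\<open>irr_char_padded\<close>).  By
\<open>Phi_formula\<close>, \<open>Theta\<close> is a polynomial in the numbers of cycles of lengths \<open>1, ..., m\<close>, and these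
converge jointly to independent Poisson variables of parameters \<open>1 / d\<close> (\<open>cycle_count_limit\<close>).  The
limit measure is the law of that polynomial in the Poisson variables.

Invariants: a partition is determined by the sets that are unions of its blocks, and composing
partitions amounts to multiplying the 0/1 matrices indexed by pairs of subsets that record these sets,
up to a power of 2 that counts the loops (\<open>sat_mat_mult\<close>).  This yields associativity, compatibility with tensor
products, and all the explicit compositions below.  The idempotent \<open>c'\<close> defining the object is
annihilated by the ideal of maps factoring through smaller sets, and so by the two kinds of maps that
merge two points or cut a point off.  Hence, in a mixed tensor power with \<open>k\<close> factors, only the
partitions of \<open>k\<close> copies of \<open>M\<close> described above survive, and only permutations within each copy
contribute to the trace of the projector; the dimension of the invariants becomes a sum over
\<open>(\<sigma>\<^sub>1, ..., \<sigma>\<^sub>k)\<close> of coefficients times the very number in \<open>sum_prod_psi\<close> (\<open>leg_obj_dim\<close>).  Each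
coefficient is \<open>c \<sigma>\<^sub>i\<close> or \<open>c (\<sigma>\<^sub>i\<inverse>)\<close>, and averaging over conjugacy classes replaces \<open>c\<close> by \<open>y / \<gamma>\<close>
because the two left ideals are isomorphic.  So the dimension is the mean of \<open>(Theta / \<gamma>)\<^sup>k\<close> over
\<open>S\<^sub>n\<close> for every \<open>n \<ge> k m\<close> (\<open>mixed_tensor_dim\<close>).  Eventually constant moments converge, and the
bound on the moment of twice the order lets the limit pass through the expectation
(\<open>spectral_moments\<close>).
\<close>

section \<open>Symmetric groups\<close>

lemma finite_Sym [simp]: "finite (Sym n)"
 unfolding Sym_def by (rule finite_permutations) simp

lemma id_Sym [simp]: "id \<in> Sym n" by (simp add: Sym_def permutes_id)
lemma comp_Sym [simp]: "s \<in> Sym n ==> t \<in> Sym n ==> s o t \<in> Sym n"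
 by (simp add: Sym_def permutes_compose)
lemma inv_Sym [simp]: "s \<in> Sym n ==> inv s \<in> Sym n"
 by (simp add: Sym_def permutes_inv)
lemma card_Sym: "card (Sym n) = fact n"
 unfolding Sym_def by (subst card_permutations[of _ n]) auto

lemma Sym_bij: "s \<in> Sym n ==> bij s"
 by (simp add: Sym_def permutes_bij)
lemma Sym_inv_o [simp]: "s \<in> Sym n ==> inv s o s = id"
 by (simp add: Sym_def permutes_inv_o)
lemma Sym_o_inv [simp]: "s \<in> Sym n ==> s o inv s = id"
 by (simp add: Sym_def permutes_inv_o)
lemma Sym_inv_o' [simp]: "s \<in> Sym n ==> inv s o (s o f) = f"
 by (simp add: o_assoc)
lemma Sym_o_inv' [simp]: "s \<in> Sym n ==> s o (inv s o f) = f"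
 by (simp add: o_assoc)
lemma Sym_inv_inv [simp]: "s \<in> Sym n ==> inv (inv s) = s"
 by (simp add: Sym_bij inv_inv_eq)
lemma Sym_inv_comp: "s \<in> Sym n ==> t \<in> Sym n ==> inv (s o t) = inv t o inv s"
 by (simp add: Sym_bij o_inv_distrib)
lemma Sym_range: "s \<in> Sym n ==> x \<in> {1..n} ==> s x \<in> {1..n}"
 unfolding Sym_def by (simp only: mem_Collect_eq permutes_in_image)
lemma Sym_permutation: "s \<in> Sym n ==> permutation s"
 unfolding Sym_def permutation_permutes by (auto intro: exI[of _ "{1..n}"])

lemma sum_Sym_left: "t \<in> Sym n ==> (\<Sum>r\<in>Sym n. f (t o r)) = (\<Sum>r\<in>Sym n. f r)"
 by (rule sum.reindex_bij_witness[of _ "%r. inv t o r" "%r. t o r"]) auto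

lemma sum_Sym_right: "t \<in> Sym n ==> (\<Sum>r\<in>Sym n. f (r o t)) = (\<Sum>r\<in>Sym n. f r)"
 by (rule sum.reindex_bij_witness[of _ "%r. r o inv t" "%r. r o t"]) (auto simp: comp_assoc)

lemma sum_Sym_inv: "(\<Sum>r\<in>Sym n. f (inv r)) = (\<Sum>r\<in>Sym n. f r)"
 by (rule sum.reindex_bij_witness[of _ inv inv]) auto

lemma sum_Sym_conj: "t \<in> Sym n ==> (\<Sum>r\<in>Sym n. f (t o r o inv t)) = (\<Sum>r\<in>Sym n. f r)"
 by (rule sum.reindex_bij_witness[of _ "%r. inv t o r o t" "%r. t o r o inv t"]) (auto simp: comp_assoc)

section \<open>Group algebra\<close>

lemma gmult_in [simp]: "gmult n a b \<in> grp_alg n" by (simp add: gmult_def grp_alg_def)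
lemma gdelta_in [simp]: "s \<in> Sym n ==> gdelta s \<in> grp_alg n" by (auto simp: gdelta_def grp_alg_def)

lemma grp_alg_eqI: "a \<in> grp_alg n ==> b \<in> grp_alg n ==> (\<And>s. s \<in> Sym n ==> a s = b s) ==> a = b"
 unfolding grp_alg_def by (rule ext) (metis (mono_tags, lifting) mem_Collect_eq)

lemma gmult_apply: "s \<in> Sym n ==> gmult n a b s = (\<Sum>t\<in>Sym n. a t * b (inv t o s))"
 by (simp add: gmult_def)

lemma gmult_apply_right: "s \<in> Sym n ==> gmult n a b s = (\<Sum>r\<in>Sym n. a (s o inv r) * b r)"
 unfolding gmult_apply
 by (rule sum.reindex_bij_witness[of _ "%r. s o inv r" "%t. inv t o s"])
  (auto simp: comp_assoc Sym_inv_comp[where n=n])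

lemma gmult_assoc: "gmult n (gmult n a b) c = gmult n a (gmult n b c)"
proof (rule grp_alg_eqI[of _ n])
 fix s assume s: "s \<in> Sym n"
 have "gmult n (gmult n a b) c s = (\<Sum>r\<in>Sym n. \<Sum>t\<in>Sym n. a t * b (inv t o r) * c (inv r o s))"
  using s by (simp add: gmult_apply sum_distrib_right)
 also have "... = (\<Sum>t\<in>Sym n. \<Sum>r\<in>Sym n. a t * b (inv t o r) * c (inv r o s))" by (rule sum.swap)
 also have "... = (\<Sum>t\<in>Sym n. \<Sum>r\<in>Sym n. a t * (b r * c (inv r o (inv t o s))))"
 proof (rule sum.cong[OF refl])
  fix t assume t: "t \<in> Sym n"
  show "(\<Sum>r\<in>Sym n. a t * b (inv t o r) * c (inv r o s)) = (\<Sum>r\<in>Sym n. a t * (b r * c (inv r o (inv t o s))))"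
   using t by (subst sum_Sym_left[OF t, symmetric]) (simp add: Sym_inv_comp comp_assoc mult.assoc)
 qed
 also have "... = gmult n a (gmult n b c) s"
  using s by (simp add: gmult_apply sum_distrib_left)
 finally show "gmult n (gmult n a b) c s = gmult n a (gmult n b c) s" .
qed simp_all

lemma gmult_delta_left: "g \<in> Sym n ==> s \<in> Sym n ==> gmult n (gdelta g) a s = a (inv g o s)"
proof -
 assume g: "g \<in> Sym n" and s: "s \<in> Sym n"
 have "gmult n (gdelta g) a s = (\<Sum>t\<in>Sym n. if t = g then a (inv g o s) else 0)"
  unfolding gmult_apply[OF s] by (rule sum.cong) (auto simp: gdelta_def)
 thus ?thesis using g by simp
qed

lemma gmult_delta_right: "g \<in> Sym n ==> s \<in> Sym n ==> gmult n a (gdelta g) s = a (s o inv g)"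
proof -
 assume g: "g \<in> Sym n" and s: "s \<in> Sym n"
 have "gmult n a (gdelta g) s = (\<Sum>t\<in>Sym n. if t = g then a (s o inv g) else 0)"
  unfolding gmult_apply_right[OF s] by (rule sum.cong) (auto simp: gdelta_def)
 thus ?thesis using g by simp
qed

lemma gmult_delta_delta: "g \<in> Sym n ==> h \<in> Sym n ==> gmult n (gdelta g) (gdelta h) = gdelta (g o h)"
 by (rule grp_alg_eqI[of _ n]) (simp_all add: gmult_delta_left, auto simp: gdelta_def comp_assoc)

lemma gmult_id_left [simp]: "a \<in> grp_alg n ==> gmult n (gdelta id) a = a"
 by (rule grp_alg_eqI[of _ n]) (auto simp: gmult_delta_left)

lemma gmult_id_right [simp]: "a \<in> grp_alg n ==> gmult n a (gdelta id) = a"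
 by (rule grp_alg_eqI[of _ n]) (auto simp: gmult_delta_right)

lemma scale_galg_in [simp]: "a \<in> grp_alg n ==> scale_galg c a \<in> grp_alg n"
 by (simp add: grp_alg_def scale_galg_def)

lemma gmult_scale_left: "gmult n (scale_galg c a) b = scale_galg c (gmult n a b)"
 by (rule ext) (simp add: gmult_def scale_galg_def sum_distrib_left mult.assoc)

lemma gmult_scale_right: "gmult n a (scale_galg c b) = scale_galg c (gmult n a b)"
 by (rule ext) (simp add: gmult_def scale_galg_def sum_distrib_left mult_ac)

lemma gmult_add_left: "gmult n (a + b) c = gmult n a c + gmult n b c"
 by (rule ext) (simp add: gmult_def sum.distrib algebra_simps)

lemma gmult_add_right: "gmult n a (b + c) = gmult n a b + gmult n a c"
 by (rule ext) (simp add: gmult_def sum.distrib algebra_simps)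

text \<open>
Makes a product linear in its middle factor, so that \<open>a * z * b\<close> need only be computed for group elements \<open>z\<close>.
\<close>
lemma gmult_expand_mid:
 "gmult n a (gmult n z b) s = (\<Sum>g\<in>Sym n. z g * gmult n a (gmult n (gdelta g) b) s)"
proof (cases "s \<in> Sym n")
 case True
 have "gmult n a (gmult n z b) s = (\<Sum>t\<in>Sym n. \<Sum>g\<in>Sym n. a t * (z g * gmult n (gdelta g) b (inv t o s)))"
  using True by (simp add: gmult_apply[of _ n a] sum_distrib_left)
   (intro sum.cong refl, simp add: gmult_apply[of _ n z] gmult_delta_left sum_distrib_left)
 also have "... = (\<Sum>g\<in>Sym n. \<Sum>t\<in>Sym n. a t * (z g * gmult n (gdelta g) b (inv t o s)))" by (rule sum.swap)
 also have "... = (\<Sum>g\<in>Sym n. z g * gmult n a (gmult n (gdelta g) b) s)"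
  using True by (simp add: gmult_apply[of _ n a] sum_distrib_left mult_ac)
 finally show ?thesis .
qed (simp add: gmult_def)

text \<open>The anti-involution of the group algebra.\<close>
definition gstar :: "('k::field) galg => 'k galg" where "gstar a = (%s. a (inv s))"

lemma gstar_gmult: "s \<in> Sym n ==> gmult n a b (inv s) = gmult n (gstar b) (gstar a) s"
 unfolding gmult_apply_right[OF inv_Sym] gmult_apply gstar_def
 by (subst sum_Sym_inv[symmetric]) (rule sum.cong, auto simp: Sym_inv_comp[where n=n] mult.commute)

definition class_sum :: "nat => ('k::field) galg => 'k galg" where
 "class_sum n a s = (\<Sum>t\<in>Sym n. a (t o s o inv t))"

text \<open>
Averaging over conjugation is a trace: it cannot tell \<open>a * b\<close> from \<open>b * a\<close>.  This is what makes it insensitive to the choice of an idempotent within its isomorphism class.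
\<close>
lemma class_sum_gmult_commute:
 assumes s: "s \<in> Sym n"
 shows "class_sum n (gmult n a b) s = class_sum n (gmult n b a) s"
proof -
 have "class_sum n (gmult n a b) s = (\<Sum>t\<in>Sym n. \<Sum>r\<in>Sym n. a r * b (inv r o (t o s o inv t)))"
  using s by (simp add: class_sum_def gmult_apply)
 also have "... = (\<Sum>r\<in>Sym n. \<Sum>t\<in>Sym n. a r * b (inv r o (t o s o inv t)))" by (rule sum.swap)
 also have "... = (\<Sum>r\<in>Sym n. \<Sum>t\<in>Sym n. a r * b (t o s o inv t o inv r))"
 proof (rule sum.cong[OF refl])
  fix r assume r: "r \<in> Sym n"
  show "(\<Sum>t\<in>Sym n. a r * b (inv r o (t o s o inv t))) = (\<Sum>t\<in>Sym n. a r * b (t o s o inv t o inv r))"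
   using r by (subst sum_Sym_left[OF r, symmetric]) (simp add: Sym_inv_comp comp_assoc)
 qed
 also have "... = (\<Sum>t\<in>Sym n. \<Sum>r\<in>Sym n. b (t o s o inv t o inv r) * a r)"
  by (subst sum.swap) (simp add: mult.commute)
 also have "... = class_sum n (gmult n b a) s"
  using s by (simp add: class_sum_def gmult_apply_right)
 finally show ?thesis .
qed

lemma class_sum_gstar: "s \<in> Sym n ==> class_sum n (gstar a) s = class_sum n a (inv s)"
 unfolding class_sum_def gstar_def
 by (rule sum.cong) (auto simp: Sym_inv_comp comp_assoc)

lemma class_sum_scale: "class_sum n (scale_galg c a) s = c * class_sum n a s"
 by (simp add: class_sum_def scale_galg_def sum_distrib_left)

text \<open>A class function pairs with an element only through the class sum of that element.\<close>
lemma sum_class_function: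
 fixes a F :: "'k::field_char_0 galg"
 assumes F: "\<And>s t. s \<in> Sym n ==> t \<in> Sym n ==> F (t o s o inv t) = F s"
 shows "(\<Sum>s\<in>Sym n. class_sum n a s * F s) = fact n * (\<Sum>s\<in>Sym n. a s * F s)"
proof -
 have "(\<Sum>s\<in>Sym n. class_sum n a s * F s) = (\<Sum>s\<in>Sym n. \<Sum>t\<in>Sym n. a (t o s o inv t) * F (t o s o inv t))"
  by (rule sum.cong[OF refl]) (simp add: class_sum_def sum_distrib_right F)
 also have "... = (\<Sum>t\<in>Sym n. \<Sum>s\<in>Sym n. a (t o s o inv t) * F (t o s o inv t))" by (rule sum.swap)
 also have "... = (\<Sum>t\<in>Sym n. \<Sum>s\<in>Sym n. a s * F s)"
  by (rule sum.cong[OF refl]) (rule sum_Sym_conj)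
 also have "... = fact n * (\<Sum>s\<in>Sym n. a s * F s)" by (simp add: card_Sym)
 finally show ?thesis .
qed

section \<open>Tableaux\<close>

definition cells :: "nat list => (nat \<times> nat) set" where
 "cells lam = Sigma {..<length lam} (%i. {..<lam ! i})"

definition cell_of :: "nat list => nat => nat \<times> nat" where
 "cell_of lam = inv_into (cells lam) (%(i, j). tab_entry lam i j)"

definition trow :: "nat list => nat => nat" where "trow lam u = fst (cell_of lam u)"
definition tcol :: "nat list => nat => nat" where "tcol lam u = snd (cell_of lam u)"

lemma tab_entry_Cons_0: "tab_entry (a # lam) 0 j = Suc j"
 by (simp add: tab_entry_def)
lemma tab_entry_Cons_Suc: "tab_entry (a # lam) (Suc i) j = a + tab_entry lam i j"
 by (simp add: tab_entry_def)

lemma bij_betw_tab_entry: "bij_betw (%(i, j). tab_entry lam i j) (cells lam) {1..sum_list lam}"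
proof (induction lam)
 case Nil thus ?case by (simp add: cells_def bij_betw_def)
next
 case (Cons a lam)
 let ?f = "%lam. %(i, j). tab_entry lam i j"
 have c: "cells (a # lam) = (%j. (0, j)) ` {..<a} \<union> (%(i, j). (Suc i, j)) ` cells lam" (is "_ = ?A \<union> ?B")
 proof (rule set_eqI)
  fix p :: "nat \<times> nat" obtain i j where p: "p = (i, j)" by (cases p)
  show "p \<in> cells (a # lam) \<longleftrightarrow> p \<in> ?A \<union> ?B"
   unfolding p by (cases i) (auto simp: cells_def image_iff)
 qed
 have "bij_betw (?f (a # lam)) ?A {1..a}"
  by (rule bij_betwI[where g = "%u. (0, u - 1)"]) (auto simp: tab_entry_Cons_0)
 moreover have "bij_betw (?f (a # lam)) ?B {a + 1..a + sum_list lam}"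
 proof -
  have "bij_betw (?f (a # lam) o (%(i, j). (Suc i, j))) (cells lam) {a + 1..a + sum_list lam}"
  proof -
   have "bij_betw ((+) a o ?f lam) (cells lam) {a + 1..a + sum_list lam}"
    by (rule bij_betw_trans[OF Cons.IH]) (auto simp: bij_betw_def inj_on_def image_add_atLeastAtMost)
   moreover have "(+) a o ?f lam = ?f (a # lam) o (%(i, j). (Suc i, j))"
    by (auto simp: tab_entry_Cons_Suc)
   ultimately show ?thesis by simp
  qed
  thus ?thesis unfolding bij_betw_def image_comp by (blast intro: inj_on_imageI)
 qed
 ultimately have "bij_betw (?f (a # lam)) (?A \<union> ?B) ({1..a} \<union> {a + 1..a + sum_list lam})"
  by (rule bij_betw_combine) auto
 moreover have "{1..a} \<union> {a + 1..a + sum_list lam} = {1..sum_list (a # lam)}" by auto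
 ultimately show ?case by (simp add: c)
qed

lemma cell_of_bij: "bij_betw (cell_of lam) {1..sum_list lam} (cells lam)"
 unfolding cell_of_def by (rule bij_betw_inv_into[OF bij_betw_tab_entry])

lemma trow_tcol_entry:
 assumes "i < length lam" "j < lam ! i"
 shows "trow lam (tab_entry lam i j) = i" "tcol lam (tab_entry lam i j) = j"
proof -
 have "cell_of lam (tab_entry lam i j) = (i, j)"
  using bij_betw_inv_into_left[OF bij_betw_tab_entry, of "(i, j)" lam] assms
  by (simp add: cell_of_def cells_def)
 thus "trow lam (tab_entry lam i j) = i" "tcol lam (tab_entry lam i j) = j"
  by (simp_all add: trow_def tcol_def)
qed

lemma tab_entry_in: "i < length lam ==> j < lam ! i ==> tab_entry lam i j \<in> {1..sum_list lam}"
 using bij_betw_apply[OF bij_betw_tab_entry, of "(i, j)" lam] by (simp add: cells_def)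

lemma trow_tcol_bounds:
 assumes "u \<in> {1..sum_list lam}"
 shows "trow lam u < length lam" "tcol lam u < lam ! trow lam u" "tab_entry lam (trow lam u) (tcol lam u) = u"
proof -
 have "cell_of lam u \<in> cells lam" using bij_betw_apply[OF cell_of_bij assms] .
 thus "trow lam u < length lam" "tcol lam u < lam ! trow lam u"
  by (auto simp: cells_def trow_def tcol_def)
 show "tab_entry lam (trow lam u) (tcol lam u) = u"
  using bij_betw_inv_into_right[OF bij_betw_tab_entry assms]
  by (simp add: cell_of_def trow_def tcol_def case_prod_unfold)
qed

lemma trow_tcol_inj:
 assumes "u \<in> {1..sum_list lam}" "v \<in> {1..sum_list lam}" "trow lam u = trow lam v" "tcol lam u = tcol lam v"
 shows "u = v"
proof -
 have "u = tab_entry lam (trow lam u) (tcol lam u)" by (rule trow_tcol_bounds(3)[OF assms(1), symmetric])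
 also have "... = v" unfolding assms(3,4) by (rule trow_tcol_bounds(3)[OF assms(2)])
 finally show ?thesis .
qed

lemma tab_row_eq: "tab_row lam i = {u \<in> {1..sum_list lam}. trow lam u = i}" (is "_ = ?R")
proof
 show "tab_row lam i \<subseteq> ?R"
 proof
  fix u assume "u \<in> tab_row lam i"
  then obtain j where "i < length lam" "j < lam ! i" "u = tab_entry lam i j" unfolding tab_row_def by blast
  thus "u \<in> ?R" using tab_entry_in trow_tcol_entry(1) by simp
 qed
 show "?R \<subseteq> tab_row lam i"
 proof
  fix u assume "u \<in> ?R"
  hence "u \<in> {1..sum_list lam}" "trow lam u = i" by simp_all
  with trow_tcol_bounds[of u lam]
  have "u = tab_entry lam i (tcol lam u) \<and> i < length lam \<and> tcol lam u < lam ! i" by simp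
  thus "u \<in> tab_row lam i" unfolding tab_row_def by blast
 qed
qed

lemma tab_col_eq: "tab_col lam j = {u \<in> {1..sum_list lam}. tcol lam u = j}" (is "_ = ?R")
proof
 show "tab_col lam j \<subseteq> ?R"
 proof
  fix u assume "u \<in> tab_col lam j"
  then obtain i where "i < length lam" "j < lam ! i" "u = tab_entry lam i j" unfolding tab_col_def by blast
  thus "u \<in> ?R" using tab_entry_in trow_tcol_entry(2) by simp
 qed
 show "?R \<subseteq> tab_col lam j"
 proof
  fix u assume "u \<in> ?R"
  hence "u \<in> {1..sum_list lam}" "tcol lam u = j" by simp_all
  with trow_tcol_bounds[of u lam]
  have "u = tab_entry lam (trow lam u) j \<and> trow lam u < length lam \<and> j < lam ! trow lam u" by simp
  thus "u \<in> tab_col lam j" unfolding tab_col_def by blast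
 qed
qed

text \<open>
Permutations that preserve a labelling of the points; with the labels \<open>trow\<close> and \<open>tcol\<close> these are the row and column groups of a tableau.
\<close>
definition label_stab :: "nat => (nat => nat) => (nat => nat) set" where
 "label_stab n f = {s \<in> Sym n. \<forall>u\<in>{1..n}. f (s u) = f u}"

lemma label_stab_iff:
 "s \<in> label_stab n f \<longleftrightarrow> s \<in> Sym n \<and> (\<forall>j. s ` {u \<in> {1..n}. f u = j} = {u \<in> {1..n}. f u = j})"
proof (cases "s \<in> Sym n")
 case True
 have p: "s permutes {1..n}" using True by (simp add: Sym_def)
 show ?thesis
 proof
  assume L: "s \<in> label_stab n f"
  have "s ` {u \<in> {1..n}. f u = j} = {u \<in> {1..n}. f u = j}" for j
  proof (rule endo_inj_surj)
   show "s ` {u \<in> {1..n}. f u = j} \<subseteq> {u \<in> {1..n}. f u = j}"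
    using L Sym_range[OF True] by (auto simp: label_stab_def)
   show "inj_on s {u \<in> {1..n}. f u = j}" using permutes_inj[OF p] by (rule inj_on_subset) simp
  qed simp
  thus "s \<in> Sym n \<and> (\<forall>j. s ` {u \<in> {1..n}. f u = j} = {u \<in> {1..n}. f u = j})" using True by simp
 next
  assume R: "s \<in> Sym n \<and> (\<forall>j. s ` {u \<in> {1..n}. f u = j} = {u \<in> {1..n}. f u = j})"
  show "s \<in> label_stab n f" unfolding label_stab_def
  proof (simp only: mem_Collect_eq, intro conjI ballI)
   fix u assume "u \<in> {1..n}"
   hence "s u \<in> s ` {v \<in> {1..n}. f v = f u}" by blast
   thus "f (s u) = f u" using R by blast
  qed (use R in simp)
 qed
qed (simp add: label_stab_def)

lemma row_sym_eq: "row_sym lam s = (if s \<in> label_stab (sum_list lam) (trow lam) then 1 else 0)"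
 unfolding row_sym_def label_stab_iff tab_row_eq ..

lemma col_antisym_eq:
 "col_antisym lam s = (if s \<in> label_stab (sum_list lam) (tcol lam) then of_int (sign s) else 0)"
 unfolding col_antisym_def label_stab_iff tab_col_eq ..

lemma label_stab_Sym: "s \<in> label_stab n f ==> s \<in> Sym n" by (simp add: label_stab_def)

lemma label_stab_id [simp]: "id \<in> label_stab n f" by (simp add: label_stab_def)

lemma label_stab_comp:
 assumes s: "s \<in> label_stab n f" and t: "\<tau> \<in> label_stab n f"
 shows "s o \<tau> \<in> label_stab n f"
proof -
 have S: "s \<in> Sym n" "\<tau> \<in> Sym n" using s t by (simp_all add: label_stab_def)
 have "f ((s o \<tau>) u) = f u" if u: "u \<in> {1..n}" for u
  using s t Sym_range[OF S(2) u] u by (simp add: label_stab_def)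
 thus ?thesis using comp_Sym[OF S] by (simp add: label_stab_def)
qed

lemma label_stab_inv: "s \<in> label_stab n f ==> inv s \<in> label_stab n f"
proof -
 assume s: "s \<in> label_stab n f"
 hence sy: "s \<in> Sym n" by (rule label_stab_Sym)
 show ?thesis unfolding label_stab_def
 proof (simp only: mem_Collect_eq, intro conjI ballI)
  fix u assume "u \<in> {1..n}"
  hence "inv s u \<in> {1..n}" using Sym_range[OF inv_Sym[OF sy]] by blast
  hence "f (s (inv s u)) = f (inv s u)" using s by (simp add: label_stab_def)
  thus "f (inv s u) = f u" using bij_inv_eq_iff[OF Sym_bij[OF sy]] by metis
 qed (use sy in simp)
qed

lemma label_stab_comp_iff:
 assumes s: "s \<in> label_stab n f" and t: "\<tau> \<in> Sym n"
 shows "s o \<tau> \<in> label_stab n f \<longleftrightarrow> \<tau> \<in> label_stab n f"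
proof
 assume "s o \<tau> \<in> label_stab n f"
 from label_stab_comp[OF label_stab_inv[OF s] this] show "\<tau> \<in> label_stab n f"
  by (simp only: Sym_inv_o'[OF label_stab_Sym[OF s]])
qed (rule label_stab_comp[OF s])

lemma label_stab_comp_iff':
 assumes t: "\<tau> \<in> label_stab n f" and s: "s \<in> Sym n"
 shows "s o \<tau> \<in> label_stab n f \<longleftrightarrow> s \<in> label_stab n f"
proof
 assume "s o \<tau> \<in> label_stab n f"
 from label_stab_comp[OF this label_stab_inv[OF t]] show "s \<in> label_stab n f"
  by (simp only: comp_assoc Sym_o_inv[OF label_stab_Sym[OF t]] comp_id)
qed (rule label_stab_comp[OF _ t])

lemma label_stab_inv_iff:
 assumes s: "s \<in> Sym n" shows "inv s \<in> label_stab n f \<longleftrightarrow> s \<in> label_stab n f"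
proof
 assume "inv s \<in> label_stab n f"
 from label_stab_inv[OF this] show "s \<in> label_stab n f" by (simp only: Sym_inv_inv[OF s])
qed (rule label_stab_inv)

lemma transpose_label_stab:
 assumes "u \<in> {1..n}" "v \<in> {1..n}" "f u = f v"
 shows "Transposition.transpose u v \<in> label_stab n f"
proof -
 have "Transposition.transpose u v \<in> Sym n" unfolding Sym_def using assms permutes_swap_id[of u "{1..n}" v] by simp
 thus ?thesis using assms by (auto simp: label_stab_def Transposition.transpose_def)
qed

lemma label_stab_row_col: "s \<in> label_stab (sum_list lam) (trow lam) ==> s \<in> label_stab (sum_list lam) (tcol lam) ==> s = id"
proof -
 assume a: "s \<in> label_stab (sum_list lam) (trow lam)" "s \<in> label_stab (sum_list lam) (tcol lam)"
 hence s: "s \<in> Sym (sum_list lam)" by (simp add: label_stab_def)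
 have "s u = u" for u
 proof (cases "u \<in> {1..sum_list lam}")
  case True
  thus ?thesis using a Sym_range[OF s True] by (intro trow_tcol_inj[of "s u" lam u]) (auto simp: label_stab_def)
 next
  case False thus ?thesis using s permutes_not_in[of s "{1..sum_list lam}" u] by (simp add: Sym_def)
 qed
 thus ?thesis by (simp add: fun_eq_iff)
qed

text \<open>
The hypothesis says that \<open>h\<inverse>\<close> moves distinct entries of a row to distinct columns.  Hence row \<open>i\<close> has at
most \<open>min (lam ! i) t\<close> entries \<open>u\<close> for which \<open>h\<inverse> u\<close> lies in the first \<open>t\<close> columns.  Summed over the rows both
numbers count the entries of the first \<open>t\<close> columns, so equality holds in every row.  Therefore, in row \<open>i\<close>,
the columns of \<open>h\<inverse> u\<close> are \<open>0, \<dots>, lam ! i - 1\<close> once each, and a row permutation \<open>p\<close> can put them in order.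
\<close>
lemma row_col_factorisation:
 assumes h: "h \<in> Sym (sum_list lam)"
  and sep: "\<And>u v. u \<in> {1..sum_list lam} ==> v \<in> {1..sum_list lam} ==> u \<noteq> v ==> trow lam u = trow lam v
        ==> tcol lam (inv h u) \<noteq> tcol lam (inv h v)"
 shows "\<exists>p\<in>label_stab (sum_list lam) (trow lam). \<exists>q\<in>label_stab (sum_list lam) (tcol lam). h = p o q"
proof -
 let ?n = "sum_list lam"
 let ?N = "{1..?n}"
 define f where "f u = tcol lam (inv h u)" for u
 have ih: "inv h \<in> Sym ?n" by (rule inv_Sym[OF h])
 have rowcard_lt: "card {u\<in>?N. trow lam u = i \<and> tcol lam u < t} = min (lam ! i) t" if i: "i < length lam" for i t
 proof -
  have "bij_betw (tab_entry lam i) {..<min (lam ! i) t} {u\<in>?N. trow lam u = i \<and> tcol lam u < t}"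
  proof (rule bij_betwI[where g = "tcol lam"])
   show "tab_entry lam i \<in> {..<min (lam ! i) t} \<rightarrow> {u\<in>?N. trow lam u = i \<and> tcol lam u < t}"
    using tab_entry_in[OF i] trow_tcol_entry[OF i] by simp
   show "tcol lam \<in> {u\<in>?N. trow lam u = i \<and> tcol lam u < t} \<rightarrow> {..<min (lam ! i) t}"
   proof (rule Pi_I)
    fix u assume "u \<in> {u\<in>?N. trow lam u = i \<and> tcol lam u < t}"
    thus "tcol lam u \<in> {..<min (lam ! i) t}" using trow_tcol_bounds(2)[of u lam] by simp
   qed
   show "tcol lam (tab_entry lam i x) = x" if "x \<in> {..<min (lam ! i) t}" for x
    using that trow_tcol_entry(2)[OF i] by simp
   show "tab_entry lam i (tcol lam u) = u" if "u \<in> {u\<in>?N. trow lam u = i \<and> tcol lam u < t}" for u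
    using that trow_tcol_bounds(3)[of u lam] by simp
  qed
  thus ?thesis using bij_betw_same_card by fastforce
 qed
 have rowcard: "card {u\<in>?N. trow lam u = i} = lam ! i" if i: "i < length lam" for i
 proof -
  have "{u\<in>?N. trow lam u = i} = {u\<in>?N. trow lam u = i \<and> tcol lam u < lam ! i}"
   using trow_tcol_bounds(2) by blast
  thus ?thesis using rowcard_lt[OF i, of "lam ! i"] by simp
 qed
 have inj: "inj_on f {u\<in>?N. trow lam u = i}" for i
  unfolding inj_on_def f_def using sep by blast
 have le: "card {u\<in>?N. trow lam u = i \<and> f u < t} \<le> min (lam ! i) t" if "i < length lam" for i t
 proof -
  have "card {u\<in>?N. trow lam u = i \<and> f u < t} \<le> card {u\<in>?N. trow lam u = i}" by (rule card_mono) auto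
  moreover have "card {u\<in>?N. trow lam u = i \<and> f u < t} \<le> card {..<t}"
   by (rule card_inj_on_le[of f]) (auto intro: inj_on_subset[OF inj[of i]])
  ultimately show ?thesis using rowcard[OF that] by simp
 qed
 have split: "card {u\<in>?N. g u < t} = (\<Sum>i<length lam. card {u\<in>?N. trow lam u = i \<and> g u < t})" for g :: "nat => nat" and t
 proof -
  have "{u\<in>?N. g u < t} = (\<Union>i<length lam. {u\<in>?N. trow lam u = i \<and> g u < t})"
   using trow_tcol_bounds(1) by auto
  hence "card {u\<in>?N. g u < t} = card (\<Union>i<length lam. {u\<in>?N. trow lam u = i \<and> g u < t})" by (rule arg_cong)
  also have "... = (\<Sum>i<length lam. card {u\<in>?N. trow lam u = i \<and> g u < t})"
   by (rule card_UN_disjoint) auto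
  finally show ?thesis .
 qed
 have eqcard: "card {u\<in>?N. f u < t} = card {v\<in>?N. tcol lam v < t}" for t
 proof -
  have hi: "inv h (h v) = v" "h (inv h v) = v" for v
   using Sym_bij[OF h] by (simp_all add: bij_is_inj bij_is_surj surj_f_inv_f)
  have "bij_betw (inv h) {u\<in>?N. f u < t} {v\<in>?N. tcol lam v < t}"
  proof (rule bij_betwI[where g = h])
   show "inv h \<in> {u\<in>?N. f u < t} \<rightarrow> {v\<in>?N. tcol lam v < t}"
    using Sym_range[OF ih] unfolding f_def by blast
   show "h \<in> {v\<in>?N. tcol lam v < t} \<rightarrow> {u\<in>?N. f u < t}"
   proof (rule Pi_I)
    fix v assume "v \<in> {v\<in>?N. tcol lam v < t}"
    thus "h v \<in> {u\<in>?N. f u < t}" using Sym_range[OF h, of v] unfolding f_def by (simp add: hi)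
   qed
  qed (simp_all add: hi)
  thus ?thesis by (rule bij_betw_same_card)
 qed
 have eq: "card {u\<in>?N. trow lam u = i \<and> f u < t} = min (lam ! i) t" if i: "i < length lam" for i t
 proof (rule ccontr)
  assume ne: "card {u\<in>?N. trow lam u = i \<and> f u < t} \<noteq> min (lam ! i) t"
  have lt: "card {u\<in>?N. trow lam u = i \<and> f u < t} < min (lam ! i) t" by (rule le_neq_implies_less[OF le[OF i] ne])
  have "(\<Sum>i<length lam. card {u\<in>?N. trow lam u = i \<and> f u < t}) < (\<Sum>i<length lam. min (lam ! i) t)"
  proof (rule sum_strict_mono_ex1)
   show "\<exists>i\<in>{..<length lam}. card {u\<in>?N. trow lam u = i \<and> f u < t} < min (lam ! i) t"
    using lt i by (intro bexI[of _ i]) simp_all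
  qed (use le in blast)+
  moreover have "(\<Sum>i<length lam. min (lam ! i) t) = (\<Sum>i<length lam. card {u\<in>?N. trow lam u = i \<and> tcol lam u < t})"
   by (rule sum.cong[OF refl]) (rule rowcard_lt[symmetric], simp)
  ultimately show False using split[of f t] split[of "tcol lam" t] eqcard[of t] by linarith
 qed
 have fb: "f u < lam ! trow lam u" if u: "u \<in> ?N" for u
 proof -
  let ?i = "trow lam u"
  have i: "?i < length lam" using trow_tcol_bounds(1)[OF u] .
  have "{v\<in>?N. trow lam v = ?i \<and> f v < lam ! ?i} = {v\<in>?N. trow lam v = ?i}"
  proof (rule card_subset_eq)
   show "card {v\<in>?N. trow lam v = ?i \<and> f v < lam ! ?i} = card {v\<in>?N. trow lam v = ?i}"
    by (simp only: eq[OF i] rowcard[OF i] min.idem)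
  qed auto
  thus ?thesis using u by blast
 qed
 define p where "p u = (if u \<in> ?N then tab_entry lam (trow lam u) (f u) else u)" for u
 have pN: "p u \<in> ?N" and prow: "trow lam (p u) = trow lam u" and pcol: "tcol lam (p u) = f u" if "u \<in> ?N" for u
  using that trow_tcol_bounds(1)[OF that] fb[OF that] tab_entry_in[of "trow lam u" lam "f u"]
   trow_tcol_entry[of "trow lam u" lam "f u"] by (simp_all add: p_def)
 have "inj_on p ?N"
 proof (rule inj_onI)
  fix u v assume uv: "u \<in> ?N" "v \<in> ?N" "p u = p v"
  hence "trow lam u = trow lam v" "f u = f v" using prow pcol by metis+
  thus "u = v" using sep[OF uv(1,2)] by (auto simp: f_def)
 qed
 moreover have "p ` ?N \<subseteq> ?N" using pN by blast
 ultimately have "bij_betw p ?N ?N" by (simp add: bij_betw_def endo_inj_surj)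
 hence "p permutes ?N" by (rule bij_imp_permutes) (simp only: p_def if_False)
 hence pS: "p \<in> Sym ?n" by (simp add: Sym_def)
 have pR: "p \<in> label_stab ?n (trow lam)" using pS prow by (simp add: label_stab_def)
 have "p o h \<in> label_stab ?n (tcol lam)"
 proof -
  have "tcol lam (p (h v)) = tcol lam v" if "v \<in> ?N" for v
   using pcol[OF Sym_range[OF h that]] bij_is_inj[OF Sym_bij[OF h]] by (simp add: f_def inv_f_f)
  thus ?thesis using pS h by (simp add: label_stab_def)
 qed
 moreover have "h = inv p o (p o h)" using pS by simp
 ultimately show ?thesis using label_stab_inv[OF pR] by blast
qed

section \<open>Young symmetrizers\<close>

abbreviation young :: "nat list => ('k::field) galg" where
 "young lam \<equiv> gmult (sum_list lam) (row_sym lam) (col_antisym lam)"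

lemma row_sym_in [simp]: "row_sym lam \<in> grp_alg (sum_list lam)"
 by (simp add: grp_alg_def row_sym_def)
lemma col_antisym_in [simp]: "col_antisym lam \<in> grp_alg (sum_list lam)"
 by (simp add: grp_alg_def col_antisym_def)

lemma row_sym_gdelta:
 assumes p: "p \<in> label_stab (sum_list lam) (trow lam)"
 shows "gmult (sum_list lam) (row_sym lam) (gdelta p) = row_sym lam"
 using label_stab_Sym[OF p]
 by (intro grp_alg_eqI[of _ "sum_list lam"])
  (simp_all add: gmult_delta_right row_sym_eq label_stab_comp_iff'[OF label_stab_inv[OF p]])

lemma gdelta_col_antisym:
 assumes q: "q \<in> label_stab (sum_list lam) (tcol lam)"
 shows "gmult (sum_list lam) (gdelta q) (col_antisym lam) = scale_galg (of_int (sign q)) (col_antisym lam)"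
proof (rule grp_alg_eqI[of _ "sum_list lam"])
 fix s assume "s \<in> Sym (sum_list lam)"
 thus "gmult (sum_list lam) (gdelta q) (col_antisym lam) s = scale_galg (of_int (sign q)) (col_antisym lam) s"
  using label_stab_Sym[OF q]
  by (simp add: gmult_delta_left col_antisym_eq label_stab_comp_iff[OF label_stab_inv[OF q]]
   scale_galg_def sign_compose Sym_permutation[of _ "sum_list lam"] sign_inverse)
qed simp_all

lemma gstar_row_sym: "s \<in> Sym (sum_list lam) ==> gstar (row_sym lam) s = row_sym lam s"
 by (simp add: gstar_def row_sym_eq label_stab_inv_iff)

lemma gstar_col_antisym: "s \<in> Sym (sum_list lam) ==> gstar (col_antisym lam) s = col_antisym lam s"
 by (simp add: gstar_def col_antisym_eq label_stab_inv_iff sign_inverse Sym_permutation[of _ "sum_list lam"])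

lemma gmult_cong:
 "(\<And>s. s \<in> Sym n ==> a s = a' s) ==> (\<And>s. s \<in> Sym n ==> b s = b' s) ==> gmult n a b = gmult n a' b'"
 by (rule ext) (simp add: gmult_def)

text \<open>
If two entries \<open>u, v\<close> of a row come under \<open>h\<inverse>\<close> from one column, the transposition of \<open>u\<close> and \<open>v\<close> is absorbed by
the row sum and, moved past \<open>h\<close>, changes the sign of the column sum, so that the product vanishes.
Otherwise \<open>h = p \<circ> q\<close> with a row permutation \<open>p\<close> and a column permutation \<open>q\<close>, and both are absorbed.
\<close>
lemma young_delta:
 assumes h: "h \<in> Sym (sum_list lam)"
 shows "\<exists>\<zeta>::'k::field_char_0. gmult (sum_list lam) (row_sym lam) (gmult (sum_list lam) (gdelta h) (col_antisym lam))
      = scale_galg \<zeta> (young lam)"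
proof (cases "\<exists>u\<in>{1..sum_list lam}. \<exists>v\<in>{1..sum_list lam}. u \<noteq> v \<and> trow lam u = trow lam v
        \<and> tcol lam (inv h u) = tcol lam (inv h v)")
 case False
 let ?n = "sum_list lam"
 obtain p q where p: "p \<in> label_stab ?n (trow lam)" and q: "q \<in> label_stab ?n (tcol lam)" and hpq: "h = p o q"
  using row_col_factorisation[OF h] False by blast
 have "gdelta h = gmult ?n (gdelta p) (gdelta q :: 'k galg)"
  by (simp add: gmult_delta_delta[OF label_stab_Sym[OF p] label_stab_Sym[OF q]] hpq)
 hence "gmult ?n (row_sym lam) (gmult ?n (gdelta h) (col_antisym lam))
   = gmult ?n (gmult ?n (row_sym lam) (gdelta p)) (gmult ?n (gdelta q) (col_antisym lam :: 'k galg))"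
  by (simp add: gmult_assoc)
 also have "... = scale_galg (of_int (sign q)) (young lam)"
  by (simp add: row_sym_gdelta[OF p] gdelta_col_antisym[OF q] gmult_scale_right)
 finally show ?thesis by blast
next
 case True
 let ?n = "sum_list lam"
 let ?X = "gmult ?n (row_sym lam) (gmult ?n (gdelta h) (col_antisym lam)) :: 'k galg"
 obtain u v where uv: "u \<in> {1..?n}" "v \<in> {1..?n}" "u \<noteq> v" "trow lam u = trow lam v"
  "tcol lam (inv h u) = tcol lam (inv h v)" using True by blast
 define p where "p = Transposition.transpose u v"
 define q where "q = Transposition.transpose (inv h u) (inv h v)"
 have ih: "inv h \<in> Sym ?n" by (rule inv_Sym[OF h])
 have p: "p \<in> label_stab ?n (trow lam)" unfolding p_def by (rule transpose_label_stab[OF uv(1,2,4)])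
 have q: "q \<in> label_stab ?n (tcol lam)" unfolding q_def
  by (rule transpose_label_stab[OF Sym_range[OF ih uv(1)] Sym_range[OF ih uv(2)] uv(5)])
 have bij: "bij h" by (rule Sym_bij[OF h])
 have ne: "inv h u \<noteq> inv h v" using uv(3) bij by (metis bij_inv_eq_iff)
 have "p o h = h o q"
 proof
  fix w show "(p o h) w = (h o q) w"
   using bij bij_inv_eq_iff[OF bij] by (simp add: p_def q_def Transposition.transpose_def) metis
 qed
 hence "gmult ?n (gdelta p) (gdelta h) = gmult ?n (gdelta h) (gdelta q :: 'k galg)"
  using gmult_delta_delta[OF label_stab_Sym[OF p] h] gmult_delta_delta[OF h label_stab_Sym[OF q]] by metis
 hence e: "gmult ?n (gdelta p) (gmult ?n (gdelta h) (col_antisym lam))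
   = gmult ?n (gdelta h) (gmult ?n (gdelta q) (col_antisym lam :: 'k galg))" by (metis gmult_assoc)
 have "sign q = -1" using ne by (simp add: q_def sign_swap_id)
 hence "?X = scale_galg (-1) ?X"
 proof -
  have "?X = gmult ?n (gmult ?n (row_sym lam) (gdelta p)) (gmult ?n (gdelta h) (col_antisym lam))"
   by (simp only: row_sym_gdelta[OF p])
  also have "... = gmult ?n (row_sym lam) (gmult ?n (gdelta h) (gmult ?n (gdelta q) (col_antisym lam)))"
   by (simp only: gmult_assoc e)
  also have "... = scale_galg (-1) ?X"
   by (simp only: gdelta_col_antisym[OF q] gmult_scale_right \<open>sign q = -1\<close> of_int_minus of_int_1)
  finally show ?thesis .
 qed
 hence "?X s = - ?X s" for s by (metis mult_minus1 scale_galg_def)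
 hence "2 * ?X s = 0" for s by (metis add.right_inverse mult_2)
 hence "?X s = 0" for s by simp
 hence "?X = scale_galg 0 (young lam)" by (simp add: scale_galg_def fun_eq_iff)
 thus ?thesis by blast
qed

lemma young_at_id: "(young lam :: 'k::field_char_0 galg) id = 1"
proof -
 let ?n = "sum_list lam"
 have "(young lam :: 'k galg) id = (\<Sum>t\<in>Sym ?n. if t = id then 1 else 0)"
  unfolding gmult_apply[OF id_Sym]
 proof (rule sum.cong[OF refl])
  fix t assume t: "t \<in> Sym ?n"
  have "t \<in> label_stab ?n (trow lam) ==> t \<in> label_stab ?n (tcol lam) ==> t = id"
   by (rule label_stab_row_col)
  thus "row_sym lam t * col_antisym lam (inv t o id) = (if t = id then 1 else (0::'k))"
   using t by (auto simp: row_sym_eq col_antisym_eq label_stab_inv_iff)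
 qed
 thus ?thesis by simp
qed

lemma young_sandwich:
 "\<exists>\<zeta>::'k::field_char_0. gmult (sum_list lam) (row_sym lam) (gmult (sum_list lam) z (col_antisym lam))
      = scale_galg \<zeta> (young lam)"
proof -
 let ?n = "sum_list lam"
 have "\<forall>h\<in>Sym ?n. \<exists>\<zeta>::'k. gmult ?n (row_sym lam) (gmult ?n (gdelta h) (col_antisym lam)) = scale_galg \<zeta> (young lam)"
  using young_delta by blast
 then obtain \<zeta> where z: "\<And>h. h \<in> Sym ?n ==>
   gmult ?n (row_sym lam) (gmult ?n (gdelta h) (col_antisym lam)) = scale_galg (\<zeta> h :: 'k) (young lam)"
  by (auto dest!: bchoice)
 have "gmult ?n (row_sym lam) (gmult ?n z (col_antisym lam)) = scale_galg (\<Sum>h\<in>Sym ?n. z h * \<zeta> h) (young lam)"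
  by (rule ext) (simp add: gmult_expand_mid[of _ _ z] z scale_galg_def sum_distrib_right mult.assoc)
 thus ?thesis by blast
qed

definition young_const :: "nat list => 'k::field" where
 "young_const lam = gmult (sum_list lam) (young lam) (young lam) id"

lemma young_square: "gmult (sum_list lam) (young lam) (young lam) = scale_galg (young_const lam :: 'k::field_char_0) (young lam)"
proof -
 let ?n = "sum_list lam"
 obtain \<zeta> :: 'k where z: "gmult ?n (row_sym lam) (gmult ?n (gmult ?n (col_antisym lam) (row_sym lam)) (col_antisym lam)) = scale_galg \<zeta> (young lam)"
  using young_sandwich by blast
 have e: "gmult ?n (young lam) (young lam) = scale_galg \<zeta> (young lam)" using z by (simp add: gmult_assoc)
 hence "(young_const lam :: 'k) = \<zeta>" by (simp add: young_const_def scale_galg_def young_at_id)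
 thus ?thesis using e by simp
qed

text \<open>
Integral coefficients of the Young symmetrizer, which transport identities between the fields \<open>real\<close>, \<open>complex\<close> and \<open>complex poly fract\<close>.
\<close>
definition young_int :: "nat list => (nat => nat) => int" where
 "young_int lam s = (if s \<in> Sym (sum_list lam) then \<Sum>t\<in>Sym (sum_list lam).
   if t \<in> label_stab (sum_list lam) (trow lam) \<and> inv t o s \<in> label_stab (sum_list lam) (tcol lam)
   then sign (inv t o s) else 0 else 0)"

lemma young_of_int: "young lam s = of_int (young_int lam s)"
 unfolding gmult_def young_int_def
 by (auto simp: of_int_sum row_sym_eq col_antisym_eq intro!: sum.cong)

text \<open>The factor in \<open>young_square\<close>, as an integer.\<close>
definition young_norm :: "nat list => int" where
 "young_norm lam = (\<Sum>t\<in>Sym (sum_list lam). young_int lam t * young_int lam (inv t))"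

lemma young_const_of_int: "young_const lam = of_int (young_norm lam)"
 unfolding young_const_def young_norm_def gmult_apply[OF id_Sym] by (simp add: young_of_int of_int_sum)

text \<open>
For a symmetric element the coefficient of the identity in \<open>a * a\<close> is the sum of the squares of its coefficients.
\<close>
lemma gstar_eq_self_square_zero:
 fixes a :: "real galg"
 assumes a: "\<And>s. s \<in> Sym n ==> a (inv s) = a s" and z: "gmult n a a id = 0" and s: "s \<in> Sym n"
 shows "a s = 0"
proof -
 have "(\<Sum>t\<in>Sym n. (a t)\<^sup>2) = gmult n a a id"
  unfolding gmult_apply[OF id_Sym] by (rule sum.cong) (auto simp: a power2_eq_square)
 hence "(\<Sum>t\<in>Sym n. (a t)\<^sup>2) = 0" using z by simp
 hence "\<forall>t\<in>Sym n. (a t)\<^sup>2 = 0" by (subst (asm) sum_nonneg_eq_0_iff) auto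
 thus ?thesis using s by simp
qed

text \<open>
Let \<open>r\<close> and \<open>k\<close> be the row and column sums.  The element \<open>r * k * r\<close> is symmetric, and its square is a
multiple of \<open>(r * k) * (r * k) * r\<close>; so if the constant vanished, \<open>r * k * r\<close> would be zero at the identity.
But \<open>r * k * r\<close> is, up to a positive factor, \<open>r * k\<close> times its image under the anti-involution, whose
coefficient at the identity is a sum of squares containing \<open>1\<close>.
\<close>
lemma young_const_nonzero_real: "(young_const lam :: real) \<noteq> 0"
proof
 assume z: "(young_const lam :: real) = 0"
 let ?n = "sum_list lam"
 let ?r = "row_sym lam :: real galg" and ?k = "col_antisym lam :: real galg"
 let ?s = "gmult ?n ?r (gmult ?n ?k ?r)"
 have star: "gmult ?n (gmult ?n ?r ?k) ?r (inv s) = gmult ?n (gmult ?n ?r ?k) ?r s" if s: "s \<in> Sym ?n" for s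
 proof -
  have "gmult ?n (gmult ?n ?r ?k) ?r (inv s) = gmult ?n (gstar ?r) (gstar (gmult ?n ?r ?k)) s"
   by (rule gstar_gmult[OF s])
  also have "gmult ?n (gstar ?r) (gstar (gmult ?n ?r ?k)) = gmult ?n ?r (gmult ?n (gstar ?k) (gstar ?r))"
   by (rule gmult_cong) (simp_all add: gstar_row_sym, simp add: gstar_def gstar_gmult[unfolded gstar_def])
  also have "gmult ?n (gstar ?k) (gstar ?r) = gmult ?n ?k ?r"
   by (rule gmult_cong) (simp_all add: gstar_row_sym gstar_col_antisym)
  finally show ?thesis by (simp add: gmult_assoc)
 qed
 have zy: "gmult ?n (young lam) (young lam) = (%_. 0 :: real)"
  using young_square[of lam, where 'k = real] z by (simp add: scale_galg_def)
 have rr: "gmult ?n ?r ?r = scale_galg (real (card (label_stab ?n (trow lam)))) ?r"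
 proof (rule grp_alg_eqI[of _ ?n])
  fix s assume s: "s \<in> Sym ?n"
  have "gmult ?n ?r ?r s = (\<Sum>t\<in>Sym ?n. if t \<in> label_stab ?n (trow lam) then ?r s else 0)"
   unfolding gmult_apply[OF s] using s
   by (intro sum.cong refl) (simp add: row_sym_eq label_stab_comp_iff[OF label_stab_inv])
  also have "... = (\<Sum>t\<in>label_stab ?n (trow lam). ?r s)"
   by (rule sum.mono_neutral_cong_right) (auto simp: label_stab_Sym)
  finally show "gmult ?n ?r ?r s = scale_galg (real (card (label_stab ?n (trow lam)))) ?r s"
   by (simp add: scale_galg_def)
 qed simp_all
 have "gmult ?n ?s ?s = (%_. 0)"
 proof -
  have "gmult ?n ?s ?s = gmult ?n ?r (gmult ?n ?k (gmult ?n (gmult ?n ?r ?r) (gmult ?n ?k ?r)))"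
   by (simp add: gmult_assoc)
  also have "... = scale_galg (real (card (label_stab ?n (trow lam)))) (gmult ?n (gmult ?n (young lam) (young lam)) ?r)"
   by (simp add: rr gmult_scale_left gmult_scale_right gmult_assoc)
  also have "... = (%_. 0)" unfolding zy by (simp add: scale_galg_def gmult_def fun_eq_iff)
  finally show ?thesis .
 qed
 hence s0: "?s id = 0" using gstar_eq_self_square_zero[of ?n ?s id] star by (simp add: gmult_assoc)
 have kk: "gmult ?n ?k ?k = scale_galg (real (card (label_stab ?n (tcol lam)))) ?k"
 proof (rule grp_alg_eqI[of _ ?n])
  fix s assume s: "s \<in> Sym ?n"
  have "gmult ?n ?k ?k s = (\<Sum>t\<in>Sym ?n. if t \<in> label_stab ?n (tcol lam) then ?k s else 0)"
   unfolding gmult_apply[OF s] using s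
   by (intro sum.cong refl) (simp add: col_antisym_eq label_stab_comp_iff[OF label_stab_inv]
    sign_compose Sym_permutation[of _ ?n] sign_inverse flip: of_int_mult mult.assoc)
  also have "... = (\<Sum>t\<in>label_stab ?n (tcol lam). ?k s)"
   by (rule sum.mono_neutral_cong_right) (auto simp: label_stab_Sym)
  finally show "gmult ?n ?k ?k s = scale_galg (real (card (label_stab ?n (tcol lam)))) ?k s"
   by (simp add: scale_galg_def)
 qed simp_all
 have "gmult ?n (young lam) (gmult ?n ?k ?r) id = (\<Sum>t\<in>Sym ?n. (young lam t :: real)\<^sup>2)"
  unfolding gmult_apply[OF id_Sym]
 proof (rule sum.cong[OF refl])
  fix t assume t: "t \<in> Sym ?n"
  have "gmult ?n ?k ?r (inv t o id) = gmult ?n (gstar ?r) (gstar ?k) t" using gstar_gmult[OF t] by simp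
  also have "gmult ?n (gstar ?r) (gstar ?k) = young lam"
   by (rule gmult_cong) (simp_all add: gstar_row_sym gstar_col_antisym)
  finally show "young lam t * gmult ?n ?k ?r (inv t o id) = (young lam t :: real)\<^sup>2"
   by (simp add: power2_eq_square)
 qed
 moreover have "(\<Sum>t\<in>Sym ?n. (young lam t :: real)\<^sup>2) \<ge> (young lam id :: real)\<^sup>2"
  by (rule member_le_sum[OF id_Sym]) auto
 ultimately have "gmult ?n (young lam) (gmult ?n ?k ?r) id \<ge> (1::real)" by (simp add: young_at_id)
 moreover have "gmult ?n (young lam) (gmult ?n ?k ?r) = scale_galg (real (card (label_stab ?n (tcol lam)))) ?s"
 proof -
  have "gmult ?n (young lam) (gmult ?n ?k ?r) = gmult ?n ?r (gmult ?n (gmult ?n ?k ?k) ?r)" by (simp add: gmult_assoc)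
  thus ?thesis by (simp add: kk gmult_scale_left gmult_scale_right)
 qed
 ultimately show False using s0 by (simp add: scale_galg_def)
qed

lemma young_norm_nonzero: "young_norm lam \<noteq> 0"
 using young_const_nonzero_real[of lam] by (auto simp: young_const_of_int)

text \<open>The anti-involution sends \<open>r * k\<close> to \<open>k * r\<close>, which has the same class sum.\<close>
lemma class_sum_young_inv:
 "s \<in> Sym (sum_list lam) ==> class_sum (sum_list lam) (young lam) (inv s) = class_sum (sum_list lam) (young lam :: 'k::field_char_0 galg) s"
proof -
 let ?n = "sum_list lam"
 let ?r = "row_sym lam :: 'k galg" and ?k = "col_antisym lam :: 'k galg"
 assume s: "s \<in> Sym ?n"
 have "class_sum ?n (young lam) (inv s) = class_sum ?n (gstar (gmult ?n ?r ?k)) s"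
  by (rule class_sum_gstar[OF s, symmetric])
 also have "... = class_sum ?n (gmult ?n ?k ?r) s" unfolding class_sum_def
 proof (rule sum.cong[OF refl])
  fix t assume "t \<in> Sym ?n"
  hence w: "t o s o inv t \<in> Sym ?n" using s by simp
  have "gstar (gmult ?n ?r ?k) (t o s o inv t) = gmult ?n (gstar ?k) (gstar ?r) (t o s o inv t)"
   using gstar_gmult[OF w, of ?r ?k] by (simp only: gstar_def)
  also have "gmult ?n (gstar ?k) (gstar ?r) = gmult ?n ?k ?r"
   by (rule gmult_cong) (simp_all add: gstar_row_sym gstar_col_antisym)
  finally show "gstar (gmult ?n ?r ?k) (t o s o inv t) = gmult ?n ?k ?r (t o s o inv t)" .
 qed
 also have "... = class_sum ?n (young lam) s" by (rule class_sum_gmult_commute[OF s])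
 finally show ?thesis .
qed

text \<open>
The orthogonality relation \<open>\<langle>\<chi>, \<chi>\<rangle> = 1\<close> in disguise, since \<open>\<chi>\<close> is the class sum divided by the constant.
It follows from \<open>young_sandwich\<close>, by which \<open>y * t\<inverse> * y\<close> is a multiple of \<open>y\<close>: evaluation at the
identity determines the multiple.
\<close>
lemma young_class_norm:
 "(\<Sum>s\<in>Sym (sum_list lam). young lam s * class_sum (sum_list lam) (young lam) s) = (young_const lam :: 'k::field_char_0)\<^sup>2"
proof -
 let ?n = "sum_list lam" and ?y = "young lam :: 'k galg"
 have "(\<Sum>s\<in>Sym ?n. ?y s * class_sum ?n ?y s) = (\<Sum>s\<in>Sym ?n. ?y s * class_sum ?n ?y (inv s))"
  by (rule sum.cong) (auto simp: class_sum_young_inv)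
 also have "... = (\<Sum>s\<in>Sym ?n. \<Sum>t\<in>Sym ?n. ?y s * ?y (t o inv s o inv t))"
  by (simp add: class_sum_def sum_distrib_left)
 also have "... = (\<Sum>t\<in>Sym ?n. \<Sum>s\<in>Sym ?n. ?y s * ?y (t o inv s o inv t))" by (rule sum.swap)
 also have "... = (\<Sum>t\<in>Sym ?n. young_const lam * (?y t * ?y (inv t)))"
 proof (rule sum.cong[OF refl])
  fix t assume t: "t \<in> Sym ?n"
  let ?c = "inv t"
  have c: "?c \<in> Sym ?n" by (rule inv_Sym[OF t])
  let ?X = "gmult ?n ?y (gmult ?n (gdelta ?c) ?y)"
  have X: "?X w = (\<Sum>s\<in>Sym ?n. ?y s * ?y (t o (inv s o w)))" if w: "w \<in> Sym ?n" for w
   unfolding gmult_apply[OF w] using c t w by (intro sum.cong refl) (simp add: gmult_delta_left)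
  obtain \<zeta> where z: "gmult ?n (row_sym lam) (gmult ?n (gmult ?n (col_antisym lam) (gmult ?n (gdelta ?c) (row_sym lam))) (col_antisym lam)) = scale_galg (\<zeta>::'k) ?y"
   using young_sandwich by blast
  have Xz: "?X = scale_galg \<zeta> ?y" using z by (simp add: gmult_assoc)
  have "\<zeta> = ?X id" using Xz by (simp add: scale_galg_def young_at_id)
  also have "... = (\<Sum>s\<in>Sym ?n. ?y (t o inv s) * ?y s)" unfolding X[OF id_Sym] by (simp add: mult.commute)
  also have "... = gmult ?n ?y ?y t" by (rule gmult_apply_right[OF t, symmetric])
  also have "... = young_const lam * ?y t" by (simp add: young_square scale_galg_def)
  finally have "?X ?c = young_const lam * ?y t * ?y ?c" using Xz by (simp add: scale_galg_def)
  thus "(\<Sum>s\<in>Sym ?n. ?y s * ?y (t o inv s o inv t)) = young_const lam * (?y t * ?y (inv t))"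
   unfolding X[OF c] by (simp add: comp_assoc mult.assoc)
 qed
 also have "... = young_const lam * gmult ?n ?y ?y id"
  by (simp add: gmult_apply sum_distrib_left)
 finally show ?thesis by (simp add: young_const_def power2_eq_square)
qed

section \<open>Equivariant injections\<close>

definition eqv_inj :: "'a set => ('a => 'a) => 'b set => ('b => 'b) => ('a => 'b) set" where
 "eqv_inj A s Y g = {x \<in> A \<rightarrow>\<^sub>E Y. inj_on x A \<and> (\<forall>a\<in>A. g (x a) = x (s a))}"

text \<open>
For the identity \<open>s\<close> this is the permutation character of \<open>S\<^sub>n\<close> on injections of \<open>A\<close>; a general \<open>s\<close> twists it by the action on the source.
\<close>
definition Phi :: "'a set => ('a => 'a) => 'b set => ('b => 'b) => nat" where
 "Phi A s Y g = card (eqv_inj A s Y g)"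

lemma finite_eqv_inj: "finite A ==> finite Y ==> finite (eqv_inj A s Y g)"
 unfolding eqv_inj_def by (rule finite_subset[of _ "A \<rightarrow>\<^sub>E Y"]) (auto intro: finite_PiE)

lemma extend_injection:
 assumes "finite A" "x ` A \<subseteq> {1..n}" "x' ` A \<subseteq> {1..n}" "inj_on x A" "inj_on x' A"
 shows "\<exists>h\<in>Sym n. \<forall>a\<in>A. h (x a) = x' a"
proof -
 define f where "f = x' o inv_into A x"
 have f: "bij_betw f (x ` A) (x' ` A)" unfolding f_def
  by (rule bij_betw_trans[OF bij_betw_inv_into]) (use assms in \<open>auto simp: bij_betw_def\<close>)
 have "card ({1..n} - x ` A) = card ({1..n} - x' ` A)"
  using assms by (simp add: card_Diff_subset card_image)
 then obtain e where e: "bij_betw e ({1..n} - x ` A) ({1..n} - x' ` A)"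
  using finite_same_card_bij[of "{1..n} - x ` A" "{1..n} - x' ` A"] by auto
 define h where "h u = (if u \<in> {1..n} then (if u \<in> x ` A then f u else e u) else u)" for u
 have "bij_betw h {1..n} {1..n}"
 proof -
  have "bij_betw h (x ` A) (x' ` A)"
   using f by (rule bij_betw_cong[THEN iffD1, rotated]) (use assms(2) in \<open>auto simp: h_def\<close>)
  moreover have "bij_betw h ({1..n} - x ` A) ({1..n} - x' ` A)"
   using e by (rule bij_betw_cong[THEN iffD1, rotated]) (auto simp: h_def)
  ultimately have "bij_betw h (x ` A \<union> ({1..n} - x ` A)) (x' ` A \<union> ({1..n} - x' ` A))"
   by (rule bij_betw_combine) auto
  thus ?thesis using assms(2,3) by (simp add: Un_absorb1)
 qed
 hence "h permutes {1..n}" by (rule bij_imp_permutes) (simp only: h_def if_False)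
 moreover have "h (x a) = x' a" if "a \<in> A" for a
  using that assms(2,4) by (auto simp: h_def f_def)
 ultimately show ?thesis unfolding Sym_def by blast
qed

text \<open>Both sets are cosets of stabilizers of injections, and these stabilizers are conjugate.\<close>
lemma card_injections_transitive:
 assumes A: "finite A" and x: "x ` A \<subseteq> {1..n}" "inj_on x A" and y: "y ` A \<subseteq> {1..n}" "inj_on y A"
  and x': "x' ` A \<subseteq> {1..n}" "inj_on x' A" and y': "y' ` A \<subseteq> {1..n}" "inj_on y' A"
 shows "card {g \<in> Sym n. \<forall>a\<in>A. g (x a) = y a} = card {g \<in> Sym n. \<forall>a\<in>A. g (x' a) = y' a}"
proof -
 obtain h where h: "h \<in> Sym n" "\<forall>a\<in>A. h (x a) = x' a" using extend_injection[OF A x(1) x'(1) x(2) x'(2)] by blast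
 obtain k where k: "k \<in> Sym n" "\<forall>a\<in>A. k (y a) = y' a" using extend_injection[OF A y(1) y'(1) y(2) y'(2)] by blast
 have ih: "inv h (x' a) = x a" if "a \<in> A" for a
  using h that bij_inv_eq_iff[OF Sym_bij[OF h(1)]] by metis
 have ik: "inv k (y' a) = y a" if "a \<in> A" for a
  using k that bij_inv_eq_iff[OF Sym_bij[OF k(1)]] by metis
 have "bij_betw (%g. k o g o inv h) {g \<in> Sym n. \<forall>a\<in>A. g (x a) = y a} {g \<in> Sym n. \<forall>a\<in>A. g (x' a) = y' a}"
  by (rule bij_betwI[where g = "%g. inv k o g o h"])
   (use h k ih ik in \<open>auto simp: comp_assoc Sym_range\<close>)
 thus ?thesis by (rule bij_betw_same_card)
qed

text \<open>
Burnside counting: by transitivity, for each injection \<open>x\<close> the number of \<open>g\<close> with \<open>g \<circ> x = x \<circ> s\<close> is the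
order of the group divided by the number of injections.
\<close>
lemma sum_Phi:
 assumes A: "finite A" and c: "card A \<le> n" and s: "bij_betw s A A"
 shows "(\<Sum>g\<in>Sym n. Phi A s {1..n} g) = fact n"
proof -
 let ?I = "{x \<in> A \<rightarrow>\<^sub>E {1..n}. inj_on x A}"
 have finI: "finite ?I" by (rule finite_subset[of _ "A \<rightarrow>\<^sub>E {1..n}"]) (auto intro: finite_PiE A)
 obtain j where j: "j \<in> ?I"
 proof -
  obtain f where "f ` A \<subseteq> {1..n}" "inj_on f A"
   using card_le_inj[OF A, of "{1..n}"] c by auto
  hence "restrict f A \<in> ?I" by (auto simp: inj_on_def)
  thus ?thesis using that by blast
 qed
 have jr: "j ` A \<subseteq> {1..n}" "inj_on j A" using j by (auto simp: PiE_def Pi_def)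
 have rng: "x ` A \<subseteq> {1..n}" "inj_on x A" if "x \<in> ?I" for x using that by (auto simp: PiE_def Pi_def)
 have sA: "s ` A = A" "inj_on s A" using s by (auto simp: bij_betw_def)
 have rngs: "(x o s) ` A \<subseteq> {1..n}" "inj_on (x o s) A" if "x \<in> ?I" for x
  using rng[OF that] sA by (simp_all only: image_comp[symmetric] comp_inj_on) 
 have "(\<Sum>g\<in>Sym n. Phi A s {1..n} g) = (\<Sum>g\<in>Sym n. \<Sum>x\<in>?I. of_bool (\<forall>a\<in>A. g (x a) = x (s a)))"
 proof (rule sum.cong[OF refl])
  fix g
  have "eqv_inj A s {1..n} g = {x \<in> ?I. \<forall>a\<in>A. g (x a) = x (s a)}" by (auto simp: eqv_inj_def)
  thus "Phi A s {1..n} g = (\<Sum>x\<in>?I. of_bool (\<forall>a\<in>A. g (x a) = x (s a)))"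
   unfolding Phi_def using finI by (simp add: Int_def)
 qed
 also have "... = (\<Sum>x\<in>?I. card {g \<in> Sym n. \<forall>a\<in>A. g (x a) = x (s a)})"
  by (subst sum.swap) (simp add: Int_def)
 also have "... = (\<Sum>x\<in>?I. card {g \<in> Sym n. \<forall>a\<in>A. g (j a) = x a})"
 proof (rule sum.cong[OF refl])
  fix x assume x: "x \<in> ?I"
  show "card {g \<in> Sym n. \<forall>a\<in>A. g (x a) = x (s a)} = card {g \<in> Sym n. \<forall>a\<in>A. g (j a) = x a}"
   using card_injections_transitive[OF A rng[OF x] rngs[OF x] jr rng[OF x]] by simp
 qed
 also have "... = card (\<Union>x\<in>?I. {g \<in> Sym n. \<forall>a\<in>A. g (j a) = x a})"
 proof (rule card_UN_disjoint[symmetric])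
  show "\<forall>x\<in>?I. \<forall>y\<in>?I. x \<noteq> y \<longrightarrow> {g \<in> Sym n. \<forall>a\<in>A. g (j a) = x a} \<inter> {g \<in> Sym n. \<forall>a\<in>A. g (j a) = y a} = {}"
  proof (intro ballI impI)
   fix x y assume xy: "x \<in> ?I" "y \<in> ?I" "x \<noteq> y"
   then obtain a where "a \<in> A" "x a \<noteq> y a" by (metis (mono_tags, lifting) PiE_ext mem_Collect_eq)
   thus "{g \<in> Sym n. \<forall>a\<in>A. g (j a) = x a} \<inter> {g \<in> Sym n. \<forall>a\<in>A. g (j a) = y a} = {}" by fastforce
  qed
 qed (use finI in auto)
 also have "(\<Union>x\<in>?I. {g \<in> Sym n. \<forall>a\<in>A. g (j a) = x a}) = Sym n"
 proof -
  have "g \<in> (\<Union>x\<in>?I. {g \<in> Sym n. \<forall>a\<in>A. g (j a) = x a})" if g: "g \<in> Sym n" for g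
  proof -
   have "restrict (g o j) A \<in> ?I"
    using jr Sym_range[OF g] Sym_bij[OF g]
    by (auto simp: inj_on_def bij_def inj_def intro!: restrict_PiE_iff[THEN iffD2])
   thus ?thesis using g by (intro UN_I[of "restrict (g o j) A"]) auto
  qed
  thus ?thesis by auto
 qed
 finally show ?thesis by (simp add: card_Sym)
qed

lemma sum_Phi_zero:
 assumes A: "finite A" and c: "card A > n"
 shows "Phi A s {1..n} g = 0"
proof -
 have "eqv_inj A s {1..n} g = {}"
 proof (rule ccontr)
  assume "eqv_inj A s {1..n} g \<noteq> {}"
  then obtain x where "x \<in> eqv_inj A s {1..n} g" by blast
  hence "x ` A \<subseteq> {1..n}" "inj_on x A" by (auto simp: eqv_inj_def PiE_def Pi_def)
  hence "card A \<le> card {1..n}" by (intro card_inj_on_le[of x]) auto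
  thus False using c by simp
 qed
 thus ?thesis by (simp add: Phi_def)
qed

text \<open>
Exchanges the roles of \<open>g\<close> and \<open>x\<close>: sums over \<open>g\<close> can be carried out for a fixed injection.
\<close>
lemma Phi_as_sum:
 assumes A: "finite A" and Y: "finite Y"
 shows "real (Phi A s Y g) = (\<Sum>x\<in>{x \<in> A \<rightarrow>\<^sub>E Y. inj_on x A}. of_bool (\<forall>a\<in>A. g (x a) = x (s a)))"
proof -
 have "finite {x \<in> A \<rightarrow>\<^sub>E Y. inj_on x A}" by (rule finite_subset[of _ "A \<rightarrow>\<^sub>E Y"]) (auto intro: finite_PiE A Y)
 moreover have "eqv_inj A s Y g = {x \<in> {x \<in> A \<rightarrow>\<^sub>E Y. inj_on x A}. \<forall>a\<in>A. g (x a) = x (s a)}" by (auto simp: eqv_inj_def)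
 ultimately show ?thesis by (simp add: Phi_def Int_def)
qed

section \<open>Cycle counts\<close>

lemma orbit_self: "permutation s ==> a \<in> orbit s a"
 by (rule permutation_self_in_orbit)

lemma orbit_eq: "permutation s ==> b \<in> orbit s a ==> orbit s b = orbit s a"
 by (rule orbit_cyclic_eq3[OF cyclic_on_orbit'])

lemma orbit_subset_stable: "s ` A \<subseteq> A ==> a \<in> A ==> orbit s a \<subseteq> A"
proof
 fix b assume A: "s ` A \<subseteq> A" "a \<in> A" and "b \<in> orbit s a"
 from this(3) show "b \<in> A" by induction (use A in auto)
qed

lemma funpow_eq_iff:
 assumes s: "permutation s"
 shows "(s ^^ i) a = (s ^^ j) a \<longleftrightarrow> i mod card (orbit s a) = j mod card (orbit s a)"
proof -
 let ?n = "funpow_dist1 s a a"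
 have o: "a \<in> orbit s a" by (rule orbit_self[OF s])
 have inj: "inj_on (%n. (s ^^ n) a) {0..<?n}" by (rule inj_on_funpow_dist1[OF o])
 have orb: "orbit s a = (%n. (s ^^ n) a) ` {0..<?n}" by (rule orbit_conv_funpow_dist1[OF o])
 have c: "card (orbit s a) = ?n" unfolding orb using card_image[OF inj] by simp
 have fx: "(s ^^ ?n) a = a" by (rule funpow_dist1_prop[OF o])
 have md: "(s ^^ i) a = (s ^^ (i mod ?n)) a" for i using funpow_mod_eq[OF fx, of i] by (rule sym)
 have pos: "?n > 0" by simp
 have "(s ^^ i) a = (s ^^ j) a \<longleftrightarrow> (s ^^ (i mod ?n)) a = (s ^^ (j mod ?n)) a" using md by metis
 also have "... \<longleftrightarrow> i mod ?n = j mod ?n" by (rule inj_on_eq_iff[OF inj]) (simp_all only: atLeastLessThan_iff pos mod_less_divisor le0 simp_thms)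
 finally show ?thesis by (simp only: c)
qed

lemma orbit_funpow: "permutation s ==> orbit s a = range (%i. (s ^^ i) a)"
 using orbit_altdef_permutation[of s a] by auto

lemma finite_orbit_perm: "permutation s ==> finite (orbit s a)"
 by (rule finite_orbit[OF orbit_self])

lemma card_orbit_pos: "permutation s ==> card (orbit s a) > 0"
 using finite_orbit_perm[of s a] orbit_self[of s a] by (auto simp: card_gt_0_iff)

definition orbs :: "('a => 'a) => 'a set => 'a set set" where "orbs s A = orbit s ` A"

definition ncyc :: "('a => 'a) => 'a set => nat => nat" where
 "ncyc s A d = card {o' \<in> orbs s A. card o' = d}"

lemma orbs_diff:
 assumes s: "permutation s" and a: "a \<in> A"
 shows "orbs s (A - orbit s a) = orbs s A - {orbit s a}"
 unfolding orbs_def using orbit_eq[OF s] orbit_self[OF s] by blast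

lemma stable_diff:
 assumes s: "permutation s" and A: "s ` A \<subseteq> A"
 shows "s ` (A - orbit s a) \<subseteq> A - orbit s a"
proof -
 have "s b \<notin> orbit s a" if "b \<notin> orbit s a" for b
 proof
  assume "s b \<in> orbit s a"
  hence e: "orbit s (s b) = orbit s a" by (rule orbit_eq[OF s])
  have "s b \<in> orbit s b" by (rule orbit.base)
  hence "orbit s (s b) = orbit s b" by (rule orbit_eq[OF s])
  thus False using e that orbit_self[OF s, of b] by blast
 qed
 thus ?thesis using A by blast
qed

lemma ncyc_diff:
 assumes s: "permutation s" and a: "a \<in> A" and A: "finite A"
 shows "ncyc s (A - orbit s a) d = ncyc s A d - (if d = card (orbit s a) then 1 else 0)"
proof -
 have "{o' \<in> orbs s (A - orbit s a). card o' = d} = {o' \<in> orbs s A. card o' = d} - {orbit s a}"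
  unfolding orbs_diff[OF s a] by blast
 moreover have "orbit s a \<in> orbs s A" using a by (simp add: orbs_def)
 ultimately show ?thesis using A by (auto simp: ncyc_def orbs_def card_Diff_singleton_if)
qed

lemma card_orbit_size:
 assumes s: "permutation s" and A: "finite A" "s ` A \<subseteq> A"
 shows "card {a \<in> A. card (orbit s a) = d} = d * ncyc s A d"
proof -
 have "{a \<in> A. card (orbit s a) = d} = \<Union>{o' \<in> orbs s A. card o' = d}"
  unfolding orbs_def using orbit_self[OF s] orbit_subset_stable[OF A(2)] orbit_eq[OF s] by fastforce
 also have "card ... = (\<Sum>o'\<in>{o' \<in> orbs s A. card o' = d}. card o')"
 proof (rule card_Union_disjoint)
  show "disjoint {o' \<in> orbs s A. card o' = d}"
   unfolding orbs_def disjoint_def using orbit_eq[OF s] by blast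
 qed (use finite_orbit_perm[OF s] in \<open>auto simp: orbs_def\<close>)
 also have "... = d * ncyc s A d" by (simp add: ncyc_def)
 finally show ?thesis .
qed

text \<open>
An equivariant injection maps the cycle of \<open>a\<close> onto a cycle of \<open>g\<close> of the same length.  It is determined
there by the image \<open>y\<close> of \<open>a\<close>, and is arbitrary on the remaining cycles.
\<close>
lemma Phi_split_orbit:
 assumes s: "permutation s" and g: "permutation g" and A: "finite A" "s ` A \<subseteq> A" and Y: "finite Y" "g ` Y \<subseteq> Y"
  and a: "a \<in> A"
 shows "Phi A s Y g = (\<Sum>y\<in>{y\<in>Y. card (orbit g y) = card (orbit s a)}. Phi (A - orbit s a) s (Y - orbit g y) g)"
proof -
 let ?O = "orbit s a"
 let ?A = "A - ?O"
 let ?S = "Sigma {y\<in>Y. card (orbit g y) = card ?O} (%y. eqv_inj ?A s (Y - orbit g y) g)"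
 define idx where "idx b = (SOME i. (s ^^ i) a = b)" for b
 have OA: "?O \<subseteq> A" by (rule orbit_subset_stable[OF A(2) a])
 have idx: "(s ^^ idx b) a = b" if "b \<in> ?O" for b
 proof -
  have "\<exists>i. (s ^^ i) a = b" using that unfolding orbit_funpow[OF s] by blast
  thus ?thesis unfolding idx_def by (rule someI_ex)
 qed
 have powA: "(s ^^ i) a \<in> A" for i using OA by (auto simp: orbit_funpow[OF s])
 have Opow: "(s ^^ i) a \<in> ?O" for i by (auto simp: orbit_funpow[OF s])
 have pow: "x ((s ^^ i) a) = (g ^^ i) (x a)" if x: "x \<in> eqv_inj A s Y g" for x i
 proof (induction i)
  case (Suc i)
  have "x ((s ^^ Suc i) a) = g (x ((s ^^ i) a))" using x powA[of i] by (simp add: eqv_inj_def)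
  thus ?case using Suc by simp
 qed simp
 define \<psi> where "\<psi> = (%(y, x') b. if b \<in> ?A then x' b else if b \<in> ?O then (g ^^ idx b) y else undefined)"
 have "bij_betw (%x. (x a, restrict x ?A)) (eqv_inj A s Y g) ?S"
 proof (rule bij_betwI[where g = \<psi>])
  show "(%x. (x a, restrict x ?A)) \<in> eqv_inj A s Y g \<rightarrow> ?S"
  proof (rule Pi_I)
   fix x assume x: "x \<in> eqv_inj A s Y g"
   have xY: "x b \<in> Y" if "b \<in> A" for b using x that by (auto simp: eqv_inj_def)
   have inj: "inj_on x A" using x by (simp add: eqv_inj_def)
   have im: "orbit g (x a) = x ` ?O"
    unfolding orbit_funpow[OF g] orbit_funpow[OF s] image_image pow[OF x] ..
   have "card (orbit g (x a)) = card ?O" unfolding im by (rule card_image[OF inj_on_subset[OF inj OA]])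
   moreover have "x b \<notin> orbit g (x a)" if "b \<in> ?A" for b
    unfolding im using inj that OA by (auto simp: inj_on_def)
   moreover have "s b \<in> ?A" if "b \<in> ?A" for b using stable_diff[OF s A(2), of a] that by blast
   ultimately show "(x a, restrict x ?A) \<in> ?S"
    using xY a x inj by (auto simp: eqv_inj_def inj_on_def)
  qed
  show "\<psi> \<in> ?S \<rightarrow> eqv_inj A s Y g"
  proof (rule Pi_I)
   fix p assume "p \<in> ?S"
   then obtain y x' where p: "p = (y, x')" and y: "y \<in> Y" "card (orbit g y) = card ?O"
    and x': "x' \<in> eqv_inj ?A s (Y - orbit g y) g" by blast
   have iff: "(s ^^ i) a = (s ^^ j) a \<longleftrightarrow> (g ^^ i) y = (g ^^ j) y" for i j
    unfolding funpow_eq_iff[OF s] funpow_eq_iff[OF g] y(2) ..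
   have vA: "\<psi> p b = x' b" if "b \<in> ?A" for b using that by (simp add: \<psi>_def p)
   have vO: "\<psi> p ((s ^^ i) a) = (g ^^ i) y" for i
   proof -
    have "\<psi> p ((s ^^ i) a) = (g ^^ idx ((s ^^ i) a)) y" using Opow[of i] by (simp add: \<psi>_def p)
    also have "... = (g ^^ i) y" using iff idx[OF Opow[of i]] by blast
    finally show ?thesis .
   qed
   have vE: "\<psi> p b = undefined" if "b \<notin> A" for b using that OA by (auto simp: \<psi>_def p)
   have orbY: "(g ^^ i) y \<in> Y" for i
    using orbit_subset_stable[OF Y(2) y(1)] by (auto simp: orbit_funpow[OF g])
   have cases: P if 1: "b \<in> ?A ==> P" and 2: "\<And>i. b = (s ^^ i) a ==> P" and 3: "b \<in> A" for b P
   proof (cases "b \<in> ?O")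
    case True show P by (rule 2[OF idx[OF True, symmetric]])
   qed (use 1 3 in blast)
   have x'Y: "x' b \<in> Y" "x' b \<notin> orbit g y" if "b \<in> ?A" for b using x' that by (auto simp: eqv_inj_def)
   have "\<psi> p b \<in> Y" if "b \<in> A" for b
    by (rule cases[OF _ _ that]) (use vA vO orbY x'Y in auto)
   moreover have "inj_on (\<psi> p) A"
   proof (rule inj_onI)
    fix b c assume bc: "b \<in> A" "c \<in> A" "\<psi> p b = \<psi> p c"
    show "b = c"
    proof (rule cases[OF _ _ bc(1)])
     assume b: "b \<in> ?A"
     show "b = c"
     proof (rule cases[OF _ _ bc(2)])
      assume "c \<in> ?A"
      thus ?thesis using b bc(3) vA x' by (auto simp: eqv_inj_def inj_on_def)
     next
      fix i assume "c = (s ^^ i) a"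
      thus ?thesis using b bc(3) vA vO x'Y(2)[OF b] by (auto simp: orbit_funpow[OF g])
     qed
    next
     fix i assume b: "b = (s ^^ i) a"
     show "b = c"
     proof (rule cases[OF _ _ bc(2)])
      assume c: "c \<in> ?A"
      have "x' c = (g ^^ i) y" using b bc(3) vA[OF c] vO[of i] by simp
      hence "x' c \<in> orbit g y" unfolding orbit_funpow[OF g] by blast
      thus ?thesis using x'Y(2)[OF c] by blast
     next
      fix j assume "c = (s ^^ j) a"
      thus ?thesis using b bc(3) vO iff by metis
     qed
    qed
   qed
   moreover have "g (\<psi> p b) = \<psi> p (s b)" if "b \<in> A" for b
   proof (rule cases[OF _ _ that])
    assume b: "b \<in> ?A"
    hence "s b \<in> ?A" using stable_diff[OF s A(2), of a] by blast
    thus ?thesis using b vA x' by (simp add: eqv_inj_def)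
   next
    fix i assume "b = (s ^^ i) a"
    thus ?thesis using vO[of i] vO[of "Suc i"] by simp
   qed
   ultimately show "\<psi> p \<in> eqv_inj A s Y g" using vE by (auto simp: eqv_inj_def PiE_def extensional_def)
  qed
  show "\<psi> (x a, restrict x ?A) = x" if x: "x \<in> eqv_inj A s Y g" for x
  proof
   fix b
   consider "b \<in> ?A" | "b \<in> ?O" | "b \<notin> A" using OA by blast
   thus "\<psi> (x a, restrict x ?A) b = x b"
   proof cases
    case 2 thus ?thesis using pow[OF x, of "idx b"] idx[OF 2] by (simp add: \<psi>_def)
   next
    case 3 thus ?thesis using x OA by (auto simp: \<psi>_def eqv_inj_def PiE_def extensional_def)
   qed (simp add: \<psi>_def)
  qed
  show "(\<psi> p a, restrict (\<psi> p) ?A) = p" if pS: "p \<in> ?S" for p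
  proof -
   from pS obtain y x' where p: "p = (y, x')" and y: "y \<in> Y" "card (orbit g y) = card ?O"
    and x': "x' \<in> eqv_inj ?A s (Y - orbit g y) g" by blast
   have "(s ^^ idx a) a = (s ^^ 0) a" using idx[OF orbit_self[OF s]] by simp
   hence "(g ^^ idx a) y = (g ^^ 0) y" unfolding funpow_eq_iff[OF s] funpow_eq_iff[OF g] y(2) .
   hence "\<psi> p a = y" using orbit_self[OF s, of a] by (simp add: \<psi>_def p)
   moreover have "restrict (\<psi> p) ?A = x'"
    using x' by (auto simp: \<psi>_def p eqv_inj_def PiE_def extensional_def fun_eq_iff)
   ultimately show ?thesis by (simp add: p)
  qed
 qed
 hence "Phi A s Y g = card ?S" unfolding Phi_def by (rule bij_betw_same_card)
 also have "... = (\<Sum>y\<in>{y\<in>Y. card (orbit g y) = card ?O}. Phi ?A s (Y - orbit g y) g)"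
  unfolding Phi_def by (rule card_SigmaI) (use A Y in \<open>auto intro!: finite_eqv_inj\<close>)
 finally show ?thesis .
qed

text \<open>
Falling factorial, in natural numbers: it is \<open>0\<close> for \<open>k > c\<close> because one of the factors is.
\<close>
definition ff :: "nat => nat => nat" where "ff c k = (\<Prod>i<k. c - i)"

lemma ff_0 [simp]: "ff c 0 = 1" by (simp add: ff_def)
lemma ff_Suc: "ff c (Suc k) = c * ff (c - 1) k"
 unfolding ff_def by (subst prod.lessThan_Suc_shift) simp
lemma ff_binomial: "ff c k = (c choose k) * fact k"
proof (induction k arbitrary: c)
 case (Suc k)
 show ?case
 proof (cases c)
  case (Suc c')
  have "Suc k * (Suc c' choose Suc k) = Suc c' * (c' choose k)" by (rule Suc_times_binomial)
  hence "ff c (Suc k) = Suc k * (c choose Suc k) * fact k"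
   using Suc.IH[of c'] Suc by (simp only: ff_Suc diff_Suc_1 mult.assoc[symmetric])
  thus ?thesis by (simp only: fact_Suc of_nat_id mult_ac)
 qed (simp add: ff_Suc)
qed simp

text \<open>
Cycles of length \<open>d\<close> of \<open>s\<close> go injectively to cycles of length \<open>d\<close> of \<open>g\<close>, each with \<open>d\<close> choices of a
rotation.  So the count is a polynomial in the cycle numbers of \<open>g\<close>.
\<close>
theorem Phi_formula:
 assumes s: "permutation s" and g: "permutation g"
 shows "finite A ==> s ` A \<subseteq> A ==> card A \<le> N ==> finite Y ==> g ` Y \<subseteq> Y ==>
  Phi A s Y g = (\<Prod>d\<in>{1..N}. d ^ ncyc s A d * ff (ncyc g Y d) (ncyc s A d))"
proof (induction "card A" arbitrary: A Y rule: less_induct)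
 case less
 note A = less.prems(1,2) and Y = less.prems(4,5)
 show ?case
 proof (cases "A = {}")
  case True
  thus ?thesis by (simp add: Phi_def eqv_inj_def ncyc_def orbs_def)
 next
  case False
  then obtain a where a: "a \<in> A" by blast
  let ?O = "orbit s a" and ?d = "card (orbit s a)"
  let ?A = "A - ?O"
  have OA: "?O \<subseteq> A" by (rule orbit_subset_stable[OF A(2) a])
  have lt: "card ?A < card A" using A a orbit_self[OF s, of a] by (intro psubset_card_mono) auto
  have dN: "?d \<in> {1..N}" using card_mono[OF A(1) OA] card_orbit_pos[OF s, of a] less.prems(3) by simp
  let ?G = "%d. d ^ ncyc s ?A d * ff (ncyc g Y d - (if d = ?d then 1 else 0)) (ncyc s ?A d)"
  have IH: "Phi ?A s (Y - orbit g y) g = (\<Prod>d\<in>{1..N}. ?G d)" if y: "y \<in> Y" "card (orbit g y) = ?d" for y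
  proof -
   have "Phi ?A s (Y - orbit g y) g = (\<Prod>d\<in>{1..N}. d ^ ncyc s ?A d * ff (ncyc g (Y - orbit g y) d) (ncyc s ?A d))"
    by (rule less.hyps[OF lt]) (use A Y lt less.prems(3) stable_diff[OF s A(2)] stable_diff[OF g Y(2)] in auto)
   thus ?thesis by (simp add: ncyc_diff[OF g y(1) Y(1)] y(2))
  qed
  have "Phi A s Y g = (\<Sum>y\<in>{y\<in>Y. card (orbit g y) = ?d}. (\<Prod>d\<in>{1..N}. ?G d))"
   unfolding Phi_split_orbit[OF s g A Y a] by (rule sum.cong) (use IH in auto)
  also have "... = ?d * ncyc g Y ?d * (\<Prod>d\<in>{1..N}. ?G d)"
   by (simp add: card_orbit_size[OF g Y])
  also have "(\<Prod>d\<in>{1..N}. ?G d) = ?G ?d * (\<Prod>d\<in>{1..N} - {?d}. ?G d)"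
   by (rule prod.remove) (use dN in auto)
  also have "?d * ncyc g Y ?d * (?G ?d * (\<Prod>d\<in>{1..N} - {?d}. ?G d)) =
   (?d * ncyc g Y ?d * ?G ?d) * (\<Prod>d\<in>{1..N} - {?d}. ?G d)" by simp
  also have "?d * ncyc g Y ?d * ?G ?d = ?d ^ ncyc s A ?d * ff (ncyc g Y ?d) (ncyc s A ?d)"
  proof -
   have "?O \<in> {o' \<in> orbs s A. card o' = ?d}" using a by (simp add: orbs_def)
   hence "ncyc s A ?d > 0" unfolding ncyc_def using A by (subst card_gt_0_iff) (auto simp: orbs_def)
   then obtain k where k: "ncyc s A ?d = Suc k" by (cases "ncyc s A ?d") auto
   hence "ncyc s ?A ?d = k" by (simp add: ncyc_diff[OF s a A(1)])
   thus ?thesis using k by (simp add: ff_Suc)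
  qed
  also have "(\<Prod>d\<in>{1..N} - {?d}. ?G d) = (\<Prod>d\<in>{1..N} - {?d}. d ^ ncyc s A d * ff (ncyc g Y d) (ncyc s A d))"
   by (rule prod.cong) (auto simp: ncyc_diff[OF s a A(1)])
  also have "?d ^ ncyc s A ?d * ff (ncyc g Y ?d) (ncyc s A ?d) * ...
   = (\<Prod>d\<in>{1..N}. d ^ ncyc s A d * ff (ncyc g Y d) (ncyc s A d))"
   by (rule prod.remove[symmetric]) (use dN in auto)
  finally show ?thesis .
 qed
qed

section \<open>Poisson limit of the cycle counts\<close>

lemma mod_shift: "i < d ==> (Suc i mod d + d - Suc 0) mod d = (i::nat)"
 by (cases "Suc i = d") (auto simp: mod_Suc)
lemma mod_shift': "i < d ==> Suc ((i + d - Suc 0) mod d) mod d = (i::nat)"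
 by (cases i) (auto simp: mod_Suc_eq)

text \<open>
By \<open>Phi_formula\<close> the integrand is \<open>Phi\<close> for a permutation with \<open>k d\<close> cycles of each length \<open>d\<close>, realised
here on triples \<open>(d, j, i)\<close> with \<open>i\<close> running around the \<open>j\<close>-th cycle of length \<open>d\<close>.  So the joint
factorial moments of the cycle counts agree with those of independent Poisson variables as long as
\<open>\<Sum>d. d * k d \<le> n\<close>.
\<close>
lemma sum_ff_cycles:
 fixes k :: "nat => nat"
 shows "(\<Sum>g\<in>Sym n. \<Prod>d\<in>{1..m}. d ^ k d * ff (ncyc g {1..n} d) (k d)) = (if (\<Sum>d\<in>{1..m}. d * k d) \<le> n then fact n else 0)"
proof -
 define A where "A = Sigma {1..m} (%d. {..<k d} \<times> {..<d})"
 define s where "s = (%(d, j, i). if (d, j, i) \<in> A then (d, j, Suc i mod d) else (d, j, i))"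
 have fin: "finite A" by (simp add: A_def)
 have cardA: "card A = (\<Sum>d\<in>{1..m}. d * k d)"
  unfolding A_def by (subst card_SigmaI) (auto simp: mult.commute)
 have sA: "s (d, j, i) = (d, j, Suc i mod d)" "s (d, j, i) \<in> A" if "(d, j, i) \<in> A" for d j i
  using that by (auto simp: s_def A_def)
 have bij: "bij_betw s A A"
  by (rule bij_betwI[where g = "%(d, j, i). (d, j, (i + d - 1) mod d)"])
   (auto simp: A_def s_def mod_shift mod_shift')
 hence "s permutes A" by (rule bij_imp_permutes) (auto simp: s_def)
 hence perm: "permutation s" using fin unfolding permutation_permutes by blast
 have pow: "(s ^^ r) (d, j, i) = (d, j, (i + r) mod d)" if "(d, j, i) \<in> A" for d j i r
 proof (induction r)
  case 0 thus ?case using that by (simp add: A_def)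
 next
  case (Suc r)
  have "(d, j, (i + r) mod d) \<in> A" using that by (auto simp: A_def)
  thus ?case using Suc sA(1) by (simp add: mod_Suc_eq)
 qed
 have orb: "orbit s (d, j, i) = {d} \<times> {j} \<times> {..<d}" if a: "(d, j, i) \<in> A" for d j i
 proof -
  have "(%r. (i + r) mod d) ` UNIV = {..<d}"
  proof (intro equalityI subsetI)
   fix x assume "x \<in> {..<d}"
   hence "(i + (x + d - i)) mod d = x" using a by (auto simp: A_def)
   thus "x \<in> range (%r. (i + r) mod d)" by (metis rangeI)
  qed (use a in \<open>auto simp: A_def\<close>)
  thus ?thesis unfolding orbit_funpow[OF perm] pow[OF a] by (auto simp: image_iff)
 qed
 have orbs: "orbs s A = (%(d, j). {d} \<times> {j} \<times> {..<d}) ` Sigma {1..m} (%d. {..<k d})"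
 proof -
  have "orbs s A = (%(d, j, i). {d} \<times> {j} \<times> {..<d}) ` A"
   unfolding orbs_def by (rule image_cong) (auto simp: orb)
  also have "... = (%(d, j). {d} \<times> {j} \<times> {..<d}) ` ((%(d, j, i). (d, j)) ` A)"
   unfolding image_image by (rule image_cong) auto
  also have "(%(d, j, i). (d, j)) ` A = Sigma {1..m} (%d. {..<k d})"
  proof (intro equalityI subsetI)
   fix p assume "p \<in> Sigma {1..m} (%d. {..<k d})"
   then obtain d j where p: "p = (d, j)" "d \<in> {1..m}" "j < k d" by auto
   hence "(d, j, 0) \<in> A" by (simp add: A_def)
   thus "p \<in> (%(d, j, i). (d, j)) ` A" using p(1) by (intro image_eqI[of _ _ "(d, j, 0)"]) simp_all
  qed (auto simp: A_def)
  finally show ?thesis .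
 qed
 have nc: "ncyc s A d = (if d \<in> {1..m} then k d else 0)" for d
 proof -
  have "{o' \<in> orbs s A. card o' = d} = (%j. {d} \<times> {j} \<times> {..<d}) ` (if d \<in> {1..m} then {..<k d} else {})"
   unfolding orbs by (auto simp: card_cartesian_product)
  moreover have "inj_on (%j. {d} \<times> {j} \<times> {..<d}) (if d \<in> {1..m} then {..<k d} else {})"
  proof (rule inj_onI)
   fix i j assume "i \<in> (if d \<in> {1..m} then {..<k d} else {})" and e: "{d} \<times> {i} \<times> {..<d} = {d} \<times> {j} \<times> {..<d}"
   hence "d \<ge> 1" by (simp split: if_splits)
   hence "(d, i, 0) \<in> {d} \<times> {i} \<times> {..<d}" by simp
   hence "(d, i, 0) \<in> {d} \<times> {j} \<times> {..<d}" unfolding e .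
   thus "i = j" by simp
  qed
  ultimately show ?thesis by (simp add: ncyc_def card_image)
 qed
 have "Phi A s {1..n} g = (\<Prod>d\<in>{1..m}. d ^ k d * ff (ncyc g {1..n} d) (k d))" if g: "g \<in> Sym n" for g
 proof -
  have "g ` {1..n} \<subseteq> {1..n}" using Sym_range[OF g] by blast
  hence "Phi A s {1..n} g = (\<Prod>d\<in>{1..m + card A}. d ^ ncyc s A d * ff (ncyc g {1..n} d) (ncyc s A d))"
   using bij fin by (intro Phi_formula perm Sym_permutation[OF g]) (auto simp: bij_betw_def)
  also have "... = (\<Prod>d\<in>{1..m}. d ^ k d * ff (ncyc g {1..n} d) (k d))"
   by (rule prod.mono_neutral_cong_right) (auto simp: nc)
  finally show ?thesis .
 qed
 hence "(\<Sum>g\<in>Sym n. \<Prod>d\<in>{1..m}. d ^ k d * ff (ncyc g {1..n} d) (k d)) = (\<Sum>g\<in>Sym n. Phi A s {1..n} g)" by simp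
 also have "... = (if card A \<le> n then fact n else 0)"
  using sum_Phi[OF fin _ bij, of n] sum_Phi_zero[OF fin, of n s] by simp
 finally show ?thesis by (simp add: cardA)
qed

text \<open>Inclusion-exclusion, which recovers probabilities of values from factorial moments.\<close>
lemma indicator_binomial_sum:
 assumes "c \<le> n"
 shows "(of_bool (c = k) :: real) = (\<Sum>l\<in>{0..n}. (-1) ^ l / (fact k * fact l) * real (ff c (k + l)))"
proof -
 have t: "(-1) ^ l / (fact k * fact l) * real (ff c (k + l)) = real (c choose k) * ((-1) ^ l * real ((c - k) choose l))" for l
 proof (cases "k + l \<le> c")
  case True
  have "real (c choose (k + l)) * fact (k + l) / (fact k * fact l) = real (c choose k) * real ((c - k) choose l)"
   using True by (simp add: binomial_fact)
  have "(-1) ^ l / (fact k * fact l) * real (ff c (k + l)) = (-1) ^ l * (real (c choose (k + l)) * fact (k + l) / (fact k * fact l))"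
   by (simp add: ff_binomial)
  also have "real (c choose (k + l)) * fact (k + l) / (fact k * fact l) = real (c choose k) * real ((c - k) choose l)" by fact
  finally show ?thesis by simp
 next
  case False
  thus ?thesis by (cases "c < k") (auto simp: ff_binomial binomial_eq_0)
 qed
 show ?thesis
 proof (cases "k \<le> c")
  case False thus ?thesis unfolding t by (simp add: binomial_eq_0)
 next
  case True
  have "(\<Sum>l\<in>{0..n}. (-1) ^ l * real ((c - k) choose l)) = (\<Sum>l\<le>c - k. (-1) ^ l * real ((c - k) choose l))"
   by (rule sum.mono_neutral_right) (use assms in auto)
  also have "... = of_bool (c = k)"
   using True choose_alternating_sum[of "c - k", where 'a = real] by (cases "c = k") auto
  finally show ?thesis unfolding t sum_distrib_left[symmetric] by simp
 qed
qed

lemma ncyc_le: "ncyc g {1..n} d \<le> n"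
proof -
 have "ncyc g {1..n} d \<le> card (orbs g {1..n})" unfolding ncyc_def by (rule card_mono) (auto simp: orbs_def)
 also have "... \<le> card {1..n}" unfolding orbs_def by (rule card_image_le) simp
 finally show ?thesis by simp
qed

definition cyc_count :: "nat => nat => (nat => nat) => nat => nat" where
 "cyc_count m n g = (%d. if d \<in> {1..m} then ncyc g {1..n} d else 0)"

definition cyc_coeff :: "(nat => nat) => nat => nat => real" where
 "cyc_coeff k d l = (-1) ^ l / (fact (k d) * fact l) / real d ^ (k d + l)"

lemma prob_cycle_counts:
 fixes k :: "nat => nat"
 shows "real (card {g \<in> Sym n. \<forall>d\<in>{1..m}. ncyc g {1..n} d = k d}) / fact n
  = (\<Sum>l\<in>PiE {1..m} (%_. {0..n}). (\<Prod>d\<in>{1..m}. cyc_coeff k d (l d)) * of_bool ((\<Sum>d\<in>{1..m}. d * (k d + l d)) \<le> n))"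
proof -
 let ?B = "PiE {1..m} (%_. {0..n})"
 have "real (card {g \<in> Sym n. \<forall>d\<in>{1..m}. ncyc g {1..n} d = k d}) = (\<Sum>g\<in>Sym n. \<Prod>d\<in>{1..m}. of_bool (ncyc g {1..n} d = k d))"
 proof -
  have "(\<Prod>d\<in>{1..m}. of_bool (P d)) = (of_bool (\<forall>d\<in>{1..m}. P d) :: real)" for P :: "nat => bool"
   by (auto simp: prod_eq_1_iff intro!: prod_zero)
  thus ?thesis by (simp add: Int_def)
 qed
 also have "... = (\<Sum>g\<in>Sym n. \<Prod>d\<in>{1..m}. \<Sum>l\<in>{0..n}. (-1) ^ l / (fact (k d) * fact l) * real (ff (ncyc g {1..n} d) (k d + l)))"
  by (intro sum.cong prod.cong refl indicator_binomial_sum ncyc_le)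
 also have "... = (\<Sum>g\<in>Sym n. \<Sum>l\<in>?B. \<Prod>d\<in>{1..m}. (-1) ^ l d / (fact (k d) * fact (l d)) * real (ff (ncyc g {1..n} d) (k d + l d)))"
  by (subst prod_sum_PiE) auto
 also have "... = (\<Sum>l\<in>?B. \<Sum>g\<in>Sym n. \<Prod>d\<in>{1..m}. cyc_coeff k d (l d) * real (d ^ (k d + l d) * ff (ncyc g {1..n} d) (k d + l d)))"
  by (subst sum.swap) (intro sum.cong prod.cong refl, simp add: cyc_coeff_def)
 also have "... = (\<Sum>l\<in>?B. (\<Prod>d\<in>{1..m}. cyc_coeff k d (l d)) * real (\<Sum>g\<in>Sym n. \<Prod>d\<in>{1..m}. d ^ (k d + l d) * ff (ncyc g {1..n} d) (k d + l d)))"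
  by (simp add: prod.distrib sum_distrib_left of_nat_sum of_nat_prod)
 also have "... = (\<Sum>l\<in>?B. (\<Prod>d\<in>{1..m}. cyc_coeff k d (l d)) * (of_bool ((\<Sum>d\<in>{1..m}. d * (k d + l d)) \<le> n) * fact n))"
  using sum_ff_cycles[where m = m and k = "%d. k d + l d" and n = n for l] by (intro sum.cong refl) (simp add: of_bool_def)
 finally show ?thesis by (simp add: sum_divide_distrib mult.assoc[symmetric])
qed

lemma cyc_coeff_sums: "d \<ge> 1 ==> cyc_coeff k d sums pmf (poisson_pmf (1 / real d)) (k d)"
 and cyc_coeff_abs_summable: "d \<ge> 1 ==> summable (%l. \<bar>cyc_coeff k d l\<bar>)"
proof -
 assume d: "d \<ge> 1"
 have e: "cyc_coeff k d l = (1 / real d) ^ k d / fact (k d) * ((- (1 / real d)) ^ l /\<^sub>R fact l)" for l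
  by (simp add: cyc_coeff_def power_add power_divide power_minus[of "1 / real d"] field_simps)
 have "(%l. (- (1 / real d)) ^ l /\<^sub>R fact l) sums exp (- (1 / real d))" by (rule exp_converges)
 hence "cyc_coeff k d sums ((1 / real d) ^ k d / fact (k d) * exp (- (1 / real d)))"
  unfolding e by (rule sums_mult)
 thus "cyc_coeff k d sums pmf (poisson_pmf (1 / real d)) (k d)" using d by simp
 have e': "\<bar>cyc_coeff k d l\<bar> = (1 / real d) ^ k d / fact (k d) * ((1 / real d) ^ l /\<^sub>R fact l)" for l
  by (simp add: cyc_coeff_def power_add power_divide field_simps abs_mult power_abs)
 show "summable (%l. \<bar>cyc_coeff k d l\<bar>)"
  unfolding e' by (intro summable_mult sums_summable[OF exp_converges])
qed

text \<open>
The probability is a finite sum of products of terms of absolutely convergent series, truncated by the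
condition \<open>\<Sum>d. d * (k d + l d) \<le> n\<close>.  Terms violating it lie outside a box that grows with \<open>n\<close>, so that
the limit is the product of the full series, and each of these is the expansion of a Poisson probability.
\<close>
lemma cycle_count_limit:
 fixes k :: "nat => nat"
 shows "(%n. real (card {g \<in> Sym n. \<forall>d\<in>{1..m}. ncyc g {1..n} d = k d}) / fact n)
   \<longlonglongrightarrow> (\<Prod>d\<in>{1..m}. pmf (poisson_pmf (1 / real d)) (k d))"
proof -
 let ?Q = "%n l. (\<Sum>d\<in>{1..m}. d * (k d + l d)) \<le> n"
 let ?B = "%n::nat. PiE {1..m} (%_. {0..n})"
 define a where "a l = (\<Prod>d\<in>{1..m}. cyc_coeff k d (l d))" for l
 define S where "S = (\<Sum>d\<in>{1..m}. d * k d)"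
 \<comment> \<open>Any \<open>l\<close> bounded by \<open>K n\<close> satisfies the condition \<open>?Q n\<close>, as \<open>m\<close> terms of size at most \<open>m * K n\<close> are added to \<open>S\<close>.\<close>
 define K where "K n = (n - S) div (m * m + 1)" for n
 define T where "T n = (\<Sum>l\<in>?B n. \<bar>a l\<bar>)" for n
 have finB: "finite (?B n)" for n by (intro finite_PiE) auto
 have box: "(\<Sum>l\<in>?B n. a l) = (\<Prod>d\<in>{1..m}. \<Sum>l\<in>{0..n}. cyc_coeff k d l)" for n
  unfolding a_def by (rule prod_sum_PiE[symmetric]) auto
 have boxT: "T n = (\<Prod>d\<in>{1..m}. \<Sum>l\<in>{0..n}. \<bar>cyc_coeff k d l\<bar>)" for n
  unfolding T_def a_def abs_prod by (rule prod_sum_PiE[symmetric]) auto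
 have lim: "(%n. \<Sum>l\<in>?B n. a l) \<longlonglongrightarrow> (\<Prod>d\<in>{1..m}. pmf (poisson_pmf (1 / real d)) (k d))"
  unfolding box
  by (intro tendsto_prod) (use cyc_coeff_sums in \<open>auto simp: sums_def_le atMost_atLeast0\<close>)
 have limT: "T \<longlonglongrightarrow> (\<Prod>d\<in>{1..m}. \<Sum>l. \<bar>cyc_coeff k d l\<bar>)"
  unfolding boxT
  by (intro tendsto_prod) (use cyc_coeff_abs_summable in \<open>auto simp: summable_sums sums_def_le[symmetric] atMost_atLeast0[symmetric]\<close>)
 have Klim: "filterlim K at_top at_top"
  unfolding filterlim_at_top eventually_at_top_linorder
 proof (intro allI)
  fix Z show "\<exists>N. \<forall>n\<ge>N. Z \<le> K n"
  proof (intro exI allI impI)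
   fix n assume "n \<ge> S + Z * (m * m + 1)"
   hence "Z * (m * m + 1) \<le> n - S" by simp
   thus "Z \<le> K n" unfolding K_def by (simp add: less_eq_div_iff_mult_less_eq)
  qed
 qed
 have KT: "(%n. T n - T (K n)) \<longlonglongrightarrow> 0"
  using tendsto_diff[OF limT filterlim_compose[OF limT Klim]] by simp
 have sub: "?B (K n) \<subseteq> {l \<in> ?B n. ?Q n l}" if n: "n \<ge> S" for n
 proof
  fix l assume l: "l \<in> ?B (K n)"
  have Kn: "K n * (m * m + 1) \<le> n - S" unfolding K_def by (rule div_times_less_eq_dividend)
  have le: "K n \<le> n"  unfolding K_def by (meson diff_le_self div_le_dividend le_trans)
  have "(\<Sum>d\<in>{1..m}. d * l d) \<le> (\<Sum>d\<in>{1..m}. m * K n)"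
   by (rule sum_mono) (use l in \<open>auto intro!: mult_mono simp: PiE_def Pi_def\<close>)
  also have "... \<le> K n * (m * m + 1)" by simp
  finally have "(\<Sum>d\<in>{1..m}. d * l d) \<le> n - S" using Kn by simp
  hence "?Q n l" using n by (simp add: S_def distrib_left sum.distrib)
  moreover have "?B (K n) \<subseteq> ?B n" by (rule PiE_mono) (use le in auto)
  hence "l \<in> ?B n" using l by blast
  ultimately show "l \<in> {l \<in> ?B n. ?Q n l}" by simp
 qed
 have bound: "\<bar>(\<Sum>l\<in>?B n. a l * of_bool (?Q n l)) - (\<Sum>l\<in>?B n. a l)\<bar> \<le> T n - T (K n)" if n: "n \<ge> S" for n
 proof -
  have "\<bar>(\<Sum>l\<in>?B n. a l * of_bool (?Q n l)) - (\<Sum>l\<in>?B n. a l)\<bar> = \<bar>\<Sum>l\<in>?B n. a l * of_bool (?Q n l) - a l\<bar>"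
   by (simp add: sum_subtractf)
  also have "... \<le> (\<Sum>l\<in>?B n. \<bar>a l * of_bool (?Q n l) - a l\<bar>)" by (rule sum_abs)
  also have "... \<le> (\<Sum>l\<in>?B n. \<bar>a l\<bar> - \<bar>a l\<bar> * of_bool (l \<in> ?B (K n)))"
   by (rule sum_mono) (use sub[OF n] in \<open>auto simp: of_bool_def\<close>)
  also have "... = T n - (\<Sum>l\<in>?B n. \<bar>a l\<bar> * of_bool (l \<in> ?B (K n)))" by (simp add: sum_subtractf T_def)
  also have "(\<Sum>l\<in>?B n. \<bar>a l\<bar> * of_bool (l \<in> ?B (K n))) = T (K n)"
   unfolding T_def by (rule sum.mono_neutral_cong_right) (use finB sub[OF n] in auto)
  finally show ?thesis .
 qed
 have "(%n. (\<Sum>l\<in>?B n. a l * of_bool (?Q n l)) - (\<Sum>l\<in>?B n. a l)) \<longlonglongrightarrow> 0"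
  by (rule Lim_null_comparison[OF _ KT]) (use bound in \<open>auto simp: eventually_at_top_linorder intro!: exI[of _ S]\<close>)
 from tendsto_add[OF this lim]
 show ?thesis unfolding prob_cycle_counts a_def by simp
qed

section \<open>Convergence of discrete laws\<close>

text \<open>
Pointwise convergence of probability masses to a probability mass function is convergence in total variation, by the lemma of Scheffe.
\<close>
lemma pmf_tendsto_bounded:
 fixes p :: "nat => 'a pmf" and f :: "'a => real"
 assumes lim: "\<And>x. (%n. pmf (p n) x) \<longlonglongrightarrow> pmf q x" and bd: "\<And>x. \<bar>f x\<bar> \<le> B"
 shows "(%n. \<integral>x. f x \<partial>(p n)) \<longlonglongrightarrow> (\<integral>x. f x \<partial>q)"
proof -
 let ?M = "count_space UNIV :: 'a measure"
 have B: "B \<ge> 0" using bd by (meson abs_ge_zero order_trans)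
 have int: "integrable ?M (pmf r)" for r :: "'a pmf" by (rule integrable_pmf)
 have nn: "(\<integral>\<^sup>+x. norm (pmf r x) \<partial>?M) = 1" for r :: "'a pmf"
  using nn_integral_pmf[of UNIV r] measure_pmf.emeasure_space_1[of r] by simp
 have S: "(%n. \<integral>\<^sup>+ x. norm (pmf (p n) x - pmf q x) \<partial>?M) \<longlonglongrightarrow> 0"
  by (rule Scheffe_lemma2) (use lim nn int in auto)
 have ex: "(\<integral>x. f x \<partial>r) = (\<integral>x. f x * pmf r x \<partial>?M)" for r :: "'a pmf"
  unfolding measure_pmf_eq_density by (subst integral_density) (auto simp: mult.commute)
 have fint: "integrable ?M (%x. f x * pmf r x)" for r :: "'a pmf"
  by (rule Bochner_Integration.integrable_bound[OF integrable_mult_right[OF int[of r], of B]])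
   (use bd B in \<open>auto simp: abs_mult intro!: mult_right_mono AE_I2\<close>)
 have le: "norm ((\<integral>x. f x \<partial>(p n)) - (\<integral>x. f x \<partial>q)) \<le> B * (\<integral>x. \<bar>pmf (p n) x - pmf q x\<bar> \<partial>?M)" for n
 proof -
  have "(\<integral>x. f x \<partial>(p n)) - (\<integral>x. f x \<partial>q) = (\<integral>x. f x * (pmf (p n) x - pmf q x) \<partial>?M)"
   unfolding ex by (subst Bochner_Integration.integral_diff[symmetric]) (auto simp: fint algebra_simps)
  also have "norm ... \<le> (\<integral>x. norm (f x * (pmf (p n) x - pmf q x)) \<partial>?M)" by (rule integral_norm_bound)
  also have "... \<le> (\<integral>x. B * \<bar>pmf (p n) x - pmf q x\<bar> \<partial>?M)"
  proof (rule integral_mono)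
   show "integrable ?M (%x. norm (f x * (pmf (p n) x - pmf q x)))"
    using Bochner_Integration.integrable_diff[OF fint[of "p n"] fint[of q]] by (intro integrable_norm) (simp add: algebra_simps)
   show "integrable ?M (%x. B * \<bar>pmf (p n) x - pmf q x\<bar>)"
    by (intro integrable_mult_right integrable_abs Bochner_Integration.integrable_diff int)
  qed (use bd in \<open>auto simp: abs_mult intro!: mult_right_mono\<close>)
  finally show ?thesis by simp
 qed
 have "(%n. \<integral>x. \<bar>pmf (p n) x - pmf q x\<bar> \<partial>?M) \<longlonglongrightarrow> 0"
 proof -
  have "(\<integral>\<^sup>+ x. norm (pmf (p n) x - pmf q x) \<partial>?M) = ennreal (\<integral>x. \<bar>pmf (p n) x - pmf q x\<bar> \<partial>?M)" for n
   by (subst nn_integral_eq_integral)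
    (auto intro!: integrable_abs Bochner_Integration.integrable_diff int)
  hence "(%n. ennreal (\<integral>x. \<bar>pmf (p n) x - pmf q x\<bar> \<partial>?M)) \<longlonglongrightarrow> ennreal 0" using S by simp
  thus ?thesis by (subst (asm) tendsto_ennreal_iff) (auto intro!: always_eventually)
 qed
 hence "(%n. B * (\<integral>x. \<bar>pmf (p n) x - pmf q x\<bar> \<partial>?M)) \<longlonglongrightarrow> 0" by (rule tendsto_mult_right_zero)
 hence "(%n. (\<integral>x. f x \<partial>(p n)) - (\<integral>x. f x \<partial>q)) \<longlonglongrightarrow> 0"
  by (rule Lim_null_comparison[rotated]) (use le in auto)
 thus ?thesis by (simp add: LIM_zero_iff)
qed

text \<open>
A bounded second moment makes \<open>f\<close> uniformly integrable: the part of the expectation beyond height \<open>L\<close> is at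
most \<open>K / L\<close>, both for \<open>p n\<close> and, by monotone convergence, for the limit \<open>q\<close>.
\<close>
lemma pmf_tendsto_bounded_second_moment:
 fixes p :: "nat => 'a pmf" and f :: "'a => real"
 assumes lim: "\<And>x. (%n. pmf (p n) x) \<longlonglongrightarrow> pmf q x"
  and fin: "\<And>n. finite (set_pmf (p n))"
  and bd: "eventually (%n. (\<integral>x. (f x)\<^sup>2 \<partial>(p n)) \<le> K) sequentially"
 shows "integrable q f" and "(%n. \<integral>x. f x \<partial>(p n)) \<longlonglongrightarrow> (\<integral>x. f x \<partial>q)"
proof -
 have ip: "integrable (p n) h" for n and h :: "'a => real" by (rule integrable_measure_pmf_finite[OF fin])
 have trunc: "(\<integral>x. min ((f x)\<^sup>2) L \<partial>q) \<le> K" if L: "L \<ge> 0" for L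
 proof (rule tendsto_upperbound)
  show "(%n. \<integral>x. min ((f x)\<^sup>2) L \<partial>(p n)) \<longlonglongrightarrow> (\<integral>x. min ((f x)\<^sup>2) L \<partial>q)"
   by (rule pmf_tendsto_bounded[OF lim, where B = L]) (use L in auto)
  show "eventually (%n. (\<integral>x. min ((f x)\<^sup>2) L \<partial>(p n)) \<le> K) sequentially"
   using bd
  proof eventually_elim
   case (elim n)
   have "(\<integral>x. min ((f x)\<^sup>2) L \<partial>(p n)) \<le> (\<integral>x. (f x)\<^sup>2 \<partial>(p n))" by (rule integral_mono) (auto intro: ip)
   thus ?case using elim by simp
  qed
 qed simp
 have bi: "integrable q (%x. min ((f x)\<^sup>2) L)" if "L \<ge> 0" for L
  by (rule measure_pmf.integrable_const_bound[where B = L]) (use that in auto)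
 have f2: "integrable q (%x. (f x)\<^sup>2)" "(\<integral>x. (f x)\<^sup>2 \<partial>q) \<le> K"
 proof -
  have mono: "AE x in q. mono (%n. min ((f x)\<^sup>2) (real n))" by (auto simp: mono_def min_def)
  have lm: "AE x in q. (%n. min ((f x)\<^sup>2) (real n)) \<longlonglongrightarrow> (f x)\<^sup>2"
  proof (intro AE_I2)
   fix x
   obtain N where "(f x)\<^sup>2 \<le> real N" using real_arch_simple by blast
   hence "eventually (%n. min ((f x)\<^sup>2) (real n) = (f x)\<^sup>2) sequentially"
    by (intro eventually_sequentiallyI[of N]) (simp add: min_def)
   thus "(%n. min ((f x)\<^sup>2) (real n)) \<longlonglongrightarrow> (f x)\<^sup>2" by (rule tendsto_eventually)
  qed
  have inc: "incseq (%n. \<integral>x. min ((f x)\<^sup>2) (real n) \<partial>q)"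
   unfolding incseq_def by (intro allI impI integral_mono bi) auto
  obtain I where I: "(%n. \<integral>x. min ((f x)\<^sup>2) (real n) \<partial>q) \<longlonglongrightarrow> I"
   using incseq_convergent[OF inc, of K] trunc by (metis of_nat_0_le_iff)
  show i: "integrable q (%x. (f x)\<^sup>2)"
   by (rule integrable_monotone_convergence[OF bi mono lm I]) auto
  have "(\<integral>x. (f x)\<^sup>2 \<partial>q) = I"
   by (rule integral_monotone_convergence[OF bi mono lm I]) auto
  also have "I \<le> K" by (rule LIMSEQ_le_const2[OF I]) (use trunc in auto)
  finally show "(\<integral>x. (f x)\<^sup>2 \<partial>q) \<le> K" .
 qed
 show fi: "integrable q f"
 proof (rule Bochner_Integration.integrable_bound)
  show "integrable q (%x. 1 + (f x)\<^sup>2)" using f2 by simp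
  have "\<bar>f x\<bar> \<le> 1 + (f x)\<^sup>2" for x
  proof -
   have "0 \<le> (\<bar>f x\<bar> - 1)\<^sup>2" by simp
   thus ?thesis by (simp add: power2_eq_square algebra_simps)
  qed
  thus "AE x in q. norm (f x) \<le> norm (1 + (f x)\<^sup>2)" by (auto intro!: AE_I2 simp: order_trans[OF _ abs_ge_self])
 qed simp
 define cl where "cl L x = max (- L) (min L (f x))" for L x
 have clb: "\<bar>f x - cl L x\<bar> \<le> (f x)\<^sup>2 / L" if "L > 0" for L x
 proof (cases "\<bar>f x\<bar> \<le> L")
  case False
  have "\<bar>f x - cl L x\<bar> \<le> \<bar>f x\<bar>" using that by (auto simp: cl_def)
  also have "... * L \<le> \<bar>f x\<bar> * \<bar>f x\<bar>" using False by (intro mult_left_mono) auto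
  hence "\<bar>f x\<bar> \<le> (f x)\<^sup>2 / L" using that by (simp add: field_simps power2_eq_square)
  finally show ?thesis .
 qed (use that in \<open>auto simp: cl_def\<close>)
 have clint: "integrable (measure_pmf r) (cl L)" if "L > 0" for L and r :: "'a pmf"
  by (rule measure_pmf.integrable_const_bound[where B = L]) (use that in \<open>auto simp: cl_def\<close>)
 have dist: "\<bar>(\<integral>x. f x \<partial>r) - (\<integral>x. cl L x \<partial>r)\<bar> \<le> K / L"
  if L: "L > 0" and i: "integrable (measure_pmf r) f" "integrable (measure_pmf r) (%x. (f x)\<^sup>2)" "(\<integral>x. (f x)\<^sup>2 \<partial>r) \<le> K" for L and r :: "'a pmf"
 proof -
  have "\<bar>(\<integral>x. f x \<partial>r) - (\<integral>x. cl L x \<partial>r)\<bar> = \<bar>\<integral>x. f x - cl L x \<partial>r\<bar>"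
   using i(1) clint[OF L] by simp
  also have "... \<le> (\<integral>x. \<bar>f x - cl L x\<bar> \<partial>r)" by (rule integral_abs_bound)
  also have "... \<le> (\<integral>x. (f x)\<^sup>2 / L \<partial>r)"
   by (rule integral_mono) (use i clint[OF L] clb[OF L] in auto)
  also have "... \<le> K / L" using i(3) L by (simp add: divide_right_mono)
  finally show ?thesis .
 qed
 show "(%n. \<integral>x. f x \<partial>(p n)) \<longlonglongrightarrow> (\<integral>x. f x \<partial>q)"
 proof (rule LIMSEQ_I)
  fix e :: real assume e: "e > 0"
  define L where "L = (\<bar>K\<bar> + 1) * 4 / e"
  have L: "L > 0" using e by (simp add: L_def)
  have KL: "K / L < e / 3"
  proof -
   have "K * 3 < (\<bar>K\<bar> + 1) * 4" by (smt (verit))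
   hence "K * 3 * e < (\<bar>K\<bar> + 1) * 4 * e" using e by (rule mult_strict_right_mono)
   thus ?thesis using e by (simp add: L_def field_simps)
  qed
  have "(%n. \<integral>x. cl L x \<partial>(p n)) \<longlonglongrightarrow> (\<integral>x. cl L x \<partial>q)"
   by (rule pmf_tendsto_bounded[OF lim, where B = L]) (use L in \<open>auto simp: cl_def\<close>)
  hence "eventually (%n. \<bar>(\<integral>x. cl L x \<partial>(p n)) - (\<integral>x. cl L x \<partial>q)\<bar> < e / 3) sequentially"
   using e by (auto simp: tendsto_iff dist_real_def dest!: spec[of _ "e / 3"])
  with bd have "eventually (%n. norm ((\<integral>x. f x \<partial>(p n)) - (\<integral>x. f x \<partial>q)) < e) sequentially"
  proof eventually_elim
   case (elim n)
   have "\<bar>(\<integral>x. f x \<partial>(p n)) - (\<integral>x. cl L x \<partial>(p n))\<bar> \<le> K / L" by (rule dist[OF L ip ip elim(1)])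
   moreover have "\<bar>(\<integral>x. f x \<partial>q) - (\<integral>x. cl L x \<partial>q)\<bar> \<le> K / L" by (rule dist[OF L fi f2])
   ultimately show ?case using elim(2) KL unfolding real_norm_def by linarith
  qed
  thus "\<exists>no. \<forall>n\<ge>no. norm ((\<integral>x. f x \<partial>(p n)) - (\<integral>x. f x \<partial>q)) < e"
   by (simp add: eventually_sequentially)
 qed
qed

section \<open>Products of counts and stable partitions\<close>

definition blk :: "'a set set => 'a => 'a set" where "blk D z = (THE B. B \<in> D \<and> z \<in> B)"

lemma blk_eq: "partition_on Z D ==> B \<in> D ==> z \<in> B ==> blk D z = B"
 unfolding blk_def by (rule the_equality) (auto simp: partition_on_def disjoint_def)

lemma blk_in: "partition_on Z D ==> z \<in> Z ==> blk D z \<in> D \<and> z \<in> blk D z"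
proof -
 assume D: "partition_on Z D" and "z \<in> Z"
 then obtain B where "B \<in> D" "z \<in> B" unfolding partition_on_def by blast
 thus ?thesis using blk_eq[OF D] by metis
qed

lemma partition_subset: "partition_on Z D ==> B \<in> D ==> B \<subseteq> Z"
 unfolding partition_on_def by blast

lemma partition_nonempty: "partition_on Z D ==> B \<in> D ==> \<exists>z. z \<in> B"
 unfolding partition_on_def by (metis ex_in_conv)

lemma partition_eqI_blk:
 assumes D: "partition_on Z D" and E: "partition_on Z E"
  and eq: "\<And>z w. z \<in> Z ==> w \<in> Z ==> blk D z = blk D w \<longleftrightarrow> blk E z = blk E w"
 shows "D = E"
proof -
 have r: "D = (%z. {w\<in>Z. blk D w = blk D z}) ` Z" if D: "partition_on Z D" for D :: "'a set set"
 proof -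
  have b: "{w\<in>Z. blk D w = blk D z} = blk D z" if "z \<in> Z" for z
   using blk_in[OF D] blk_eq[OF D] partition_subset[OF D] that by blast
  have "D = blk D ` Z"
  proof (intro equalityI subsetI)
   fix B assume B: "B \<in> D"
   obtain z where z: "z \<in> B" using partition_nonempty[OF D B] by blast
   hence "B = blk D z" "z \<in> Z" using blk_eq[OF D B z] partition_subset[OF D B] by auto
   thus "B \<in> blk D ` Z" by blast
  qed (use blk_in[OF D] in blast)
  also have "... = (%z. {w\<in>Z. blk D w = blk D z}) ` Z" using b by (intro image_cong) auto
  finally show ?thesis .
 qed
 have "(%z. {w\<in>Z. blk D w = blk D z}) ` Z = (%z. {w\<in>Z. blk E w = blk E z}) ` Z"
  using eq by (intro image_cong) auto
 thus ?thesis using r[OF D] r[OF E] by simp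
qed

definition fam_perm :: "('i => 'a => 'a) => 'i \<times> 'a => 'i \<times> 'a" where
 "fam_perm s = (%(i, a). (i, s i a))"

text \<open>
The possible patterns of coincidences between equivariant injections defined on the fibres of \<open>Z\<close>.
\<close>
definition transv :: "('i \<times> 'a) set => ('i => 'a => 'a) => ('i \<times> 'a) set set set" where
 "transv Z s = {D. partition_on Z D \<and> (\<forall>B\<in>D. inj_on fst B) \<and> (`) (fam_perm s) ` D = D}"

lemma fam_perm_simp [simp]: "fam_perm s (i, a) = (i, s i a)" by (simp add: fam_perm_def)

text \<open>
A family of equivariant injections is the same as a partition of the disjoint union, recording
which points share their image, together with an equivariant injection of the set of blocks.  Injectivity in
each fibre makes blocks transversal, and equivariance makes the partition stable.
\<close>
lemma prod_Phi:
 fixes s :: "'i => 'a => 'a" and g :: "'b => 'b"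
 assumes I: "finite I" and A: "\<And>i. i \<in> I ==> finite (A i)" and s: "\<And>i. i \<in> I ==> bij_betw (s i) (A i) (A i)"
  and Y: "finite Y" and g: "inj g"
 shows "(\<Prod>i\<in>I. Phi (A i) (s i) Y g) = (\<Sum>D\<in>transv (Sigma I A) s. Phi D ((`) (fam_perm s)) Y g)"
proof -
 let ?Z = "Sigma I A" and ?s = "fam_perm s"
 have finZ: "finite ?Z" using I A by auto
 have finT: "finite (transv ?Z s)"
  by (rule finite_subset[OF _ finitely_many_partition_on[OF finZ]]) (auto simp: transv_def)
 have finD: "finite D" if "D \<in> transv ?Z s" for D
  using that finite_elements[OF finZ] by (auto simp: transv_def)
 have sZ: "?s z \<in> ?Z" if "z \<in> ?Z" for z using that bij_betwE[OF s] by auto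
 define \<psi> where "\<psi> = (%(D, j). (\<lambda>i\<in>I. \<lambda>a\<in>A i. j (blk D (i, a))) :: 'i => 'a => 'b)"
 let ?S = "Sigma (transv ?Z s) (%D. eqv_inj D ((`) ?s) Y g)"
 let ?T = "PiE I (%i. eqv_inj (A i) (s i) Y g)"
 have v: "\<psi> (D, j) i a = j (blk D (i, a))" if "i \<in> I" "a \<in> A i" for D j i a using that by (simp add: \<psi>_def)
 have "bij_betw \<psi> ?S ?T"
 proof (rule bij_betw_imageI)
  show "inj_on \<psi> ?S"
  proof (rule inj_onI)
   fix p q assume p: "p \<in> ?S" and q: "q \<in> ?S" and eq: "\<psi> p = \<psi> q"
   obtain D j where pd: "p = (D, j)" and D: "D \<in> transv ?Z s" and j: "j \<in> eqv_inj D ((`) ?s) Y g" using p by blast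
   obtain E k where qd: "q = (E, k)" and E: "E \<in> transv ?Z s" and k: "k \<in> eqv_inj E ((`) ?s) Y g" using q by blast
   have pD: "partition_on ?Z D" and pE: "partition_on ?Z E" using D E by (auto simp: transv_def)
   have e: "j (blk D z) = k (blk E z)" if "z \<in> ?Z" for z
    using that v[of "fst z" "snd z" D j] v[of "fst z" "snd z" E k] eq pd qd by (cases z) auto
   have ij: "inj_on j D" "inj_on k E" using j k by (auto simp: eqv_inj_def)
   have DE: "D = E"
   proof (rule partition_eqI_blk[OF pD pE])
    fix z w assume "z \<in> ?Z" "w \<in> ?Z"
    thus "blk D z = blk D w \<longleftrightarrow> blk E z = blk E w"
     using e[of z] e[of w] inj_on_eq_iff[OF ij(1)] inj_on_eq_iff[OF ij(2)] blk_in[OF pD] blk_in[OF pE] by metis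
   qed
   have "j = k"
   proof (rule PiE_ext[of j D "%_. Y" k])
    show "j \<in> D \<rightarrow>\<^sub>E Y" "k \<in> D \<rightarrow>\<^sub>E Y" using j k DE by (auto simp: eqv_inj_def)
    fix B assume B: "B \<in> D"
    obtain z where z: "z \<in> B" using partition_nonempty[OF pD B] by blast
    hence "z \<in> ?Z" using partition_subset[OF pD B] by blast
    thus "j B = k B" using e[of z] DE blk_eq[OF pD B z] by simp
   qed
   thus "p = q" using DE pd qd by simp
  qed
  show "\<psi> ` ?S = ?T"
  proof (intro equalityI subsetI)
   fix x assume "x \<in> \<psi> ` ?S"
   then obtain D j where xe: "x = \<psi> (D, j)" and D: "D \<in> transv ?Z s" and j: "j \<in> eqv_inj D ((`) ?s) Y g" by blast
   have pD: "partition_on ?Z D" and tr: "\<And>B. B \<in> D ==> inj_on fst B" and st: "(`) ?s ` D = D"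
    using D by (auto simp: transv_def)
   have jY: "\<And>B. B \<in> D ==> j B \<in> Y" and ji: "inj_on j D" and je: "\<And>B. B \<in> D ==> g (j B) = j (?s ` B)"
    using j by (auto simp: eqv_inj_def)
   have "x i \<in> eqv_inj (A i) (s i) Y g" if i: "i \<in> I" for i
   proof -
    have b: "blk D (i, a) \<in> D" "(i, a) \<in> blk D (i, a)" if "a \<in> A i" for a
     using blk_in[OF pD, of "(i, a)"] that i by auto
    have xv: "x i a = j (blk D (i, a))" if "a \<in> A i" for a using v[OF i that] xe by simp
    have "inj_on (x i) (A i)"
    proof (rule inj_onI)
     fix a c assume a: "a \<in> A i" "c \<in> A i" "x i a = x i c"
     hence "blk D (i, a) = blk D (i, c)" using xv b ji by (metis inj_on_eq_iff)
     hence "(i, a) \<in> blk D (i, a)" "(i, c) \<in> blk D (i, a)" using b a by auto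
     thus "a = c" using inj_onD[OF tr[OF b(1)[OF a(1)]], of "(i, a)" "(i, c)"] by simp
    qed
    moreover have "g (x i a) = x i (s i a)" if a: "a \<in> A i" for a
    proof -
     have sa: "s i a \<in> A i" using s[OF i] a by (auto simp: bij_betw_def)
     have "?s ` blk D (i, a) \<in> D" using st b(1)[OF a] by blast
     moreover have "(i, s i a) \<in> ?s ` blk D (i, a)" using b(2)[OF a] by force
     ultimately have "blk D (i, s i a) = ?s ` blk D (i, a)" by (rule blk_eq[OF pD])
     thus ?thesis using xv[OF a] xv[OF sa] je[OF b(1)[OF a]] by simp
    qed
    moreover have "x i \<in> A i \<rightarrow>\<^sub>E Y" using xe i jY b by (auto simp: \<psi>_def)
    ultimately show ?thesis by (simp add: eqv_inj_def)
   qed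
   moreover have "x \<in> extensional I" by (simp add: xe \<psi>_def)
   ultimately show "x \<in> ?T" by (auto simp: PiE_def)
  next
   fix x assume x: "x \<in> ?T"
   define u where "u z = x (fst z) (snd z)" for z
   \<comment> \<open>The partition into level sets of the family, and the induced injection of its blocks.\<close>
   define D where "D = (%z. {w\<in>?Z. u w = u z}) ` ?Z"
   have xi: "x i \<in> eqv_inj (A i) (s i) Y g" if "i \<in> I" for i using x that by auto
   have uY: "u z \<in> Y" if "z \<in> ?Z" for z using xi that by (fastforce simp: u_def eqv_inj_def)
   have us: "u (?s z) = g (u z)" if "z \<in> ?Z" for z using xi that by (auto simp: u_def eqv_inj_def)
   have pD: "partition_on ?Z D" unfolding D_def partition_on_def disjoint_def by auto
   have cst: "u z = u w" if "B \<in> D" "z \<in> B" "w \<in> B" for B z w using that by (auto simp: D_def)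
   have mem: "w \<in> B" if "B \<in> D" "z \<in> B" "w \<in> ?Z" "u w = u z" for B z w using that by (auto simp: D_def)
   have tr: "inj_on fst B" if B: "B \<in> D" for B
   proof (rule inj_onI)
    fix z w assume zw: "z \<in> B" "w \<in> B" "fst z = fst w"
    have "z \<in> ?Z" "w \<in> ?Z" using zw partition_subset[OF pD B] by auto
    moreover have "u z = u w" using cst[OF B zw(1,2)] .
    ultimately show "z = w" using xi[of "fst z"] zw(3)
     by (cases z; cases w) (auto simp: u_def eqv_inj_def inj_on_def)
   qed
   have ssurj: "\<exists>z\<in>?Z. w = ?s z" if wZ: "w \<in> ?Z" for w
   proof -
    obtain i a where w: "w = (i, a)" "i \<in> I" "a \<in> A i" using wZ by auto
    then obtain b where "b \<in> A i" "a = s i b" using s[of i] by (auto simp: bij_betw_def)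
    thus ?thesis using w by (intro bexI[of _ "(i, b)"]) auto
   qed
   have img: "?s ` {w\<in>?Z. u w = u z} = {w\<in>?Z. u w = u (?s z)}" if z: "z \<in> ?Z" for z
   proof (intro equalityI subsetI)
    fix w assume "w \<in> ?s ` {w\<in>?Z. u w = u z}"
    thus "w \<in> {w\<in>?Z. u w = u (?s z)}" using sZ us z by auto
   next
    fix w assume w: "w \<in> {w\<in>?Z. u w = u (?s z)}"
    then obtain w' where w': "w' \<in> ?Z" "w = ?s w'" using ssurj[of w] by blast
    hence "g (u w') = g (u z)" using w us z by simp
    hence "u w' = u z" using g by (simp add: inj_def)
    thus "w \<in> ?s ` {w\<in>?Z. u w = u z}" using w' by blast
   qed
   have "(`) ?s ` D = (%z. {w\<in>?Z. u w = u (?s z)}) ` ?Z"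
    unfolding D_def image_image by (rule image_cong[OF refl]) (rule img)
   also have "... = (%z. {w\<in>?Z. u w = u z}) ` (?s ` ?Z)" by (simp add: image_image)
   also have "?s ` ?Z = ?Z" using sZ ssurj by blast
   finally have st: "(`) ?s ` D = D" by (simp add: D_def)
   have DT: "D \<in> transv ?Z s" using pD tr st by (simp add: transv_def)
   define j where "j = (\<lambda>B\<in>D. u (SOME z. z \<in> B))"
   have jB: "j B = u z" if "B \<in> D" "z \<in> B" for B z
   proof -
    have "(SOME z. z \<in> B) \<in> B" using that(2) by (rule someI)
    hence "u (SOME z. z \<in> B) = u z" by (rule cst[OF that(1) _ that(2)])
    thus ?thesis using that(1) by (simp only: j_def restrict_apply if_True)
   qed
   have "j \<in> eqv_inj D ((`) ?s) Y g" unfolding eqv_inj_def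
   proof (simp only: mem_Collect_eq, intro conjI ballI)
    show "j \<in> D \<rightarrow>\<^sub>E Y"
    proof (rule PiE_I)
     fix B assume B: "B \<in> D"
     obtain z where z: "z \<in> B" using partition_nonempty[OF pD B] by blast
     thus "j B \<in> Y" using jB[OF B z] uY partition_subset[OF pD B] by auto
    qed (simp add: j_def)
    show "inj_on j D"
    proof (rule inj_onI)
     fix B C assume BC: "B \<in> D" "C \<in> D" "j B = j C"
     obtain z where z: "z \<in> B" using partition_nonempty[OF pD BC(1)] by blast
     obtain w where w: "w \<in> C" using partition_nonempty[OF pD BC(2)] by blast
     have "u w = u z" using jB[OF BC(1) z] jB[OF BC(2) w] BC(3) by simp
     hence "w \<in> B" using mem[OF BC(1) z] w partition_subset[OF pD BC(2)] by blast
     thus "B = C" using blk_eq[OF pD BC(1)] blk_eq[OF pD BC(2) w] by metis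
    qed
    fix B assume B: "B \<in> D"
    obtain z where z: "z \<in> B" using partition_nonempty[OF pD B] by blast
    have "?s ` B \<in> D" using st B by blast
    moreover have "?s z \<in> ?s ` B" using z by blast
    ultimately have "j (?s ` B) = u (?s z)" by (rule jB)
    thus "g (j B) = j (?s ` B)" using us[of z] jB[OF B z] z partition_subset[OF pD B] by auto
   qed
   moreover have "\<psi> (D, j) = x"
   proof (rule PiE_ext[of _ I "%i. A i \<rightarrow>\<^sub>E Y"])
    show "\<psi> (D, j) \<in> (\<Pi>\<^sub>E i\<in>I. A i \<rightarrow>\<^sub>E Y)"
     using blk_in[OF pD] calculation by (fastforce simp: \<psi>_def eqv_inj_def)
    show "x \<in> (\<Pi>\<^sub>E i\<in>I. A i \<rightarrow>\<^sub>E Y)" using x by (auto simp: PiE_def Pi_def eqv_inj_def)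
    fix i assume i: "i \<in> I"
    show "\<psi> (D, j) i = x i"
    proof
     fix a show "\<psi> (D, j) i a = x i a"
     proof (cases "a \<in> A i")
      case True
      hence "blk D (i, a) \<in> D" "(i, a) \<in> blk D (i, a)" using blk_in[OF pD, of "(i, a)"] i by auto
      from jB[OF this] show ?thesis using v[OF i True] by (simp add: u_def)
     next
      case False
      have "x i \<in> extensional (A i)" using xi[OF i] by (simp add: eqv_inj_def PiE_def)
      thus ?thesis using False i by (simp add: \<psi>_def extensional_def)
     qed
    qed
   qed
   ultimately show "x \<in> \<psi> ` ?S" using DT by (intro image_eqI[of _ _ "(D, j)"]) auto
  qed
 qed
 hence "card ?S = card ?T" by (rule bij_betw_same_card)
 moreover have "card ?T = (\<Prod>i\<in>I. Phi (A i) (s i) Y g)" using I by (simp add: card_PiE Phi_def)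
 moreover have "card ?S = (\<Sum>D\<in>transv ?Z s. Phi D ((`) ?s) Y g)"
  unfolding Phi_def by (rule card_SigmaI[OF finT]) (use finD Y in \<open>auto intro!: finite_eqv_inj\<close>)
 ultimately show ?thesis by simp
qed

lemma card_partition_le: "finite Z ==> partition_on Z D ==> card D \<le> card Z"
proof -
 assume Z: "finite Z" and D: "partition_on Z D"
 have "D \<subseteq> blk D ` Z" using partition_nonempty[OF D] partition_subset[OF D] blk_eq[OF D] by blast
 thus ?thesis using Z by (meson card_image_le card_mono finite_imageI le_trans)
qed

text \<open>
By \<open>sum_Phi\<close>, applied to the set of blocks, every stable transversal partition contributes \<open>n!\<close>.
\<close>
lemma sum_prod_Phi:
 fixes s :: "'i => 'a => 'a"
 assumes I: "finite I" and A: "\<And>i. i \<in> I ==> finite (A i)" and s: "\<And>i. i \<in> I ==> bij_betw (s i) (A i) (A i)"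
  and n: "card (Sigma I A) \<le> n"
 shows "(\<Sum>g\<in>Sym n. \<Prod>i\<in>I. Phi (A i) (s i) {1..n} g) = fact n * card (transv (Sigma I A) s)"
proof -
 let ?Z = "Sigma I A" and ?s = "fam_perm s"
 have finZ: "finite ?Z" using I A by auto
 have sinj: "inj_on ?s ?Z" using s by (auto simp: inj_on_def bij_betw_def)
 have "(\<Sum>g\<in>Sym n. \<Prod>i\<in>I. Phi (A i) (s i) {1..n} g) = (\<Sum>g\<in>Sym n. \<Sum>D\<in>transv ?Z s. Phi D ((`) ?s) {1..n} g)"
  by (intro sum.cong refl prod_Phi I A s) (auto simp: Sym_bij bij_is_inj)
 also have "... = (\<Sum>D\<in>transv ?Z s. \<Sum>g\<in>Sym n. Phi D ((`) ?s) {1..n} g)" by (rule sum.swap)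
 also have "... = (\<Sum>D\<in>transv ?Z s. fact n)"
 proof (rule sum.cong[OF refl])
  fix D assume "D \<in> transv ?Z s"
  hence pD: "partition_on ?Z D" and st: "(`) ?s ` D = D" by (auto simp: transv_def)
  have "inj_on ((`) ?s) D"
   by (rule inj_on_subset[OF inj_on_image_Pow[OF sinj]]) (use partition_subset[OF pD] in blast)
  hence "bij_betw ((`) ?s) D D" using st by (simp add: bij_betw_def)
  thus "(\<Sum>g\<in>Sym n. Phi D ((`) ?s) {1..n} g) = fact n"
   using card_partition_le[OF finZ pD] n by (intro sum_Phi finite_elements[OF finZ pD]) auto
 qed
 finally show ?thesis by simp
qed

text \<open>
Adding the points of \<open>U\<close> as singleton blocks identifies partitions of \<open>Z - U\<close> with those partitions of \<open>Z\<close> in which \<open>U\<close> is split into singletons.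
\<close>
lemma card_transv_diff:
 fixes s :: "'i => 'a => 'a"
 assumes UZ: "U \<subseteq> Z" and U: "fam_perm s ` U = U" and inj: "inj_on (fam_perm s) Z"
 shows "card (transv (Z - U) s) = card {D \<in> transv Z s. \<forall>u\<in>U. {u} \<in> D}"
proof -
 let ?s = "fam_perm s" and ?T = "{D \<in> transv Z s. \<forall>u\<in>U. {u} \<in> D}"
 define sg where "sg = (%z. {z}) ` U"
 have sgs: "(`) ?s ` sg = sg"
 proof -
  have "(`) ?s ` sg = (%z. {z}) ` (?s ` U)" unfolding sg_def image_image by simp
  thus ?thesis by (simp only: U sg_def)
 qed
 have Usg: "\<Union>sg = U" by (auto simp: sg_def)
 have "bij_betw (%D. D \<union> sg) (transv (Z - U) s) ?T"
 proof (rule bij_betwI[where g = "%D. D - sg"])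
  show "(%D. D \<union> sg) \<in> transv (Z - U) s \<rightarrow> ?T"
  proof (rule Pi_I)
   fix D assume "D \<in> transv (Z - U) s"
   hence D: "partition_on (Z - U) D" "\<forall>B\<in>D. inj_on fst B" "(`) ?s ` D = D" by (auto simp: transv_def)
   have "\<Union>(D \<union> sg) = Z" using D(1) UZ Usg unfolding partition_on_def by blast
   moreover have "disjoint (D \<union> sg)"
    using D(1) partition_subset[OF D(1)] unfolding partition_on_def disjoint_def sg_def by blast
   moreover have "{} \<notin> D \<union> sg" using D(1) by (auto simp: partition_on_def sg_def)
   ultimately have "partition_on Z (D \<union> sg)" by (simp add: partition_on_def)
   thus "D \<union> sg \<in> ?T"
    using D sgs by (auto simp: transv_def image_Un sg_def)
  qed
  show "(%D. D - sg) \<in> ?T \<rightarrow> transv (Z - U) s"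
  proof (rule Pi_I)
   fix D assume "D \<in> ?T"
   hence D: "partition_on Z D" "\<forall>B\<in>D. inj_on fst B" "(`) ?s ` D = D" and sub: "sg \<subseteq> D"
    by (auto simp: transv_def sg_def)
   have avoid: "B \<inter> U = {}" if "B \<in> D - sg" for B
   proof (rule ccontr)
    assume "B \<inter> U \<noteq> {}"
    then obtain u where u: "u \<in> B" "u \<in> U" by blast
    hence "{u} \<in> D" "{u} \<in> sg" using sub by (auto simp: sg_def)
    hence "B = {u}" using blk_eq[OF D(1) _ u(1)] blk_eq[OF D(1), of "{u}" u] that by simp
    thus False using that \<open>{u} \<in> sg\<close> by simp
   qed
   have "\<Union>(D - sg) = Z - U"
   proof
    show "\<Union>(D - sg) \<subseteq> Z - U" using avoid partition_subset[OF D(1)] by blast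
    show "Z - U \<subseteq> \<Union>(D - sg)"
    proof
     fix z assume z: "z \<in> Z - U"
     hence "blk D z \<in> D" "z \<in> blk D z" using blk_in[OF D(1)] by auto
     moreover have "blk D z \<notin> sg" using z calculation by (auto simp: sg_def)
     ultimately show "z \<in> \<Union>(D - sg)" by blast
    qed
   qed
   moreover have "disjoint (D - sg)" "{} \<notin> D - sg" using D(1) by (auto simp: partition_on_def disjoint_def)
   ultimately have "partition_on (Z - U) (D - sg)" by (simp add: partition_on_def)
   moreover have "(`) ?s ` (D - sg) = D - sg"
   proof -
    have "inj_on ((`) ?s) D"
     by (rule inj_on_subset[OF inj_on_image_Pow[OF inj]]) (use partition_subset[OF D(1)] in blast)
    hence "(`) ?s ` (D - sg) = (`) ?s ` D - (`) ?s ` sg" by (rule inj_on_image_set_diff) (use sub in auto)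
    thus ?thesis by (simp only: D(3) sgs)
   qed
   ultimately show "D - sg \<in> transv (Z - U) s" using D(2) by (auto simp: transv_def)
  qed
  show "D \<union> sg - sg = D" if "D \<in> transv (Z - U) s" for D
  proof -
   have D: "partition_on (Z - U) D" using that by (simp add: transv_def)
   have "B \<notin> sg" if "B \<in> D" for B using partition_subset[OF D that] by (auto simp: sg_def)
   thus ?thesis by blast
  qed
  show "D - sg \<union> sg = D" if "D \<in> ?T" for D
   using that by (auto simp: sg_def)
 qed
 thus ?thesis by (rule bij_betw_same_card)
qed

lemma alternating_sum_Pow:
 assumes "finite S"
 shows "(\<Sum>X\<in>Pow S. (-1) ^ card X) = (of_bool (S = {}) :: int)"
proof (cases "S = {}")
 case False
 then obtain x where x: "x \<in> S" by blast
 let ?h = "%X. if x \<in> X then X - {x} else insert x X"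
 have "(\<Sum>X\<in>Pow S. (-1) ^ card X) = (\<Sum>X\<in>Pow S. - ((-1 :: int) ^ card X))"
 proof (rule sum.reindex_bij_witness[of _ ?h ?h])
  fix X assume X: "X \<in> Pow S"
  hence fin: "finite X" using assms finite_subset by auto
  show "- ((-1 :: int) ^ card (?h X)) = (-1) ^ card X"
  proof (cases "x \<in> X")
   case True
   hence "card X = Suc (card (X - {x}))" using fin by (metis card_Suc_Diff1)
   hence "(-1 :: int) ^ card X = - ((-1) ^ card (X - {x}))" by (simp only: power_Suc mult_minus1)
   thus ?thesis using True by (simp only: if_True)
  next
   case False thus ?thesis using fin by simp
  qed
 qed (use x in auto)
 thus ?thesis using False by (simp add: sum_negf)
qed simp

text \<open>
Inclusion-exclusion over the cycles of \<open>s\<close> that are deleted.  It removes singletons from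
the partitions counted by \<open>sum_prod_Phi\<close>, and it leaves the pairing with larger Young symmetrizers unchanged.
\<close>
definition psi :: "('a => 'a) => 'a set => 'b set => ('b => 'b) => int" where
 "psi s M Y g = (\<Sum>X\<in>Pow (orbs s M). (-1) ^ card X * int (Phi (M - \<Union>X) s Y g))"

definition good_parts :: "'i set => 'a set => ('i => 'a => 'a) => ('i \<times> 'a) set set set" where
 "good_parts I M s = {D \<in> transv (I \<times> M) s. \<forall>z\<in>I \<times> M. {z} \<notin> D}"

lemma orbs_union_stable:
 assumes s: "s permutes M" "finite M" and X: "X \<subseteq> orbs s M"
 shows "\<Union>X \<subseteq> M" "s ` \<Union>X = \<Union>X"
proof -
 have sM: "s ` M \<subseteq> M" using permutes_image[OF s(1)] by simp
 show U: "\<Union>X \<subseteq> M" using X orbit_subset_stable[OF sM] unfolding orbs_def by blast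
 have sub: "s ` \<Union>X \<subseteq> \<Union>X"
 proof
  fix b assume "b \<in> s ` \<Union>X"
  then obtain o' c where o': "o' \<in> X" "c \<in> o'" "b = s c" by blast
  then obtain a where "o' = orbit s a" using X by (auto simp: orbs_def)
  thus "b \<in> \<Union>X" using o' orbit.step[of c s a] by auto
 qed
 show "s ` \<Union>X = \<Union>X"
  by (rule card_subset_eq[OF _ sub])
   (use finite_subset[OF U s(2)] permutes_inj[OF s(1)] in \<open>auto intro!: card_image inj_on_subset[of s UNIV]\<close>)
qed

text \<open>
Expanding all factors gives the signed sum, over families \<open>f\<close> of sets of cycles, of the numbers of stable
transversal partitions in which the points of the chosen cycles are singletons.  For a fixed
partition \<open>D\<close> the signs cancel unless no cycle consists of singletons of \<open>D\<close>; by stability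
this means that \<open>D\<close> has no singleton at all.
\<close>
theorem sum_prod_psi:
 fixes s :: "'i => 'a => 'a"
 assumes I: "finite I" and M: "finite M" and s: "\<And>i. i \<in> I ==> s i permutes M"
  and n: "card I * card M \<le> n"
 shows "(\<Sum>g\<in>Sym n. \<Prod>i\<in>I. psi (s i) M {1..n} g) = fact n * int (card (good_parts I M s))"
proof -
 let ?Z = "I \<times> M" and ?s = "fam_perm s"
 let ?F = "PiE I (%i. Pow (orbs (s i) M))"
 have finZ: "finite ?Z" using I M by simp
 have perm: "permutation (s i)" if "i \<in> I" for i using s[OF that] M permutation_permutes by blast
 have finO: "finite (orbs (s i) M)" for i using M by (simp add: orbs_def)
 have finT: "finite (transv ?Z s)"
  by (rule finite_subset[OF _ finitely_many_partition_on[OF finZ]]) (auto simp: transv_def)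
 have sinj: "inj_on ?s ?Z"
 proof (rule inj_onI)
  fix z w assume z: "z \<in> ?Z" "w \<in> ?Z" "?s z = ?s w"
  thus "z = w" using injD[OF permutes_inj[OF s[of "fst z"]], of "snd z" "snd w"] by (cases z; cases w) auto
 qed
 define w :: "('i => 'a set set) => int" where "w f = (\<Prod>i\<in>I. (-1) ^ card (f i))" for f
 define sgl where "sgl D i = {o' \<in> orbs (s i) M. \<forall>a\<in>o'. {(i, a)} \<in> D}" for D i
 have T: "(\<Sum>g\<in>Sym n. \<Prod>i\<in>I. Phi (M - \<Union>(f i)) (s i) {1..n} g) = fact n * card {D \<in> transv ?Z s. \<forall>i\<in>I. f i \<subseteq> sgl D i}"
  if f: "f \<in> ?F" for f
 proof -
  have fi: "f i \<subseteq> orbs (s i) M" if "i \<in> I" for i using f that by (auto simp: PiE_def Pi_def)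
  define U where "U = Sigma I (%i. \<Union>(f i))"
  have st: "\<Union>(f i) \<subseteq> M" "s i ` \<Union>(f i) = \<Union>(f i)" if "i \<in> I" for i
   using orbs_union_stable[OF s[OF that] M fi[OF that]] by auto
  have ZU: "Sigma I (%i. M - \<Union>(f i)) = ?Z - U" by (auto simp: U_def)
  have "(\<Sum>g\<in>Sym n. \<Prod>i\<in>I. Phi (M - \<Union>(f i)) (s i) {1..n} g) = fact n * card (transv (Sigma I (%i. M - \<Union>(f i))) s)"
  proof (rule sum_prod_Phi[OF I])
   fix i assume i: "i \<in> I"
   have "s i ` (M - \<Union>(f i)) = s i ` M - s i ` \<Union>(f i)" by (rule image_set_diff[OF permutes_inj[OF s[OF i]]])
   hence "s i ` (M - \<Union>(f i)) = M - \<Union>(f i)" by (simp only: st(2)[OF i] permutes_image[OF s[OF i]])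
   thus "bij_betw (s i) (M - \<Union>(f i)) (M - \<Union>(f i))"
    using permutes_inj[OF s[OF i]] by (auto simp: bij_betw_def intro: inj_on_subset)
  next
   have "card (Sigma I (%i. M - \<Union>(f i))) \<le> card ?Z" by (rule card_mono[OF finZ]) auto
   thus "card (Sigma I (%i. M - \<Union>(f i))) \<le> n" using n by (simp add: card_cartesian_product)
  qed (use M in simp)
  also have "card (transv (Sigma I (%i. M - \<Union>(f i))) s) = card {D \<in> transv ?Z s. \<forall>u\<in>U. {u} \<in> D}"
   unfolding ZU
  proof (rule card_transv_diff[OF _ _ sinj])
   show "U \<subseteq> ?Z" using st by (auto simp: U_def)
   show "?s ` U = U"
   proof (intro equalityI subsetI)
    fix z assume "z \<in> ?s ` U"
    then obtain v where v: "v \<in> U" "z = ?s v" by blast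
    obtain i a where ia: "v = (i, a)" by (cases v)
    have z: "z = (i, s i a)" "i \<in> I" "a \<in> \<Union>(f i)" using v ia by (auto simp: U_def)
    hence "s i a \<in> s i ` \<Union>(f i)" by blast
    hence "s i a \<in> \<Union>(f i)" by (simp only: st(2)[OF z(2)])
    thus "z \<in> U" using z by (auto simp: U_def)
   next
    fix z assume "z \<in> U"
    then obtain i a where z: "z = (i, a)" "i \<in> I" "a \<in> \<Union>(f i)" by (auto simp: U_def)
    hence "a \<in> s i ` \<Union>(f i)" using st(2)[OF z(2)] by simp
    then obtain b where "b \<in> \<Union>(f i)" "a = s i b" by blast
    thus "z \<in> ?s ` U" using z by (intro image_eqI[of _ _ "(i, b)"]) (auto simp: U_def)
   qed
  qed
  also have "{D \<in> transv ?Z s. \<forall>u\<in>U. {u} \<in> D} = {D \<in> transv ?Z s. \<forall>i\<in>I. f i \<subseteq> sgl D i}"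
   using fi unfolding U_def sgl_def by blast
  finally show ?thesis .
 qed
 have "(\<Sum>g\<in>Sym n. \<Prod>i\<in>I. psi (s i) M {1..n} g)
   = (\<Sum>g\<in>Sym n. \<Sum>f\<in>?F. \<Prod>i\<in>I. (-1) ^ card (f i) * int (Phi (M - \<Union>(f i)) (s i) {1..n} g))"
  unfolding psi_def by (subst prod_sum_PiE[OF I]) (use finO in auto)
 also have "... = (\<Sum>f\<in>?F. \<Sum>g\<in>Sym n. w f * int (\<Prod>i\<in>I. Phi (M - \<Union>(f i)) (s i) {1..n} g))"
  by (subst sum.swap) (simp add: prod.distrib w_def of_nat_prod)
 also have "... = (\<Sum>f\<in>?F. w f * (fact n * int (card {D \<in> transv ?Z s. \<forall>i\<in>I. f i \<subseteq> sgl D i})))"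
 proof (rule sum.cong[OF refl])
  fix f assume f: "f \<in> ?F"
  have "(\<Sum>g\<in>Sym n. w f * int (\<Prod>i\<in>I. Phi (M - \<Union>(f i)) (s i) {1..n} g))
   = w f * int (\<Sum>g\<in>Sym n. \<Prod>i\<in>I. Phi (M - \<Union>(f i)) (s i) {1..n} g)"
   by (simp only: sum_distrib_left of_nat_sum)
  thus "(\<Sum>g\<in>Sym n. w f * int (\<Prod>i\<in>I. Phi (M - \<Union>(f i)) (s i) {1..n} g))
   = w f * (fact n * int (card {D \<in> transv ?Z s. \<forall>i\<in>I. f i \<subseteq> sgl D i}))"
   by (simp only: T[OF f] of_nat_mult of_nat_fact)
 qed
 also have "... = fact n * (\<Sum>f\<in>?F. \<Sum>D\<in>transv ?Z s. w f * of_bool (\<forall>i\<in>I. f i \<subseteq> sgl D i))"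
  using finT by (simp add: sum_distrib_left mult_ac Int_def)
 also have "(\<Sum>f\<in>?F. \<Sum>D\<in>transv ?Z s. w f * of_bool (\<forall>i\<in>I. f i \<subseteq> sgl D i))
   = (\<Sum>D\<in>transv ?Z s. \<Sum>f\<in>?F. w f * of_bool (\<forall>i\<in>I. f i \<subseteq> sgl D i))" by (rule sum.swap)
 also have "... = (\<Sum>D\<in>transv ?Z s. of_bool (\<forall>z\<in>?Z. {z} \<notin> D))"
 proof (rule sum.cong[OF refl])
  fix D assume D: "D \<in> transv ?Z s"
  have pb: "(\<Prod>i\<in>I. of_bool (P i)) = (of_bool (\<forall>i\<in>I. P i) :: int)" for P
   using I by (auto simp: prod_eq_1_iff intro!: prod_zero)
  have "(\<Sum>f\<in>?F. w f * of_bool (\<forall>i\<in>I. f i \<subseteq> sgl D i)) = (\<Sum>f\<in>?F. \<Prod>i\<in>I. (-1) ^ card (f i) * of_bool (f i \<subseteq> sgl D i))"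
   by (simp add: w_def prod.distrib pb)
  also have "... = (\<Prod>i\<in>I. \<Sum>X\<in>Pow (orbs (s i) M). (-1) ^ card X * of_bool (X \<subseteq> sgl D i))"
   by (rule prod_sum_PiE[OF I, symmetric]) (use finO in auto)
  also have "... = (\<Prod>i\<in>I. of_bool (sgl D i = {}))"
  proof (rule prod.cong[OF refl])
   fix i
   have "(\<Sum>X\<in>Pow (orbs (s i) M). (-1) ^ card X * of_bool (X \<subseteq> sgl D i)) = (\<Sum>X\<in>Pow (sgl D i). (-1 :: int) ^ card X)"
    by (rule sum.mono_neutral_cong_right) (use finO in \<open>auto simp: sgl_def\<close>)
   also have "... = of_bool (sgl D i = {})" by (rule alternating_sum_Pow) (use finO in \<open>simp add: sgl_def\<close>)
   finally show "(\<Sum>X\<in>Pow (orbs (s i) M). (-1) ^ card X * of_bool (X \<subseteq> sgl D i)) = (of_bool (sgl D i = {}) :: int)" .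
  qed
  also have "... = of_bool (\<forall>i\<in>I. sgl D i = {})" by (rule pb)
  also have "(\<forall>i\<in>I. sgl D i = {}) \<longleftrightarrow> (\<forall>z\<in>?Z. {z} \<notin> D)"
  proof
   assume L: "\<forall>i\<in>I. sgl D i = {}"
   show "\<forall>z\<in>?Z. {z} \<notin> D"
   proof (intro ballI notI)
    fix z assume "z \<in> ?Z" "{z} \<in> D"
    then obtain i a where z: "i \<in> I" "a \<in> M" "{(i, a)} \<in> D" by auto
    have "{(i, b)} \<in> D" if "b \<in> orbit (s i) a" for b
     using that
    proof induction
     case base
     have "?s ` {(i, a)} \<in> D" using D z(3) unfolding transv_def by blast
     thus ?case by simp
    next
     case (step c)
     have "?s ` {(i, c)} \<in> D" using D step.IH unfolding transv_def by blast
     thus ?case by simp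
    qed
    hence "orbit (s i) a \<in> sgl D i" using z by (simp add: sgl_def orbs_def)
    thus False using L z by blast
   qed
  next
   assume R: "\<forall>z\<in>?Z. {z} \<notin> D"
   show "\<forall>i\<in>I. sgl D i = {}"
   proof (rule ccontr)
    assume "\<not> (\<forall>i\<in>I. sgl D i = {})"
    then obtain i o' where i: "i \<in> I" and o': "o' \<in> sgl D i" by blast
    then obtain a where a: "a \<in> M" "o' = orbit (s i) a" by (auto simp: sgl_def orbs_def)
    hence "{(i, a)} \<in> D" using o' orbit_self[OF perm[OF i], of a] by (auto simp: sgl_def)
    thus False using R i a by blast
   qed
  qed
  finally show "(\<Sum>f\<in>?F. w f * of_bool (\<forall>i\<in>I. f i \<subseteq> sgl D i)) = (of_bool (\<forall>z\<in>?Z. {z} \<notin> D) :: int)" .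
 qed
 also have "... = int (card (good_parts I M s))"
  using finT by (simp add: good_parts_def Int_def)
 finally show ?thesis .
qed

text \<open>
With two fibres, transversal partitions without singletons are the graphs of bijections, and stability says that the bijection intertwines the two permutations.
\<close>
lemma card_good_parts_two:
 fixes M :: "'a set" and s :: "nat => 'a => 'a"
 assumes M: "finite M" and s: "s 0 permutes M" "s 1 permutes M"
 shows "card (good_parts {..<2} M s) = card {b. b permutes M \<and> b o s 0 = s 1 o b}"
proof -
 let ?Z = "{..<2::nat} \<times> M" and ?s = "fam_perm s" and ?B = "{b. b permutes M \<and> b o s 0 = s 1 o b}"
 define P where "P b = (%a. {(0::nat, a), (1, b a)}) ` M" for b :: "'a => 'a"
 have "bij_betw P ?B (good_parts {..<2} M s)"
 proof (rule bij_betw_imageI)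
  show "inj_on P ?B"
  proof (rule inj_onI)
   fix b c assume b: "b \<in> ?B" and c: "c \<in> ?B"
    and e: "P b = P c"
   show "b = c"
   proof
    fix a show "b a = c a"
    proof (cases "a \<in> M")
     case True
     hence "{(0, a), (1, b a)} \<in> P c" using e unfolding P_def by blast
     then obtain a' where "{(0::nat, a), (1, b a)} = {(0, a'), (1, c a')}" unfolding P_def by blast
     thus ?thesis by (auto simp: doubleton_eq_iff)
    next
     case False thus ?thesis using b c by (auto simp: permutes_not_in)
    qed
   qed
  qed
  show "P ` ?B = good_parts {..<2} M s"
  proof (intro equalityI subsetI)
   fix D assume "D \<in> P ` ?B"
   then obtain b where b: "b permutes M" "b o s 0 = s 1 o b" and D: "D = P b" by blast
   have bM: "b a \<in> M \<longleftrightarrow> a \<in> M" for a using permutes_in_image[OF b(1)] .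
   have binj: "b a = b c \<longleftrightarrow> a = c" for a c using permutes_inj[OF b(1)] by (auto simp: inj_def)
   have comm: "b (s 0 a) = s 1 (b a)" for a using b(2) by (metis comp_apply)
   have "\<Union>D = ?Z"
   proof (intro equalityI subsetI)
    fix z assume z: "z \<in> ?Z"
    obtain i a where ia: "z = (i, a)" "i = 0 \<or> i = 1" "a \<in> M" using z by fastforce
    show "z \<in> \<Union>D"
    proof (cases "i = 0")
     case True thus ?thesis using ia by (auto simp: D P_def)
    next
     case False
     have "inv b a \<in> M" "b (inv b a) = a" using b(1) ia(3) permutes_inverses(1)[OF b(1)] bM by metis+
     thus ?thesis using ia False unfolding D P_def by (intro UnionI[of "{(0, inv b a), (1, b (inv b a))}"]) auto
    qed
   qed (auto simp: D P_def bM)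
   moreover have "disjoint D" unfolding disjoint_def D P_def by (auto simp: binj)
   moreover have "{} \<notin> D" by (auto simp: D P_def)
   ultimately have "partition_on ?Z D" by (simp add: partition_on_def)
   moreover have "\<forall>B\<in>D. inj_on fst B" by (auto simp: D P_def)
   moreover have "(`) ?s ` D = D"
   proof -
    have "(`) ?s ` D = (%a. {(0, s 0 a), (1, b (s 0 a))}) ` M"
     unfolding D P_def image_image by (rule image_cong) (auto simp: comm)
    also have "... = P b" unfolding P_def using permutes_image[OF s(1)] by (metis (no_types, lifting) image_cong image_image)
    finally show ?thesis by (simp add: D)
   qed
   moreover have "\<forall>z\<in>?Z. {z} \<notin> D" by (auto simp: D P_def)
   ultimately show "D \<in> good_parts {..<2} M s" by (simp add: good_parts_def transv_def)
  next
   fix D assume "D \<in> good_parts {..<2} M s"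
   hence D: "partition_on ?Z D" and tr: "\<And>B. B \<in> D ==> inj_on fst B" and st: "(`) ?s ` D = D"
    and ns: "\<And>z. z \<in> ?Z ==> {z} \<notin> D" by (auto simp: good_parts_def transv_def)
   have shape: "\<exists>a\<in>M. \<exists>c\<in>M. B = {(0, a), (1, c)}" if B: "B \<in> D" for B
   proof -
    obtain z where z: "z \<in> B" using partition_nonempty[OF D B] by blast
    have sub: "B \<subseteq> ?Z" by (rule partition_subset[OF D B])
    have "B \<noteq> {z}" using ns[of z] z sub B by blast
    then obtain w where w: "w \<in> B" "w \<noteq> z" using z by blast
    have ne: "fst z \<noteq> fst w" using inj_onD[OF tr[OF B] _ z w(1)] w(2) by blast
    have "fst z < 2" "fst w < 2" using z w sub by auto
    hence "\<exists>z0\<in>B. \<exists>z1\<in>B. fst z0 = 0 \<and> fst z1 = 1"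
    proof (cases "fst z = 0")
     case True thus ?thesis using z w ne \<open>fst w < 2\<close> by (intro bexI[of _ z] bexI[of _ w]) auto
    next
     case False thus ?thesis using z w ne \<open>fst w < 2\<close> \<open>fst z < 2\<close> by (intro bexI[of _ w] bexI[of _ z]) auto
    qed
    then obtain a c where ac: "(0, a) \<in> B" "(1, c) \<in> B" by (metis prod.collapse)
    have "v \<in> {(0, a), (1, c)}" if v: "v \<in> B" for v
    proof -
     have "fst v < 2" using v sub by auto
     hence "fst v = 0 \<or> fst v = 1" by auto
     thus ?thesis using inj_onD[OF tr[OF B] _ v ac(1)] inj_onD[OF tr[OF B] _ v ac(2)] by auto
    qed
    hence "B = {(0, a), (1, c)}" using ac by blast
    moreover have "a \<in> M" "c \<in> M" using ac sub by auto
    ultimately show ?thesis by blast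
   qed
   have ex: "\<exists>c\<in>M. {(0, a), (1, c)} \<in> D" if a: "a \<in> M" for a
   proof -
    have "blk D (0, a) \<in> D" "(0, a) \<in> blk D (0, a)" using blk_in[OF D, of "(0, a)"] a by auto
    moreover from shape[OF this(1)] obtain a' c where "c \<in> M" "blk D (0, a) = {(0, a'), (1, c)}" by blast
    ultimately show ?thesis by (intro bexI[of _ c]) auto
   qed
   define b where "b a = (if a \<in> M then SOME c. c \<in> M \<and> {(0::nat, a), (1, c)} \<in> D else a)" for a
   have b: "b a \<in> M" "{(0, a), (1, b a)} \<in> D" if "a \<in> M" for a
    using someI_ex[of "%c. c \<in> M \<and> {(0::nat, a), (1, c)} \<in> D"] ex[OF that] that by (auto simp: b_def)
   have uniq: "a = a' \<longleftrightarrow> c = c'" if "{(0::nat, a), (1, c)} \<in> D" "{(0, a'), (1, c')} \<in> D" for a a' c c'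
   proof
    assume "a = a'"
    hence "{(0::nat, a), (1, c)} = {(0, a'), (1, c')}"
     using blk_eq[OF D that(1), of "(0, a)"] blk_eq[OF D that(2), of "(0, a)"] by simp
    thus "c = c'" by (auto simp: doubleton_eq_iff)
   next
    assume "c = c'"
    hence "{(0::nat, a), (1, c)} = {(0, a'), (1, c')}"
     using blk_eq[OF D that(1), of "(1, c)"] blk_eq[OF D that(2), of "(1, c)"] by simp
    thus "a = a'" by (auto simp: doubleton_eq_iff)
   qed
   have "inj_on b M" using uniq b by (metis (no_types, lifting) inj_onI)
   moreover have "b ` M \<subseteq> M" using b by blast
   ultimately have "bij_betw b M M" using M by (simp add: bij_betw_def endo_inj_surj)
   hence perm: "b permutes M" by (rule bij_imp_permutes) (simp add: b_def)
   have DP: "D = P b"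
   proof (intro equalityI subsetI)
    fix B assume B: "B \<in> D"
    then obtain a c where ac: "a \<in> M" "B = {(0, a), (1, c)}" using shape by blast
    hence "c = b a" using uniq[of a c a "b a"] B b[OF ac(1)] by simp
    thus "B \<in> P b" using ac by (auto simp: P_def)
   qed (use b in \<open>auto simp: P_def\<close>)
   have "b (s 0 a) = s 1 (b a)" for a
   proof (cases "a \<in> M")
    case True
    have "?s ` {(0, a), (1, b a)} \<in> D" using st b(2)[OF True] by blast
    hence "{(0, s 0 a), (1, s 1 (b a))} \<in> D" by simp
    moreover have "s 0 a \<in> M" using permutes_in_image[OF s(1)] True by simp
    ultimately show ?thesis using uniq b(2) by blast
   next
    case False
    thus ?thesis using permutes_not_in[OF s(1) False] permutes_not_in[OF s(2) False] permutes_not_in[OF perm False] by simp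
   qed
   hence "b o s 0 = s 1 o b" by (simp add: fun_eq_iff)
   thus "D \<in> P ` ?B" using perm DP by blast
  qed
 qed
 from bij_betw_same_card[OF this] show ?thesis by (rule sym)
qed

lemma orbit_conj:
 assumes t: "bij t"
 shows "orbit (t o s o inv t) (t a) = t ` orbit s a"
proof -
 have it: "inv t (t x) = x" for x using t by (simp add: bij_is_inj)
 have sub: "t b \<in> orbit (t o s o inv t) (t a)" if "b \<in> orbit s a" for b
  using that
 proof induction
  case base
  have "(t o s o inv t) (t a) \<in> orbit (t o s o inv t) (t a)" by (rule orbit.base)
  thus ?case unfolding o_apply it .
 next
  case (step c)
  have "(t o s o inv t) (t c) \<in> orbit (t o s o inv t) (t a)" by (rule orbit.step[OF step.IH])
  thus ?case unfolding o_apply it .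
 qed
 have sup: "c \<in> t ` orbit s a" if "c \<in> orbit (t o s o inv t) (t a)" for c
  using that
 proof induction
  case base show ?case using orbit.base[of s a] by (simp add: it)
 next
  case (step c)
  then obtain b where "b \<in> orbit s a" "c = t b" by blast
  thus ?case using orbit.step[of b s a] by (simp add: it)
 qed
 show ?thesis using sub sup by blast
qed

lemma orbs_conj: "bij t ==> orbs (t o s o inv t) (t ` A) = (`) t ` orbs s A"
 unfolding orbs_def by (simp add: image_image orbit_conj)

lemma ncyc_conj:
 assumes t: "bij t"
 shows "ncyc (t o s o inv t) (t ` A) d = ncyc s A d"
proof -
 have inj: "inj_on t X" for X using t by (meson bij_is_inj inj_on_subset subset_UNIV)
 have "{o' \<in> (`) t ` orbs s A. card o' = d} = (`) t ` {o' \<in> orbs s A. card o' = d}"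
  using card_image[OF inj] by auto
 moreover have "inj ((`) t)" by (rule injI) (simp add: inj_image_eq_iff[OF bij_is_inj[OF t]])
 hence "card ((`) t ` {o' \<in> orbs s A. card o' = d}) = card {o' \<in> orbs s A. card o' = d}"
  by (rule card_image[OF inj_on_subset[OF _ subset_UNIV]])
 ultimately show ?thesis unfolding ncyc_def orbs_conj[OF t] by simp
qed

text \<open>\<open>psi\<close> as a function of the cycle numbers \<open>c\<close>, by \<open>Phi_formula\<close>.\<close>
definition psi_count :: "('a => 'a) => 'a set => (nat => nat) => int" where
 "psi_count s M c = (\<Sum>X\<in>Pow (orbs s M). (-1) ^ card X *
   int (\<Prod>d\<in>{1..card M}. d ^ ncyc s (M - \<Union>X) d * ff (c d) (ncyc s (M - \<Union>X) d)))"

lemma psi_eq_count: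
 assumes M: "finite M" and s: "s permutes M" and g: "g \<in> Sym n"
  and c: "\<And>d. d \<in> {1..card M} ==> c d = ncyc g {1..n} d"
 shows "psi s M {1..n} g = psi_count s M c"
 unfolding psi_def psi_count_def
proof (rule sum.cong[OF refl])
 fix X assume "X \<in> Pow (orbs s M)"
 hence X: "X \<subseteq> orbs s M" by simp
 have p: "permutation s" using s M permutation_permutes by blast
 have st: "s ` (M - \<Union>X) \<subseteq> M - \<Union>X"
  using image_set_diff[OF permutes_inj[OF s], of M "\<Union>X"] orbs_union_stable[OF s M X] permutes_image[OF s] by simp
 have gn: "g ` {1..n} \<subseteq> {1..n}" using Sym_range[OF g] by blast
 have "Phi (M - \<Union>X) s {1..n} g
   = (\<Prod>d\<in>{1..card M}. d ^ ncyc s (M - \<Union>X) d * ff (ncyc g {1..n} d) (ncyc s (M - \<Union>X) d))"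
  by (rule Phi_formula[OF p Sym_permutation[OF g] _ st]) (use M gn in \<open>auto intro: card_mono\<close>)
 thus "(-1) ^ card X * int (Phi (M - \<Union>X) s {1..n} g) = (-1) ^ card X *
   int (\<Prod>d\<in>{1..card M}. d ^ ncyc s (M - \<Union>X) d * ff (c d) (ncyc s (M - \<Union>X) d))"
  using c by simp
qed

lemma psi_conj_right:
 assumes M: "finite M" and s: "s permutes M" and g: "g \<in> Sym n" and h: "h \<in> Sym n"
 shows "psi s M {1..n} (h o g o inv h) = psi s M {1..n} g"
proof -
 have "h ` {1..n} = {1..n}" using h by (simp add: Sym_def permutes_image)
 hence "ncyc (h o g o inv h) {1..n} d = ncyc g {1..n} d" for d
  using ncyc_conj[OF Sym_bij[OF h], of g "{1..n}" d] by simp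
 thus ?thesis using psi_eq_count[OF M s, of "h o g o inv h" n "ncyc g {1..n}"] psi_eq_count[OF M s g, of "ncyc g {1..n}"] g h by simp
qed

lemma psi_conj_left:
 assumes M: "finite M" and s: "s permutes M" and t: "t permutes M" and g: "g \<in> Sym n"
 shows "psi (t o s o inv t) M {1..n} g = psi s M {1..n} g"
proof -
 have bt: "bij t" by (rule permutes_bij[OF t])
 have tM: "t ` M = M" by (rule permutes_image[OF t])
 have p: "(t o s o inv t) permutes M" using s t by (simp add: permutes_compose permutes_inv)
 have orb: "orbs (t o s o inv t) M = (`) t ` orbs s M" using orbs_conj[OF bt, of s M] by (simp add: tM)
 have inj: "inj ((`) t)" by (rule injI) (simp add: inj_image_eq_iff[OF bij_is_inj[OF bt]])
 have "psi_count (t o s o inv t) M c = psi_count s M c" for c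
  unfolding psi_count_def orb
 proof -
  have "Pow ((`) t ` orbs s M) = (`) ((`) t) ` Pow (orbs s M)" by (simp add: image_Pow_surj)
  moreover have "inj_on ((`) ((`) t)) (Pow (orbs s M))" by (rule inj_onI) (simp add: inj_image_eq_iff[OF inj])
  ultimately have "(\<Sum>X\<in>Pow ((`) t ` orbs s M). (-1) ^ card X *
    int (\<Prod>d\<in>{1..card M}. d ^ ncyc (t o s o inv t) (M - \<Union>X) d * ff (c d) (ncyc (t o s o inv t) (M - \<Union>X) d)))
   = (\<Sum>X\<in>Pow (orbs s M). (-1) ^ card ((`) t ` X) *
    int (\<Prod>d\<in>{1..card M}. d ^ ncyc (t o s o inv t) (M - \<Union>((`) t ` X)) d * ff (c d) (ncyc (t o s o inv t) (M - \<Union>((`) t ` X)) d)))"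
   by (simp only: sum.reindex o_def)
  also have "... = (\<Sum>X\<in>Pow (orbs s M). (-1) ^ card X *
    int (\<Prod>d\<in>{1..card M}. d ^ ncyc s (M - \<Union>X) d * ff (c d) (ncyc s (M - \<Union>X) d)))"
  proof (rule sum.cong[OF refl])
   fix X
   have "M - \<Union>((`) t ` X) = t ` (M - \<Union>X)" using tM image_set_diff[OF bij_is_inj[OF bt], of M "\<Union>X"] by auto
   moreover have "card ((`) t ` X) = card X" using inj by (meson card_image inj_on_subset subset_UNIV)
   ultimately show "(-1) ^ card ((`) t ` X) *
    int (\<Prod>d\<in>{1..card M}. d ^ ncyc (t o s o inv t) (M - \<Union>((`) t ` X)) d * ff (c d) (ncyc (t o s o inv t) (M - \<Union>((`) t ` X)) d))
    = (-1) ^ card X * int (\<Prod>d\<in>{1..card M}. d ^ ncyc s (M - \<Union>X) d * ff (c d) (ncyc s (M - \<Union>X) d))"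
    by (simp only: ncyc_conj[OF bt])
  qed
  finally show "(\<Sum>X\<in>Pow ((`) t ` orbs s M). (-1) ^ card X *
    int (\<Prod>d\<in>{1..card M}. d ^ ncyc (t o s o inv t) (M - \<Union>X) d * ff (c d) (ncyc (t o s o inv t) (M - \<Union>X) d)))
   = (\<Sum>X\<in>Pow (orbs s M). (-1) ^ card X *
    int (\<Prod>d\<in>{1..card M}. d ^ ncyc s (M - \<Union>X) d * ff (c d) (ncyc s (M - \<Union>X) d)))" .
 qed
 thus ?thesis using psi_eq_count[OF M s g] psi_eq_count[OF M p g] by metis
qed

section \<open>Traces and dimensions from spanning families\<close>

text \<open>
A family \<open>e\<close> with linear functionals \<open>\<xi>\<close> that reconstruct every vector as \<open>v = \<Sum>s. \<xi> s v e s\<close> computes traces like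
a basis with its dual basis, although \<open>e\<close> may be linearly dependent: the sum is the trace of a product
of two maps in one order, and the usual trace is the trace in the other order.
\<close>
lemma (in vector_space) trace_frame:
 assumes S: "finite S" and V: "subspace V"
  and e: "\<And>s. s \<in> S ==> e s \<in> V"
  and xi_add: "\<And>s v w. s \<in> S ==> v \<in> V ==> w \<in> V ==> \<xi> s (v + w) = \<xi> s v + \<xi> s w"
  and xi_scale: "\<And>s c v. s \<in> S ==> v \<in> V ==> \<xi> s (scale c v) = c * \<xi> s v"
  and frame: "\<And>v. v \<in> V ==> v = (\<Sum>s\<in>S. scale (\<xi> s v) (e s))"
  and f: "\<And>v. v \<in> V ==> f v \<in> V"
  and f_add: "\<And>v w. v \<in> V ==> w \<in> V ==> f (v + w) = f v + f w"
  and f_scale: "\<And>c v. v \<in> V ==> f (scale c v) = scale c (f v)"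
  and B: "B \<subseteq> V" "independent B" "span B = V"
 shows "finite B" "(\<Sum>b\<in>B. representation B (f b) b) = (\<Sum>s\<in>S. \<xi> s (f (e s)))"
proof -
 have Vsp: "V \<subseteq> span (e ` S)"
 proof
  fix v assume "v \<in> V"
  hence "v = (\<Sum>s\<in>S. scale (\<xi> s v) (e s))" by (rule frame)
  also have "... \<in> span (e ` S)" by (intro span_sum span_scale span_base) auto
  finally show "v \<in> span (e ` S)" .
 qed
 show finB: "finite B"
  using independent_span_bound[of "e ` S" B] S B Vsp by auto
 have sumV: "(\<Sum>t\<in>T. scale (c t) (u t)) \<in> V" if "\<And>t. t \<in> T ==> u t \<in> V" for T c and u :: "'x => 'b"
  by (intro subspace_sum[OF V] subspace_scale[OF V]) (rule that)
 have zV: "0 \<in> V" by (rule subspace_0[OF V])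
 have xi0: "\<xi> s 0 = 0" if "s \<in> S" for s using xi_scale[OF that zV, of 0] by simp
 have f0: "f 0 = 0" using f_scale[OF zV, of 0] by simp
 have xi_sum: "\<xi> s (\<Sum>t\<in>T. scale (c t) (u t)) = (\<Sum>t\<in>T. c t * \<xi> s (u t))"
  if "finite T" "s \<in> S" "\<And>t. t \<in> T ==> u t \<in> V" for s T c and u :: "'b => 'b"
  using that(1,3)
 proof (induction T rule: finite_induct)
  case (insert t T)
  have "scale (c t) (u t) \<in> V" using insert by (intro subspace_scale[OF V]) auto
  moreover have "(\<Sum>t\<in>T. scale (c t) (u t)) \<in> V" using insert by (intro sumV) auto
  ultimately show ?case using insert that(2) by (simp add: xi_add xi_scale)
 qed (use xi0 that in simp)
 have f_sum: "f (\<Sum>t\<in>T. scale (c t) (u t)) = (\<Sum>t\<in>T. scale (c t) (f (u t)))"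
  if "finite T" "\<And>t. t \<in> T ==> u t \<in> V" for T c and u :: "'b => 'b"
  using that
 proof (induction T rule: finite_induct)
  case (insert t T)
  have "scale (c t) (u t) \<in> V" using insert by (intro subspace_scale[OF V]) auto
  moreover have "(\<Sum>t\<in>T. scale (c t) (u t)) \<in> V" using insert by (intro sumV) auto
  ultimately show ?case using insert by (simp add: f_add f_scale)
 qed (use f0 in simp)
 have rep: "v = (\<Sum>b\<in>B. scale (representation B v b) b)" if "v \<in> V" for v
  by (rule sum_representation_eq[OF B(2) _ finB order_refl, symmetric]) (use B that in simp)
 have repsum: "representation B (\<Sum>s\<in>S. scale (c s) (e s)) b = (\<Sum>s\<in>S. c s * representation B (e s) b)" for c b
 proof -
  have "representation B (\<Sum>s\<in>S. scale (c s) (e s)) = (%b. \<Sum>s\<in>S. representation B (scale (c s) (e s)) b)"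
   by (rule representation_sum[OF B(2)]) (use B(3) e in \<open>auto intro!: span_scale\<close>)
  moreover have "representation B (scale (c s) (e s)) b = c s * representation B (e s) b" if "s \<in> S" for s
   using representation_scale[OF B(2), of "e s" "c s"] B e[OF that] by simp
  ultimately show ?thesis by simp
 qed
 have "(\<Sum>b\<in>B. representation B (f b) b) = (\<Sum>b\<in>B. \<Sum>s\<in>S. \<xi> s (f b) * representation B (e s) b)"
 proof (rule sum.cong[OF refl])
  fix b assume "b \<in> B"
  hence "f b \<in> V" using B f by blast
  from frame[OF this] show "representation B (f b) b = (\<Sum>s\<in>S. \<xi> s (f b) * representation B (e s) b)"
   using repsum[of "%s. \<xi> s (f b)" b] by simp
 qed
 also have "... = (\<Sum>s\<in>S. \<Sum>b\<in>B. representation B (e s) b * \<xi> s (f b))"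
  by (subst sum.swap) (simp add: mult.commute)
 also have "... = (\<Sum>s\<in>S. \<xi> s (f (e s)))"
 proof (rule sum.cong[OF refl])
  fix s assume s: "s \<in> S"
  have "f (e s) = f (\<Sum>b\<in>B. scale (representation B (e s) b) b)" using rep[OF e[OF s]] by simp
  also have "... = (\<Sum>b\<in>B. scale (representation B (e s) b) (f b))" by (rule f_sum[OF finB]) (use B in auto)
  finally have "\<xi> s (f (e s)) = \<xi> s (\<Sum>b\<in>B. scale (representation B (e s) b) (f b))" by simp
  also have "... = (\<Sum>b\<in>B. representation B (e s) b * \<xi> s (f b))"
   by (rule xi_sum[OF finB s]) (use B f in auto)
  finally show "(\<Sum>b\<in>B. representation B (e s) b * \<xi> s (f b)) = \<xi> s (f (e s))" by simp
 qed
 finally show "(\<Sum>b\<in>B. representation B (f b) b) = (\<Sum>s\<in>S. \<xi> s (f (e s)))" .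
qed

lemma (in vector_space) dim_frame:
 assumes S: "finite S" and V: "subspace V"
  and e: "\<And>s. s \<in> S ==> e s \<in> V"
  and xi_add: "\<And>s v w. s \<in> S ==> v \<in> V ==> w \<in> V ==> \<xi> s (v + w) = \<xi> s v + \<xi> s w"
  and xi_scale: "\<And>s c v. s \<in> S ==> v \<in> V ==> \<xi> s (scale c v) = c * \<xi> s v"
  and frame: "\<And>v. v \<in> V ==> v = (\<Sum>s\<in>S. scale (\<xi> s v) (e s))"
 shows "of_nat (dim V) = (\<Sum>s\<in>S. \<xi> s (e s))"
proof -
 obtain B where B: "B \<subseteq> V" "independent B" "V \<subseteq> span B" "card B = dim V" using basis_exists[of V] by blast
 have sp: "span B = V" using B span_minimal[OF B(1) V] by blast
 have "(\<Sum>b\<in>B. representation B b b) = (\<Sum>s\<in>S. \<xi> s (e s))"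
  using trace_frame(2)[OF S V e xi_add xi_scale frame, of "%v. v" B] B sp by auto
 moreover have "(\<Sum>b\<in>B. representation B b b) = (\<Sum>b\<in>B. 1)"
  by (rule sum.cong) (use representation_basis[OF B(2)] in auto)
 ultimately show ?thesis using B(4) by simp
qed

text \<open>
On the left ideal of a quasi-idempotent \<open>y\<close>, right multiplication by \<open>y / \<gamma>\<close> is the identity.  So \<open>\<tau> * y / \<gamma>\<close>, for \<open>\<tau> \<in> S\<^sub>n\<close>, with evaluation at \<open>\<tau>\<close>, is a family as in \<open>trace_frame\<close>.
\<close>
lemma trace_on_left_ideal:
 fixes y :: "'k::field galg"
 assumes y: "y \<in> grp_alg n" "gmult n y y = scale_galg \<gamma> y" "\<gamma> \<noteq> 0" and g: "g \<in> Sym n"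
 shows "trace_on (left_ideal n y) (gmult n (gdelta g)) = class_sum n y (inv g) / \<gamma>"
proof -
 interpret vs: vector_space "scale_galg :: 'k => _" by (rule vector_space_scale_galg)
 let ?V = "left_ideal n y"
 let ?B = "SOME B. B \<subseteq> ?V \<and> \<not> module.dependent scale_galg B \<and> module.span scale_galg B = ?V"
 have addin: "a + b \<in> grp_alg n" if "a \<in> grp_alg n" "b \<in> grp_alg n" for a b :: "'k galg"
  using that by (simp add: grp_alg_def)
 have zin: "(0 :: 'k galg) \<in> grp_alg n" by (simp add: grp_alg_def)
 have V: "vs.subspace ?V"
 proof (rule vs.subspaceI)
  show "0 \<in> ?V" unfolding left_ideal_def using zin
   by (intro CollectI exI[of _ 0]) (simp add: gmult_def fun_eq_iff)
  show "u + v \<in> ?V" if uv: "u \<in> ?V" "v \<in> ?V" for u v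
  proof -
   obtain a b where "a \<in> grp_alg n" "b \<in> grp_alg n" "u = gmult n a y" "v = gmult n b y"
    using uv by (auto simp: left_ideal_def)
   thus ?thesis unfolding left_ideal_def using addin[of a b] gmult_add_left[of n a b y] by (intro CollectI exI[of _ "a + b"]) simp
  qed
  show "scale_galg c u \<in> ?V" if u: "u \<in> ?V" for c u
  proof -
   obtain a where "a \<in> grp_alg n" "u = gmult n a y" using u by (auto simp: left_ideal_def)
   thus ?thesis unfolding left_ideal_def using gmult_scale_left[of n c a y] by (intro CollectI exI[of _ "scale_galg c a"]) simp
  qed
 qed
 have ex: "\<exists>B. B \<subseteq> ?V \<and> \<not> vs.dependent B \<and> vs.span B = ?V"
 proof -
  obtain B where B: "B \<subseteq> ?V" "vs.independent B" "?V \<subseteq> vs.span B" by (rule vs.basis_exists)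
  have "vs.span B = ?V" by (rule equalityI[OF vs.span_minimal[OF B(1) V] B(3)])
  thus ?thesis using B(1,2) by (intro exI[of _ B] conjI)
 qed
 have B: "?B \<subseteq> ?V" "vs.independent ?B" "vs.span ?B = ?V" using someI_ex[OF ex] by blast+
 define e where "e s = scale_galg (inverse \<gamma>) (gmult n (gdelta s) y)" for s
 have absorb: "gmult n v y = scale_galg \<gamma> v" if v: "v \<in> ?V" for v
 proof -
  obtain a where "v = gmult n a y" using v by (auto simp: left_ideal_def)
  thus ?thesis by (simp add: gmult_assoc y(2) gmult_scale_right)
 qed
 have Vin: "v \<in> grp_alg n" if "v \<in> ?V" for v using that by (auto simp: left_ideal_def)
 have frame: "v = (\<Sum>s\<in>Sym n. scale_galg (v s) (e s))" if v: "v \<in> ?V" for v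
 proof (rule grp_alg_eqI[of _ n])
  show "v \<in> grp_alg n" by (rule Vin[OF v])
  have "(\<Sum>s\<in>T. scale_galg (v s) (e s)) \<in> grp_alg n" for T
  proof (induction T rule: infinite_finite_induct)
   case (insert t T)
   have "scale_galg (v t) (e t) \<in> grp_alg n" by (simp add: e_def)
   thus ?case unfolding sum.insert[OF insert.hyps] using insert.IH by (rule addin)
  qed (simp_all add: grp_alg_def)
  thus "(\<Sum>s\<in>Sym n. scale_galg (v s) (e s)) \<in> grp_alg n" .
  fix \<sigma> assume s: "\<sigma> \<in> Sym n"
  have ap: "(\<Sum>s\<in>T. scale_galg (v s) (e s)) \<sigma> = (\<Sum>s\<in>T. scale_galg (v s) (e s) \<sigma>)" for T
   by (induction T rule: infinite_finite_induct) auto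
  have "(\<Sum>s\<in>Sym n. scale_galg (v s) (e s)) \<sigma> = inverse \<gamma> * gmult n v y \<sigma>"
  proof -
   have "(\<Sum>t\<in>Sym n. scale_galg (v t) (e t) \<sigma>) = (\<Sum>t\<in>Sym n. inverse \<gamma> * (v t * y (inv t o \<sigma>)))"
    by (rule sum.cong[OF refl]) (simp add: e_def scale_galg_def gmult_delta_left s mult_ac)
   thus ?thesis unfolding ap gmult_apply[OF s] sum_distrib_left .
  qed
  also have "... = v \<sigma>" using y(3) by (simp add: absorb[OF v] scale_galg_def)
  finally show "v \<sigma> = (\<Sum>s\<in>Sym n. scale_galg (v s) (e s)) \<sigma>" by simp
 qed
 have eV: "e s \<in> ?V" if "s \<in> Sym n" for s unfolding e_def
  by (rule vs.subspace_scale[OF V]) (use that in \<open>auto simp: left_ideal_def\<close>)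
 have fV: "gmult n (gdelta g) v \<in> ?V" if v: "v \<in> ?V" for v
 proof -
  obtain a where "v = gmult n a y" using v by (auto simp: left_ideal_def)
  hence "gmult n (gdelta g) v = gmult n (gmult n (gdelta g) a) y" by (simp add: gmult_assoc)
  thus ?thesis by (auto simp: left_ideal_def)
 qed
 have "trace_on ?V (gmult n (gdelta g)) = (\<Sum>s\<in>Sym n. gmult n (gdelta g) (e s) s)"
  unfolding trace_on_def Let_def
  by (rule vs.trace_frame(2)[where \<xi> = "%s v. v s" and S = "Sym n", OF finite_Sym V eV _ _ frame fV _ _ B])
   (simp_all add: gmult_add_right gmult_scale_right, simp add: scale_galg_def)
 also have "... = (\<Sum>s\<in>Sym n. inverse \<gamma> * y (inv s o inv g o s))"
  using g by (intro sum.cong refl) (simp add: e_def gmult_delta_left scale_galg_def comp_assoc)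
 also have "... = inverse \<gamma> * (\<Sum>s\<in>Sym n. y (s o inv g o inv s))"
  unfolding sum_distrib_left by (subst sum_Sym_inv[symmetric]) simp
 finally show ?thesis by (simp add: class_sum_def divide_inverse mult.commute)
qed

lemma irr_char_class_sum:
 assumes g: "g \<in> Sym (sum_list lam)"
 shows "irr_char lam g = class_sum (sum_list lam) (young lam) g / young_const lam"
proof -
 have nz: "(young_const lam :: complex) \<noteq> 0" by (simp add: young_const_of_int young_norm_nonzero)
 have "irr_char lam g = class_sum (sum_list lam) (young lam) (inv g) / young_const lam"
  unfolding irr_char_def irrep_def by (rule trace_on_left_ideal[OF _ young_square nz g]) simp
 thus ?thesis using g by (simp add: class_sum_young_inv)
qed

section \<open>Padded shapes\<close>

definition shift_ext :: "nat => nat => (nat => nat) => nat => nat" where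
 "shift_ext p m q u = (if u \<in> {p+1..p+m} then p + q (u - p) else u)"

text \<open>
Labels the entries below the first row, so that \<open>label_stab\<close> becomes the Young subgroup \<open>S\<^sub>p \<times> S\<^sub>m\<close>.
\<close>
definition low :: "nat => nat => nat" where "low p u = (if p < u then 1 else 0)"

lemma low_eq: "low p u = low p v \<longleftrightarrow> (p < u \<longleftrightarrow> p < v)" by (simp add: low_def)

lemma shift_ext_eq_map: "shift_ext p m q = map_permutation {1..m} ((+) p) q"
proof
 fix u
 have im: "(+) p ` {1..m} = {p+1..p+m}" by auto
 have "inv_into {1..m} ((+) p) u = u - p" if "u \<in> {p+1..p+m}"
  by (rule inv_into_f_eq) (use that in auto)
 thus "shift_ext p m q u = map_permutation {1..m} ((+) p) q u"
  unfolding map_permutation_def restrict_id_def im by (simp add: shift_ext_def)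
qed

lemma shift_ext_Sym: "q \<in> Sym m ==> shift_ext p m q \<in> Sym (p + m)"
proof -
 assume q: "q \<in> Sym m"
 have "map_permutation {1..m} ((+) p) q permutes {p+1..p+m}"
  by (rule map_permutation_permutes[of _ "{1..m}"]) (use q in \<open>auto simp: Sym_def bij_betw_def\<close>)
 thus ?thesis unfolding shift_ext_eq_map Sym_def by (auto intro: permutes_subset)
qed

lemma sign_shift_ext: "q \<in> Sym m ==> sign (shift_ext p m q) = sign q"
 unfolding shift_ext_eq_map by (rule sign_map_permutation) (auto simp: Sym_def)

lemma shift_ext_apply: "a \<in> {1..m} ==> shift_ext p m q (p + a) = p + q a"
 by (simp add: shift_ext_def)

definition shift_res :: "nat => nat => (nat => nat) => nat => nat" where
 "shift_res p m w a = (if a \<in> {1..m} then w (p + a) - p else a)"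

lemma shift_res:
 assumes w: "w \<in> label_stab (p + m) (low p)"
 shows "shift_res p m w \<in> Sym m" "a \<in> {1..m} ==> w (p + a) = p + shift_res p m w a"
proof -
 have ws: "w \<in> Sym (p + m)" by (rule label_stab_Sym[OF w])
 have r: "w (p + a) = p + shift_res p m w a" "shift_res p m w a \<in> {1..m}" if a: "a \<in> {1..m}" for a
 proof -
  have "p + a \<in> {1..p+m}" using a by simp
  hence "low p (w (p + a)) = low p (p + a)" "w (p + a) \<in> {1..p+m}" using w Sym_range[OF ws] by (simp_all only: label_stab_def mem_Collect_eq)
  hence "p < w (p + a)" "w (p + a) \<le> p + m" using a by (simp_all add: low_eq)
  thus "w (p + a) = p + shift_res p m w a" "shift_res p m w a \<in> {1..m}" using a by (auto simp: shift_res_def)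
 qed
 show "a \<in> {1..m} ==> w (p + a) = p + shift_res p m w a" by (rule r(1))
 have "inj_on (shift_res p m w) {1..m}"
 proof (rule inj_onI)
  fix a b assume ab: "a \<in> {1..m}" "b \<in> {1..m}" "shift_res p m w a = shift_res p m w b"
  hence "w (p + a) = w (p + b)" using r by simp
  hence "p + a = p + b" by (rule injD[OF bij_is_inj[OF Sym_bij[OF ws]]])
  thus "a = b" by simp
 qed
 moreover have "shift_res p m w ` {1..m} \<subseteq> {1..m}" using r(2) by blast
 ultimately have "bij_betw (shift_res p m w) {1..m} {1..m}" by (simp add: bij_betw_def endo_inj_surj)
 thus "shift_res p m w \<in> Sym m" unfolding Sym_def
  by (intro CollectI bij_imp_permutes) (simp_all only: shift_res_def if_False)
qed

lemma low_stabI: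
 assumes w: "w \<in> Sym (p + m)" and q: "q \<in> Sym m" and e: "\<And>a. a \<in> {1..m} ==> w (p + a) = p + q a"
 shows "w \<in> label_stab (p + m) (low p)"
proof -
 let ?L = "{p+1..p+m}"
 have inj: "inj w" by (rule bij_is_inj[OF Sym_bij[OF w]])
 have sub: "w ` ?L \<subseteq> ?L"
 proof
  fix u assume "u \<in> w ` ?L"
  then obtain v where v: "v \<in> ?L" "u = w v" by blast
  have vp: "v - p \<in> {1..m}" "p + (v - p) = v" using v by auto
  have "u = p + q (v - p)" using e[OF vp(1)] v(2) unfolding vp(2) by simp
  moreover have "q (v - p) \<in> {1..m}" by (rule Sym_range[OF q vp(1)])
  ultimately show "u \<in> ?L" by simp
 qed
 have eq: "w ` ?L = ?L" by (rule endo_inj_surj[OF _ sub]) (use inj in \<open>auto intro: inj_on_subset\<close>)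
 have "low p (w u) = low p u" if u: "u \<in> {1..p+m}" for u
 proof -
  have "w u \<in> ?L \<longleftrightarrow> u \<in> ?L" using inj_image_mem_iff[OF inj, of u ?L] eq by simp
  moreover have "w u \<in> {1..p+m}" by (rule Sym_range[OF w u])
  ultimately show ?thesis using u by (auto simp: low_def)
 qed
 thus ?thesis using w by (simp add: label_stab_def)
qed

text \<open>
The shape \<open>P\<close> has a first row of length \<open>p\<close> above \<open>lam\<close>; its tableau has the entries \<open>1, \<dots>, p\<close> in the first row
and the tableau of \<open>lam\<close>, shifted by \<open>p\<close>, below.
\<close>
locale padded_shape =
 fixes p :: nat and lam :: "nat list"
 assumes wide: "\<And>l. l \<in> set lam ==> l \<le> p"
begin

abbreviation "m \<equiv> sum_list lam"
abbreviation "P \<equiv> p # lam"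
abbreviation "n \<equiv> p + m"

lemma trow_upper: "u \<in> {1..p} ==> trow P u = 0" and tcol_upper: "u \<in> {1..p} ==> tcol P u = u - 1"
proof -
 assume u: "u \<in> {1..p}"
 hence e: "u = tab_entry P 0 (u - 1)" by (simp add: tab_entry_Cons_0)
 show "trow P u = 0" by (subst e, rule trow_tcol_entry(1)) (use u in auto)
 show "tcol P u = u - 1" by (subst e, rule trow_tcol_entry(2)) (use u in auto)
qed

lemma trow_lower: "a \<in> {1..m} ==> trow P (p + a) = Suc (trow lam a)"
 and tcol_lower: "a \<in> {1..m} ==> tcol P (p + a) = tcol lam a"
proof -
 assume a: "a \<in> {1..m}"
 have e: "p + a = tab_entry P (Suc (trow lam a)) (tcol lam a)"
  using trow_tcol_bounds(3)[OF a] by (simp add: tab_entry_Cons_Suc)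
 show "trow P (p + a) = Suc (trow lam a)"
  by (subst e, rule trow_tcol_entry(1)) (use trow_tcol_bounds[OF a] in auto)
 show "tcol P (p + a) = tcol lam a"
  by (subst e, rule trow_tcol_entry(2)) (use trow_tcol_bounds[OF a] in auto)
qed

lemma tcol_bound: "u \<in> {1..n} ==> tcol P u < p"
proof -
 assume u: "u \<in> {1..n}"
 hence u': "u \<in> {1..sum_list P}" by simp
 have "tcol P u < P ! trow P u" by (rule trow_tcol_bounds(2)[OF u'])
 moreover have "P ! trow P u \<in> set P" by (rule nth_mem[OF trow_tcol_bounds(1)[OF u']])
 hence "P ! trow P u \<le> p" using wide by auto
 ultimately show ?thesis by simp
qed

lemma cases_u: "u \<in> {1..n} ==> (u \<in> {1..p} ==> Q) ==> (\<And>a. a \<in> {1..m} ==> u = p + a ==> Q) ==> Q"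
proof (cases "u \<le> p")
 case False
 assume u: "u \<in> {1..n}" and 2: "\<And>a. a \<in> {1..m} ==> u = p + a ==> Q"
 show Q by (rule 2[of "u - p"]) (use u False in auto)
qed simp

lemma row_stab_low: "w \<in> label_stab n (trow P) ==> w \<in> label_stab n (low p)"
proof -
 assume w: "w \<in> label_stab n (trow P)"
 have e: "low p u = 0 \<longleftrightarrow> trow P u = 0" if u: "u \<in> {1..n}" for u
  by (rule cases_u[OF u]) (auto simp: low_def trow_upper trow_lower)
 have l01: "low p u = 0 \<or> low p u = 1" for u by (simp add: low_def)
 have "low p (w u) = low p u" if u: "u \<in> {1..n}" for u
 proof -
  have "trow P (w u) = trow P u" using w u by (simp only: label_stab_def mem_Collect_eq)
  moreover have "w u \<in> {1..n}" by (rule Sym_range[OF label_stab_Sym[OF w] u])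
  ultimately show ?thesis using e[OF u] e[of "w u"] l01[of u] l01[of "w u"] by auto
 qed
 thus ?thesis using label_stab_Sym[OF w] by (simp only: label_stab_def mem_Collect_eq) blast
qed

lemma row_stab_res:
 assumes w: "w \<in> label_stab n (low p)" and s: "s \<in> Sym m" and e: "\<And>a. a \<in> {1..m} ==> w (p + a) = p + s a"
 shows "w \<in> label_stab n (trow P) \<longleftrightarrow> s \<in> label_stab m (trow lam)"
proof
 assume L: "w \<in> label_stab n (trow P)"
 have "trow lam (s a) = trow lam a" if a: "a \<in> {1..m}" for a
 proof -
  have "trow P (w (p + a)) = trow P (p + a)" using L a by (simp add: label_stab_def)
  thus ?thesis using e[OF a] trow_lower[OF a] trow_lower[OF Sym_range[OF s a]] by simp
 qed
 thus "s \<in> label_stab m (trow lam)" using s by (simp add: label_stab_def)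
next
 assume R: "s \<in> label_stab m (trow lam)"
 have ws: "w \<in> Sym n" by (rule label_stab_Sym[OF w])
 have "trow P (w u) = trow P u" if u: "u \<in> {1..n}" for u
 proof (rule cases_u[OF u])
  assume up: "u \<in> {1..p}"
  have "low p (w u) = low p u" using w u by (simp only: label_stab_def mem_Collect_eq)
  hence "w u \<in> {1..p}" using up Sym_range[OF ws u] by (auto simp: low_def split: if_splits)
  thus ?thesis using up trow_upper by simp
 next
  fix a assume a: "a \<in> {1..m}" "u = p + a"
  have "trow lam (s a) = trow lam a" using R a by (simp add: label_stab_def)
  thus ?thesis using a e trow_lower[OF a(1)] trow_lower[OF Sym_range[OF s a(1)]] by simp
 qed
 thus "w \<in> label_stab n (trow P)" using ws by (simp only: label_stab_def mem_Collect_eq) blast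
qed

lemma shift_ext_low: "q \<in> Sym m ==> shift_ext p m q \<in> label_stab n (low p)"
 by (rule low_stabI[OF shift_ext_Sym]) (auto simp: shift_ext_def)

lemma shift_ext_col: "q \<in> label_stab m (tcol lam) ==> shift_ext p m q \<in> label_stab n (tcol P)"
proof -
 assume q: "q \<in> label_stab m (tcol lam)"
 have qs: "q \<in> Sym m" by (rule label_stab_Sym[OF q])
 have "tcol P (shift_ext p m q u) = tcol P u" if u: "u \<in> {1..n}" for u
 proof (rule cases_u[OF u])
  fix a assume a: "a \<in> {1..m}" "u = p + a"
  have "tcol lam (q a) = tcol lam a" using q a by (simp add: label_stab_def)
  thus ?thesis using a shift_ext_apply[OF a(1)] tcol_lower[OF a(1)] tcol_lower[OF Sym_range[OF qs a(1)]] by simp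
 qed (simp add: shift_ext_def)
 thus ?thesis using shift_ext_Sym[OF qs] by (simp only: label_stab_def mem_Collect_eq) blast
qed

lemma col_low_stab:
 "label_stab n (tcol P) \<inter> label_stab n (low p) = shift_ext p m ` label_stab m (tcol lam)"
proof (intro equalityI subsetI)
 fix w assume "w \<in> label_stab n (tcol P) \<inter> label_stab n (low p)"
 hence w: "w \<in> label_stab n (tcol P)" "w \<in> label_stab n (low p)" by auto
 have ws: "w \<in> Sym n" by (rule label_stab_Sym[OF w(1)])
 let ?q = "shift_res p m w"
 have q: "?q \<in> Sym m" by (rule shift_res(1)[OF w(2)])
 have "tcol lam (?q a) = tcol lam a" if a: "a \<in> {1..m}" for a
 proof -
  have "tcol P (w (p + a)) = tcol P (p + a)" using w(1) a by (simp add: label_stab_def)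
  thus ?thesis using shift_res(2)[OF w(2) a] tcol_lower[OF a] tcol_lower[OF Sym_range[OF q a]] by simp
 qed
 hence "?q \<in> label_stab m (tcol lam)" using q by (simp add: label_stab_def)
 moreover have "w = shift_ext p m ?q"
 proof
  fix u show "w u = shift_ext p m ?q u"
  proof (cases "u \<in> {1..n}")
   case True
   show ?thesis
   proof (rule cases_u[OF True])
    assume up: "u \<in> {1..p}"
    have "low p (w u) = low p u" "tcol P (w u) = tcol P u" using w True by (simp_all only: label_stab_def mem_Collect_eq)
    moreover from this(1) have "w u \<in> {1..p}" using up Sym_range[OF ws True] by (auto simp: low_def split: if_splits)
    ultimately have "w u - 1 = u - 1" "w u \<in> {1..p}" using up tcol_upper by auto
    thus ?thesis using up by (simp add: shift_ext_def) linarith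
   next
    fix a assume a: "a \<in> {1..m}" "u = p + a"
    thus ?thesis using shift_res(2)[OF w(2) a(1)] by (simp add: shift_ext_apply)
   qed
  next
   case False
   hence "w u = u" using ws by (auto simp: Sym_def intro: permutes_not_in)
   thus ?thesis using False by (auto simp: shift_ext_def)
  qed
 qed
 ultimately show "w \<in> shift_ext p m ` label_stab m (tcol lam)" by blast
next
 fix w assume "w \<in> shift_ext p m ` label_stab m (tcol lam)"
 thus "w \<in> label_stab n (tcol P) \<inter> label_stab n (low p)"
  using shift_ext_col shift_ext_low label_stab_Sym by blast
qed

lemma shift_ext_inj: "inj_on (shift_ext p m) (Sym m)"
proof (rule inj_onI)
 fix q r assume q: "q \<in> Sym m" and r: "r \<in> Sym m" and e: "shift_ext p m q = shift_ext p m r"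
 show "q = r"
 proof
  fix a show "q a = r a"
  proof (cases "a \<in> {1..m}")
   case True
   have "p + q a = p + r a" using shift_ext_apply[OF True, of p q] shift_ext_apply[OF True, of p r] e by simp
   thus ?thesis by simp
  next
   case False
   thus ?thesis using q r permutes_not_in[of q "{1..m}" a] permutes_not_in[of r "{1..m}" a] by (simp add: Sym_def)
  qed
 qed
qed

text \<open>
The part of the column sum that preserves the first row; it consists of column permutations of \<open>lam\<close>.
\<close>
definition kl :: "real galg" where
 "kl q = (if q \<in> label_stab n (low p) then col_antisym P q else 0)"

text \<open>Restriction of the Young symmetrizer of \<open>P\<close> to \<open>S\<^sub>p \<times> S\<^sub>m\<close>.\<close>
definition v :: "real galg" where
 "v w = (if w \<in> label_stab n (low p) then young P w else 0)"

lemma young_stab: "w \<in> Sym n ==> gmult n (row_sym P) kl w = v w"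
proof -
 assume w: "w \<in> Sym n"
 let ?H = "label_stab n (low p)"
 have t: "row_sym P (w o inv q) * kl q = (if w \<in> ?H then row_sym P (w o inv q) * col_antisym P q else (0::real))"
  if q: "q \<in> Sym n" for q
 proof (cases "row_sym P (w o inv q) = (0::real)")
  case False
  hence r: "w o inv q \<in> label_stab n (trow P)" by (simp add: row_sym_eq split: if_splits)
  hence h: "w o inv q \<in> ?H" by (rule row_stab_low)
  have "w \<in> ?H \<longleftrightarrow> q \<in> ?H"
  proof -
   have "(w o inv q) o q \<in> ?H \<longleftrightarrow> q \<in> ?H" by (rule label_stab_comp_iff[OF h q])
   thus ?thesis using q by (simp add: comp_assoc)
  qed
  thus ?thesis by (simp add: kl_def)
 qed simp
 have "gmult n (row_sym P) kl w = (\<Sum>q\<in>Sym n. row_sym P (w o inv q) * kl q)" by (rule gmult_apply_right[OF w])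
 also have "... = (\<Sum>q\<in>Sym n. if w \<in> ?H then row_sym P (w o inv q) * col_antisym P q else 0)"
  by (rule sum.cong[OF refl]) (rule t)
 also have "... = v w" using w by (simp add: v_def gmult_apply_right[of w n])
 finally show ?thesis .
qed

text \<open>
On \<open>S\<^sub>p \<times> S\<^sub>m\<close> the Young symmetrizer of \<open>P\<close> is the product of the row sum of \<open>S\<^sub>p\<close> and the Young symmetrizer of \<open>lam\<close>, because a column has only one entry in the first row, which is fixed by every column permutation that preserves the row.
\<close>
lemma v_res:
 assumes w: "w \<in> label_stab n (low p)"
 shows "v w = young lam (shift_res p m w)"
proof -
 let ?s = "shift_res p m w"
 have ws: "w \<in> Sym n" by (rule label_stab_Sym[OF w])
 have s: "?s \<in> Sym m" by (rule shift_res(1)[OF w])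
 have klz: "kl q = 0" if "q \<notin> shift_ext p m ` label_stab m (tcol lam)" for q
  using that col_low_stab by (auto simp: kl_def col_antisym_eq)
 have "v w = (\<Sum>q\<in>Sym n. row_sym P (w o inv q) * kl q)"
  using young_stab[OF ws] gmult_apply_right[OF ws, of "row_sym P" kl] by simp
 also have "... = (\<Sum>q\<in>shift_ext p m ` label_stab m (tcol lam). row_sym P (w o inv q) * kl q)"
  by (rule sum.mono_neutral_right) (use klz shift_ext_Sym label_stab_Sym in auto)
 also have "... = (\<Sum>q\<in>label_stab m (tcol lam). row_sym P (w o inv (shift_ext p m q)) * kl (shift_ext p m q))"
  by (subst sum.reindex) (use shift_ext_inj label_stab_Sym in \<open>auto intro: inj_on_subset\<close>)
 also have "... = (\<Sum>q\<in>label_stab m (tcol lam). row_sym lam (?s o inv q) * col_antisym lam q)"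
 proof (rule sum.cong[OF refl])
  fix q assume q: "q \<in> label_stab m (tcol lam)"
  have qs: "q \<in> Sym m" by (rule label_stab_Sym[OF q])
  let ?q = "shift_ext p m q"
  have qn: "?q \<in> Sym n" by (rule shift_ext_Sym[OF qs])
  have ql: "?q \<in> label_stab n (low p)" by (rule shift_ext_low[OF qs])
  have inv: "inv ?q (p + a) = p + inv q a" if a: "a \<in> {1..m}" for a
  proof -
   have "inv q a \<in> {1..m}" by (rule Sym_range[OF inv_Sym[OF qs] a])
   hence "?q (p + inv q a) = p + q (inv q a)" by (rule shift_ext_apply)
   also have "q (inv q a) = a" using Sym_bij[OF qs] by (simp add: bij_is_surj surj_f_inv_f)
   finally show ?thesis using bij_inv_eq_iff[OF Sym_bij[OF qn]] by metis
  qed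
  have "w o inv ?q \<in> label_stab n (trow P) \<longleftrightarrow> ?s o inv q \<in> label_stab m (trow lam)"
  proof (rule row_stab_res)
   show "w o inv ?q \<in> label_stab n (low p)" by (rule label_stab_comp[OF w label_stab_inv[OF ql]])
   show "?s o inv q \<in> Sym m" using s qs by simp
   fix a assume a: "a \<in> {1..m}"
   have "inv q a \<in> {1..m}" by (rule Sym_range[OF inv_Sym[OF qs] a])
   from shift_res(2)[OF w this] show "(w o inv ?q) (p + a) = p + (?s o inv q) a" using inv[OF a] by simp
  qed
  hence "row_sym P (w o inv ?q) = (row_sym lam (?s o inv q) :: real)" by (simp add: row_sym_eq)
  moreover have "kl ?q = col_antisym lam q"
   using shift_ext_col[OF q] ql q by (simp add: kl_def col_antisym_eq sign_shift_ext[OF qs])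
  ultimately show "row_sym P (w o inv ?q) * kl ?q = row_sym lam (?s o inv q) * col_antisym lam q" by simp
 qed
 also have "... = (\<Sum>q\<in>Sym m. row_sym lam (?s o inv q) * col_antisym lam q)"
  by (rule sum.mono_neutral_left) (auto simp: label_stab_Sym col_antisym_eq)
 also have "... = young lam ?s" by (rule gmult_apply_right[OF s, symmetric])
 finally show ?thesis .
qed

lemma v_sum:
 assumes w: "w \<in> Sym n"
 shows "v w = (\<Sum>s\<in>Sym m. young lam s * of_bool (\<forall>a\<in>{1..m}. w (p + a) = p + s a))"
proof (cases "w \<in> label_stab n (low p)")
 case True
 let ?s = "shift_res p m w"
 have eq: "(\<forall>a\<in>{1..m}. w (p + a) = p + s a) \<longleftrightarrow> s = ?s" if s: "s \<in> Sym m" for s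
 proof
  assume L: "\<forall>a\<in>{1..m}. w (p + a) = p + s a"
  show "s = ?s"
  proof
   fix a show "s a = ?s a"
   proof (cases "a \<in> {1..m}")
    case False
    have "s a = a" using permutes_not_in[of s "{1..m}" a] s False by (simp only: Sym_def mem_Collect_eq not_False_eq_True)
    thus ?thesis using False by (simp only: shift_res_def if_False)
   qed (use L in \<open>simp add: shift_res_def\<close>)
  qed
 qed (use shift_res(2)[OF True] in simp)
 have "(\<Sum>s\<in>Sym m. young lam s * of_bool (\<forall>a\<in>{1..m}. w (p + a) = p + s a)) = (\<Sum>s\<in>Sym m. if s = ?s then young lam ?s else (0::real))"
 proof (rule sum.cong[OF refl])
  fix s assume "s \<in> Sym m"
  from eq[OF this] show "young lam s * of_bool (\<forall>a\<in>{1..m}. w (p + a) = p + s a) = (if s = ?s then young lam ?s else (0::real))"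
   by (simp only: of_bool_def) simp
 qed
 thus ?thesis using v_res[OF True] shift_res(1)[OF True] by simp
next
 case False
 have "\<not> (\<forall>a\<in>{1..m}. w (p + a) = p + s a)" if "s \<in> Sym m" for s
  using low_stabI[OF w that] False by blast
 hence "young lam s * of_bool (\<forall>a\<in>{1..m}. w (p + a) = p + s a) = (0::real)" if "s \<in> Sym m" for s
  using that by (simp only: of_bool_def if_False mult_zero_right)
 hence "(\<Sum>s\<in>Sym m. young lam s * of_bool (\<forall>a\<in>{1..m}. w (p + a) = p + s a)) = (0::real)" by (intro sum.neutral ballI)
 thus ?thesis using False by (simp only: v_def if_False)
qed

end

section \<open>Pairing the Young symmetrizer with equivariant injections\<close>

lemma young_sandwich':
 assumes g: "g \<in> Sym (sum_list lam)"
 shows "gmult (sum_list lam) (col_antisym lam) (gmult (sum_list lam) (gdelta g) (row_sym lam))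
  = scale_galg (young lam (inv g)) (gmult (sum_list lam) (col_antisym lam) (row_sym lam) :: 'k::field_char_0 galg)"
proof -
 let ?n = "sum_list lam"
 let ?r = "row_sym lam :: 'k galg" and ?k = "col_antisym lam :: 'k galg"
 obtain \<zeta> :: 'k where z: "gmult ?n ?r (gmult ?n (gdelta (inv g)) ?k) = scale_galg \<zeta> (young lam)"
  using young_delta[OF inv_Sym[OF g]] by blast
 have kr: "gmult ?n ?k ?r \<sigma> = young lam (inv \<sigma>)" if s: "\<sigma> \<in> Sym ?n" for \<sigma>
 proof -
  have "gmult ?n ?r ?k (inv \<sigma>) = gmult ?n (gstar ?k) (gstar ?r) \<sigma>" by (rule gstar_gmult[OF s])
  also have "gmult ?n (gstar ?k) (gstar ?r) = gmult ?n ?k ?r"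
   by (rule gmult_cong) (simp_all add: gstar_row_sym gstar_col_antisym)
  finally show ?thesis by simp
 qed
 have eq: "gmult ?n ?k (gmult ?n (gdelta g) ?r) = scale_galg \<zeta> (gmult ?n ?k ?r)"
 proof (rule grp_alg_eqI[of _ ?n])
  fix \<sigma> assume s: "\<sigma> \<in> Sym ?n"
  have "scale_galg \<zeta> (young lam) (inv \<sigma>) = gmult ?n ?r (gmult ?n (gdelta (inv g)) ?k) (inv \<sigma>)" by (simp only: z)
  also have "... = gmult ?n (gstar (gmult ?n (gdelta (inv g)) ?k)) (gstar ?r) \<sigma>" by (rule gstar_gmult[OF s])
  also have "gmult ?n (gstar (gmult ?n (gdelta (inv g)) ?k)) (gstar ?r) = gmult ?n (gmult ?n ?k (gdelta g)) ?r"
  proof (rule gmult_cong)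
   fix \<tau> assume t: "\<tau> \<in> Sym ?n"
   have "gstar (gmult ?n (gdelta (inv g)) ?k) \<tau> = gmult ?n (gstar ?k) (gstar (gdelta (inv g))) \<tau>"
    using gstar_gmult[OF t, of "gdelta (inv g)" ?k] by (simp only: gstar_def)
   also have "gmult ?n (gstar ?k) (gstar (gdelta (inv g))) = gmult ?n ?k (gdelta g)"
   proof (rule gmult_cong)
    fix \<rho> assume r: "\<rho> \<in> Sym ?n"
    have "inv \<rho> = inv g \<longleftrightarrow> \<rho> = g" using r g Sym_inv_inv by metis
    thus "gstar (gdelta (inv g)) \<rho> = (gdelta g \<rho> :: 'k)" by (simp add: gstar_def gdelta_def)
   qed (rule gstar_col_antisym)
   finally show "gstar (gmult ?n (gdelta (inv g)) ?k) \<tau> = gmult ?n ?k (gdelta g) \<tau>" .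
  qed (rule gstar_row_sym)
  finally show "gmult ?n ?k (gmult ?n (gdelta g) ?r) \<sigma> = scale_galg \<zeta> (gmult ?n ?k ?r) \<sigma>"
   by (simp add: gmult_assoc scale_galg_def kr[OF s])
 qed simp_all
 have "gmult ?n ?k ?r id = 1" using kr[OF id_Sym] young_at_id by simp
 hence "\<zeta> = gmult ?n ?k (gmult ?n (gdelta g) ?r) id" by (simp add: eq scale_galg_def)
 also have "... = (\<Sum>\<tau>\<in>Sym ?n. ?k \<tau> * ?r (inv g o inv \<tau>))"
  unfolding gmult_apply[OF id_Sym] using g by (intro sum.cong refl) (simp add: gmult_delta_left)
 also have "... = young lam (inv g)" unfolding gmult_apply_right[OF inv_Sym[OF g]] by (simp add: mult.commute)
 finally show ?thesis using eq by simp
qed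

context padded_shape
begin

text \<open>
The argument of \<open>young_class_norm\<close>, with \<open>v = r * kl\<close> in place of the second factor: only the left factor \<open>r\<close> of \<open>v\<close> enters.
\<close>
lemma young_class_v: "(\<Sum>w\<in>Sym n. class_sum n (young P) w * v w) = young_const P * (\<Sum>w\<in>Sym n. v (inv w) * v w)"
proof -
 let ?y = "young P :: real galg"
 have nP: "sum_list P = n" by simp
 have yv: "gmult n ?y (gmult n (gdelta g) v) = scale_galg (?y (inv g)) (gmult n ?y v)" if g: "g \<in> Sym n" for g
 proof -
  have vk: "gmult n a v = gmult n a (gmult n (row_sym P) kl)" for a
   by (rule gmult_cong) (simp_all add: young_stab)
  have v': "gmult n (gdelta g) v = gmult n (gdelta g) (gmult n (row_sym P) kl)" by (rule vk)
  have "gmult n ?y (gmult n (gdelta g) v)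
   = gmult n (row_sym P) (gmult n (gmult n (col_antisym P) (gmult n (gdelta g) (row_sym P))) kl)"
   by (simp add: v' gmult_assoc)
  also have "... = scale_galg (?y (inv g)) (gmult n (row_sym P) (gmult n (gmult n (col_antisym P) (row_sym P)) kl))"
   using young_sandwich'[where 'k = real and lam = P and g = g] g by (simp only: nP gmult_scale_left gmult_scale_right)
  also have "gmult n (row_sym P) (gmult n (gmult n (col_antisym P) (row_sym P)) kl) = gmult n ?y v"
   by (simp add: vk gmult_assoc)
  finally show ?thesis .
 qed
 have "(\<Sum>w\<in>Sym n. class_sum n ?y w * v w) = (\<Sum>w\<in>Sym n. class_sum n ?y (inv w) * v w)"
  using class_sum_young_inv[of _ P, where 'k = real] by (intro sum.cong refl) (simp only: nP)
 also have "... = (\<Sum>w\<in>Sym n. \<Sum>g\<in>Sym n. ?y (g o inv w o inv g) * v w)" by (simp add: class_sum_def sum_distrib_right)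
 also have "... = (\<Sum>g\<in>Sym n. \<Sum>w\<in>Sym n. ?y (g o inv w o inv g) * v w)" by (rule sum.swap)
 also have "... = (\<Sum>g\<in>Sym n. ?y (inv g) * gmult n ?y v g)"
 proof (rule sum.cong[OF refl])
  fix g assume g: "g \<in> Sym n"
  have "gmult n ?y (gmult n (gdelta g) v) g = (\<Sum>\<rho>\<in>Sym n. ?y (g o inv \<rho>) * v (inv g o \<rho>))"
   unfolding gmult_apply_right[OF g] using g by (intro sum.cong refl) (simp add: gmult_delta_left)
  also have "... = (\<Sum>w\<in>Sym n. ?y (g o inv (g o w)) * v (inv g o (g o w)))" by (rule sum_Sym_left[OF g, symmetric])
  also have "... = (\<Sum>w\<in>Sym n. ?y (g o inv w o inv g) * v w)"
   using g by (intro sum.cong refl) (simp add: Sym_inv_comp[where n = n] comp_assoc)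
  finally show "(\<Sum>w\<in>Sym n. ?y (g o inv w o inv g) * v w) = ?y (inv g) * gmult n ?y v g"
   by (simp add: yv[OF g, unfolded nP] scale_galg_def)
 qed
 also have "... = gmult n ?y (gmult n ?y v) id"
  unfolding gmult_apply[OF id_Sym] by (subst sum_Sym_inv[symmetric], rule sum.cong) auto
 also have "... = young_const P * gmult n ?y v id"
 proof -
  have "gmult n ?y ?y = scale_galg (young_const P) ?y"
   using young_square[of P, where 'k = real] by (simp only: nP)
  hence "gmult n ?y (gmult n ?y v) = scale_galg (young_const P) (gmult n ?y v)"
   by (simp only: gmult_assoc[symmetric, of n ?y ?y v] gmult_scale_left)
  thus ?thesis by (simp only: scale_galg_def)
 qed
 also have "gmult n ?y v id = (\<Sum>w\<in>Sym n. ?y (inv w) * v w)"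
  by (simp add: gmult_apply_right)
 also have "... = (\<Sum>w\<in>Sym n. v (inv w) * v w)"
  by (rule sum.cong) (auto simp: v_def label_stab_inv_iff)
 finally show ?thesis .
qed

definition fixer :: nat where "fixer = card {w \<in> Sym n. \<forall>a\<in>{1..m}. w (p + a) = p + a}"

lemma card_moving:
 assumes x: "x ` {1..m} \<subseteq> {1..n}" "inj_on x {1..m}" and y: "y ` {1..m} \<subseteq> {1..n}" "inj_on y {1..m}"
 shows "card {w \<in> Sym n. \<forall>a\<in>{1..m}. w (x a) = y a} = fixer"
 unfolding fixer_def by (rule card_injections_transitive[OF _ x y]) auto

lemma fixer_pos: "fixer > 0"
 unfolding fixer_def by (subst card_gt_0_iff) (auto intro!: exI[of _ id])

text \<open>
By \<open>v_sum\<close> the sum over \<open>w\<close> becomes the coefficient at the identity of the square of the Young symmetrizer of \<open>lam\<close>, once for each element fixing the lower rows pointwise.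
\<close>
lemma v_norm: "(\<Sum>w\<in>Sym n. v (inv w) * v w) = real fixer * young_const lam"
proof -
 let ?y = "young lam :: real galg"
 have "(\<Sum>w\<in>Sym n. v (inv w) * v w) = (\<Sum>w\<in>Sym n. \<Sum>t\<in>Sym m. ?y (inv t) * ?y t * of_bool (\<forall>a\<in>{1..m}. w (p + a) = p + t a))"
 proof (rule sum.cong[OF refl])
  fix w assume w: "w \<in> Sym n"
  have key: "v (inv w) * ?y t * of_bool (\<forall>a\<in>{1..m}. w (p + a) = p + t a) = ?y (inv t) * ?y t * of_bool (\<forall>a\<in>{1..m}. w (p + a) = p + t a)"
   if t: "t \<in> Sym m" for t
  proof (cases "\<forall>a\<in>{1..m}. w (p + a) = p + t a")
   case True
   hence wl: "w \<in> label_stab n (low p)" by (intro low_stabI[OF w t]) auto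
   have il: "inv w \<in> label_stab n (low p)" by (rule label_stab_inv[OF wl])
   have "shift_res p m (inv w) = inv t"
   proof
    fix a show "shift_res p m (inv w) a = inv t a"
    proof (cases "a \<in> {1..m}")
     case a: True
     have "inv t a \<in> {1..m}" by (rule Sym_range[OF inv_Sym[OF t] a])
     hence "w (p + inv t a) = p + t (inv t a)" using True by blast
     also have "t (inv t a) = a" using Sym_bij[OF t] by (simp add: bij_is_surj surj_f_inv_f)
     finally have "inv w (p + a) = p + inv t a" using bij_inv_eq_iff[OF Sym_bij[OF w]] by metis
     thus ?thesis using a by (simp add: shift_res_def)
    next
     case False
     have "inv t a = a" using permutes_not_in[of "inv t" "{1..m}" a] inv_Sym[OF t] False by (simp only: Sym_def mem_Collect_eq not_False_eq_True)
     thus ?thesis using False by (simp only: shift_res_def if_False)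
    qed
   qed
   thus ?thesis using v_res[OF il] by simp
  qed (simp only: of_bool_def if_False mult_zero_right)
  have "v (inv w) * v w = (\<Sum>t\<in>Sym m. v (inv w) * ?y t * of_bool (\<forall>a\<in>{1..m}. w (p + a) = p + t a))"
   unfolding v_sum[OF w] sum_distrib_left by (simp only: mult.assoc)
  also have "... = (\<Sum>t\<in>Sym m. ?y (inv t) * ?y t * of_bool (\<forall>a\<in>{1..m}. w (p + a) = p + t a))"
   by (rule sum.cong[OF refl]) (rule key)
  finally show "v (inv w) * v w = (\<Sum>t\<in>Sym m. ?y (inv t) * ?y t * of_bool (\<forall>a\<in>{1..m}. w (p + a) = p + t a))" .
 qed
 also have "... = (\<Sum>t\<in>Sym m. \<Sum>w\<in>Sym n. ?y (inv t) * ?y t * of_bool (\<forall>a\<in>{1..m}. w (p + a) = p + t a))" by (rule sum.swap)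
 also have "... = (\<Sum>t\<in>Sym m. ?y (inv t) * ?y t * real fixer)"
 proof (rule sum.cong[OF refl])
  fix t assume t: "t \<in> Sym m"
  have "card {w \<in> Sym n. \<forall>a\<in>{1..m}. w (p + a) = p + t a} = fixer"
  proof (rule card_moving)
   show "(%a. p + t a) ` {1..m} \<subseteq> {1..n}" using Sym_range[OF t] by fastforce
   show "inj_on (%a. p + t a) {1..m}" using bij_is_inj[OF Sym_bij[OF t]] by (auto simp: inj_on_def inj_def)
  qed auto
  thus "(\<Sum>w\<in>Sym n. ?y (inv t) * ?y t * of_bool (\<forall>a\<in>{1..m}. w (p + a) = p + t a)) = ?y (inv t) * ?y t * real fixer"
   by (simp add: sum_distrib_left[symmetric] Int_def)
 qed
 also have "... = real fixer * young_const lam"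
  by (simp add: young_const_def gmult_apply sum_distrib_left sum_distrib_right mult_ac)
 finally show ?thesis .
qed

lemma young_swap_right:
 assumes q: "q \<in> label_stab n (tcol P)" and h: "h \<in> Sym n"
 shows "young P (h o q) = real_of_int (sign q) * young P h"
proof -
 have qs: "q \<in> Sym n" by (rule label_stab_Sym[OF q])
 have nP: "sum_list P = n" by simp
 have "gmult n (row_sym P) (col_antisym P) (h o q) = (\<Sum>\<tau>\<in>Sym n. row_sym P \<tau> * (real_of_int (sign q) * col_antisym P (inv \<tau> o h)))"
  unfolding gmult_apply[OF comp_Sym[OF h qs]]
 proof (rule sum.cong[OF refl])
  fix \<tau> assume t: "\<tau> \<in> Sym n"
  have "inv \<tau> o h \<in> Sym n" using t h by simp
  thus "row_sym P \<tau> * col_antisym P (inv \<tau> o (h o q)) = row_sym P \<tau> * (real_of_int (sign q) * col_antisym P (inv \<tau> o h))"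
   using label_stab_comp_iff'[OF q] qs
   by (simp add: col_antisym_eq o_assoc sign_compose Sym_permutation[of _ n])
 qed
 also have "... = real_of_int (sign q) * gmult n (row_sym P) (col_antisym P) h"
  unfolding gmult_apply[OF h] by (simp add: sum_distrib_left mult_ac)
 finally show ?thesis by simp
qed

text \<open>
The image of an injection \<open>x\<close> of \<open>A\<close> misses more than \<open>p\<close> points, and there are only \<open>p\<close> columns.  Two of the missed points
therefore lie in one column, and right multiplication by their transposition changes the sign of the Young
symmetrizer without affecting the condition \<open>h \<circ> x = x \<circ> s\<close>.
\<close>
lemma young_Phi_zero:
 assumes A: "finite A" "card A < m"
 shows "(\<Sum>h\<in>Sym n. young P h * real (Phi A s {1..n} h)) = 0"
proof -
 let ?I = "{x \<in> A \<rightarrow>\<^sub>E {1..n}. inj_on x A}"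
 note Phi = Phi_as_sum[OF A(1) finite_atLeastAtMost]
 have zero: "(\<Sum>h\<in>Sym n. young P h * of_bool (\<forall>a\<in>A. h (x a) = x (s a))) = (0::real)" if x: "x \<in> ?I" for x
 proof -
  have xA: "x ` A \<subseteq> {1..n}" "card (x ` A) = card A" using x by (auto simp: card_image PiE_def Pi_def)
  have "card ({1..n} - x ` A) = n - card A" using xA A by (simp add: card_Diff_subset)
  moreover have "card (tcol P ` ({1..n} - x ` A)) \<le> card {..<p}"
   by (rule card_mono) (use tcol_bound in auto)
  ultimately have "card (tcol P ` ({1..n} - x ` A)) < card ({1..n} - x ` A)" using A by simp
  hence "\<not> inj_on (tcol P) ({1..n} - x ` A)" using card_image by fastforce
  then obtain a b where ab: "a \<in> {1..n}" "b \<in> {1..n}" "a \<notin> x ` A" "b \<notin> x ` A" "a \<noteq> b" "tcol P a = tcol P b"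
   by (auto simp: inj_on_def)
  define q where "q = Transposition.transpose a b"
  have q: "q \<in> label_stab n (tcol P)" unfolding q_def by (rule transpose_label_stab[OF ab(1,2,6)])
  have qs: "q \<in> Sym n" by (rule label_stab_Sym[OF q])
  have qx: "q (x c) = x c" if "c \<in> A" for c using ab that by (auto simp: q_def Transposition.transpose_def)
  have "sign q = -1" using ab(5) by (simp add: q_def sign_swap_id)
  let ?S = "\<Sum>h\<in>Sym n. young P h * of_bool (\<forall>a\<in>A. h (x a) = x (s a)) :: real"
  have "?S = (\<Sum>h\<in>Sym n. young P (h o q) * of_bool (\<forall>a\<in>A. (h o q) (x a) = x (s a)))"
   by (rule sum_Sym_right[OF qs, symmetric])
  also have "... = (\<Sum>h\<in>Sym n. - (young P h * of_bool (\<forall>a\<in>A. h (x a) = x (s a))))"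
   using young_swap_right[OF q] qx \<open>sign q = -1\<close> by (intro sum.cong refl) simp
  also have "... = - ?S" by (simp add: sum_negf)
  finally show ?thesis by simp
 qed
 have "(\<Sum>h\<in>Sym n. young P h * real (Phi A s {1..n} h)) = (\<Sum>x\<in>?I. \<Sum>h\<in>Sym n. young P h * of_bool (\<forall>a\<in>A. h (x a) = x (s a)))"
  unfolding Phi sum_distrib_left by (rule sum.swap)
 also have "... = 0" using zero by simp
 finally show ?thesis .
qed

text \<open>
All injections of \<open>{1..m}\<close> are translates \<open>g \<circ> x0\<close> of the inclusion \<open>x0\<close> onto the lower rows.  Substituting these
turns the sum into the pairing of the class sum of \<open>P\<close> with \<open>v\<close>, up to the number of \<open>g\<close> giving the
same injection.
\<close>
lemma young_Phi_top:
 "(\<Sum>h\<in>Sym n. \<Sum>s\<in>Sym m. young P h * young lam s * real (Phi {1..m} s {1..n} h)) = (young_const P * young_const lam :: real)"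
proof -
 let ?M = "{1..m}"
 let ?I = "{x \<in> ?M \<rightarrow>\<^sub>E {1..n}. inj_on x ?M}"
 have finI: "finite ?I" by (rule finite_subset[of _ "?M \<rightarrow>\<^sub>E {1..n}"]) (auto intro: finite_PiE)
 have rng: "x ` ?M \<subseteq> {1..n}" "inj_on x ?M" if "x \<in> ?I" for x using that by (auto simp: PiE_def Pi_def)
 note Phi = Phi_as_sum[OF finite_atLeastAtMost finite_atLeastAtMost]
 \<comment> \<open>The contribution of a single injection; it depends on \<open>x\<close> only through its values on \<open>{1..m}\<close>.\<close>
 define T :: "(nat => nat) => real" where
  "T x = (\<Sum>h\<in>Sym n. \<Sum>s\<in>Sym m. young P h * young lam s * of_bool (\<forall>a\<in>?M. h (x a) = x (s a)))" for x
 have L: "(\<Sum>h\<in>Sym n. \<Sum>s\<in>Sym m. young P h * young lam s * real (Phi ?M s {1..n} h)) = (\<Sum>x\<in>?I. T x)"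
  unfolding Phi T_def sum_distrib_left by (subst sum.swap[of _ ?I]) (intro sum.cong refl sum.swap)
 have Tcong: "T x = T y" if "\<And>a. a \<in> ?M ==> x a = y a" for x y
  unfolding T_def
 proof (intro sum.cong refl)
  fix h s assume s: "s \<in> Sym m"
  have "(\<forall>a\<in>?M. h (x a) = x (s a)) \<longleftrightarrow> (\<forall>a\<in>?M. h (y a) = y (s a))"
   using that Sym_range[OF s] by metis
  thus "young P h * young lam s * of_bool (\<forall>a\<in>?M. h (x a) = x (s a)) = (young P h * young lam s * of_bool (\<forall>a\<in>?M. h (y a) = y (s a)) :: real)"
   by simp
 qed
 define x0 where "x0 a = p + a" for a
 have x0: "x0 ` ?M \<subseteq> {1..n}" "inj_on x0 ?M" by (auto simp: x0_def inj_on_def)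
 have "real fixer * (\<Sum>x\<in>?I. T x) = (\<Sum>x\<in>?I. \<Sum>g\<in>Sym n. of_bool (\<forall>a\<in>?M. g (x0 a) = x a) * T (g o x0))"
  unfolding sum_distrib_left
 proof (rule sum.cong[OF refl])
  fix x assume x: "x \<in> ?I"
  have "(\<Sum>g\<in>Sym n. of_bool (\<forall>a\<in>?M. g (x0 a) = x a) * T (g o x0)) = (\<Sum>g\<in>Sym n. of_bool (\<forall>a\<in>?M. g (x0 a) = x a) * T x)"
  proof (rule sum.cong[OF refl])
   fix g show "of_bool (\<forall>a\<in>?M. g (x0 a) = x a) * T (g o x0) = of_bool (\<forall>a\<in>?M. g (x0 a) = x a) * T x"
    using Tcong[of "g o x0" x] by (cases "\<forall>a\<in>?M. g (x0 a) = x a") (auto simp: of_bool_def)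
  qed
  also have "... = real (card {g \<in> Sym n. \<forall>a\<in>?M. g (x0 a) = x a}) * T x"
   by (simp add: sum_distrib_right[symmetric] Int_def)
  also have "card {g \<in> Sym n. \<forall>a\<in>?M. g (x0 a) = x a} = fixer" by (rule card_moving[OF x0 rng[OF x]])
  finally show "real fixer * T x = (\<Sum>g\<in>Sym n. of_bool (\<forall>a\<in>?M. g (x0 a) = x a) * T (g o x0))" by (rule sym)
 qed
 also have "... = (\<Sum>g\<in>Sym n. \<Sum>x\<in>?I. of_bool (\<forall>a\<in>?M. g (x0 a) = x a) * T (g o x0))" by (rule sum.swap)
 also have "... = (\<Sum>g\<in>Sym n. T (g o x0))"
 proof (rule sum.cong[OF refl])
  fix g assume g: "g \<in> Sym n"
  let ?x = "restrict (g o x0) ?M"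
  have gi: "inj g" by (rule bij_is_inj[OF Sym_bij[OF g]])
  have xI: "?x \<in> ?I"
  proof (intro CollectI conjI)
   show "?x \<in> ?M \<rightarrow>\<^sub>E {1..n}"
   proof (rule PiE_I)
    fix a assume a: "a \<in> ?M"
    hence "g (x0 a) \<in> {1..n}" using x0(1) by (intro Sym_range[OF g]) blast
    thus "?x a \<in> {1..n}" using a by simp
   qed (simp only: restrict_apply if_False)
   have "inj_on (g o x0) ?M" by (rule comp_inj_on[OF x0(2)]) (rule inj_on_subset[OF gi], simp)
   thus "inj_on ?x ?M" by (simp only: inj_on_restrict_eq)
  qed
  have "(\<Sum>x\<in>?I. of_bool (\<forall>a\<in>?M. g (x0 a) = x a) * T (g o x0)) = (\<Sum>x\<in>?I. if x = ?x then T (g o x0) else 0)"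
  proof (rule sum.cong[OF refl])
   fix x assume x: "x \<in> ?I"
   have "(\<forall>a\<in>?M. g (x0 a) = x a) \<longleftrightarrow> x = ?x"
   proof
    assume L: "\<forall>a\<in>?M. g (x0 a) = x a"
    show "x = ?x" by (rule PiE_ext[of _ ?M "%_. {1..n}"]) (use x xI L in auto)
   qed auto
   thus "of_bool (\<forall>a\<in>?M. g (x0 a) = x a) * T (g o x0) = (if x = ?x then T (g o x0) else 0)" by (simp only: of_bool_def) simp
  qed
  thus "(\<Sum>x\<in>?I. of_bool (\<forall>a\<in>?M. g (x0 a) = x a) * T (g o x0)) = T (g o x0)" using finI xI by simp
 qed
 also have "... = (\<Sum>g\<in>Sym n. \<Sum>w\<in>Sym n. young P (g o w o inv g) * v w)"
 proof (rule sum.cong[OF refl])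
  fix g assume g: "g \<in> Sym n"
  have gi: "inj g" by (rule bij_is_inj[OF Sym_bij[OF g]])
  have "T (g o x0) = (\<Sum>w\<in>Sym n. \<Sum>s\<in>Sym m. young P (g o w o inv g) * young lam s * of_bool (\<forall>a\<in>?M. (g o w o inv g) ((g o x0) a) = (g o x0) (s a)))"
   unfolding T_def by (rule sum_Sym_conj[OF g, symmetric])
  also have "... = (\<Sum>w\<in>Sym n. \<Sum>s\<in>Sym m. young P (g o w o inv g) * young lam s * of_bool (\<forall>a\<in>?M. w (p + a) = p + s a))"
   by (simp add: inv_f_f[OF gi] inj_eq[OF gi] x0_def)
  also have "... = (\<Sum>w\<in>Sym n. young P (g o w o inv g) * v w)"
   by (intro sum.cong refl) (simp only: v_sum sum_distrib_left mult.assoc)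
  finally show "T (g o x0) = (\<Sum>w\<in>Sym n. young P (g o w o inv g) * v w)" .
 qed
 also have "... = (\<Sum>w\<in>Sym n. class_sum n (young P) w * v w)"
  by (subst sum.swap) (simp add: class_sum_def sum_distrib_right)
 also have "... = real fixer * (young_const P * young_const lam)"
  unfolding young_class_v v_norm by simp
 finally show ?thesis using fixer_pos L by simp
qed

end

section \<open>Characters of padded shapes\<close>

definition Theta :: "nat list => nat => (nat => nat) => int" where
 "Theta lam n g = (\<Sum>\<sigma>\<in>Sym (sum_list lam). young_int lam \<sigma> * psi \<sigma> {1..sum_list lam} {1..n} g)"

lemma Theta_conj: "g \<in> Sym n ==> h \<in> Sym n ==> Theta lam n (h o g o inv h) = Theta lam n g"
 unfolding Theta_def
proof (rule sum.cong[OF refl])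
 fix s assume "s \<in> Sym (sum_list lam)" and g: "g \<in> Sym n" and h: "h \<in> Sym n"
 hence "s permutes {1..sum_list lam}" by (simp add: Sym_def)
 from psi_conj_right[OF _ this g h]
 show "young_int lam s * psi s {1..sum_list lam} {1..n} (h o g o inv h) = young_int lam s * psi s {1..sum_list lam} {1..n} g"
  by simp
qed

text \<open>
By \<open>sum_prod_psi\<close> for two factors and \<open>card_good_parts_two\<close>, the \<open>psi \<sigma>\<close> are orthogonal for different classes, and the sum reduces to \<open>young_class_norm\<close> for \<open>lam\<close>.
\<close>
lemma sum_Theta_square:
 assumes n: "n \<ge> 2 * sum_list lam"
 shows "(\<Sum>g\<in>Sym n. (Theta lam n g)\<^sup>2) = fact n * (young_norm lam)\<^sup>2"
proof -
 let ?m = "sum_list lam" and ?y = "young_int lam"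
 let ?M = "{1..?m}"
 have pair: "(\<Sum>g\<in>Sym n. psi \<sigma> ?M {1..n} g * psi \<tau> ?M {1..n} g) = fact n * (\<Sum>b\<in>Sym ?m. of_bool (\<tau> = b o \<sigma> o inv b))"
  if s: "\<sigma> \<in> Sym ?m" and t: "\<tau> \<in> Sym ?m" for \<sigma> \<tau>
 proof -
  define f where "f i = (if i = 0 then \<sigma> else \<tau>)" for i :: nat
  have "(\<Prod>i\<in>{..<2::nat}. psi (f i) ?M {1..n} g) = psi \<sigma> ?M {1..n} g * psi \<tau> ?M {1..n} g" for g
   by (simp add: numeral_2_eq_2 f_def)
  hence "(\<Sum>g\<in>Sym n. psi \<sigma> ?M {1..n} g * psi \<tau> ?M {1..n} g) = fact n * int (card (good_parts {..<2::nat} ?M f))"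
   using sum_prod_psi[of "{..<2::nat}" ?M f n] s t n by (simp add: f_def Sym_def)
  also have "card (good_parts {..<2::nat} ?M f) = card {b. b permutes ?M \<and> b o f 0 = f 1 o b}"
   by (rule card_good_parts_two) (use s t in \<open>auto simp: f_def Sym_def\<close>)
  also have "{b. b permutes ?M \<and> b o f 0 = f 1 o b} = {b \<in> Sym ?m. \<tau> = b o \<sigma> o inv b}"
  proof -
   have "b o \<sigma> = \<tau> o b \<longleftrightarrow> \<tau> = b o \<sigma> o inv b" if "b \<in> Sym ?m" for b
    using that by (metis Sym_o_inv Sym_inv_o comp_assoc comp_id)
   thus ?thesis by (auto simp: f_def Sym_def)
  qed
  finally show ?thesis by (simp add: Int_def)
 qed
 have "(\<Sum>g\<in>Sym n. (Theta lam n g)\<^sup>2)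
   = (\<Sum>g\<in>Sym n. \<Sum>\<sigma>\<in>Sym ?m. \<Sum>\<tau>\<in>Sym ?m. ?y \<sigma> * ?y \<tau> * (psi \<sigma> ?M {1..n} g * psi \<tau> ?M {1..n} g))"
  by (simp add: Theta_def power2_eq_square sum_product mult_ac)
 also have "... = (\<Sum>\<sigma>\<in>Sym ?m. \<Sum>\<tau>\<in>Sym ?m. \<Sum>g\<in>Sym n. ?y \<sigma> * ?y \<tau> * (psi \<sigma> ?M {1..n} g * psi \<tau> ?M {1..n} g))"
  by (subst sum.swap) (intro sum.cong refl sum.swap)
 also have "... = (\<Sum>\<sigma>\<in>Sym ?m. \<Sum>\<tau>\<in>Sym ?m. ?y \<sigma> * ?y \<tau> * (fact n * (\<Sum>b\<in>Sym ?m. of_bool (\<tau> = b o \<sigma> o inv b))))"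
  by (intro sum.cong refl) (simp only: sum_distrib_left[symmetric] pair)
 also have "... = fact n * (\<Sum>\<sigma>\<in>Sym ?m. \<Sum>\<tau>\<in>Sym ?m. \<Sum>b\<in>Sym ?m. if \<tau> = b o \<sigma> o inv b then ?y \<sigma> * ?y \<tau> else 0)"
  unfolding sum_distrib_left by (intro sum.cong refl) (simp add: of_bool_def)
 also have "(\<Sum>\<sigma>\<in>Sym ?m. \<Sum>\<tau>\<in>Sym ?m. \<Sum>b\<in>Sym ?m. if \<tau> = b o \<sigma> o inv b then ?y \<sigma> * ?y \<tau> else 0)
   = (\<Sum>\<sigma>\<in>Sym ?m. \<Sum>b\<in>Sym ?m. ?y \<sigma> * ?y (b o \<sigma> o inv b))"
  by (rule sum.cong[OF refl], subst sum.swap, intro sum.cong refl, subst sum.delta) simp_all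
 also have "real_of_int ... = real_of_int ((young_norm lam)\<^sup>2)"
  using young_class_norm[of lam, where 'k = real]
  by (simp add: class_sum_def young_of_int young_const_of_int sum_distrib_left)
 hence "(\<Sum>\<sigma>\<in>Sym ?m. \<Sum>b\<in>Sym ?m. ?y \<sigma> * ?y (b o \<sigma> o inv b)) = (young_norm lam)\<^sup>2" by (simp only: of_int_eq_iff)
 finally show ?thesis .
qed

context padded_shape
begin

text \<open>
Terms of \<open>psi\<close> with deleted cycles involve fewer than \<open>m\<close> points and vanish; the remaining one is \<open>young_Phi_top\<close>.
\<close>
lemma sum_young_Theta:
 "(\<Sum>h\<in>Sym n. young P h * real_of_int (Theta lam n h)) = real_of_int (young_norm P * young_norm lam)"
proof -
 let ?M = "{1..m}"
 have z: "(\<Sum>h\<in>Sym n. young P h * real_of_int (psi s ?M {1..n} h)) = (\<Sum>h\<in>Sym n. young P h * real (Phi ?M s {1..n} h))"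
  if s: "s \<in> Sym m" for s
 proof -
  have sp: "s permutes ?M" "permutation s" using s Sym_permutation by (auto simp: Sym_def)
  have finO: "finite (orbs s ?M)" by (simp add: orbs_def)
  have "(\<Sum>h\<in>Sym n. young P h * real_of_int (psi s ?M {1..n} h))
   = (\<Sum>X\<in>Pow (orbs s ?M). (-1) ^ card X * (\<Sum>h\<in>Sym n. young P h * real (Phi (?M - \<Union>X) s {1..n} h)))"
   unfolding psi_def of_int_sum sum_distrib_left by (subst sum.swap) (simp add: mult_ac)
  also have "... = (\<Sum>X\<in>{{}}. (-1) ^ card X * (\<Sum>h\<in>Sym n. young P h * real (Phi (?M - \<Union>X) s {1..n} h)))"
  proof (rule sum.mono_neutral_right)
   show "\<forall>X\<in>Pow (orbs s ?M) - {{}}. (-1) ^ card X * (\<Sum>h\<in>Sym n. young P h * real (Phi (?M - \<Union>X) s {1..n} h)) = 0"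
   proof
    fix X assume X: "X \<in> Pow (orbs s ?M) - {{}}"
    then obtain o' where o': "o' \<in> X" by blast
    hence "o' \<in> orbs s ?M" using X by blast
    then obtain a where a: "a \<in> ?M" "o' = orbit s a" unfolding orbs_def by blast
    have "a \<in> \<Union>X" using o' a orbit_self[OF sp(2), of a] by blast
    hence "?M - \<Union>X \<subset> ?M" using a by blast
    hence "card (?M - \<Union>X) < card ?M" by (intro psubset_card_mono) auto
    hence "(\<Sum>h\<in>Sym n. young P h * real (Phi (?M - \<Union>X) s {1..n} h)) = 0"
     by (intro young_Phi_zero) auto
    thus "(-1) ^ card X * (\<Sum>h\<in>Sym n. young P h * real (Phi (?M - \<Union>X) s {1..n} h)) = 0" by simp
   qed
  qed (use finO in auto)
  finally show ?thesis by simp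
 qed
 have "(\<Sum>h\<in>Sym n. young P h * real_of_int (Theta lam n h))
   = (\<Sum>s\<in>Sym m. young lam s * (\<Sum>h\<in>Sym n. young P h * real_of_int (psi s ?M {1..n} h)))"
  unfolding Theta_def of_int_sum sum_distrib_left by (subst sum.swap) (simp add: mult_ac young_of_int)
 also have "... = (\<Sum>s\<in>Sym m. young lam s * (\<Sum>h\<in>Sym n. young P h * real (Phi ?M s {1..n} h)))"
  by (rule sum.cong[OF refl]) (simp only: z)
 also have "... = (\<Sum>h\<in>Sym n. \<Sum>s\<in>Sym m. young P h * young lam s * real (Phi ?M s {1..n} h))"
  unfolding sum_distrib_left by (subst sum.swap) (simp add: mult_ac)
 also have "... = young_const P * young_const lam" by (rule young_Phi_top)
 finally show ?thesis by (simp add: young_const_of_int)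
qed

text \<open>
For the normalised scalar product both functions have norm \<open>1\<close> and product \<open>1\<close>, so the norm of their difference is zero.
\<close>
theorem class_sum_eq_Theta:
 assumes big: "p \<ge> m" and g: "g \<in> Sym n"
 shows "class_sum n (young P) g / young_const P = real_of_int (Theta lam n g) / real_of_int (young_norm lam)"
proof -
 have nP: "sum_list P = n" by simp
 define c where "c g = class_sum n (young P) g / real_of_int (young_norm P)" for g
 define t where "t g = real_of_int (Theta lam n g) / real_of_int (young_norm lam)" for g
 have nz: "real_of_int (young_norm P) \<noteq> 0" "real_of_int (young_norm lam) \<noteq> 0" using young_norm_nonzero by auto
 have cls: "class_sum n (young P) (h o g o inv h) = (class_sum n (young P) g :: real)" if g: "g \<in> Sym n" and h: "h \<in> Sym n" for g h
 proof -
  have "class_sum n a g = class_sum n a (h o g o inv h)" for a :: "real galg"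
   unfolding class_sum_def
   using sum_Sym_right[OF h, of "%\<tau>. a (\<tau> o g o inv \<tau>)"] h
   by (simp add: Sym_inv_comp[where n = n] comp_assoc)
  from this[of "young P"] show ?thesis by (rule sym)
 qed
 have cc: "(\<Sum>g\<in>Sym n. (c g)\<^sup>2) = fact n"
 proof -
  have "(\<Sum>g\<in>Sym n. (c g)\<^sup>2) = (\<Sum>g\<in>Sym n. class_sum n (young P) g * class_sum n (young P) g) / (real_of_int (young_norm P))\<^sup>2"
   by (simp add: c_def power2_eq_square sum_divide_distrib)
  also have "(\<Sum>g\<in>Sym n. class_sum n (young P) g * class_sum n (young P) g) = fact n * (\<Sum>g\<in>Sym n. young P g * class_sum n (young P) g :: real)"
   by (rule sum_class_function) (rule cls)
  also have "(\<Sum>g\<in>Sym n. young P g * class_sum n (young P) g) = (real_of_int (young_norm P))\<^sup>2"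
   using young_class_norm[of P, where 'k = real] by (simp only: nP young_const_of_int)
  finally show ?thesis using nz by simp
 qed
 have tt: "(\<Sum>g\<in>Sym n. (t g)\<^sup>2) = fact n"
 proof -
  have "(\<Sum>g\<in>Sym n. (t g)\<^sup>2) = real_of_int (\<Sum>g\<in>Sym n. (Theta lam n g)\<^sup>2) / (real_of_int (young_norm lam))\<^sup>2"
   by (simp add: t_def power_divide sum_divide_distrib)
  also have "... = fact n" using nz big by (simp add: sum_Theta_square)
  finally show ?thesis .
 qed
 have ct: "(\<Sum>g\<in>Sym n. c g * t g) = fact n"
 proof -
  have "(\<Sum>g\<in>Sym n. c g * t g) = (\<Sum>g\<in>Sym n. class_sum n (young P) g * real_of_int (Theta lam n g)) / (real_of_int (young_norm P) * real_of_int (young_norm lam))"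
   by (simp add: c_def t_def sum_divide_distrib)
  also have "(\<Sum>g\<in>Sym n. class_sum n (young P) g * real_of_int (Theta lam n g)) = fact n * (\<Sum>g\<in>Sym n. young P g * real_of_int (Theta lam n g))"
   by (rule sum_class_function) (simp add: Theta_conj)
  also have "(\<Sum>g\<in>Sym n. young P g * real_of_int (Theta lam n g)) = real_of_int (young_norm P * young_norm lam)"
   by (rule sum_young_Theta)
  finally show ?thesis using nz by simp
 qed
 have "(\<Sum>g\<in>Sym n. (c g - t g)\<^sup>2) = (\<Sum>g\<in>Sym n. (c g)\<^sup>2) + (\<Sum>g\<in>Sym n. (t g)\<^sup>2) - 2 * (\<Sum>g\<in>Sym n. c g * t g)"
  by (simp add: power2_diff sum.distrib sum_subtractf sum_distrib_left mult.assoc)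
 also have "... = 0" by (simp add: cc tt ct)
 finally have "\<forall>g\<in>Sym n. (c g - t g)\<^sup>2 = 0" by (subst (asm) sum_nonneg_eq_0_iff) auto
 hence "c g = t g" using g by simp
 thus ?thesis by (simp add: c_def t_def young_const_of_int)
qed

end

theorem irr_char_padded:
 assumes wide: "\<And>l. l \<in> set lam ==> l \<le> n - sum_list lam" and n: "n \<ge> 2 * sum_list lam" and g: "g \<in> Sym n"
 shows "irr_char (padded lam n) g = complex_of_real (real_of_int (Theta lam n g) / real_of_int (young_norm lam))"
proof -
 let ?m = "sum_list lam" and ?p = "n - sum_list lam"
 interpret padded_shape ?p lam by unfold_locales (rule wide)
 have pm: "?p + ?m = n" using n by simp
 have nP: "sum_list (padded lam n) = n" using pm by (simp add: padded_def)
 have "irr_char (padded lam n) g = class_sum n (young (padded lam n)) g / young_const (padded lam n)"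
  using irr_char_class_sum[of g "padded lam n"] g by (simp only: nP)
 also have "class_sum n (young (padded lam n)) g = complex_of_real (class_sum n (young (padded lam n)) g)"
  by (simp add: class_sum_def young_of_int[of "padded lam n", unfolded nP] nP)
 also have "complex_of_real (class_sum n (young (padded lam n)) g) / young_const (padded lam n)
   = complex_of_real (class_sum n (young (padded lam n)) g / young_const (padded lam n))"
  by (simp add: young_const_of_int)
 also have "class_sum n (young (padded lam n)) g / young_const (padded lam n) = real_of_int (Theta lam n g) / real_of_int (young_norm lam)"
  using class_sum_eq_Theta[of g] g n by (simp only: pm padded_def)
 finally show ?thesis .
qed

section \<open>Composition of partitions as matrix multiplication\<close>

definition saturated :: "'a set set => 'a set => bool" where
 "saturated P S \<longleftrightarrow> (\<forall>B\<in>P. B \<subseteq> S \<or> B \<inter> S = {})"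

lemma saturated_iff: "saturated P S \<longleftrightarrow> (\<forall>B\<in>P. \<forall>u\<in>B. \<forall>v\<in>B. u \<in> S \<longrightarrow> v \<in> S)"
 unfolding saturated_def by blast

lemma saturatedD: "saturated P S ==> B \<in> P ==> u \<in> B ==> v \<in> B ==> u \<in> S ==> v \<in> S"
 unfolding saturated_iff by blast

lemma saturated_block: "partition_on A P ==> B \<in> P ==> saturated P B"
 unfolding saturated_def partition_on_def disjoint_def by blast

lemma partition_eqI_saturated:
 assumes P: "partition_on A P" and Q: "partition_on A Q"
  and eq: "\<And>S. S \<subseteq> A ==> saturated P S \<longleftrightarrow> saturated Q S"
 shows "P = Q"
proof -
 have sub: "P \<subseteq> Q" if P: "partition_on A P" and Q: "partition_on A Q"
  and eq: "\<And>S. S \<subseteq> A ==> saturated P S \<longleftrightarrow> saturated Q S" for P Q :: "'a set set"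
 proof
  fix B assume B: "B \<in> P"
  obtain u where u: "u \<in> B" using B P by (metis partition_onD3 ex_in_conv)
  have BA: "B \<subseteq> A" using B P by (auto simp: partition_on_def)
  then obtain C where C: "C \<in> Q" "u \<in> C" using Q u by (auto simp: partition_on_def)
  have CA: "C \<subseteq> A" using C Q by (auto simp: partition_on_def)
  have "saturated Q B" using eq[OF BA] saturated_block[OF P B] by simp
  hence "C \<subseteq> B" using C u by (auto simp: saturated_def)
  moreover have "saturated P C" using eq[OF CA] saturated_block[OF Q C(1)] by simp
  hence "B \<subseteq> C" using C u B by (auto simp: saturated_def)
  ultimately show "B \<in> Q" using C by auto
 qed
 from sub[OF P Q eq] sub[OF Q P] eq show ?thesis by blast
qed

definition join_blocks :: "spart => spart => (nat + (nat + nat)) set set" where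
 "join_blocks a b = (%B. map_sum id Inl ` B) ` a \<union> (%B. Inr ` B) ` b"

lemma join_classes_eq: "join_classes a b = \<Union>(join_blocks a b) // (same_block (join_blocks a b))\<^sup>+"
 unfolding join_classes_def join_blocks_def Let_def ..

lemma equiv_same_block_trancl: "equiv (\<Union>P) ((same_block P)\<^sup>+)"
proof (rule equivI)
 have sub: "same_block P \<subseteq> \<Union>P \<times> \<Union>P" unfolding same_block_def by blast
 show "(same_block P)\<^sup>+ \<subseteq> \<Union>P \<times> \<Union>P" using trancl_subset_Sigma[OF sub] .
 show "refl_on (\<Union>P) ((same_block P)\<^sup>+)"
  unfolding refl_on_def same_block_def by blast
 show "sym ((same_block P)\<^sup>+)" by (rule sym_trancl) (auto simp: same_block_def sym_def)
qed simp

lemma saturated_quotient_trancl: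
 "saturated (\<Union>P // (same_block P)\<^sup>+) S \<longleftrightarrow> saturated P S"
proof
 assume L: "saturated (\<Union>P // (same_block P)\<^sup>+) S"
 show "saturated P S" unfolding saturated_iff
 proof (intro ballI impI)
  fix B u v assume B: "B \<in> P" "u \<in> B" "v \<in> B" "u \<in> S"
  let ?C = "(same_block P)\<^sup>+ `` {u}"
  have "?C \<in> \<Union>P // (same_block P)\<^sup>+" using B by (auto intro: quotientI)
  moreover have "u \<in> ?C" "v \<in> ?C" using B by (auto simp: same_block_def)
  ultimately show "v \<in> S" using L[unfolded saturated_iff, rule_format, of ?C u v] B(4) by simp
 qed
next
 assume R: "saturated P S"
 have step: "w \<in> S" if "(v, w) \<in> (same_block P)\<^sup>+" "v \<in> S" for v w
  using that
  by (induction rule: trancl_induct) (use R in \<open>auto simp: same_block_def saturated_iff\<close>)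
 have sym: "sym ((same_block P)\<^sup>+)" by (rule sym_trancl) (auto simp: same_block_def sym_def)
 show "saturated (\<Union>P // (same_block P)\<^sup>+) S" unfolding saturated_iff
 proof (intro ballI impI)
  fix C u v assume C: "C \<in> \<Union>P // (same_block P)\<^sup>+" "u \<in> C" "v \<in> C" "u \<in> S"
  then obtain x where "C = (same_block P)\<^sup>+ `` {x}" by (auto elim: quotientE)
  hence "(x, u) \<in> (same_block P)\<^sup>+" "(x, v) \<in> (same_block P)\<^sup>+" using C by auto
  hence "(u, v) \<in> (same_block P)\<^sup>+" using sym by (meson symD trancl_trans)
  thus "v \<in> S" using step C by blast
 qed
qed

lemma spartsD: "a \<in> sparts X Y ==> partition_on (X <+> Y) a" by (simp add: sparts_def)

lemma finite_sparts: "finite X ==> finite Y ==> finite (sparts X Y)"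
 unfolding sparts_def by (intro finitely_many_partition_on) auto

lemma Union_join_blocks:
 assumes "a \<in> sparts X Y" "b \<in> sparts Y Z"
 shows "\<Union>(join_blocks a b) = X <+> (Y <+> Z)"
proof -
 have "\<Union>((%B. map_sum id Inl ` B) ` a) = map_sum id Inl ` (X <+> Y)"
  using spartsD[OF assms(1)] by (auto simp: partition_on_def)
 moreover have "\<Union>((%B. Inr ` B) ` b) = Inr ` (Y <+> Z)"
  using spartsD[OF assms(2)] by (auto simp: partition_on_def)
 ultimately have "\<Union>(join_blocks a b) = map_sum id Inl ` (X <+> Y) \<union> Inr ` (Y <+> Z)"
  unfolding join_blocks_def Union_Un_distrib by (rule arg_cong2)
 also have "... = X <+> (Y <+> Z)"
  unfolding Plus_def image_Un image_image by (simp add: Un_ac)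
 finally show ?thesis .
qed

lemma partition_on_join_classes:
 assumes "a \<in> sparts X Y" "b \<in> sparts Y Z"
 shows "partition_on (X <+> (Y <+> Z)) (join_classes a b)"
 unfolding join_classes_eq using partition_on_quotient[OF equiv_same_block_trancl[of "join_blocks a b"]]
 unfolding Union_join_blocks[OF assms] .

lemma spart_comp_in_sparts:
 assumes "a \<in> sparts X Y" "b \<in> sparts Y Z"
 shows "spart_comp a b \<in> sparts X Z"
proof -
 have "map_sum id Inr -` (X <+> (Y <+> Z)) = X <+> Z"
 proof (rule set_eqI)
  fix u :: "nat + nat" show "u \<in> map_sum id Inr -` (X <+> (Y <+> Z)) \<longleftrightarrow> u \<in> X <+> Z"
   by (cases u) auto
 qed
 thus ?thesis using partition_on_vimage[OF partition_on_join_classes[OF assms], of "map_sum id Inr"]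
  unfolding sparts_def spart_comp_def by simp
qed

lemma image_subset_iff_mem: "(\<And>x. f x \<in> T \<longleftrightarrow> x \<in> S) ==> f ` B \<subseteq> T \<longleftrightarrow> B \<subseteq> S"
 by blast

lemma image_disjoint_iff_mem: "(\<And>x. f x \<in> T \<longleftrightarrow> x \<in> S) ==> f ` B \<inter> T = {} \<longleftrightarrow> B \<inter> S = {}"
 by blast

lemma saturated_join_classes:
 "saturated (join_classes a b) (S <+> (T <+> U)) \<longleftrightarrow> saturated a (S <+> T) \<and> saturated b (T <+> U)"
proof -
 have m: "map_sum id Inl x \<in> S <+> (T <+> U) \<longleftrightarrow> x \<in> S <+> T" for x by (cases x) auto
 note 1 = image_subset_iff_mem[OF m] and 2 = image_disjoint_iff_mem[OF m]
 have 3: "Inr ` B \<subseteq> S <+> (T <+> U) \<longleftrightarrow> B \<subseteq> T <+> U" for B by auto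
 have 4: "Inr ` B \<inter> (S <+> (T <+> U)) = {} \<longleftrightarrow> B \<inter> (T <+> U) = {}" for B by auto
 show ?thesis unfolding join_classes_eq saturated_quotient_trancl
  by (simp add: join_blocks_def saturated_def ball_Un 1 2 3 4)
qed

lemma Plus_decompose: "S \<subseteq> X <+> Y ==> \<exists>S1\<subseteq>X. \<exists>S2\<subseteq>Y. S = S1 <+> S2"
proof -
 assume S: "S \<subseteq> X <+> Y"
 have "S = (Inl -` S) <+> (Inr -` S)"
  by (rule set_eqI, rename_tac u, case_tac u) auto
 moreover have "Inl -` S \<subseteq> X" "Inr -` S \<subseteq> Y" using S by blast+
 ultimately show ?thesis by metis
qed

text \<open>
\<open>T\<close> is saturated for both partitions, together with \<open>S\<close> and \<open>U\<close>, exactly if \<open>S \<union> T \<union> U\<close> is a union of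
classes of the join.  The classes meeting the outer sets are prescribed by \<open>S\<close> and \<open>U\<close>, consistently if
and only if these are saturated for the composite, and each class inside the middle set may be chosen freely.
\<close>
lemma binary_functor:
 assumes a: "a \<in> sparts X Y" and b: "b \<in> sparts Y Z" and fin: "finite X" "finite Y" "finite Z"
  and S: "S \<subseteq> X" and U: "U \<subseteq> Z"
 shows "card {T \<in> Pow Y. saturated a (S <+> T) \<and> saturated b (T <+> U)}
    = (if saturated (spart_comp a b) (S <+> U) then 2 ^ loops a b else 0)"
proof -
 let ?J = "join_classes a b"
 let ?f = "map_sum id Inr :: nat + nat => nat + (nat + nat)"
 let ?M = "{T \<in> Pow Y. saturated a (S <+> T) \<and> saturated b (T <+> U)}"
 \<comment> \<open>The classes in \<open>L\<close> may be chosen freely, those in \<open>C0\<close> are forced by \<open>S\<close> and \<open>U\<close>.\<close>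
 define L where "L = {C \<in> ?J. C \<subseteq> range (Inr o Inl)}"
 define C0 where "C0 = {C \<in> ?J. \<exists>u\<in>C. u \<in> ?f ` (S <+> U)}"
 have J: "partition_on (X <+> (Y <+> Z)) ?J" by (rule partition_on_join_classes[OF a b])
 have finJ: "finite ?J" by (rule finite_elements[OF _ J]) (use fin in auto)
 have M: "?M = {T \<in> Pow Y. saturated ?J (S <+> (T <+> U))}" by (simp add: saturated_join_classes)
 have Jsub: "C \<subseteq> X <+> (Y <+> Z)" if "C \<in> ?J" for C using J that by (auto simp: partition_on_def)
 have Jdis: "C = D" if "C \<in> ?J" "D \<in> ?J" "u \<in> C" "u \<in> D" for C D u
  using J that by (auto simp: partition_on_def disjoint_def)
 have Jcov: "\<exists>C\<in>?J. w \<in> C" if "w \<in> X <+> (Y <+> Z)" for w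
  using that partition_onD1[OF J] by blast
 have fmem: "?f u \<in> S <+> (T <+> U) \<longleftrightarrow> u \<in> S <+> U" for u T by (cases u) auto
 have notL: "\<exists>u. ?f u \<in> C" if "C \<in> ?J" "C \<notin> L" for C
 proof -
  from that obtain v where v: "v \<in> C" "v \<notin> range (Inr o Inl)" by (auto simp: L_def)
  have "\<exists>u. v = ?f u"
  proof (cases v)
   case (Inl x) thus ?thesis by (intro exI[of _ "Inl x"]) simp
  next
   case (Inr w) thus ?thesis using v by (cases w) (auto intro: exI[of _ "Inr _"])
  qed
  thus ?thesis using v by blast
 qed
 have Lf: "?f u \<notin> C" if "C \<in> L" for u C using that by (cases u) (auto simp: L_def)
 show ?thesis
 proof (cases "saturated (spart_comp a b) (S <+> U)")
  case False
  have "?M = {}"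
  proof (rule ccontr)
   assume "?M \<noteq> {}"
   then obtain T where T: "saturated ?J (S <+> (T <+> U))" unfolding M by auto
   have "saturated (spart_comp a b) (S <+> U)" unfolding saturated_iff
   proof (intro ballI impI)
    fix B u v assume B: "B \<in> spart_comp a b" "u \<in> B" "v \<in> B" "u \<in> S <+> U"
    then obtain C where C: "C \<in> ?J" "B = ?f -` C" unfolding spart_comp_def by blast
    hence "?f u \<in> C" "?f v \<in> C" using B by auto
    thus "v \<in> S <+> U" using saturatedD[OF T C(1), of "?f u" "?f v"] B(4) fmem[of u T] fmem[of v T] by simp
   qed
   with False show False by simp
  qed
  thus ?thesis using False by (simp only: card.empty if_False)
 next
  case True
  define TQ where "TQ Q = {y. Inr (Inl y) \<in> \<Union>(C0 \<union> Q)}" for Q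
  have C0J: "C0 \<subseteq> ?J" by (auto simp: C0_def)
  have comp_block: "v \<in> S <+> U" if "C \<in> ?J" "?f u \<in> C" "?f v \<in> C" "u \<in> S <+> U" for C u v
  proof -
   have "?f -` C \<in> spart_comp a b" unfolding spart_comp_def using that by auto
   thus ?thesis using saturatedD[OF True, of "?f -` C" u v] that by simp
  qed
  have set: "S <+> (TQ Q <+> U) = \<Union>(C0 \<union> Q)" if Q: "Q \<subseteq> L" for Q
  proof (rule set_eqI)
   fix w
   have key: "?f u \<in> \<Union>(C0 \<union> Q) \<longleftrightarrow> u \<in> S <+> U" for u
   proof
    assume "?f u \<in> \<Union>(C0 \<union> Q)"
    then obtain C where C: "C \<in> C0 \<union> Q" "?f u \<in> C" by blast
    hence "C \<in> C0" using Lf Q by blast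
    then obtain v where "C \<in> ?J" "?f v \<in> C" "v \<in> S <+> U" by (auto simp: C0_def)
    thus "u \<in> S <+> U" using comp_block C by blast
   next
    assume u: "u \<in> S <+> U"
    hence "?f u \<in> X <+> (Y <+> Z)" using S U by (cases u) auto
    then obtain C where C: "C \<in> ?J" "?f u \<in> C" using Jcov by metis
    hence "C \<in> C0" using u by (auto simp: C0_def)
    thus "?f u \<in> \<Union>(C0 \<union> Q)" using C by blast
   qed
   show "w \<in> S <+> (TQ Q <+> U) \<longleftrightarrow> w \<in> \<Union>(C0 \<union> Q)"
   proof (cases w)
    case (Inl x) thus ?thesis using key[of "Inl x"] by auto
   next
    case (Inr w') thus ?thesis
    proof (cases w')
     case (Inl y) thus ?thesis using \<open>w = Inr w'\<close> unfolding TQ_def by auto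
    next
     case (Inr z) thus ?thesis using \<open>w = Inr w'\<close> key[of "Inr z"] by auto
    qed
   qed
  qed
  have LC0: "L \<inter> C0 = {}"
  proof -
   have False if "C \<in> L" "C \<in> C0" for C
    using that Lf[of C] unfolding C0_def by blast
   thus ?thesis by blast
  qed
  have "bij_betw TQ (Pow L) ?M"
  proof (rule bij_betwI')
   fix Q Q' assume Q: "Q \<in> Pow L" "Q' \<in> Pow L"
   show "TQ Q = TQ Q' \<longleftrightarrow> Q = Q'"
   proof
    assume "TQ Q = TQ Q'"
    hence eq: "\<Union>(C0 \<union> Q) = \<Union>(C0 \<union> Q')" using set[of Q] set[of Q'] Q by auto
    have sub: "Q1 \<subseteq> Q2" if "\<Union>(C0 \<union> Q1) = \<Union>(C0 \<union> Q2)" "Q1 \<subseteq> L" "Q2 \<subseteq> L" for Q1 Q2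
    proof
     fix C assume C: "C \<in> Q1"
     hence CJ: "C \<in> ?J" using that by (auto simp: L_def)
     then obtain u where u: "u \<in> C" using J by (metis partition_onD3 ex_in_conv)
     hence "u \<in> \<Union>(C0 \<union> Q2)" using that(1) C by blast
     then obtain D where D: "D \<in> C0 \<union> Q2" "u \<in> D" by blast
     hence "D \<in> ?J" using that C0J by (auto simp: L_def)
     hence "C = D" using Jdis CJ u D by blast
     thus "C \<in> Q2" using D C that LC0 by blast
    qed
    show "Q = Q'" using sub[OF eq] sub[OF eq[symmetric]] Q by blast
   qed simp
  next
   fix Q assume Q: "Q \<in> Pow L"
   have "TQ Q \<subseteq> Y"
   proof
    fix y assume "y \<in> TQ Q"
    then obtain C where C: "C \<in> C0 \<union> Q" "Inr (Inl y) \<in> C" unfolding TQ_def by blast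
    hence "C \<in> ?J" using Q C0J by (auto simp: L_def)
    thus "y \<in> Y" using Jsub[of C] C by auto
   qed
   moreover have "saturated ?J (\<Union>(C0 \<union> Q))" unfolding saturated_iff
   proof (intro ballI impI)
    fix B u v assume B: "B \<in> ?J" "u \<in> B" "v \<in> B" "u \<in> \<Union>(C0 \<union> Q)"
    then obtain C where C: "C \<in> C0 \<union> Q" "u \<in> C" by blast
    hence "C \<in> ?J" using Q C0J by (auto simp: L_def)
    hence "B = C" using Jdis B C by blast
    thus "v \<in> \<Union>(C0 \<union> Q)" using B C by blast
   qed
   ultimately show "TQ Q \<in> ?M" unfolding M using set[of Q] Q by auto
  next
   fix T assume T: "T \<in> ?M"
   hence T: "T \<subseteq> Y" "saturated ?J (S <+> (T <+> U))" unfolding M by auto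
   define Q where "Q = {C \<in> L. C \<subseteq> S <+> (T <+> U)}"
   have "T = TQ Q"
   proof (rule set_eqI)
    fix y show "y \<in> T \<longleftrightarrow> y \<in> TQ Q"
    proof
     assume y: "y \<in> T"
     hence "Inr (Inl y) \<in> X <+> (Y <+> Z)" using T by auto
     then obtain C where C: "C \<in> ?J" "Inr (Inl y) \<in> C" using Jcov by metis
     have Csub: "C \<subseteq> S <+> (T <+> U)" using saturatedD[OF T(2) C(1) C(2)] y by blast
     show "y \<in> TQ Q"
     proof (cases "C \<in> L")
      case True thus ?thesis using C Csub unfolding TQ_def Q_def by blast
     next
      case False
      then obtain u where u: "?f u \<in> C" using notL C by blast
      hence "u \<in> S <+> U" using Csub fmem by blast
      hence "C \<in> C0" using C u by (auto simp: C0_def)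
      thus ?thesis using C unfolding TQ_def by blast
     qed
    next
     assume "y \<in> TQ Q"
     then obtain C where C: "C \<in> C0 \<union> Q" "Inr (Inl y) \<in> C" unfolding TQ_def by blast
     have "C \<subseteq> S <+> (T <+> U)"
     proof (cases "C \<in> Q")
      case True thus ?thesis by (simp add: Q_def)
     next
      case False
      hence "C \<in> C0" using C by simp
      then obtain u where u: "C \<in> ?J" "?f u \<in> C" "u \<in> S <+> U" by (auto simp: C0_def)
      hence "?f u \<in> S <+> (T <+> U)" using fmem by simp
      thus ?thesis using saturatedD[OF T(2) u(1) u(2)] by (intro subsetI)
     qed
     thus "y \<in> T" using C by auto
    qed
   qed
   moreover have "Q \<in> Pow L" by (auto simp: Q_def)
   ultimately show "\<exists>Q\<in>Pow L. T = TQ Q" by blast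
  qed
  hence "card ?M = card (Pow L)" by (simp add: bij_betw_same_card)
  also have "... = 2 ^ card L" by (rule card_Pow) (use finJ in \<open>simp add: L_def\<close>)
  finally show ?thesis using True by (simp add: loops_def L_def)
 qed
qed

text \<open>
The image of a partition under the functor from the category at \<open>t = 2\<close> that sends \<open>X\<close> to the functions on subsets
of \<open>X\<close>.  It is faithful on partitions, so that identities between composites can be checked on these matrices.
\<close>
definition sat_mat :: "spart => nat set => nat set => nat" where
 "sat_mat a S T = of_bool (saturated a (S <+> T))"

lemma sat_mat_eq_iff: "sat_mat a S T = sat_mat b S' T' \<longleftrightarrow> (saturated a (S <+> T) \<longleftrightarrow> saturated b (S' <+> T'))"
 by (simp add: sat_mat_def of_bool_eq_iff)

lemma sat_mat_mult:
 assumes "a \<in> sparts X Y" "b \<in> sparts Y Z" "finite X" "finite Y" "finite Z" "S \<subseteq> X" "U \<subseteq> Z"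
 shows "(\<Sum>T\<in>Pow Y. sat_mat a S T * sat_mat b T U) = 2 ^ loops a b * sat_mat (spart_comp a b) S U"
proof -
 have "(\<Sum>T\<in>Pow Y. sat_mat a S T * sat_mat b T U) = (\<Sum>T\<in>Pow Y. of_bool (saturated a (S <+> T) \<and> saturated b (T <+> U)))"
  by (intro sum.cong) (auto simp: sat_mat_def)
 also have "... = card {T \<in> Pow Y. saturated a (S <+> T) \<and> saturated b (T <+> U)}"
  using assms by (simp add: Int_def conj_commute)
 finally show ?thesis using binary_functor[OF assms] by (simp add: sat_mat_def)
qed

lemma saturated_empty [simp]: "saturated P {}" by (simp add: saturated_def)
lemma Plus_empty [simp]: "{} <+> {} = {}" by auto

text \<open>
The way in which all composites below are computed, loops included: evaluation at the empty sets determines the exponent.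
\<close>
lemma spart_comp_unique:
 assumes a: "a \<in> sparts X Y" "b \<in> sparts Y Z" "finite X" "finite Y" "finite Z"
  and g: "c \<in> sparts X Z"
  and eq: "\<And>S U. S \<subseteq> X ==> U \<subseteq> Z ==>
    (\<Sum>T\<in>Pow Y. sat_mat a S T * sat_mat b T U) = 2 ^ l * sat_mat c S U"
 shows "spart_comp a b = c" and "loops a b = l"
proof -
 have e: "2 ^ loops a b * sat_mat (spart_comp a b) S U = 2 ^ l * sat_mat c S U" if "S \<subseteq> X" "U \<subseteq> Z" for S U
  using eq[OF that] sat_mat_mult[OF a that] by simp
 have "(2::nat) ^ loops a b = 2 ^ l" using e[of "{}" "{}"] by (simp add: sat_mat_def)
 thus l: "loops a b = l" by (simp add: power_inject_exp)
 show "spart_comp a b = c"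
 proof (rule partition_eqI_saturated[OF spartsD[OF spart_comp_in_sparts[OF a(1,2)]] spartsD[OF g]])
  fix S assume "S \<subseteq> X <+> Z"
  then obtain S1 S2 where S: "S1 \<subseteq> X" "S2 \<subseteq> Z" "S = S1 <+> S2" using Plus_decompose[of S] by metis
  show "saturated (spart_comp a b) S = saturated c S"
   using e[OF S(1,2)] l S(3) by (simp add: sat_mat_eq_iff)
 qed
qed

lemma spart_comp_assoc:
 assumes a: "a \<in> sparts X Y" "b \<in> sparts Y Z" "c \<in> sparts Z W" 
  and f: "finite X" "finite Y" "finite Z" "finite W"
 shows "spart_comp (spart_comp a b) c = spart_comp a (spart_comp b c)"
  and "loops a b + loops (spart_comp a b) c = loops b c + loops a (spart_comp b c)"
proof -
 let ?ab = "spart_comp a b" and ?bg = "spart_comp b c"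
 have ab: "?ab \<in> sparts X Z" and bg: "?bg \<in> sparts Y W" using a spart_comp_in_sparts by blast+
 have e: "2 ^ (loops a b + loops ?ab c) * sat_mat (spart_comp ?ab c) S V
   = 2 ^ (loops b c + loops a ?bg) * sat_mat (spart_comp a ?bg) S V" if SV: "S \<subseteq> X" "V \<subseteq> W" for S V
 proof -
  have "2 ^ (loops a b + loops ?ab c) * sat_mat (spart_comp ?ab c) S V
   = 2 ^ loops a b * (\<Sum>U\<in>Pow Z. sat_mat ?ab S U * sat_mat c U V)"
   using sat_mat_mult[OF ab a(3) f(1,3,4) SV] by (simp add: power_add)
  also have "... = (\<Sum>U\<in>Pow Z. (\<Sum>T\<in>Pow Y. sat_mat a S T * sat_mat b T U) * sat_mat c U V)"
   unfolding sum_distrib_left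
   by (intro sum.cong refl) (use sat_mat_mult[OF a(1,2) f(1,2,3) SV(1)] in simp)
  also have "... = (\<Sum>T\<in>Pow Y. sat_mat a S T * (\<Sum>U\<in>Pow Z. sat_mat b T U * sat_mat c U V))"
   unfolding sum_distrib_left sum_distrib_right by (subst sum.swap) (simp add: mult_ac)
  also have "... = (\<Sum>T\<in>Pow Y. sat_mat a S T * (2 ^ loops b c * sat_mat ?bg T V))"
   by (intro sum.cong refl) (use sat_mat_mult[OF a(2,3) f(2,3,4) _ SV(2)] in simp)
  also have "... = 2 ^ loops b c * (\<Sum>T\<in>Pow Y. sat_mat a S T * sat_mat ?bg T V)"
   by (simp add: sum_distrib_left mult_ac)
  finally show ?thesis using sat_mat_mult[OF a(1) bg f(1,2,4) SV] by (simp add: power_add)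
 qed
 have "(2::nat) ^ (loops a b + loops ?ab c) = 2 ^ (loops b c + loops a ?bg)"
  using e[of "{}" "{}"] by (simp add: sat_mat_def)
 thus l: "loops a b + loops ?ab c = loops b c + loops a ?bg" by (simp add: power_inject_exp)
 show "spart_comp ?ab c = spart_comp a ?bg"
 proof (rule partition_eqI_saturated[of "X <+> W"])
  fix S assume "S \<subseteq> X <+> W"
  then obtain S1 S2 where S: "S1 \<subseteq> X" "S2 \<subseteq> W" "S = S1 <+> S2" using Plus_decompose[of S] by metis
  show "saturated (spart_comp ?ab c) S = saturated (spart_comp a ?bg) S"
   using e[OF S(1,2)] l S(3) by (simp add: sat_mat_eq_iff)
 qed (use ab bg a spart_comp_in_sparts spartsD in blast)+
qed

section \<open>The linear category of partitions\<close>

lemma sum_collapse: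
 fixes F :: "'e => 'k::field"
 assumes "finite S" "\<And>a b. a \<in> A ==> b \<in> B ==> k a b \<in> S"
 shows "(\<Sum>e\<in>S. F e * (\<Sum>a\<in>A. \<Sum>b\<in>B. if k a b = e then u a b else 0)) = (\<Sum>a\<in>A. \<Sum>b\<in>B. F (k a b) * u a b)"
proof -
 have "(\<Sum>e\<in>S. F e * (\<Sum>a\<in>A. \<Sum>b\<in>B. if k a b = e then u a b else 0))
  = (\<Sum>e\<in>S. \<Sum>a\<in>A. \<Sum>b\<in>B. if k a b = e then F e * u a b else 0)"
  unfolding sum_distrib_left by (intro sum.cong refl) simp
 also have "... = (\<Sum>a\<in>A. \<Sum>e\<in>S. \<Sum>b\<in>B. if k a b = e then F e * u a b else 0)" by (rule sum.swap)
 also have "... = (\<Sum>a\<in>A. \<Sum>b\<in>B. \<Sum>e\<in>S. if k a b = e then F e * u a b else 0)"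
  by (rule sum.cong[OF refl]) (rule sum.swap)
 also have "... = (\<Sum>a\<in>A. \<Sum>b\<in>B. F (k a b) * u a b)"
 proof (intro sum.cong refl)
  fix a b assume "a \<in> A" "b \<in> B"
  thus "(\<Sum>e\<in>S. if k a b = e then F e * u a b else 0) = F (k a b) * u a b"
   using assms by (simp add: sum.delta')
 qed
 finally show ?thesis .
qed

lemma hom0_eqI: "f \<in> hom0 X Y ==> g \<in> hom0 X Y ==> (\<And>a. a \<in> sparts X Y ==> f a = g a) ==> f = g"
 unfolding hom0_def by (rule ext) (metis (mono_tags, lifting) mem_Collect_eq)

lemma comp0_in [simp]: "comp0 t X Y Z g f \<in> hom0 X Z"
 unfolding hom0_def comp0_def using spart_comp_in_sparts by (auto intro!: sum.neutral)

lemma basis0_in: "a \<in> sparts X Y ==> basis0 a \<in> hom0 X Y"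
 by (auto simp: hom0_def basis0_def)

lemma comp0_assoc:
 assumes f: "finite X" "finite Y" "finite Z" "finite W"
 shows "comp0 t X Z W h (comp0 t X Y Z g f) = comp0 t X Y W (comp0 t Y Z W h g) f"
proof
 fix d
 let ?c = spart_comp
 have "comp0 t X Z W h (comp0 t X Y Z g f) d
  = (\<Sum>e\<in>sparts X Z. (\<Sum>c\<in>sparts Z W. if ?c e c = d then h c * t ^ loops e c else 0) *
    (\<Sum>a\<in>sparts X Y. \<Sum>b\<in>sparts Y Z. if ?c a b = e then g b * f a * t ^ loops a b else 0))"
  unfolding comp0_def[of t X Z W] sum_distrib_right
  by (intro sum.cong refl) (auto simp: comp0_def)
 also have "... = (\<Sum>a\<in>sparts X Y. \<Sum>b\<in>sparts Y Z.
   (\<Sum>c\<in>sparts Z W. if ?c (?c a b) c = d then h c * t ^ loops (?c a b) c else 0) * (g b * f a * t ^ loops a b))"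
  by (rule sum_collapse) (auto simp: finite_sparts f intro: spart_comp_in_sparts)
 also have "... = (\<Sum>a\<in>sparts X Y. \<Sum>b\<in>sparts Y Z. \<Sum>c\<in>sparts Z W.
   (if ?c a (?c b c) = d then f a * t ^ loops a (?c b c) else 0) * (h c * g b * t ^ loops b c))"
  unfolding sum_distrib_right
 proof (intro sum.cong refl)
  fix a b c assume a: "a \<in> sparts X Y" "b \<in> sparts Y Z" "c \<in> sparts Z W"
  have l: "t ^ loops (?c a b) c * t ^ loops a b = t ^ loops a (?c b c) * t ^ loops b c"
   using spart_comp_assoc(2)[OF a f] unfolding power_add[symmetric] by (simp add: add.commute)
  have "h c * t ^ loops (?c a b) c * (g b * f a * t ^ loops a b) = h c * g b * f a * (t ^ loops (?c a b) c * t ^ loops a b)"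
   by (simp add: mult_ac)
  also have "... = f a * t ^ loops a (?c b c) * (h c * g b * t ^ loops b c)" unfolding l by (simp add: mult_ac)
  finally have e: "h c * t ^ loops (?c a b) c * (g b * f a * t ^ loops a b) = f a * t ^ loops a (?c b c) * (h c * g b * t ^ loops b c)" .
  show "(if ?c (?c a b) c = d then h c * t ^ loops (?c a b) c else 0) * (g b * f a * t ^ loops a b)
    = (if ?c a (?c b c) = d then f a * t ^ loops a (?c b c) else 0) * (h c * g b * t ^ loops b c)"
   unfolding spart_comp_assoc(1)[OF a f]
   by (cases "?c a (?c b c) = d") (simp_all only: if_True if_False mult_zero_left e simp_thms)
 qed
 also have "... = (\<Sum>a\<in>sparts X Y. \<Sum>e\<in>sparts Y W. (if ?c a e = d then f a * t ^ loops a e else 0) *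
   (\<Sum>b\<in>sparts Y Z. \<Sum>c\<in>sparts Z W. if ?c b c = e then h c * g b * t ^ loops b c else 0))"
  by (intro sum.cong refl sum_collapse[symmetric]) (auto simp: finite_sparts f intro: spart_comp_in_sparts)
 also have "... = comp0 t X Y W (comp0 t Y Z W h g) f d"
  unfolding comp0_def[of t X Y W] by (intro sum.cong refl) (auto simp: comp0_def)
 finally show "comp0 t X Z W h (comp0 t X Y Z g f) d = comp0 t X Y W (comp0 t Y Z W h g) f d" .
qed

lemma if_add_zero: "(if P then x + y else 0) = (if P then x else 0) + (if P then y else (0::'k::field))" by simp
lemma if_diff_zero: "(if P then x - y else 0) = (if P then x else 0) - (if P then y else (0::'k::field))" by simp

lemma comp0_add_right: "comp0 t X Y Z g (f + f') = comp0 t X Y Z g f + comp0 t X Y Z g f'"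
 by (rule ext) (simp add: comp0_def distrib_left distrib_right if_add_zero sum.distrib cong: if_cong)
lemma comp0_diff_right: "comp0 t X Y Z g (f - f') = comp0 t X Y Z g f - comp0 t X Y Z g f'"
 by (rule ext) (simp add: comp0_def left_diff_distrib right_diff_distrib if_diff_zero sum_subtractf cong: if_cong)
lemma comp0_add_left: "comp0 t X Y Z (g + g') f = comp0 t X Y Z g f + comp0 t X Y Z g' f"
 by (rule ext) (simp add: comp0_def distrib_left distrib_right if_add_zero sum.distrib cong: if_cong)
lemma comp0_diff_left: "comp0 t X Y Z (g - g') f = comp0 t X Y Z g f - comp0 t X Y Z g' f"
 by (rule ext) (simp add: comp0_def left_diff_distrib right_diff_distrib if_diff_zero sum_subtractf cong: if_cong)
lemma comp0_0_right [simp]: "comp0 t X Y Z g 0 = 0"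
 by (rule ext) (simp add: comp0_def zero_fun_def cong: if_cong)
lemma comp0_0_left [simp]: "comp0 t X Y Z 0 f = 0"
 by (rule ext) (simp add: comp0_def zero_fun_def cong: if_cong)

lemma comp0_basis_right:
 assumes a: "a \<in> sparts X Y" and f: "finite X" "finite Y"
 shows "comp0 t X Y Z g (basis0 a) d = (\<Sum>b\<in>sparts Y Z. if spart_comp a b = d then g b * t ^ loops a b else 0)"
proof -
 have "comp0 t X Y Z g (basis0 a) d = (\<Sum>a'\<in>sparts X Y. if a' = a then
   (\<Sum>b\<in>sparts Y Z. if spart_comp a b = d then g b * t ^ loops a b else 0) else 0)"
  unfolding comp0_def
 proof (rule sum.cong[OF refl])
  fix a'
  show "(\<Sum>b\<in>sparts Y Z. if spart_comp a' b = d then g b * basis0 a a' * t ^ loops a' b else 0)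
   = (if a' = a then (\<Sum>b\<in>sparts Y Z. if spart_comp a b = d then g b * t ^ loops a b else 0) else 0)"
   by (cases "a' = a") (simp_all add: basis0_def cong: if_cong)
 qed
 thus ?thesis using a finite_sparts[OF f] by simp
qed

lemma comp0_basis_left:
 assumes b: "b \<in> sparts Y Z" and f: "finite Y" "finite Z"
 shows "comp0 t X Y Z (basis0 b) h d = (\<Sum>a\<in>sparts X Y. if spart_comp a b = d then h a * t ^ loops a b else 0)"
 unfolding comp0_def
proof (rule sum.cong[OF refl])
 fix a
 have "(\<Sum>b'\<in>sparts Y Z. if spart_comp a b' = d then basis0 b b' * h a * t ^ loops a b' else 0)
  = (\<Sum>b'\<in>sparts Y Z. if b' = b then (if spart_comp a b = d then h a * t ^ loops a b else 0) else 0)"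
  by (rule sum.cong) (auto simp: basis0_def)
 thus "(\<Sum>b'\<in>sparts Y Z. if spart_comp a b' = d then basis0 b b' * h a * t ^ loops a b' else 0)
  = (if spart_comp a b = d then h a * t ^ loops a b else 0)" using b finite_sparts[OF f] by simp
qed

lemma comp0_basis_basis:
 assumes a: "a \<in> sparts X Y" and b: "b \<in> sparts Y Z" and f: "finite X" "finite Y" "finite Z"
 shows "comp0 t X Y Z (basis0 b) (basis0 a) d = t ^ loops a b * basis0 (spart_comp a b) d"
proof -
 have "comp0 t X Y Z (basis0 b) (basis0 a) d = (\<Sum>b'\<in>sparts Y Z. if b' = b then t ^ loops a b * basis0 (spart_comp a b) d else 0)"
  unfolding comp0_basis_right[OF a f(1,2)] by (rule sum.cong) (auto simp: basis0_def)
 thus ?thesis using b finite_sparts[OF f(2,3)] by simp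
qed

definition ppart :: "nat set => (nat => nat) => spart" where
 "ppart X s = (%x. {Inl x, Inr (s x)}) ` X"

lemma ppart_sparts: "bij_betw s X Y ==> ppart X s \<in> sparts X Y"
 unfolding sparts_def ppart_def partition_on_def disjoint_def bij_betw_def by (auto dest: inj_onD)

lemma sat_mat_ppart:
 assumes s: "bij_betw s X Y" and "S \<subseteq> X" "T \<subseteq> Y"
 shows "sat_mat (ppart X s) S T = of_bool (T = s ` S)"
proof -
 have inj: "s x = s y \<longleftrightarrow> x = y" if "x \<in> X" "y \<in> X" for x y using s that by (auto simp: bij_betw_def inj_on_def)
 have "saturated (ppart X s) (S <+> T) \<longleftrightarrow> (\<forall>x\<in>X. x \<in> S \<longleftrightarrow> s x \<in> T)"
  unfolding saturated_iff ppart_def by auto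
 also have "... \<longleftrightarrow> T = s ` S"
 proof
  assume L: "\<forall>x\<in>X. x \<in> S \<longleftrightarrow> s x \<in> T"
  show "T = s ` S"
  proof (intro equalityI subsetI)
   fix y assume y: "y \<in> T"
   then obtain x where "x \<in> X" "y = s x" using assms(3) s by (auto simp: bij_betw_def)
   thus "y \<in> s ` S" using L y by blast
  qed (use L assms(2) in blast)
 next
  assume "T = s ` S"
  thus "\<forall>x\<in>X. x \<in> S \<longleftrightarrow> s x \<in> T" using inj assms(2) by auto
 qed
 finally show ?thesis by (simp add: sat_mat_def)
qed

lemma sat_mat_id:
 assumes "S \<subseteq> X" "T \<subseteq> X"
 shows "sat_mat (ppart X (%x. x)) S T = of_bool (T = S)"
 using sat_mat_ppart[of "%x. x" X X S T] assms by (simp add: bij_betw_def)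

lemma id0_ppart: "id0 X = basis0 (ppart X (%x. x))" by (simp add: id0_def ppart_def)

lemma spart_comp_ppart_left:
 assumes s: "bij_betw s X Y" and b: "b \<in> sparts Y Z" and f: "finite X" "finite Y" "finite Z"
  and g: "c \<in> sparts X Z" and eq: "\<And>S U. S \<subseteq> X ==> U \<subseteq> Z ==> sat_mat c S U = sat_mat b (s ` S) U"
 shows "spart_comp (ppart X s) b = c" "loops (ppart X s) b = 0"
proof -
 have "(\<Sum>T\<in>Pow Y. sat_mat (ppart X s) S T * sat_mat b T U) = 2 ^ 0 * sat_mat c S U" if SU: "S \<subseteq> X" "U \<subseteq> Z" for S U
 proof -
  have sS: "s ` S \<in> Pow Y" using SU s by (auto simp: bij_betw_def)
  have "(\<Sum>T\<in>Pow Y. sat_mat (ppart X s) S T * sat_mat b T U) = (\<Sum>T\<in>Pow Y. if T = s ` S then sat_mat b (s ` S) U else 0)"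
   using SU by (intro sum.cong refl) (simp add: sat_mat_ppart[OF s])
  thus ?thesis using sS f by (simp add: eq[OF SU])
 qed
 from spart_comp_unique[OF ppart_sparts[OF s] b f g this]
 show "spart_comp (ppart X s) b = c" "loops (ppart X s) b = 0" by blast+
qed

lemma spart_comp_id_left:
 assumes b: "b \<in> sparts X Z" and f: "finite X" "finite Z"
 shows "spart_comp (ppart X (%x. x)) b = b" "loops (ppart X (%x. x)) b = 0"
 using spart_comp_ppart_left[OF _ b f(1) f b, of "%x. x"] by (simp_all add: bij_betw_def)

lemma spart_comp_id_right:
 assumes a: "a \<in> sparts X Z" and f: "finite X" "finite Z"
 shows "spart_comp a (ppart Z (%x. x)) = a" "loops a (ppart Z (%x. x)) = 0"
proof -
 have bij: "bij_betw (%x. x) Z Z" by (simp add: bij_betw_def)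
 have "(\<Sum>T\<in>Pow Z. sat_mat a S T * sat_mat (ppart Z (%x. x)) T U) = 2 ^ 0 * sat_mat a S U" if SU: "S \<subseteq> X" "U \<subseteq> Z" for S U
 proof -
  have "(\<Sum>T\<in>Pow Z. sat_mat a S T * sat_mat (ppart Z (%x. x)) T U) = (\<Sum>T\<in>Pow Z. if T = U then sat_mat a S U else 0)"
   using SU by (intro sum.cong refl) (auto simp: sat_mat_id)
  thus ?thesis using SU f by simp
 qed
 from spart_comp_unique[OF a ppart_sparts[OF bij] f(1) f(2) f(2) a this]
 show "spart_comp a (ppart Z (%x. x)) = a" "loops a (ppart Z (%x. x)) = 0" by blast+
qed

lemma ppart_id_sparts: "ppart X (%x. x) \<in> sparts X X" by (rule ppart_sparts) (simp add: bij_betw_def)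

lemma comp0_id_right [simp]: "f \<in> hom0 X Y ==> finite X ==> finite Y ==> comp0 t X X Y f (id0 X) = f"
proof (rule hom0_eqI[of _ X Y])
 fix a assume f: "f \<in> hom0 X Y" "finite X" "finite Y" and a: "a \<in> sparts X Y"
 have "comp0 t X X Y f (id0 X) a = (\<Sum>b\<in>sparts X Y. if b = a then f a else 0)"
  unfolding id0_ppart comp0_basis_right[OF ppart_id_sparts f(2,2)]
  by (rule sum.cong) (auto simp: spart_comp_id_left[OF _ f(2,3)])
 thus "comp0 t X X Y f (id0 X) a = f a" using a finite_sparts[OF f(2,3)] by simp
qed simp_all

lemma comp0_id_left [simp]: "f \<in> hom0 X Y ==> finite X ==> finite Y ==> comp0 t X Y Y (id0 Y) f = f"
proof (rule hom0_eqI[of _ X Y])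
 fix a assume f: "f \<in> hom0 X Y" "finite X" "finite Y" and a: "a \<in> sparts X Y"
 have "comp0 t X Y Y (id0 Y) f a = (\<Sum>b\<in>sparts X Y. if b = a then f a else 0)"
  unfolding id0_ppart comp0_basis_left[OF ppart_id_sparts f(3,3)]
  by (rule sum.cong) (auto simp: spart_comp_id_right[OF _ f(2,3)])
 thus "comp0 t X Y Y (id0 Y) f a = f a" using a finite_sparts[OF f(2,3)] by simp
qed simp_all

section \<open>Merging and cutting\<close>

text \<open>
The elementary maps through smaller sets: \<open>merge\<close> ties two strands of the identity together and \<open>cut\<close> interrupts one.
\<close>
definition merge :: "nat set => nat => nat => spart" where
 "merge X x y = insert {Inl x, Inr x, Inl y, Inr y} ((%z. {Inl z, Inr z}) ` (X - {x, y}))"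

definition cut :: "nat set => nat => spart" where
 "cut X x = insert {Inl x} (insert {Inr x} ((%z. {Inl z, Inr z}) ` (X - {x})))"

lemma merge_sparts: "x \<in> X ==> y \<in> X ==> merge X x y \<in> sparts X X"
 unfolding sparts_def merge_def partition_on_def disjoint_def by auto

lemma cut_sparts: "x \<in> X ==> cut X x \<in> sparts X X"
 unfolding sparts_def cut_def partition_on_def disjoint_def by auto

lemma saturated_insert: "saturated (insert B P) S \<longleftrightarrow> (B \<subseteq> S \<or> B \<inter> S = {}) \<and> saturated P S"
 by (simp add: saturated_def)

lemma saturated_pairs: "saturated ((%z. {Inl z, Inr (s z)}) ` A) (S <+> T) \<longleftrightarrow> (\<forall>z\<in>A. z \<in> S \<longleftrightarrow> s z \<in> T)"
 unfolding saturated_def by auto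

lemma saturated_merge:
 assumes "x \<in> X" "y \<in> X" "S \<subseteq> X" "T \<subseteq> X"
 shows "saturated (merge X x y) (S <+> T) \<longleftrightarrow> T = S \<and> (x \<in> S \<longleftrightarrow> y \<in> S)"
proof -
 have "saturated (merge X x y) (S <+> T) \<longleftrightarrow> (\<forall>z\<in>X - {x, y}. z \<in> S \<longleftrightarrow> z \<in> T) \<and>
   (x \<in> S \<longleftrightarrow> x \<in> T) \<and> (y \<in> S \<longleftrightarrow> y \<in> T) \<and> (x \<in> S \<longleftrightarrow> y \<in> S)"
  unfolding merge_def saturated_insert saturated_pairs by simp blast
 also have "... \<longleftrightarrow> T = S \<and> (x \<in> S \<longleftrightarrow> y \<in> S)" using assms by blast
 finally show ?thesis .
qed

lemma saturated_cut:
 assumes "x \<in> X" "S \<subseteq> X" "T \<subseteq> X"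
 shows "saturated (cut X x) (S <+> T) \<longleftrightarrow> T - {x} = S - {x}"
proof -
 have "saturated (cut X x) (S <+> T) \<longleftrightarrow> (\<forall>z\<in>X - {x}. z \<in> S \<longleftrightarrow> z \<in> T)"
  unfolding cut_def saturated_insert saturated_pairs by simp
 also have "... \<longleftrightarrow> T - {x} = S - {x}" using assms by blast
 finally show ?thesis .
qed

definition flip :: "spart => spart" where "flip a = (%B. case_sum Inr Inl ` B) ` a"

lemma flip_flip [simp]: "flip (flip a) = a"
proof -
 have "case_sum Inr Inl ` (case_sum Inr Inl ` B) = B" for B :: "(nat + nat) set"
 proof -
  have "case_sum Inr Inl (case_sum Inr Inl u) = u" for u :: "nat + nat" by (cases u) auto
  thus ?thesis by (simp add: image_image)
 qed
 thus ?thesis by (simp add: flip_def image_image)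
qed

lemma saturated_flip: "saturated (flip a) (S <+> T) \<longleftrightarrow> saturated a (T <+> S)"
proof -
 have m: "case_sum Inr Inl u \<in> S <+> T \<longleftrightarrow> u \<in> T <+> S" for u :: "nat + nat" by (cases u) auto
 show ?thesis unfolding saturated_def flip_def
  by (simp add: image_subset_iff_mem[OF m] image_disjoint_iff_mem[OF m])
qed

lemma flip_sparts: "a \<in> sparts X Y ==> flip a \<in> sparts Y X"
proof -
 assume a: "a \<in> sparts X Y"
 have inj: "inj (case_sum Inr Inl :: nat + nat => nat + nat)"
 proof (rule injI)
  fix u v :: "nat + nat" assume "(case_sum Inr Inl u :: nat + nat) = case_sum Inr Inl v"
  thus "u = v" by (cases u; cases v) auto
 qed
 have "partition_on (case_sum Inr Inl ` (X <+> Y)) ((`) (case_sum Inr Inl) ` a - {{}})"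
  by (rule partition_on_inj_image[OF spartsD[OF a] inj_on_subset[OF inj]]) simp
 moreover have "(case_sum Inr Inl ` (X <+> Y) :: (nat + nat) set) = Y <+> X"
  unfolding Plus_def image_Un image_image by auto
 moreover have "(`) (case_sum Inr Inl) ` a - {{}} = flip a"
  using partition_onD3[OF spartsD[OF a]] by (auto simp: flip_def)
 ultimately show ?thesis by (simp add: sparts_def)
qed

lemma sat_mat_flip: "sat_mat (flip a) S T = sat_mat a T S"
 by (simp add: sat_mat_def saturated_flip)

lemma flip_comp:
 assumes a: "a \<in> sparts X Y" "b \<in> sparts Y Z" and f: "finite X" "finite Y" "finite Z"
 shows "spart_comp (flip b) (flip a) = flip (spart_comp a b)" "loops (flip b) (flip a) = loops a b"
proof -
 have "(\<Sum>T\<in>Pow Y. sat_mat (flip b) S T * sat_mat (flip a) T U) = 2 ^ loops a b * sat_mat (flip (spart_comp a b)) S U"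
  if "S \<subseteq> Z" "U \<subseteq> X" for S U
  using sat_mat_mult[OF a f that(2,1)] by (simp add: sat_mat_flip mult.commute)
 from spart_comp_unique[OF flip_sparts[OF a(2)] flip_sparts[OF a(1)] f(3,2,1) flip_sparts[OF spart_comp_in_sparts[OF a]] this]
 show "spart_comp (flip b) (flip a) = flip (spart_comp a b)" "loops (flip b) (flip a) = loops a b" by blast+
qed

lemma transpose0_flip: "transpose0 f a = f (flip a)" by (simp add: transpose0_def flip_def)

lemma transpose0_in: "f \<in> hom0 X Y ==> transpose0 f \<in> hom0 Y X"
 unfolding hom0_def using flip_sparts[of "flip a" X Y for a] by (auto simp: transpose0_flip)

lemma sum_sparts_flip: "(\<Sum>a\<in>sparts X Y. F (flip a)) = (\<Sum>a\<in>sparts Y X. F a)"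
 by (rule sum.reindex_bij_witness[of _ flip flip]) (auto simp: flip_sparts)

lemma transpose0_comp:
 assumes f: "finite X" "finite Y" "finite Z"
 shows "transpose0 (comp0 t X Y Z g h) = comp0 t Z Y X (transpose0 h) (transpose0 g)"
proof
 fix d
 define F where "F a b = (if spart_comp (flip a) (flip b) = d then h b * g a * t ^ loops (flip a) (flip b) else 0)" for a b
 have "comp0 t Z Y X (transpose0 h) (transpose0 g) d = (\<Sum>a\<in>sparts Z Y. \<Sum>b\<in>sparts Y X. F (flip a) (flip b))"
  by (simp add: comp0_def transpose0_flip F_def cong: if_cong)
 also have "... = (\<Sum>a\<in>sparts Z Y. \<Sum>b\<in>sparts X Y. F (flip a) b)"
  by (rule sum.cong[OF refl]) (rule sum_sparts_flip)
 also have "... = (\<Sum>a\<in>sparts Y Z. \<Sum>b\<in>sparts X Y. F a b)" by (rule sum_sparts_flip)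
 also have "... = (\<Sum>a\<in>sparts Y Z. \<Sum>b\<in>sparts X Y. if spart_comp b a = flip d then g a * h b * t ^ loops b a else 0)"
  unfolding F_def
 proof (intro sum.cong refl)
  fix a b assume a: "a \<in> sparts Y Z" and b: "b \<in> sparts X Y"
  have "flip (spart_comp b a) = d \<longleftrightarrow> spart_comp b a = flip d" by (metis flip_flip)
  thus "(if spart_comp (flip a) (flip b) = d then h b * g a * t ^ loops (flip a) (flip b) else 0)
    = (if spart_comp b a = flip d then g a * h b * t ^ loops b a else 0)"
   by (simp add: flip_comp[OF b a f] mult.commute)
 qed
 also have "... = comp0 t X Y Z g h (flip d)" unfolding comp0_def by (rule sum.swap)
 finally show "transpose0 (comp0 t X Y Z g h) d = comp0 t Z Y X (transpose0 h) (transpose0 g) d"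
  by (simp add: transpose0_flip)
qed

section \<open>Tensor products\<close>

abbreviation eL :: "nat => nat" where "eL \<equiv> sum_encode o Inl"
abbreviation eR :: "nat => nat" where "eR \<equiv> sum_encode o Inr"

lemma eL_eq [simp]: "sum_encode (Inl x) = sum_encode (Inl y) \<longleftrightarrow> x = y"
 and eR_eq [simp]: "sum_encode (Inr x) = sum_encode (Inr y) \<longleftrightarrow> x = y"
 and eLR [simp]: "sum_encode (Inl x) \<noteq> sum_encode (Inr y)" and eRL [simp]: "sum_encode (Inr y) \<noteq> sum_encode (Inl x)"
 using sum_encode_eq[of "Inl x" "Inl y"] sum_encode_eq[of "Inr x" "Inr y"] sum_encode_eq[of "Inl x" "Inr y"] by auto

lemma inj_eL: "inj eL" and inj_eR: "inj eR" by (auto simp: inj_def)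

lemma dunion_eq: "dunion X Y = eL ` X \<union> eR ` Y"
 unfolding dunion_def Plus_def image_Un image_image by simp

lemma finite_dunion: "finite X ==> finite Y ==> finite (dunion X Y)" by (simp add: dunion_eq)

lemma vimage_parts: "eL -` (eL ` S \<union> eR ` T) = S" "eR -` (eL ` S \<union> eR ` T) = T" by auto

lemma parts_union: "S \<subseteq> dunion X Y ==> eL ` (eL -` S) \<union> eR ` (eR -` S) = S"
 unfolding dunion_eq by auto

lemma parts_sub: "S \<subseteq> dunion X Y ==> eL -` S \<subseteq> X" "S \<subseteq> dunion X Y ==> eR -` S \<subseteq> Y"
 unfolding dunion_eq by auto

lemma saturated_Un: "saturated (P \<union> Q) S \<longleftrightarrow> saturated P S \<and> saturated Q S"
 unfolding saturated_def by blast

lemma saturated_image: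
 assumes "\<And>u. f u \<in> S' \<longleftrightarrow> u \<in> S"
 shows "saturated ((%B. f ` B) ` P) S' \<longleftrightarrow> saturated P S"
 unfolding saturated_def using image_subset_iff_mem[of f S' S, OF assms] image_disjoint_iff_mem[of f S' S, OF assms]
 by simp

lemma saturated_tensor:
 "saturated (spart_tensor a b) (S <+> T) \<longleftrightarrow> saturated a (eL -` S <+> eL -` T) \<and> saturated b (eR -` S <+> eR -` T)"
proof -
 have m1: "map_sum eL eL u \<in> S <+> T \<longleftrightarrow> u \<in> eL -` S <+> eL -` T" for u by (cases u) auto
 have m2: "map_sum eR eR u \<in> S <+> T \<longleftrightarrow> u \<in> eR -` S <+> eR -` T" for u by (cases u) auto
 show ?thesis unfolding spart_tensor_def saturated_Un saturated_image[OF m1] saturated_image[OF m2] ..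
qed

lemma sat_mat_tensor: "sat_mat (spart_tensor a b) S T = sat_mat a (eL -` S) (eL -` T) * sat_mat b (eR -` S) (eR -` T)"
 by (simp add: sat_mat_def saturated_tensor of_bool_conj)

lemma spart_tensor_sparts:
 assumes a: "a \<in> sparts X X'" and b: "b \<in> sparts Y Y'"
 shows "spart_tensor a b \<in> sparts (dunion X Y) (dunion X' Y')"
proof -
 have inj: "inj (map_sum eL eL)" "inj (map_sum eR eR)"
  using inj_eL inj_eR by (auto simp: sum.inj_map)
 let ?A = "(%B. map_sum eL eL ` B) ` a" and ?B = "(%B. map_sum eR eR ` B) ` b"
 have U: "\<Union>a = X <+> X'" "\<Union>b = Y <+> Y'" using a b by (auto simp: sparts_def partition_on_def)
 have "\<Union>?A = map_sum eL eL ` (X <+> X')" "\<Union>?B = map_sum eR eR ` (Y <+> Y')"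
  unfolding U[symmetric] by auto
 hence UA: "\<Union>?A = eL ` X <+> eL ` X'" and UB: "\<Union>?B = eR ` Y <+> eR ` Y'"
  unfolding Plus_def image_Un image_image by simp_all
 have "\<Union>(?A \<union> ?B) = dunion X Y <+> dunion X' Y'"
  unfolding Union_Un_distrib UA UB dunion_eq by auto
 moreover have "disjoint (?A \<union> ?B)"
 proof (rule disjointI)
  fix B C assume BC: "B \<in> ?A \<union> ?B" "C \<in> ?A \<union> ?B" "B \<noteq> C"
  have dis: "disjoint a" "disjoint b" using a b by (auto simp: sparts_def partition_on_def)
  have AB: "\<Union>?A \<inter> \<Union>?B = {}" unfolding UA UB by auto
  consider "B \<in> ?A" "C \<in> ?A" | "B \<in> ?B" "C \<in> ?B" | "B \<in> ?A" "C \<in> ?B" | "B \<in> ?B" "C \<in> ?A" using BC by blast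
  thus "B \<inter> C = {}"
  proof cases
   case 1
   then obtain B' C' where "B' \<in> a" "C' \<in> a" "B = map_sum eL eL ` B'" "C = map_sum eL eL ` C'" by blast
   moreover have "B' \<noteq> C'" using calculation BC(3) by blast
   hence "B' \<inter> C' = {}" using dis(1) calculation(1,2) by (simp add: disjoint_def)
   ultimately show ?thesis using image_Int[OF inj(1), of B' C'] by simp
  next
   case 2
   then obtain B' C' where "B' \<in> b" "C' \<in> b" "B = map_sum eR eR ` B'" "C = map_sum eR eR ` C'" by blast
   moreover have "B' \<noteq> C'" using calculation BC(3) by blast
   hence "B' \<inter> C' = {}" using dis(2) calculation(1,2) by (simp add: disjoint_def)
   ultimately show ?thesis using image_Int[OF inj(2), of B' C'] by simp
  qed (use AB in blast)+
 qed
 moreover have "{} \<notin> ?A \<union> ?B" using a b by (auto simp: sparts_def partition_on_def)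
 ultimately show ?thesis by (simp add: sparts_def partition_on_def spart_tensor_def)
qed

lemma sum_Pow_dunion:
 "(\<Sum>T\<in>Pow (dunion X Y). F (eL -` T) (eR -` T)) = (\<Sum>T\<in>Pow X. \<Sum>U\<in>Pow Y. F T U)"
proof -
 have "(\<Sum>T\<in>Pow X. \<Sum>U\<in>Pow Y. F T U) = (\<Sum>(T, U)\<in>Pow X \<times> Pow Y. F T U)" by (simp add: sum.cartesian_product)
 also have "... = (\<Sum>T\<in>Pow (dunion X Y). F (eL -` T) (eR -` T))"
 proof (rule sum.reindex_bij_witness[of _ "%T. (eL -` T, eR -` T)" "%(T, U). eL ` T \<union> eR ` U"])
  fix p assume p: "p \<in> Pow X \<times> Pow Y"
  obtain T U where TU: "p = (T, U)" by (cases p)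
  show "(eL -` (case p of (T, U) => eL ` T \<union> eR ` U), eR -` (case p of (T, U) => eL ` T \<union> eR ` U)) = p"
   unfolding TU by (simp only: case_prod_conv vimage_parts)
  show "(case p of (T, U) => eL ` T \<union> eR ` U) \<in> Pow (dunion X Y)"
   using p unfolding TU dunion_eq by auto
  show "F (eL -` (case p of (T, U) => eL ` T \<union> eR ` U)) (eR -` (case p of (T, U) => eL ` T \<union> eR ` U)) = (case p of (T, U) => F T U)"
   unfolding TU by (simp only: case_prod_conv vimage_parts)
 next
  fix T assume T: "T \<in> Pow (dunion X Y)"
  show "(case (eL -` T, eR -` T) of (T, U) => eL ` T \<union> eR ` U) = T"
   using T parts_union[of T X Y] by (simp only: case_prod_conv Pow_iff)
  show "(eL -` T, eR -` T) \<in> Pow X \<times> Pow Y" using parts_sub[of T X Y] T by blast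
 qed
 finally show ?thesis by simp
qed

lemma spart_comp_tensor:
 assumes a: "a \<in> sparts X X'" "c \<in> sparts X' X''" and b: "b \<in> sparts Y Y'" "e \<in> sparts Y' Y''"
  and f: "finite X" "finite X'" "finite X''" "finite Y" "finite Y'" "finite Y''"
 shows "spart_comp (spart_tensor a b) (spart_tensor c e) = spart_tensor (spart_comp a c) (spart_comp b e)"
  and "loops (spart_tensor a b) (spart_tensor c e) = loops a c + loops b e"
proof -
 have e: "(\<Sum>T\<in>Pow (dunion X' Y'). sat_mat (spart_tensor a b) S T * sat_mat (spart_tensor c e) T U)
   = 2 ^ (loops a c + loops b e) * sat_mat (spart_tensor (spart_comp a c) (spart_comp b e)) S U"
  if SU: "S \<subseteq> dunion X Y" "U \<subseteq> dunion X'' Y''" for S U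
 proof -
  have "(\<Sum>T\<in>Pow (dunion X' Y'). sat_mat (spart_tensor a b) S T * sat_mat (spart_tensor c e) T U)
   = (\<Sum>T\<in>Pow X'. \<Sum>T'\<in>Pow Y'. (sat_mat a (eL -` S) T * sat_mat c T (eL -` U)) * (sat_mat b (eR -` S) T' * sat_mat e T' (eR -` U)))"
   unfolding sat_mat_tensor by (subst sum_Pow_dunion[symmetric]) (simp add: mult_ac)
  also have "... = (\<Sum>T\<in>Pow X'. sat_mat a (eL -` S) T * sat_mat c T (eL -` U)) * (\<Sum>T'\<in>Pow Y'. sat_mat b (eR -` S) T' * sat_mat e T' (eR -` U))"
   by (rule sum_product[symmetric])
  also have "... = (2 ^ loops a c * sat_mat (spart_comp a c) (eL -` S) (eL -` U)) * (2 ^ loops b e * sat_mat (spart_comp b e) (eR -` S) (eR -` U))"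
   using sat_mat_mult[OF a f(1-3) parts_sub(1)[OF SU(1)] parts_sub(1)[OF SU(2)]]
    sat_mat_mult[OF b f(4-6) parts_sub(2)[OF SU(1)] parts_sub(2)[OF SU(2)]] by simp
  finally show ?thesis by (simp add: sat_mat_tensor power_add mult_ac)
 qed
 from spart_comp_unique[OF spart_tensor_sparts[OF a(1) b(1)] spart_tensor_sparts[OF a(2) b(2)] finite_dunion[OF f(1,4)] finite_dunion[OF f(2,5)] finite_dunion[OF f(3,6)]
   spart_tensor_sparts[OF spart_comp_in_sparts[OF a] spart_comp_in_sparts[OF b]] e]
 show "spart_comp (spart_tensor a b) (spart_tensor c e) = spart_tensor (spart_comp a c) (spart_comp b e)"
  and "loops (spart_tensor a b) (spart_tensor c e) = loops a c + loops b e" by blast+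
qed

lemma spart_tensor_inj:
 assumes a: "a \<in> sparts X X'" "a' \<in> sparts X X'" and b: "b \<in> sparts Y Y'" "b' \<in> sparts Y Y'"
  and eq: "spart_tensor a b = spart_tensor a' b'"
 shows "a = a' \<and> b = b'"
proof
 show "a = a'"
 proof (rule partition_eqI_saturated[OF spartsD[OF a(1)] spartsD[OF a(2)]])
  fix S assume "S \<subseteq> X <+> X'"
  then obtain S1 S2 where S: "S = S1 <+> S2" using Plus_decompose[of S] by metis
  have v: "eL -` (eL ` A) = A" "eR -` (eL ` A) = {}" for A by auto
  show "saturated a S \<longleftrightarrow> saturated a' S"
   using saturated_tensor[of a b "eL ` S1" "eL ` S2"] saturated_tensor[of a' b' "eL ` S1" "eL ` S2"] eq
   by (simp only: v S Plus_empty saturated_empty simp_thms)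
 qed
 show "b = b'"
 proof (rule partition_eqI_saturated[OF spartsD[OF b(1)] spartsD[OF b(2)]])
  fix S assume "S \<subseteq> Y <+> Y'"
  then obtain S1 S2 where S: "S = S1 <+> S2" using Plus_decompose[of S] by metis
  have v: "eR -` (eR ` A) = A" "eL -` (eR ` A) = {}" for A by auto
  show "saturated b S \<longleftrightarrow> saturated b' S"
   using saturated_tensor[of a b "eR ` S1" "eR ` S2"] saturated_tensor[of a' b' "eR ` S1" "eR ` S2"] eq
   by (simp only: v S Plus_empty saturated_empty simp_thms)
 qed
qed

lemma tensor0_in [simp]: "tensor0 X X' Y Y' f g \<in> hom0 (dunion X Y) (dunion X' Y')"
 unfolding hom0_def tensor0_def using spart_tensor_sparts by (auto intro!: sum.neutral)

lemma tensor0_apply: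
 assumes a: "a \<in> sparts X X'" and b: "b \<in> sparts Y Y'" and f: "finite X" "finite X'" "finite Y" "finite Y'"
 shows "tensor0 X X' Y Y' h g (spart_tensor a b) = h a * g b"
proof -
 have "tensor0 X X' Y Y' h g (spart_tensor a b) = (\<Sum>a'\<in>sparts X X'. \<Sum>b'\<in>sparts Y Y'. if b' = b then (if a' = a then h a * g b else 0) else 0)"
  unfolding tensor0_def
 proof (intro sum.cong refl)
  fix a' b' assume "a' \<in> sparts X X'" "b' \<in> sparts Y Y'"
  hence "spart_tensor a' b' = spart_tensor a b \<longleftrightarrow> a' = a \<and> b' = b" using spart_tensor_inj a b by blast
  thus "(if spart_tensor a' b' = spart_tensor a b then h a' * g b' else 0) = (if b' = b then (if a' = a then h a * g b else 0) else 0)" by auto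
 qed
 thus ?thesis using a b finite_sparts[OF f(1,2)] finite_sparts[OF f(3,4)] by simp
qed

lemma tensor0_nonzero:
 assumes "tensor0 X X' Y Y' h g \<pi> \<noteq> 0" and f: "finite X" "finite X'" "finite Y" "finite Y'"
 shows "\<exists>a\<in>sparts X X'. \<exists>b\<in>sparts Y Y'. \<pi> = spart_tensor a b \<and> h a \<noteq> 0 \<and> g b \<noteq> 0"
proof -
 obtain a where a: "a \<in> sparts X X'" "(\<Sum>b\<in>sparts Y Y'. if spart_tensor a b = \<pi> then h a * g b else 0) \<noteq> 0"
  by (rule sum.not_neutral_contains_not_neutral[OF assms(1)[unfolded tensor0_def]])
 obtain b where "b \<in> sparts Y Y'" "(if spart_tensor a b = \<pi> then h a * g b else 0) \<noteq> 0"
  by (rule sum.not_neutral_contains_not_neutral[OF a(2)])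
 thus ?thesis using a by (intro bexI[of _ a] bexI[of _ b]) (auto split: if_splits)
qed

lemma tensor0_0_left [simp]: "tensor0 X X' Y Y' 0 g = 0"
 by (rule ext) (simp add: tensor0_def zero_fun_def cong: if_cong)
lemma tensor0_0_right [simp]: "tensor0 X X' Y Y' f 0 = 0"
 by (rule ext) (simp add: tensor0_def zero_fun_def cong: if_cong)

lemma tensor0_basis:
 assumes a: "a \<in> sparts X X'" and b: "b \<in> sparts Y Y'" and f: "finite X" "finite X'" "finite Y" "finite Y'"
 shows "tensor0 X X' Y Y' (basis0 a) (basis0 b) = (basis0 (spart_tensor a b) :: 'k::field mor0)"
proof
 fix \<pi>
 show "tensor0 X X' Y Y' (basis0 a) (basis0 b) \<pi> = (basis0 (spart_tensor a b) \<pi> :: 'k)"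
 proof (cases "\<pi> = spart_tensor a b")
  case True thus ?thesis by (simp add: tensor0_apply[OF a b f] basis0_def)
 next
  case False
  have "tensor0 X X' Y Y' (basis0 a) (basis0 b) \<pi> = (0::'k)"
  proof (rule ccontr)
   assume "tensor0 X X' Y Y' (basis0 a) (basis0 b) \<pi> \<noteq> (0::'k)"
   from tensor0_nonzero[OF this f] show False using False by (auto simp: basis0_def split: if_splits)
  qed
  thus ?thesis using False by (simp add: basis0_def)
 qed
qed

text \<open>
The matrices of \<open>sat_mat\<close> turn disjoint unions of partitions into products, so that composition and tensor product commute, with loops added.
\<close>
lemma interchange:
 fixes h :: "'k::field mor0"
 assumes f: "finite X" "finite X'" "finite X''" "finite Y" "finite Y'" "finite Y''"
 shows "comp0 t (dunion X Y) (dunion X' Y') (dunion X'' Y'') (tensor0 X' X'' Y' Y'' h g) (tensor0 X X' Y Y' h' g')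
  = tensor0 X X'' Y Y'' (comp0 t X X' X'' h h') (comp0 t Y Y' Y'' g g')"
proof
 fix d
 let ?c = spart_comp and ?t = spart_tensor
 let ?P = "sparts (dunion X Y) (dunion X' Y')" and ?Q = "sparts (dunion X' Y') (dunion X'' Y'')"
 have finP: "finite ?P" "finite ?Q" using f by (auto intro!: finite_sparts finite_dunion)
 have "comp0 t (dunion X Y) (dunion X' Y') (dunion X'' Y'') (tensor0 X' X'' Y' Y'' h g) (tensor0 X X' Y Y' h' g') d
  = (\<Sum>\<pi>\<in>?P. (\<Sum>\<rho>\<in>?Q. (if ?c \<pi> \<rho> = d then t ^ loops \<pi> \<rho> else 0) *
     (\<Sum>c\<in>sparts X' X''. \<Sum>e\<in>sparts Y' Y''. if ?t c e = \<rho> then h c * g e else 0)) *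
    (\<Sum>a\<in>sparts X X'. \<Sum>b\<in>sparts Y Y'. if ?t a b = \<pi> then h' a * g' b else 0))"
  unfolding comp0_def[of t "dunion X Y"] sum_distrib_right
  by (intro sum.cong refl) (simp add: tensor0_def mult_ac)
 also have "... = (\<Sum>\<pi>\<in>?P. (\<Sum>c\<in>sparts X' X''. \<Sum>e\<in>sparts Y' Y''. (if ?c \<pi> (?t c e) = d then t ^ loops \<pi> (?t c e) else 0) * (h c * g e)) *
    (\<Sum>a\<in>sparts X X'. \<Sum>b\<in>sparts Y Y'. if ?t a b = \<pi> then h' a * g' b else 0))"
  by (subst sum_collapse[OF finP(2)]) (auto intro: spart_tensor_sparts)
 also have "... = (\<Sum>a\<in>sparts X X'. \<Sum>b\<in>sparts Y Y'.
   (\<Sum>c\<in>sparts X' X''. \<Sum>e\<in>sparts Y' Y''. (if ?c (?t a b) (?t c e) = d then t ^ loops (?t a b) (?t c e) else 0) * (h c * g e)) * (h' a * g' b))"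
  by (rule sum_collapse[OF finP(1)]) (auto intro: spart_tensor_sparts)
 also have "... = (\<Sum>a\<in>sparts X X'. \<Sum>b\<in>sparts Y Y'. \<Sum>c\<in>sparts X' X''. \<Sum>e\<in>sparts Y' Y''.
   (if ?t (?c a c) (?c b e) = d then 1 else 0) * (g e * g' b * t ^ loops b e) * (h c * h' a * t ^ loops a c))"
  unfolding sum_distrib_right
  by (intro sum.cong refl) (simp add: spart_comp_tensor[OF _ _ _ _ f] power_add mult_ac)
 also have "... = (\<Sum>a\<in>sparts X X'. \<Sum>c\<in>sparts X' X''. \<Sum>b\<in>sparts Y Y'. \<Sum>e\<in>sparts Y' Y''.
   (if ?t (?c a c) (?c b e) = d then 1 else 0) * (g e * g' b * t ^ loops b e) * (h c * h' a * t ^ loops a c))"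
  by (rule sum.cong[OF refl]) (rule sum.swap)
 also have "... = (\<Sum>a\<in>sparts X X'. \<Sum>c\<in>sparts X' X''.
   (\<Sum>b\<in>sparts Y Y'. \<Sum>e\<in>sparts Y' Y''. (if ?t (?c a c) (?c b e) = d then 1 else 0) * (g e * g' b * t ^ loops b e)) * (h c * h' a * t ^ loops a c))"
  unfolding sum_distrib_right ..
 also have "... = (\<Sum>\<mu>\<in>sparts X X''.
   (\<Sum>b\<in>sparts Y Y'. \<Sum>e\<in>sparts Y' Y''. (if ?t \<mu> (?c b e) = d then 1 else 0) * (g e * g' b * t ^ loops b e)) *
   (\<Sum>a\<in>sparts X X'. \<Sum>c\<in>sparts X' X''. if ?c a c = \<mu> then h c * h' a * t ^ loops a c else 0))"
  by (rule sum_collapse[symmetric]) (auto simp: finite_sparts f intro: spart_comp_in_sparts)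
 also have "... = (\<Sum>\<mu>\<in>sparts X X''.
   (\<Sum>\<nu>\<in>sparts Y Y''. (if ?t \<mu> \<nu> = d then 1 else 0) *
    (\<Sum>b\<in>sparts Y Y'. \<Sum>e\<in>sparts Y' Y''. if ?c b e = \<nu> then g e * g' b * t ^ loops b e else 0)) *
   (\<Sum>a\<in>sparts X X'. \<Sum>c\<in>sparts X' X''. if ?c a c = \<mu> then h c * h' a * t ^ loops a c else 0))"
  by (subst sum_collapse) (auto simp: finite_sparts f intro: spart_comp_in_sparts)
 also have "... = (\<Sum>\<mu>\<in>sparts X X''. (\<Sum>\<nu>\<in>sparts Y Y''. (if ?t \<mu> \<nu> = d then 1 else 0) * comp0 t Y Y' Y'' g g' \<nu>) * comp0 t X X' X'' h h' \<mu>)"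
  by (simp only: comp0_def)
 also have "... = tensor0 X X'' Y Y'' (comp0 t X X' X'' h h') (comp0 t Y Y' Y'' g g') d"
  unfolding tensor0_def sum_distrib_right by (intro sum.cong refl) simp
 finally show "comp0 t (dunion X Y) (dunion X' Y') (dunion X'' Y'') (tensor0 X' X'' Y' Y'' h g) (tensor0 X X' Y Y' h' g') d
  = tensor0 X X'' Y Y'' (comp0 t X X' X'' h h') (comp0 t Y Y' Y'' g g') d" .
qed

section \<open>Objects built from legs\<close>

text \<open>
A leg is an embedding of \<open>{1..m}\<close> as one of several disjoint copies, together with the morphism to which the projector restricts on that copy.
\<close>
type_synonym 'k leg = "(nat => nat) \<times> 'k mor0"

definition leg_points :: "nat => 'k leg list => nat list" where
 "leg_points m L = concat (map (%l. map (fst l) [1..<Suc m]) L)"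

definition legs_perm :: "nat => 'k leg list => (nat => nat) list => (nat => nat) => bool" where
 "legs_perm m L ss s \<longleftrightarrow> list_all2 (%l \<sigma>. \<sigma> \<in> Sym m \<and> (\<forall>a\<in>{1..m}. s (fst l a) = fst l (\<sigma> a))) L ss"

text \<open>
The properties of a tensor product of idempotents that determine its invariants: the projector \<open>p\<close> on \<open>X\<close> is
annihilated by cutting and merging within each leg, none of its partitions connects different legs, and its
coefficient at a permutation preserving the legs is the product of the coefficients of the legs.  Stated in this way
they are stable under tensor products.
\<close>
definition leg_obj :: "'k::field => nat => nat set => 'k leg list => 'k mor0 => bool" where
 "leg_obj t m X L p \<longleftrightarrow> X = set (leg_points m L) \<and> distinct (leg_points m L) \<and>
   p \<in> hom0 X X \<and> comp0 t X X X p p = p \<and>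
   (\<forall>l\<in>set L. \<forall>x\<in>{1..m}. comp0 t X X X p (basis0 (cut X (fst l x))) = 0) \<and>
   (\<forall>l\<in>set L. \<forall>x\<in>{1..m}. \<forall>y\<in>{1..m}. x \<noteq> y \<longrightarrow> comp0 t X X X p (basis0 (merge X (fst l x) (fst l y))) = 0) \<and>
   (\<forall>\<pi>\<in>sparts X X. p \<pi> \<noteq> 0 \<longrightarrow> (\<forall>B\<in>\<pi>. \<exists>l\<in>set L. B \<subseteq> fst l ` {1..m} <+> fst l ` {1..m})) \<and>
   (\<forall>s ss. bij_betw s X X \<and> legs_perm m L ss s \<longrightarrow>
    p (ppart X s) = prod_list (map2 (%l \<sigma>. snd l (perm_part m \<sigma>)) L ss))"

lemma leg_points_append [simp]: "leg_points m (L @ L') = leg_points m L @ leg_points m L'"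
 by (simp add: leg_points_def)

lemma leg_points_map: "leg_points m (map (%l. (e o fst l, snd l)) L) = map e (leg_points m L)"
 by (simp add: leg_points_def map_concat o_def)

lemma set_leg_points: "set (leg_points m L) = (\<Union>l\<in>set L. fst l ` {1..m})"
 unfolding leg_points_def set_concat set_map image_image set_upt atLeastLessThanSuc_atLeastAtMost ..

lemma leg_points_mem: "l \<in> set L ==> a \<in> {1..m} ==> fst l a \<in> set (leg_points m L)"
 unfolding set_leg_points by blast

lemma leg_points_memE: "u \<in> set (leg_points m L) ==> \<exists>l\<in>set L. \<exists>a\<in>{1..m}. u = fst l a"
 unfolding set_leg_points by blast

lemma map_sum_image_Plus: "C \<subseteq> A <+> B ==> map_sum e e' ` C \<subseteq> e ` A <+> e' ` B"
proof
 fix u assume C: "C \<subseteq> A <+> B" and "u \<in> map_sum e e' ` C"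
 then obtain w where w: "w \<in> C" "u = map_sum e e' w" by blast
 hence "w \<in> A <+> B" using C by blast
 thus "u \<in> e ` A <+> e' ` B" using w(2) by (cases w) auto
qed

lemma leg_objD:
 assumes "leg_obj t m X L p"
 shows "X = set (leg_points m L)" "distinct (leg_points m L)" "p \<in> hom0 X X" "comp0 t X X X p p = p"
  "\<And>l x. l \<in> set L ==> x \<in> {1..m} ==> comp0 t X X X p (basis0 (cut X (fst l x))) = 0"
  "\<And>l x y. l \<in> set L ==> x \<in> {1..m} ==> y \<in> {1..m} ==> x \<noteq> y ==> comp0 t X X X p (basis0 (merge X (fst l x) (fst l y))) = 0"
  "\<And>\<pi> B. \<pi> \<in> sparts X X ==> p \<pi> \<noteq> 0 ==> B \<in> \<pi> ==> \<exists>l\<in>set L. B \<subseteq> fst l ` {1..m} <+> fst l ` {1..m}"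
  "\<And>s ss. bij_betw s X X ==> legs_perm m L ss s ==> p (ppart X s) = prod_list (map2 (%l \<sigma>. snd l (perm_part m \<sigma>)) L ss)"
  "finite X"
proof -
 note D1 = assms[unfolded leg_obj_def]
 note D2 = conjunct2[OF D1] note D3 = conjunct2[OF D2] note D4 = conjunct2[OF D3] note D5 = conjunct2[OF D4]
 note D6 = conjunct2[OF D5] note D7 = conjunct2[OF D6] note D8 = conjunct2[OF D7]
 show X: "X = set (leg_points m L)" by (rule conjunct1[OF D1])
 show "distinct (leg_points m L)" by (rule conjunct1[OF D2])
 show "p \<in> hom0 X X" by (rule conjunct1[OF D3])
 show "comp0 t X X X p p = p" by (rule conjunct1[OF D4])
 show "\<And>l x. l \<in> set L ==> x \<in> {1..m} ==> comp0 t X X X p (basis0 (cut X (fst l x))) = 0"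
  by (rule conjunct1[OF D5, rule_format])
 show "\<And>l x y. l \<in> set L ==> x \<in> {1..m} ==> y \<in> {1..m} ==> x \<noteq> y ==> comp0 t X X X p (basis0 (merge X (fst l x) (fst l y))) = 0"
  by (rule conjunct1[OF D6, rule_format])
 show "\<And>\<pi> B. \<pi> \<in> sparts X X ==> p \<pi> \<noteq> 0 ==> B \<in> \<pi> ==> \<exists>l\<in>set L. B \<subseteq> fst l ` {1..m} <+> fst l ` {1..m}"
  by (rule conjunct1[OF D7, rule_format])
 show "\<And>s ss. bij_betw s X X ==> legs_perm m L ss s ==> p (ppart X s) = prod_list (map2 (%l \<sigma>. snd l (perm_part m \<sigma>)) L ss)"
  by (rule D8[rule_format], rule conjI)
 show "finite X" unfolding X by simp
qed

lemma leg_obj_unit: "leg_obj t m {} [] (id0 {})"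
proof -
 have s: "sparts {} {} = {{}}" by (auto simp: sparts_def partition_on_def)
 have i: "id0 {} \<in> hom0 {} {}" by (simp add: id0_def basis0_in s)
 have "id0 {} {} = (1::'a)" by (simp add: id0_def basis0_def)
 thus ?thesis unfolding leg_obj_def using i
  by (auto simp: leg_points_def s legs_perm_def ppart_def)
qed

abbreviation endo_comp :: "'k::field => nat => 'k mor0 => 'k mor0 => 'k mor0" where
 "endo_comp t m \<equiv> comp0 t {1..m} {1..m} {1..m}"

definition leg_mor :: "'k::field => nat => 'k mor0 => bool" where
 "leg_mor t m c \<longleftrightarrow> c \<in> hom0 {1..m} {1..m} \<and> endo_comp t m c c = c \<and>
   (\<forall>x\<in>{1..m}. endo_comp t m c (basis0 (cut {1..m} x)) = 0) \<and>
   (\<forall>x\<in>{1..m}. \<forall>y\<in>{1..m}. x \<noteq> y \<longrightarrow> endo_comp t m c (basis0 (merge {1..m} x y)) = 0)"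

lemma leg_obj_single:
 assumes c: "leg_mor t m c"
 shows "leg_obj t m {1..m} [(%x. x, c)] c"
 unfolding leg_obj_def
proof (intro conjI)
 show "\<forall>\<pi>\<in>sparts {1..m} {1..m}. c \<pi> \<noteq> 0 \<longrightarrow> (\<forall>B\<in>\<pi>. \<exists>l\<in>set [(%x. x, c)]. B \<subseteq> fst l ` {1..m} <+> fst l ` {1..m})"
  by (auto simp: sparts_def partition_on_def)
 show "\<forall>s ss. bij_betw s {1..m} {1..m} \<and> legs_perm m [(%x. x, c)] ss s \<longrightarrow>
    c (ppart {1..m} s) = prod_list (map2 (%l \<sigma>. snd l (perm_part m \<sigma>)) [(%x. x, c)] ss)"
 proof (intro allI impI)
  fix s :: "nat => nat" and ss assume a: "bij_betw s {1..m} {1..m} \<and> legs_perm m [(%x. x, c)] ss s"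
  then obtain \<sigma> where ss: "ss = [\<sigma>]" and e: "\<forall>a\<in>{1..m}. s a = \<sigma> a"
   by (auto simp: legs_perm_def list_all2_Cons1)
  have "ppart {1..m} s = perm_part m \<sigma>" unfolding ppart_def perm_part_def by (rule image_cong) (use e in auto)
  thus "c (ppart {1..m} s) = prod_list (map2 (%l \<sigma>. snd l (perm_part m \<sigma>)) [(%x. x, c)] ss)" by (simp add: ss)
 qed
qed (use c in \<open>auto simp: leg_mor_def leg_points_def\<close>)

lemma ppart_tensor:
 assumes "\<And>x. x \<in> X ==> s (eL x) = eL (s1 x)" "\<And>y. y \<in> Y ==> s (eR y) = eR (s2 y)"
 shows "ppart (dunion X Y) s = spart_tensor (ppart X s1) (ppart Y s2)"
proof -
 have "ppart (dunion X Y) s = (%x. {Inl (eL x), Inr (s (eL x))}) ` X \<union> (%y. {Inl (eR y), Inr (s (eR y))}) ` Y"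
  unfolding ppart_def dunion_eq image_Un image_image ..
 also have "(%x. {Inl (eL x), Inr (s (eL x))}) ` X = (%B. map_sum eL eL ` B) ` ppart X s1"
  unfolding ppart_def image_image by (rule image_cong) (use assms(1) in auto)
 also have "(%y. {Inl (eR y), Inr (s (eR y))}) ` Y = (%B. map_sum eR eR ` B) ` ppart Y s2"
  unfolding ppart_def image_image by (rule image_cong) (use assms(2) in auto)
 finally show ?thesis by (simp only: spart_tensor_def)
qed

lemma cut_tensor:
 "x \<in> X ==> cut (dunion X Y) (eL x) = spart_tensor (cut X x) (ppart Y (%y. y))"
 "y \<in> Y ==> cut (dunion X Y) (eR y) = spart_tensor (ppart X (%y. y)) (cut Y y)"
proof -
 have d: "dunion X Y - {eL x} = dunion (X - {x}) Y" "dunion X Y - {eR y} = dunion X (Y - {y})" for x y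
  unfolding dunion_eq by auto
 show "x \<in> X ==> cut (dunion X Y) (eL x) = spart_tensor (cut X x) (ppart Y (%y. y))"
  unfolding cut_def d unfolding dunion_eq spart_tensor_def ppart_def image_Un image_image image_insert by auto
 show "y \<in> Y ==> cut (dunion X Y) (eR y) = spart_tensor (ppart X (%y. y)) (cut Y y)"
  unfolding cut_def d unfolding dunion_eq spart_tensor_def ppart_def image_Un image_image image_insert by auto
qed

lemma merge_tensor:
 "merge (dunion X Y) (eL x) (eL x') = spart_tensor (merge X x x') (ppart Y (%y. y))"
 "merge (dunion X Y) (eR y) (eR y') = spart_tensor (ppart X (%y. y)) (merge Y y y')"
proof -
 have d: "dunion X Y - {eL x, eL x'} = dunion (X - {x, x'}) Y" "dunion X Y - {eR y, eR y'} = dunion X (Y - {y, y'})"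
  unfolding dunion_eq by auto
 show "merge (dunion X Y) (eL x) (eL x') = spart_tensor (merge X x x') (ppart Y (%y. y))"
  unfolding merge_def d unfolding dunion_eq spart_tensor_def ppart_def image_Un image_image image_insert by auto
 show "merge (dunion X Y) (eR y) (eR y') = spart_tensor (ppart X (%y. y)) (merge Y y y')"
  unfolding merge_def d unfolding dunion_eq spart_tensor_def ppart_def image_Un image_image image_insert by auto
qed

lemma leg_obj_tensor:
 assumes P: "leg_obj t m X L p" and Q: "leg_obj t m Y K q"
 shows "leg_obj t m (dunion X Y) (map (%l. (eL o fst l, snd l)) L @ map (%l. (eR o fst l, snd l)) K) (tensor0 X X Y Y p q)"
  (is "leg_obj t m ?Z ?M ?r")
 unfolding leg_obj_def
proof (intro conjI)
 note P' = leg_objD[OF P] and Q' = leg_objD[OF Q]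
 have fX: "finite X" and fY: "finite Y" using P'(9) Q'(9) by auto
 have idX: "ppart X (%y. y) \<in> sparts X X" and idY: "ppart Y (%y. y) \<in> sparts Y Y" by (rule ppart_id_sparts)+
 have pts: "leg_points m ?M = map eL (leg_points m L) @ map eR (leg_points m K)"
  by (simp only: leg_points_append leg_points_map)
 show "?Z = set (leg_points m ?M)" unfolding pts dunion_eq using P'(1) Q'(1) by simp
 show "distinct (leg_points m ?M)" unfolding pts using P'(2) Q'(2) inj_eL inj_eR
  by (auto simp: distinct_map intro: inj_on_subset)
 show "?r \<in> hom0 ?Z ?Z" by simp
 have ic: "comp0 t ?Z ?Z ?Z ?r (tensor0 X X Y Y f g) = tensor0 X X Y Y (comp0 t X X X p f) (comp0 t Y Y Y q g)" for f g
  by (rule interchange[OF fX fX fX fY fY fY])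
 show "comp0 t ?Z ?Z ?Z ?r ?r = ?r" by (simp only: ic P'(4) Q'(4))
 have tb: "(basis0 (spart_tensor \<alpha> \<beta>) :: 'a mor0) = tensor0 X X Y Y (basis0 \<alpha>) (basis0 \<beta>)" if "\<alpha> \<in> sparts X X" "\<beta> \<in> sparts Y Y" for \<alpha> \<beta>
  by (rule tensor0_basis[OF that fX fX fY fY, symmetric])
 have memX: "fst l x \<in> X" if "l \<in> set L" "x \<in> {1..m}" for l x using leg_points_mem[OF that] P'(1) by simp
 have memY: "fst l x \<in> Y" if "l \<in> set K" "x \<in> {1..m}" for l x using leg_points_mem[OF that] Q'(1) by simp
 have Mcases: "l \<in> set ?M ==> (\<And>k. k \<in> set L ==> l = (eL o fst k, snd k) ==> R) ==> (\<And>k. k \<in> set K ==> l = (eR o fst k, snd k) ==> R) ==> R" for l R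
  by auto
 show "\<forall>l\<in>set ?M. \<forall>x\<in>{1..m}. comp0 t ?Z ?Z ?Z ?r (basis0 (cut ?Z (fst l x))) = 0"
 proof (intro ballI)
  fix l x assume l: "l \<in> set ?M" and x: "x \<in> {1..m}"
  show "comp0 t ?Z ?Z ?Z ?r (basis0 (cut ?Z (fst l x))) = 0"
  proof (rule Mcases[OF l])
   fix k assume k: "k \<in> set L" "l = (eL o fst k, snd k)"
   have e: "fst l x = eL (fst k x)" by (simp add: k(2))
   show ?thesis unfolding e cut_tensor(1)[OF memX[OF k(1) x]] tb[OF cut_sparts[OF memX[OF k(1) x]] idY] ic P'(5)[OF k(1) x]
    by (rule tensor0_0_left)
  next
   fix k assume k: "k \<in> set K" "l = (eR o fst k, snd k)"
   have e: "fst l x = eR (fst k x)" by (simp add: k(2))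
   show ?thesis unfolding e cut_tensor(2)[OF memY[OF k(1) x]] tb[OF idX cut_sparts[OF memY[OF k(1) x]]] ic Q'(5)[OF k(1) x]
    by (rule tensor0_0_right)
  qed
 qed
 show "\<forall>l\<in>set ?M. \<forall>x\<in>{1..m}. \<forall>y\<in>{1..m}. x \<noteq> y \<longrightarrow> comp0 t ?Z ?Z ?Z ?r (basis0 (merge ?Z (fst l x) (fst l y))) = 0"
 proof (intro ballI impI)
  fix l x y assume l: "l \<in> set ?M" and x: "x \<in> {1..m}" and y: "y \<in> {1..m}" and xy: "x \<noteq> y"
  show "comp0 t ?Z ?Z ?Z ?r (basis0 (merge ?Z (fst l x) (fst l y))) = 0"
  proof (rule Mcases[OF l])
   fix k assume k: "k \<in> set L" "l = (eL o fst k, snd k)"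
   have e: "fst l x = eL (fst k x)" "fst l y = eL (fst k y)" by (simp_all add: k(2))
   show ?thesis unfolding e merge_tensor(1) tb[OF merge_sparts[OF memX[OF k(1) x] memX[OF k(1) y]] idY] ic P'(6)[OF k(1) x y xy]
    by (rule tensor0_0_left)
  next
   fix k assume k: "k \<in> set K" "l = (eR o fst k, snd k)"
   have e: "fst l x = eR (fst k x)" "fst l y = eR (fst k y)" by (simp_all add: k(2))
   show ?thesis unfolding e merge_tensor(2) tb[OF idX merge_sparts[OF memY[OF k(1) x] memY[OF k(1) y]]] ic Q'(6)[OF k(1) x y xy]
    by (rule tensor0_0_right)
  qed
 qed
 show "\<forall>\<pi>\<in>sparts ?Z ?Z. ?r \<pi> \<noteq> 0 \<longrightarrow> (\<forall>B\<in>\<pi>. \<exists>l\<in>set ?M. B \<subseteq> fst l ` {1..m} <+> fst l ` {1..m})"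
 proof (intro ballI impI)
  fix \<pi> B assume "?r \<pi> \<noteq> 0" and B: "B \<in> \<pi>"
  then obtain \<alpha> \<beta> where a: "\<alpha> \<in> sparts X X" "\<beta> \<in> sparts Y Y" "\<pi> = spart_tensor \<alpha> \<beta>" "p \<alpha> \<noteq> 0" "q \<beta> \<noteq> 0"
   using tensor0_nonzero[OF _ fX fX fY fY] by blast
  from B a(3) consider C where "C \<in> \<alpha>" "B = map_sum eL eL ` C" | C where "C \<in> \<beta>" "B = map_sum eR eR ` C"
   by (auto simp: spart_tensor_def)
  thus "\<exists>l\<in>set ?M. B \<subseteq> fst l ` {1..m} <+> fst l ` {1..m}"
  proof cases
   case 1
   then obtain l where "l \<in> set L" "C \<subseteq> fst l ` {1..m} <+> fst l ` {1..m}" using P'(7)[OF a(1,4)] by blast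
   moreover from this(2) have "B \<subseteq> eL ` (fst l ` {1..m}) <+> eL ` (fst l ` {1..m})"
    unfolding 1(2) by (rule map_sum_image_Plus)
   hence "B \<subseteq> (eL o fst l) ` {1..m} <+> (eL o fst l) ` {1..m}" by (simp only: image_comp)
   ultimately show ?thesis by (intro bexI[of _ "(eL o fst l, snd l)"]) auto
  next
   case 2
   then obtain l where "l \<in> set K" "C \<subseteq> fst l ` {1..m} <+> fst l ` {1..m}" using Q'(7)[OF a(2,5)] by blast
   moreover from this(2) have "B \<subseteq> eR ` (fst l ` {1..m}) <+> eR ` (fst l ` {1..m})"
    unfolding 2(2) by (rule map_sum_image_Plus)
   hence "B \<subseteq> (eR o fst l) ` {1..m} <+> (eR o fst l) ` {1..m}" by (simp only: image_comp)
   ultimately show ?thesis by (intro bexI[of _ "(eR o fst l, snd l)"]) auto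
  qed
 qed
 show "\<forall>s ss. bij_betw s ?Z ?Z \<and> legs_perm m ?M ss s \<longrightarrow>
    ?r (ppart ?Z s) = prod_list (map2 (%l \<sigma>. snd l (perm_part m \<sigma>)) ?M ss)"
 proof (intro allI impI)
  fix s :: "nat => nat" and ss assume a: "bij_betw s ?Z ?Z \<and> legs_perm m ?M ss s"
  then obtain s1 s2 where ss: "ss = s1 @ s2" "legs_perm m (map (%l. (eL o fst l, snd l)) L) s1 s" "legs_perm m (map (%l. (eR o fst l, snd l)) K) s2 s"
   and len: "length s1 = length L" "length s2 = length K"
   unfolding legs_perm_def list_all2_append1 by auto
  define f where "f x = inv eL (s (eL x))" for x
  define g where "g x = inv eR (s (eR x))" for x
  have iL: "inv eL (eL x) = x" and iR: "inv eR (eR x) = x" for x using inv_f_f[OF inj_eL] inv_f_f[OF inj_eR] by auto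
  have la: "list_all2 (%l \<sigma>. \<sigma> \<in> Sym m \<and> (\<forall>a\<in>{1..m}. s (eL (fst l a)) = eL (fst l (\<sigma> a)))) L s1"
   using ss(2) by (simp add: legs_perm_def list_all2_map1)
  have lb: "list_all2 (%l \<sigma>. \<sigma> \<in> Sym m \<and> (\<forall>a\<in>{1..m}. s (eR (fst l a)) = eR (fst l (\<sigma> a)))) K s2"
   using ss(3) by (simp add: legs_perm_def list_all2_map1)
  have lf: "legs_perm m L s1 f" unfolding legs_perm_def
   by (rule list_all2_mono[OF la]) (use iL in \<open>auto simp: f_def\<close>)
  have lg: "legs_perm m K s2 g" unfolding legs_perm_def
   by (rule list_all2_mono[OF lb]) (use iR in \<open>auto simp: g_def\<close>)
  have fx: "s (eL x) = eL (f x) \<and> f x \<in> X" if xX: "x \<in> X" for x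
  proof -
   have "x \<in> set (leg_points m L)" using xX by (simp only: P'(1)[symmetric])
   from leg_points_memE[OF this] obtain l a where l: "l \<in> set L" "a \<in> {1..m}" "x = fst l a" by blast
   then obtain i where i: "i < length L" "l = L ! i" by (metis in_set_conv_nth)
   have c: "s1 ! i \<in> Sym m" "s (eL x) = eL (fst l ((s1 ! i) a))"
    using list_all2_nthD[OF la i(1)] l i by auto
   hence "f x = fst l ((s1 ! i) a)" using iL by (simp only: f_def)
   thus ?thesis using c memX[OF l(1) Sym_range[OF c(1) l(2)]] by simp
  qed
  have gx: "s (eR x) = eR (g x) \<and> g x \<in> Y" if xY: "x \<in> Y" for x
  proof -
   have "x \<in> set (leg_points m K)" using xY by (simp only: Q'(1)[symmetric])
   from leg_points_memE[OF this] obtain l a where l: "l \<in> set K" "a \<in> {1..m}" "x = fst l a" by blast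
   then obtain i where i: "i < length K" "l = K ! i" by (metis in_set_conv_nth)
   have c: "s2 ! i \<in> Sym m" "s (eR x) = eR (fst l ((s2 ! i) a))"
    using list_all2_nthD[OF lb i(1)] l i by auto
   hence "g x = fst l ((s2 ! i) a)" using iR by (simp only: g_def)
   thus ?thesis using c memY[OF l(1) Sym_range[OF c(1) l(2)]] by simp
  qed
  have sinj: "inj_on s ?Z" using a by (simp add: bij_betw_def)
  have "inj_on f X"
  proof (rule inj_onI)
   fix x y assume xy: "x \<in> X" "y \<in> X" "f x = f y"
   hence "s (eL x) = s (eL y)" using fx by simp
   hence "eL x = eL y" by (rule inj_onD[OF sinj]) (use xy in \<open>auto simp: dunion_eq\<close>)
   thus "x = y" using injD[OF inj_eL] by blast
  qed
  hence bf: "bij_betw f X X" using fx fX by (simp add: bij_betw_def endo_inj_surj image_subset_iff)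
  have "inj_on g Y"
  proof (rule inj_onI)
   fix x y assume xy: "x \<in> Y" "y \<in> Y" "g x = g y"
   hence "s (eR x) = s (eR y)" using gx by simp
   hence "eR x = eR y" by (rule inj_onD[OF sinj]) (use xy in \<open>auto simp: dunion_eq\<close>)
   thus "x = y" using injD[OF inj_eR] by blast
  qed
  hence bg: "bij_betw g Y Y" using gx fY by (simp add: bij_betw_def endo_inj_surj image_subset_iff)
  have "ppart ?Z s = spart_tensor (ppart X f) (ppart Y g)" by (rule ppart_tensor) (use fx gx in blast)+
  hence "?r (ppart ?Z s) = p (ppart X f) * q (ppart Y g)"
   using tensor0_apply[OF ppart_sparts[OF bf] ppart_sparts[OF bg] fX fX fY fY] by simp
  also have "... = prod_list (map2 (%l \<sigma>. snd l (perm_part m \<sigma>)) L s1) * prod_list (map2 (%l \<sigma>. snd l (perm_part m \<sigma>)) K s2)"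
   by (simp only: P'(8)[OF bf lf] Q'(8)[OF bg lg])
  also have "... = prod_list (map2 (%l \<sigma>. snd l (perm_part m \<sigma>)) ?M ss)"
   using len by (simp add: ss(1) zip_append zip_map1 o_def case_prod_unfold)
  finally show "?r (ppart ?Z s) = prod_list (map2 (%l \<sigma>. snd l (perm_part m \<sigma>)) ?M ss)" .
 qed
qed

section \<open>Objects with a single summand\<close>

definition emb :: "'k::field mor0 => 'k morm" where "emb p = (%i j. if i = 0 \<and> j = 0 then p else 0)"

lemma Unit_emb: "Unit (Rep_S t) = ([{}], emb (id0 {}))"
 by (auto simp: Rep_S_def idm_def emb_def fun_eq_iff)

lemma Tensor_emb: "Tensor (Rep_S t) ([X], emb p) ([Y], emb q) = ([dunion X Y], emb (tensor0 X X Y Y p q))"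
 by (auto simp: Rep_S_def tensor_objm_def tensorm_def emb_def fun_eq_iff Let_def)

lemma transpose0_0 [simp]: "transpose0 0 = 0" by (simp add: transpose0_def zero_fun_def)

lemma Dual_emb: "Dual (Rep_S t) ([X], emb p) = ([X], emb (transpose0 p))"
 by (auto simp: Rep_S_def transposem_def emb_def fun_eq_iff)

lemma emb_hom: "f \<in> hom0 X Y ==> emb f \<in> homm [X] [Y]"
 by (auto simp: homm_def emb_def)

lemma homm_single: "F \<in> homm [X] [Y] ==> F = emb (F 0 0) \<and> F 0 0 \<in> hom0 X Y"
proof -
 assume "F \<in> homm [X] [Y]"
 hence F: "if i < length [Y] \<and> j < length [X] then F i j \<in> hom0 ([X] ! j) ([Y] ! i) else F i j = 0" for i j
  unfolding homm_def by blast
 have "F 0 0 \<in> hom0 X Y" using F[of 0 0] by simp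
 moreover have "F i j = emb (F 0 0) i j" for i j using F[of i j] by (auto simp: emb_def)
 hence "F = emb (F 0 0)" by (intro ext) metis
 ultimately show ?thesis by blast
qed

lemma compm_emb: "compm t [X] [Y] [Z] (emb g) (emb f) = emb (comp0 t X Y Z g f)"
 by (auto simp: compm_def emb_def fun_eq_iff)

lemma Obj_emb: "finite X ==> p \<in> hom0 X X ==> comp0 t X X X p p = p ==> ([X], emb p) \<in> Obj (Rep_S t)"
 by (auto simp: Rep_S_def emb_hom compm_emb)

lemma Hom_unit_emb:
 assumes X: "finite X"
 shows "Hom (Rep_S t) (Unit (Rep_S t)) ([X], emb p) = {emb (comp0 t {} X X p f) | f. f \<in> hom0 {} X}"
proof -
 have "Hom (Rep_S t) (Unit (Rep_S t)) ([X], emb p) = {compm t [{}] [X] [X] (emb p) (compm t [{}] [{}] [X] f (emb (id0 {}))) | f. f \<in> homm [{}] [X]}"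
  unfolding Unit_emb by (simp add: Rep_S_def)
 also have "... = {emb (comp0 t {} X X p f) | f. f \<in> hom0 {} X}"
 proof (intro equalityI subsetI)
  fix v assume "v \<in> {compm t [{}] [X] [X] (emb p) (compm t [{}] [{}] [X] f (emb (id0 {}))) | f. f \<in> homm [{}] [X]}"
  then obtain f where f: "f \<in> homm [{}] [X]" "v = compm t [{}] [X] [X] (emb p) (compm t [{}] [{}] [X] f (emb (id0 {})))" by blast
  from homm_single[OF f(1)] obtain g where g: "g \<in> hom0 {} X" "f = emb g" by blast
  have "v = emb (comp0 t {} X X p g)" unfolding f(2) g(2) compm_emb using comp0_id_right[OF g(1) _ X] by simp
  thus "v \<in> {emb (comp0 t {} X X p f) | f. f \<in> hom0 {} X}" using g by blast
 next
  fix v assume "v \<in> {emb (comp0 t {} X X p f) | f. f \<in> hom0 {} X}"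
  then obtain g where g: "g \<in> hom0 {} X" "v = emb (comp0 t {} X X p g)" by blast
  have "v = compm t [{}] [X] [X] (emb p) (compm t [{}] [{}] [X] (emb g) (emb (id0 {})))"
   unfolding g(2) compm_emb using comp0_id_right[OF g(1) _ X] by simp
  thus "v \<in> {compm t [{}] [X] [X] (emb p) (compm t [{}] [{}] [X] f (emb (id0 {}))) | f. f \<in> homm [{}] [X]}"
   using emb_hom[OF g(1)] by blast
 qed
 finally show ?thesis .
qed

section \<open>Invariants\<close>

text \<open>
The dimension of the image of a projector is its trace; \<open>dim_frame\<close> applies to the images of the basis partitions with the coefficients at these partitions.
\<close>
lemma of_nat_dim_hom:
 fixes t :: "'k::field"
 assumes X: "finite X" and p: "comp0 t X X X p p = p"
 shows "(of_nat (vector_space.dim scale_mor (Hom (Rep_S t) (Unit (Rep_S t)) ([X], emb p))) :: 'k)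
  = (\<Sum>b\<in>sparts {} X. comp0 t {} X X p (basis0 b) b)"
proof -
 interpret vs: vector_space "scale_mor :: 'k => _" by (rule vector_space_scale_mor)
 let ?V = "Hom (Rep_S t) (Unit (Rep_S t)) ([X], emb p)"
 have V: "?V = {emb (comp0 t {} X X p f) | f. f \<in> hom0 {} X}" by (rule Hom_unit_emb[OF X])
 have emb_add: "emb (f + g) = emb f + emb g" for f g :: "'k mor0" by (auto simp: emb_def fun_eq_iff)
 have emb_scale: "scale_mor c (emb f) = emb (%a. c * f a)" for c and f :: "'k mor0"
  by (auto simp: emb_def scale_mor_def fun_eq_iff)
 have comp_scale: "comp0 t {} X X p (%a. c * f a) = (%d. c * comp0 t {} X X p f d)" for c f
  by (rule ext) (auto simp: comp0_def sum_distrib_left mult_ac intro!: sum.cong)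
 have hom_add: "f + g \<in> hom0 {} X" if "f \<in> hom0 {} X" "g \<in> hom0 {} X" for f g :: "'k mor0" using that by (simp add: hom0_def)
 have hom_scale: "(%a. c * f a) \<in> hom0 {} X" if "f \<in> hom0 {} X" for c and f :: "'k mor0" using that by (simp add: hom0_def)
 have sub: "vs.subspace ?V"
 proof (rule vs.subspaceI)
  have "(0 :: 'k mor0) \<in> hom0 {} X" by (simp add: hom0_def)
  moreover have "(0 :: 'k morm) = emb (comp0 t {} X X p 0)" by (auto simp: emb_def fun_eq_iff)
  ultimately show "0 \<in> ?V" unfolding V by blast
  show "u + v \<in> ?V" if uv: "u \<in> ?V" "v \<in> ?V" for u v
  proof -
   obtain f g where "f \<in> hom0 {} X" "g \<in> hom0 {} X" "u = emb (comp0 t {} X X p f)" "v = emb (comp0 t {} X X p g)"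
    using uv unfolding V by blast
   moreover from this have "u + v = emb (comp0 t {} X X p (f + g))" by (simp add: comp0_add_right emb_add)
   ultimately show ?thesis unfolding V using hom_add by blast
  qed
  show "scale_mor c u \<in> ?V" if u: "u \<in> ?V" for c u
  proof -
   obtain f where "f \<in> hom0 {} X" "u = emb (comp0 t {} X X p f)" using u unfolding V by blast
   moreover from this have "scale_mor c u = emb (comp0 t {} X X p (%a. c * f a))" by (simp add: emb_scale comp_scale)
   ultimately show ?thesis unfolding V using hom_scale by blast
  qed
 qed
 have finS: "finite (sparts {} X)" by (rule finite_sparts) (use X in auto)
 define e where "e b = emb (comp0 t {} X X p (basis0 b))" for b
 have eV: "e b \<in> ?V" if "b \<in> sparts {} X" for b unfolding V e_def using basis0_in[OF that] by blast
 have frame: "v = (\<Sum>b\<in>sparts {} X. scale_mor (v 0 0 b) (e b))" if v: "v \<in> ?V" for v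
 proof -
  obtain f where f: "f \<in> hom0 {} X" "v = emb (comp0 t {} X X p f)" using v unfolding V by blast
  let ?w = "comp0 t {} X X p f"
  have w: "v 0 0 = ?w" by (simp add: f(2) emb_def)
  have pw: "comp0 t {} X X p ?w = ?w"
   using comp0_assoc[of "{}" X X X t p p f] X by (simp add: p)
  have sum_apply: "(\<Sum>b\<in>B. scale_mor (?w b) (e b)) i j d = (\<Sum>b\<in>B. scale_mor (?w b) (e b) i j d)" for B i j d
   by (induction B rule: infinite_finite_induct) auto
  have wsum: "?w d = (\<Sum>b\<in>sparts {} X. ?w b * comp0 t {} X X p (basis0 b) d)" for d
  proof -
   have "?w d = comp0 t {} X X p ?w d" by (simp only: pw)
   also have "... = (\<Sum>b\<in>sparts {} X. ?w b * (\<Sum>\<pi>\<in>sparts X X. if spart_comp b \<pi> = d then p \<pi> * t ^ loops b \<pi> else 0))"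
    unfolding comp0_def[of t "{}" X X p ?w] sum_distrib_left by (intro sum.cong refl) simp
   also have "... = (\<Sum>b\<in>sparts {} X. ?w b * comp0 t {} X X p (basis0 b) d)"
    by (intro sum.cong refl) (use X in \<open>simp add: comp0_basis_right\<close>)
   finally show ?thesis .
  qed
  have "v i j d = (\<Sum>b\<in>sparts {} X. scale_mor (?w b) (e b)) i j d" for i j d
  proof (cases "i = 0 \<and> j = 0")
   case True
   thus ?thesis using wsum[of d] by (simp only: sum_apply) (simp add: f(2) e_def scale_mor_def emb_def)
  next
   case False
   hence "v i j d = 0" "\<And>b. scale_mor (?w b) (e b) i j d = 0" by (auto simp: f(2) e_def scale_mor_def emb_def)
   thus ?thesis unfolding sum_apply by simp
  qed
  thus ?thesis unfolding w by (intro ext)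
 qed
 have "(of_nat (vs.dim ?V) :: 'k) = (\<Sum>b\<in>sparts {} X. e b 0 0 b)"
  by (rule vs.dim_frame[where \<xi> = "%b v. v 0 0 b", OF finS sub eV _ _ frame]) (auto simp: scale_mor_def)
 thus ?thesis by (simp add: e_def emb_def)
qed

text \<open>
If \<open>A\<close> fixes \<open>b\<close> up to loops and is annihilated by \<open>p\<close>, then \<open>p\<close> annihilates \<open>b\<close>.  This is where \<open>t \<noteq> 0\<close> is needed.
\<close>
lemma comp0_basis_zero:
 fixes t :: "'k::field"
 assumes t: "t \<noteq> 0" and X: "finite X" and A: "A \<in> sparts X X" and b: "b \<in> sparts {} X"
  and z: "comp0 t X X X p (basis0 A) = 0" and e: "spart_comp b A = b"
 shows "comp0 t {} X X p (basis0 b) = 0"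
proof -
 have "comp0 t {} X X p (comp0 t {} X X (basis0 A) (basis0 b)) = comp0 t {} X X (comp0 t X X X p (basis0 A)) (basis0 b)"
  by (rule comp0_assoc) (use X in auto)
 also have "... = 0" by (simp add: z)
 finally have 0: "comp0 t {} X X p (comp0 t {} X X (basis0 A) (basis0 b)) d = 0" for d by (simp add: zero_fun_def)
 have "comp0 t {} X X p (comp0 t {} X X (basis0 A) (basis0 b)) d = t ^ loops b A * comp0 t {} X X p (basis0 b) d" for d
 proof -
  have "comp0 t {} X X (basis0 A) (basis0 b) = (%d. t ^ loops b A * basis0 b d :: 'k)"
   by (rule ext) (use comp0_basis_basis[OF b A _ X X] in \<open>simp add: e\<close>)
  thus ?thesis by (auto simp: comp0_def sum_distrib_left mult_ac intro!: sum.cong)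
 qed
 hence "t ^ loops b A * comp0 t {} X X p (basis0 b) d = 0" for d using 0 by simp
 hence "comp0 t {} X X p (basis0 b) d = 0" for d using t by (metis mult_eq_0_iff power_not_zero)
 thus ?thesis by (intro ext) (simp add: zero_fun_def)
qed

lemma spart_comp_merge:
 assumes X: "finite X" and b: "b \<in> sparts {} X" and B: "B \<in> b" "Inr x \<in> B" "Inr y \<in> B"
 shows "spart_comp b (merge X x y) = b"
proof -
 have xy: "x \<in> X" "y \<in> X" using B partition_onD1[OF spartsD[OF b]] by auto
 have "(\<Sum>T\<in>Pow X. sat_mat b S T * sat_mat (merge X x y) T U) = 2 ^ 0 * sat_mat b S U" if SU: "S \<subseteq> {}" "U \<subseteq> X" for S U
 proof -
  have "(\<Sum>T\<in>Pow X. sat_mat b S T * sat_mat (merge X x y) T U) = (\<Sum>T\<in>Pow X. if T = U then sat_mat b S U else 0)"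
  proof (rule sum.cong[OF refl])
   fix T assume T: "T \<in> Pow X"
   have "saturated b (S <+> U) ==> x \<in> U \<longleftrightarrow> y \<in> U"
    using saturatedD[of b "S <+> U" B "Inr x" "Inr y"] saturatedD[of b "S <+> U" B "Inr y" "Inr x"] B by auto
   thus "sat_mat b S T * sat_mat (merge X x y) T U = (if T = U then sat_mat b S U else 0)"
    using saturated_merge[OF xy, of T U] T SU by (auto simp: sat_mat_def)
  qed
  thus ?thesis using SU X by simp
 qed
 from spart_comp_unique(1)[OF b merge_sparts[OF xy] _ X X b this] show ?thesis by simp
qed

lemma spart_comp_cut:
 assumes X: "finite X" and b: "b \<in> sparts {} X" and B: "{Inr x} \<in> b"
 shows "spart_comp b (cut X x) = b"
proof -
 have x: "x \<in> X" using B partition_onD1[OF spartsD[OF b]] by auto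
 have only: "C = {Inr x}" if "C \<in> b" "Inr x \<in> C" for C
  using blk_eq[OF spartsD[OF b] that] blk_eq[OF spartsD[OF b] B singletonI] by simp
 have ins: "saturated b (S <+> T) \<longleftrightarrow> saturated b (S <+> T')" if "T - {x} = T' - {x}" for S T T'
 proof -
  have w: "w \<in> S <+> T \<longleftrightarrow> w \<in> S <+> T'" if "w \<noteq> Inr x" for w
   using that \<open>T - {x} = T' - {x}\<close> by (cases w) auto
  have "(C \<subseteq> S <+> T \<or> C \<inter> (S <+> T) = {}) \<longleftrightarrow> (C \<subseteq> S <+> T' \<or> C \<inter> (S <+> T') = {})" if C: "C \<in> b" for C
  proof (cases "Inr x \<in> C")
   case True
   hence "C = {Inr x}" by (rule only[OF C])
   thus ?thesis by (simp only:) blast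
  next
   case False
   hence w': "v \<in> S <+> T \<longleftrightarrow> v \<in> S <+> T'" if "v \<in> C" for v using w that by metis
   have "C \<subseteq> S <+> T \<longleftrightarrow> C \<subseteq> S <+> T'" unfolding subset_iff using w' by (simp cong: imp_cong)
   moreover have "C \<inter> (S <+> T) = C \<inter> (S <+> T')" by (rule set_eqI) (simp add: w' cong: conj_cong)
   ultimately show ?thesis by simp
  qed
  thus ?thesis unfolding saturated_def by (rule ball_cong[OF refl])
 qed
 have "(\<Sum>T\<in>Pow X. sat_mat b S T * sat_mat (cut X x) T U) = 2 ^ 1 * sat_mat b S U" if SU: "S \<subseteq> {}" "U \<subseteq> X" for S U
 proof -
  have "(\<Sum>T\<in>Pow X. sat_mat b S T * sat_mat (cut X x) T U) = (\<Sum>T\<in>{U - {x}, insert x U}. sat_mat b S U)"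
  proof (rule sum.mono_neutral_cong_right)
   show "{U - {x}, insert x U} \<subseteq> Pow X" using SU x by auto
   show "\<forall>T\<in>Pow X - {U - {x}, insert x U}. sat_mat b S T * sat_mat (cut X x) T U = 0"
   proof
    fix T assume T: "T \<in> Pow X - {U - {x}, insert x U}"
    have "\<not> U - {x} = T - {x}" using T by blast
    thus "sat_mat b S T * sat_mat (cut X x) T U = 0" using saturated_cut[OF x, of T U] T SU by (simp add: sat_mat_def)
   qed
   fix T assume T: "T \<in> {U - {x}, insert x U}"
   hence "saturated (cut X x) (T <+> U)" using saturated_cut[OF x, of T U] SU x by auto
   moreover have "saturated b (S <+> T) \<longleftrightarrow> saturated b (S <+> U)" by (rule ins) (use T in auto)
   ultimately show "sat_mat b S T * sat_mat (cut X x) T U = sat_mat b S U" by (simp add: sat_mat_def)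
  qed (use X in simp)
  moreover have "U - {x} \<noteq> insert x U" by blast
  ultimately show ?thesis by simp
 qed
 from spart_comp_unique(1)[OF b cut_sparts[OF x] _ X X b this] show ?thesis by simp
qed

definition rename :: "(nat => nat) => spart => spart" where
 "rename s b = (%B. map_sum id s ` B) ` b"

lemma rename_sparts: "s permutes X ==> b \<in> sparts Y X ==> rename s b \<in> sparts Y X"
proof -
 assume s: "s permutes X" and b: "b \<in> sparts Y X"
 have inj: "inj (map_sum id s :: nat + nat => nat + nat)" by (rule sum.inj_map) (auto simp: permutes_inj[OF s])
 have "partition_on (map_sum id s ` (Y <+> X)) ((`) (map_sum id s) ` b - {{}})"
  by (rule partition_on_inj_image[OF spartsD[OF b] inj_on_subset[OF inj]]) simp
 moreover have "map_sum id s ` (Y <+> X) = Y <+> X"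
  unfolding Plus_def image_Un image_image using permutes_image[OF s] by (auto simp: image_iff) 
 moreover have "(`) (map_sum id s) ` b - {{}} = rename s b"
  using partition_onD3[OF spartsD[OF b]] by (auto simp: rename_def)
 ultimately show ?thesis by (simp add: sparts_def)
qed

lemma spart_comp_ppart_right:
 assumes s: "s permutes X" and b: "b \<in> sparts Y X" and f: "finite X" "finite Y"
 shows "spart_comp b (ppart X s) = rename s b" "loops b (ppart X s) = 0"
proof -
 have bij: "bij_betw s X X" by (rule permutes_imp_bij[OF s])
 have "(\<Sum>T\<in>Pow X. sat_mat b S T * sat_mat (ppart X s) T U) = 2 ^ 0 * sat_mat (rename s b) S U" if SU: "S \<subseteq> Y" "U \<subseteq> X" for S U
 proof -
  let ?V = "inv s ` U"
  have V: "?V \<subseteq> X" using SU permutes_in_image[OF permutes_inv[OF s]] by auto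
  have sV: "s ` ?V = U" using permutes_surj[OF s] by (simp add: image_f_inv_f)
  have "(\<Sum>T\<in>Pow X. sat_mat b S T * sat_mat (ppart X s) T U) = (\<Sum>T\<in>Pow X. if T = ?V then sat_mat b S ?V else 0)"
  proof (rule sum.cong[OF refl])
   fix T assume T: "T \<in> Pow X"
   have "U = s ` T \<longleftrightarrow> T = ?V" using sV permutes_inj[OF s] by (metis inj_image_eq_iff)
   thus "sat_mat b S T * sat_mat (ppart X s) T U = (if T = ?V then sat_mat b S ?V else 0)"
    using T SU by (simp add: sat_mat_ppart[OF bij])
  qed
  also have "... = sat_mat b S ?V" using V f by simp
  also have "... = sat_mat (rename s b) S U"
  proof -
   have m: "map_sum id s u \<in> S <+> U \<longleftrightarrow> u \<in> S <+> ?V" for u :: "nat + nat"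
   proof (cases u)
    case (Inr v)
    have "s v \<in> U \<longleftrightarrow> v \<in> ?V" using sV permutes_inj[OF s] by (metis inj_image_mem_iff)
    thus ?thesis by (simp add: Inr InrI image_iff Plus_def)
   qed auto
   show ?thesis unfolding sat_mat_def rename_def saturated_image[OF m] ..
  qed
  finally show ?thesis by simp
 qed
 from spart_comp_unique[OF b ppart_sparts[OF bij] f(2,1,1) rename_sparts[OF s b] this]
 show "spart_comp b (ppart X s) = rename s b" "loops b (ppart X s) = 0" by blast+
qed

lemma saturated_spart_comp:
 assumes a: "\<alpha> \<in> sparts X Y" "\<beta> \<in> sparts Y Z" "finite X" "finite Y" "finite Z" "S \<subseteq> X" "U \<subseteq> Z"
 shows "saturated (spart_comp \<alpha> \<beta>) (S <+> U) \<longleftrightarrow> (\<exists>T\<subseteq>Y. saturated \<alpha> (S <+> T) \<and> saturated \<beta> (T <+> U))"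
proof -
 let ?M = "{T \<in> Pow Y. saturated \<alpha> (S <+> T) \<and> saturated \<beta> (T <+> U)}"
 have "finite ?M" using a(4) by simp
 hence "saturated (spart_comp \<alpha> \<beta>) (S <+> U) \<longleftrightarrow> ?M \<noteq> {}"
  using binary_functor[OF a] by (metis (no_types, lifting) card_eq_0_iff power_not_zero zero_neq_numeral)
 thus ?thesis by auto
qed

lemma Plus_empty_left: "B \<subseteq> {} <+> X ==> \<exists>U\<subseteq>X. B = {} <+> U"
 using Plus_decompose[of B "{}" X] by auto

lemma Inr_mem_Plus: "Inr y \<in> A <+> B \<longleftrightarrow> y \<in> B" and Inl_mem_Plus: "Inl x \<in> A <+> B \<longleftrightarrow> x \<in> A" by auto

text \<open>
Points that are connected among the outputs of \<open>\<pi>\<close> stay connected in the composite, and an output forming a block of \<open>\<pi>\<close> by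
itself stays isolated.  So every block of \<open>\<pi>\<close> has at most one output, and every output shares its block with an
input.  As there are as many inputs as outputs, every block is a pair.
\<close>
lemma perm_of_comp:
 assumes X: "finite X" and b: "\<beta> \<in> sparts {} X" and p: "\<pi> \<in> sparts X X"
  and single: "\<And>x. x \<in> X ==> {Inr x} \<notin> spart_comp \<beta> \<pi>"
  and sep: "\<And>B C x y. B \<in> \<pi> ==> Inr x \<in> B ==> Inr y \<in> B ==> C \<in> spart_comp \<beta> \<pi> ==> Inr x \<in> C ==> Inr y \<in> C ==> x = y"
 shows "\<exists>s. s permutes X \<and> \<pi> = ppart X s"
proof -
 let ?d = "spart_comp \<beta> \<pi>"
 have d: "?d \<in> sparts {} X" by (rule spart_comp_in_sparts[OF b p])
 note D = spartsD[OF d] and P = spartsD[OF p]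
 have sat: "saturated ?d ({} <+> U) \<longleftrightarrow> (\<exists>T\<subseteq>X. saturated \<beta> ({} <+> T) \<and> saturated \<pi> (T <+> U))" if "U \<subseteq> X" for U
  by (rule saturated_spart_comp[OF b p]) (use X that in auto)
 have one: "x = y" if B: "B \<in> \<pi>" "Inr x \<in> B" "Inr y \<in> B" for B x y
 proof -
  have x: "Inr x \<in> {} <+> X" using partition_subset[OF P B(1)] B(2) by auto
  define C where "C = blk ?d (Inr x)"
  have C: "C \<in> ?d" "Inr x \<in> C" using blk_in[OF D x] by (auto simp: C_def)
  obtain U where U: "U \<subseteq> X" "C = {} <+> U" using Plus_empty_left partition_subset[OF D C(1)] by blast
  obtain T where "saturated \<pi> (T <+> U)" using sat[OF U(1)] saturated_block[OF D C(1)] U(2) by auto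
  from saturatedD[OF this B] have "Inr y \<in> C" using C(2) unfolding U(2) Inr_mem_Plus by simp
  thus ?thesis by (rule sep[OF B C])
 qed
 have ex: "\<exists>x\<in>X. Inl x \<in> blk \<pi> (Inr y)" if y: "y \<in> X" for y
 proof (rule ccontr)
  assume no: "\<not> ?thesis"
  have yy: "Inr y \<in> X <+> X" "Inr y \<in> {} <+> X" using y by auto
  note B = conjunct1[OF blk_in[OF P yy(1)]] conjunct2[OF blk_in[OF P yy(1)]]
  have "blk \<pi> (Inr y) = {Inr y}"
  proof (rule antisym)
   show "blk \<pi> (Inr y) \<subseteq> {Inr y}"
   proof
    fix u assume u: "u \<in> blk \<pi> (Inr y)"
    show "u \<in> {Inr y}"
    proof (cases u)
     case (Inl x)
     hence "x \<in> X" using partition_subset[OF P B(1)] u by auto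
     thus ?thesis using no u Inl by auto
    next
     case (Inr z) thus ?thesis using one[OF B(1) _ B(2), of z] u by simp
    qed
   qed
  qed (use B in simp)
  hence "saturated \<pi> {Inr y}" using saturated_block[OF P B(1)] by simp
  moreover have e: "{Inr y :: nat + nat} = {} <+> {y}" by auto
  ultimately have "saturated ?d ({} <+> {y})" using sat[of "{y}"] y saturated_empty[of \<beta>] by (metis Plus_empty empty_subsetI insert_subset)
  hence s: "saturated ?d {Inr y}" unfolding e .
  note C = conjunct1[OF blk_in[OF D yy(2)]] conjunct2[OF blk_in[OF D yy(2)]]
  have "blk ?d (Inr y) = {Inr y}" using saturatedD[OF s C] C(2) by auto
  thus False using C(1) single[OF y] by simp
 qed
 \<comment> \<open>The input that shares its block with the output \<open>y\<close>.\<close>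
 define f where "f y = (SOME x. x \<in> X \<and> Inl x \<in> blk \<pi> (Inr y))" for y
 have f: "f y \<in> X" "Inl (f y) \<in> blk \<pi> (Inr y)" if "y \<in> X" for y
  using someI_ex[of "%x. x \<in> X \<and> Inl x \<in> blk \<pi> (Inr y)"] ex[OF that] by (auto simp: f_def)
 have blkP: "blk \<pi> u \<in> \<pi>" "u \<in> blk \<pi> u" if "u \<in> X <+> X" for u using blk_in[OF P that] by auto
 have eqy: "y = z" if "y \<in> X" "z \<in> X" "blk \<pi> (Inr y) = blk \<pi> (Inr z)" for y z
  using one[OF blkP(1)[of "Inr y"] blkP(2)[of "Inr y"], of z] blkP(2)[of "Inr z"] that by auto
 have meet: "blk \<pi> (Inr y) = blk \<pi> (Inr z)" if "y \<in> X" "z \<in> X" "u \<in> blk \<pi> (Inr y)" "u \<in> blk \<pi> (Inr z)" for y z u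
  using blk_eq[OF P blkP(1) that(3)] blk_eq[OF P blkP(1) that(4)] that(1,2) by auto
 have inj: "inj_on f X"
 proof (rule inj_onI)
  fix y z assume yz: "y \<in> X" "z \<in> X" "f y = f z"
  show "y = z" by (rule eqy[OF yz(1,2) meet[OF yz(1,2) f(2)[OF yz(1)]]]) (use f(2)[OF yz(2)] yz(3) in simp)
 qed
 have onto: "f ` X = X" by (rule endo_inj_surj[OF X _ inj]) (use f(1) in auto)
 have block: "blk \<pi> (Inr y) = {Inl (f y), Inr y}" if y: "y \<in> X" for y
 proof (rule antisym)
  have yX: "Inr y \<in> X <+> X" using y by auto
  show "{Inl (f y), Inr y} \<subseteq> blk \<pi> (Inr y)" using f(2)[OF y] blkP(2)[OF yX] by simp
  show "blk \<pi> (Inr y) \<subseteq> {Inl (f y), Inr y}"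
  proof
   fix u assume u: "u \<in> blk \<pi> (Inr y)"
   show "u \<in> {Inl (f y), Inr y}"
   proof (cases u)
    case (Inl x)
    hence "x \<in> X" using partition_subset[OF P blkP(1)[OF yX]] u by auto
    then obtain z where z: "z \<in> X" "x = f z" using onto by auto
    have "y = z" by (rule eqy[OF y z(1) meet[OF y z(1) u]]) (use f(2)[OF z(1)] z(2) Inl in simp)
    thus ?thesis using Inl z by simp
   next
    case (Inr z) thus ?thesis using one[OF blkP(1)[OF yX] _ blkP(2)[OF yX], of z] u by simp
   qed
  qed
 qed
 define s where "s x = (if x \<in> X then the_inv_into X f x else x)" for x
 have sf: "s (f y) = y" if "y \<in> X" for y using that f(1) by (simp add: s_def the_inv_into_f_f[OF inj])
 have bij: "bij_betw f X X" using inj onto by (simp add: bij_betw_def)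
 have sp: "s permutes X"
 proof (rule bij_imp_permutes)
  have "bij_betw (the_inv_into X f) X X" by (rule bij_betw_the_inv_into[OF bij])
  thus "bij_betw s X X" by (rule bij_betw_cong[THEN iffD1, rotated]) (simp add: s_def)
 qed (simp add: s_def)
 have "\<pi> = (%y. {Inl (f y), Inr y}) ` X"
 proof (intro equalityI subsetI)
  fix B assume B: "B \<in> \<pi>"
  then obtain u where u: "u \<in> B" using partition_nonempty[OF P] by blast
  have "\<exists>y\<in>X. u \<in> blk \<pi> (Inr y)"
  proof (cases u)
   case (Inl x)
   hence "x \<in> X" using partition_subset[OF P B] u by auto
   then obtain z where "z \<in> X" "x = f z" using onto by auto
   thus ?thesis using f(2) Inl by auto
  next
   case (Inr y)
   hence "y \<in> X" using partition_subset[OF P B] u by auto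
   thus ?thesis using blkP(2)[of "Inr y"] Inr by (intro bexI[of _ y]) auto
  qed
  then obtain y where y: "y \<in> X" "u \<in> blk \<pi> (Inr y)" by blast
  hence "B = blk \<pi> (Inr y)" using blk_eq[OF P B u] blk_eq[OF P blkP(1)[of "Inr y"] y(2)] by auto
  thus "B \<in> (%y. {Inl (f y), Inr y}) ` X" using block[OF y(1)] y(1) by blast
 next
  fix B assume "B \<in> (%y. {Inl (f y), Inr y}) ` X"
  then obtain y where y: "y \<in> X" "B = blk \<pi> (Inr y)" using block by auto
  thus "B \<in> \<pi>" using blkP(1)[of "Inr y"] by auto
 qed
 also have "... = (%y. {Inl y, Inr (s y)}) ` (f ` X)" unfolding image_image by (rule image_cong) (auto simp: sf)
 finally have "\<pi> = ppart X s" by (simp only: onto ppart_def)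
 thus ?thesis using sp by blast
qed

lemma leg_points_inj:
 "distinct (leg_points m L) ==> i < length L ==> j < length L ==> a \<in> {1..m} ==> b \<in> {1..m} ==>
   fst (L ! i) a = fst (L ! j) b ==> i = j \<and> a = b"
proof (induction L arbitrary: i j)
 case (Cons l L)
 have c: "leg_points m (l # L) = map (fst l) [1..<Suc m] @ leg_points m L" by (simp add: leg_points_def)
 have d: "distinct (map (fst l) [1..<Suc m])" "distinct (leg_points m L)"
  "set (map (fst l) [1..<Suc m]) \<inter> set (leg_points m L) = {}"
  using Cons.prems(1) unfolding c distinct_append by blast+
 have S: "set [1..<Suc m] = {1..m}" by auto
 have inj: "inj_on (fst l) {1..m}" using d(1) unfolding distinct_map S by blast
 have disj: "fst l a \<noteq> fst (L ! j) b" if "a \<in> {1..m}" "b \<in> {1..m}" "j < length L" for a b j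
 proof
  assume e: "fst l a = fst (L ! j) b"
  have "fst (L ! j) b \<in> set (leg_points m L)" by (rule leg_points_mem[OF nth_mem[OF that(3)] that(2)])
  moreover have "fst l a \<in> set (map (fst l) [1..<Suc m])" unfolding set_map S using that(1) by blast
  ultimately show False using d(3) e by auto
 qed
 show ?case
 proof (cases i)
  case 0
  show ?thesis
  proof (cases j)
   case 0 thus ?thesis using \<open>i = 0\<close> Cons.prems(4-6) inj_onD[OF inj] by simp
  next
   case (Suc j') thus ?thesis using \<open>i = 0\<close> Cons.prems(3,6) disj[OF Cons.prems(4,5), of j'] by simp
  qed
 next
  case (Suc i')
  show ?thesis
  proof (cases j)
   case 0 thus ?thesis using Suc Cons.prems(2,6) disj[OF Cons.prems(5,4), of i'] by simp
  next
   case (Suc j')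
   thus ?thesis using \<open>i = Suc i'\<close> Cons.IH[OF d(2), of i' j'] Cons.prems by simp
  qed
 qed
qed simp

abbreviation leg_pt :: "'k leg list => nat \<times> nat => nat" where
 "leg_pt L \<equiv> %(i, a). fst (L ! i) a"

lemma leg_pt_bij:
 assumes "distinct (leg_points m L)"
 shows "bij_betw (leg_pt L) ({..<length L} \<times> {1..m}) (set (leg_points m L))"
proof (rule bij_betw_imageI)
 show "inj_on (leg_pt L) ({..<length L} \<times> {1..m})"
 proof (rule inj_onI)
  fix u v assume u: "u \<in> {..<length L} \<times> {1..m}" and v: "v \<in> {..<length L} \<times> {1..m}" and e: "leg_pt L u = leg_pt L v"
  obtain i a j b where uv: "u = (i, a)" "v = (j, b)" by (cases u, cases v)
  have "i = j \<and> a = b" by (rule leg_points_inj[OF assms]) (use u v e uv in simp_all)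
  thus "u = v" by (simp add: uv)
 qed
 show "leg_pt L ` ({..<length L} \<times> {1..m}) = set (leg_points m L)"
 proof (intro equalityI subsetI)
  fix x assume "x \<in> leg_pt L ` ({..<length L} \<times> {1..m})"
  then obtain i a where ia: "i < length L" "a \<in> {1..m}" "x = fst (L ! i) a" by auto
  show "x \<in> set (leg_points m L)" unfolding ia(3) by (rule leg_points_mem[OF nth_mem[OF ia(1)] ia(2)])
 next
  fix x assume "x \<in> set (leg_points m L)"
  then obtain l a where la: "l \<in> set L" "a \<in> {1..m}" "x = fst l a" using leg_points_memE[of x m L] by blast
  then obtain i where "i < length L" "L ! i = l" by (auto simp: in_set_conv_nth)
  thus "x \<in> leg_pt L ` ({..<length L} \<times> {1..m})" using la by (intro image_eqI[of _ _ "(i, a)"]) auto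
 qed
qed

text \<open>The partitions on which the projector does not vanish for a trivial reason.\<close>
definition good_state :: "nat => nat set => 'k leg list => spart => bool" where
 "good_state m X L \<beta> \<longleftrightarrow> \<beta> \<in> sparts {} X \<and> (\<forall>x\<in>X. {Inr x} \<notin> \<beta>) \<and>
   (\<forall>B\<in>\<beta>. \<forall>l\<in>set L. \<forall>a\<in>{1..m}. \<forall>b\<in>{1..m}. Inr (fst l a) \<in> B \<longrightarrow> Inr (fst l b) \<in> B \<longrightarrow> a = b)"

lemma not_good_state_zero:
 fixes t :: "'k::field"
 assumes t: "t \<noteq> 0" and P: "leg_obj t m X L p" and b: "\<beta> \<in> sparts {} X" and ng: "\<not> good_state m X L \<beta>"
 shows "comp0 t {} X X p (basis0 \<beta>) = 0"
proof -
 note P' = leg_objD[OF P]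
 have "(\<exists>x\<in>X. {Inr x} \<in> \<beta>) \<or> (\<exists>B\<in>\<beta>. \<exists>l\<in>set L. \<exists>a\<in>{1..m}. \<exists>b\<in>{1..m}. Inr (fst l a) \<in> B \<and> Inr (fst l b) \<in> B \<and> a \<noteq> b)"
  using b ng unfolding good_state_def by blast
 thus ?thesis
 proof (elim disjE bexE conjE)
  fix x assume x: "x \<in> X" "{Inr x} \<in> \<beta>"
  then obtain l a where la: "l \<in> set L" "a \<in> {1..m}" "x = fst l a" using leg_points_memE[of x m L] P'(1) by blast
  show ?thesis
   by (rule comp0_basis_zero[OF t P'(9) cut_sparts[OF x(1)] b _ spart_comp_cut[OF P'(9) b x(2)]])
    (unfold la(3), rule P'(5)[OF la(1,2)])
 next
  fix B l a c assume B: "B \<in> \<beta>" and l: "l \<in> set L" and a: "a \<in> {1..m}" and c: "c \<in> {1..m}"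
   and m: "Inr (fst l a) \<in> B" "Inr (fst l c) \<in> B" and ac: "a \<noteq> c"
  have X: "fst l a \<in> X" "fst l c \<in> X" using leg_points_mem[OF l a] leg_points_mem[OF l c] P'(1) by simp_all
  show ?thesis
   by (rule comp0_basis_zero[OF t P'(9) merge_sparts[OF X] b P'(6)[OF l a c ac] spart_comp_merge[OF P'(9) b B m]])
 qed
qed

definition leg_perms :: "nat => nat set => 'k leg list => (nat => nat) set" where
 "leg_perms m X L = {s. s permutes X \<and> (\<forall>x\<in>X. \<exists>l\<in>set L. x \<in> fst l ` {1..m} \<and> s x \<in> fst l ` {1..m})}"

lemma ppart_inj:
 assumes "s permutes X" "s' permutes X" "ppart X s = ppart X s'"
 shows "s = s'"
proof
 fix x show "s x = s' x"
 proof (cases "x \<in> X")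
  case True
  hence "{Inl x, Inr (s x)} \<in> ppart X s'" using assms(3) unfolding ppart_def by blast
  then obtain z where "{Inl x, Inr (s x)} = {Inl z, Inr (s' z)}" unfolding ppart_def by blast
  thus ?thesis by (auto simp: doubleton_eq_iff)
 next
  case False thus ?thesis using assms(1,2) by (simp add: permutes_def)
 qed
qed

text \<open>
By \<open>perm_of_comp\<close> only permutations of \<open>X\<close> can map a good partition to itself under the projector, and they preserve each leg because the projector does not connect different legs.
\<close>
lemma good_state_diagonal:
 fixes t :: "'k::field"
 assumes P: "leg_obj t m X L p" and g: "good_state m X L \<beta>"
 shows "comp0 t {} X X p (basis0 \<beta>) \<beta> = (\<Sum>s\<in>leg_perms m X L. if rename s \<beta> = \<beta> then p (ppart X s) else 0)"
proof -
 note P' = leg_objD[OF P]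
 have b: "\<beta> \<in> sparts {} X" using g by (simp add: good_state_def)
 have perm: "s permutes X" if "s \<in> leg_perms m X L" for s using that by (simp add: leg_perms_def)
 have "comp0 t {} X X p (basis0 \<beta>) \<beta> = (\<Sum>\<pi>\<in>sparts X X. if spart_comp \<beta> \<pi> = \<beta> then p \<pi> * t ^ loops \<beta> \<pi> else 0)"
  using P'(9) by (simp add: comp0_basis_right[OF b])
 also have "... = (\<Sum>\<pi>\<in>ppart X ` leg_perms m X L. if spart_comp \<beta> \<pi> = \<beta> then p \<pi> * t ^ loops \<beta> \<pi> else 0)"
 proof (rule sum.mono_neutral_right)
  show "finite (sparts X X)" by (rule finite_sparts) (use P'(9) in auto)
  show "ppart X ` leg_perms m X L \<subseteq> sparts X X"
   using ppart_sparts permutes_imp_bij perm by blast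
  show "\<forall>\<pi>\<in>sparts X X - ppart X ` leg_perms m X L. (if spart_comp \<beta> \<pi> = \<beta> then p \<pi> * t ^ loops \<beta> \<pi> else 0) = 0"
  proof (rule ballI, rule ccontr)
   fix \<pi> assume pi: "\<pi> \<in> sparts X X - ppart X ` leg_perms m X L"
    and nz: "(if spart_comp \<beta> \<pi> = \<beta> then p \<pi> * t ^ loops \<beta> \<pi> else 0) \<noteq> 0"
   have c: "spart_comp \<beta> \<pi> = \<beta>" and p0: "p \<pi> \<noteq> 0" using nz by (auto split: if_splits)
   have "\<exists>s. s permutes X \<and> \<pi> = ppart X s"
   proof (rule perm_of_comp[OF P'(9) b])
    show "\<pi> \<in> sparts X X" using pi by simp
    show "{Inr x} \<notin> spart_comp \<beta> \<pi>" if "x \<in> X" for x using g that unfolding c good_state_def by blast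
    fix B C x y assume h: "B \<in> \<pi>" "Inr x \<in> B" "Inr y \<in> B" "C \<in> spart_comp \<beta> \<pi>" "Inr x \<in> C" "Inr y \<in> C"
    obtain l where l: "l \<in> set L" "B \<subseteq> fst l ` {1..m} <+> fst l ` {1..m}" using P'(7)[OF _ p0 h(1)] pi by blast
    hence "x \<in> fst l ` {1..m}" "y \<in> fst l ` {1..m}" using h(2,3) by auto
    then obtain a a' where "a \<in> {1..m}" "x = fst l a" "a' \<in> {1..m}" "y = fst l a'" by blast
    thus "x = y" using g l(1) h(4-6) unfolding c good_state_def by blast
   qed
   then obtain s where s: "s permutes X" "\<pi> = ppart X s" by blast
   have "s \<in> leg_perms m X L" unfolding leg_perms_def
   proof (rule CollectI, rule conjI[OF s(1)], rule ballI)
    fix x assume "x \<in> X"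
    hence "{Inl x, Inr (s x)} \<in> \<pi>" unfolding s(2) ppart_def by blast
    then obtain l where "l \<in> set L" "{Inl x, Inr (s x)} \<subseteq> fst l ` {1..m} <+> fst l ` {1..m}" using P'(7)[OF _ p0] pi by blast
    thus "\<exists>l\<in>set L. x \<in> fst l ` {1..m} \<and> s x \<in> fst l ` {1..m}" by auto
   qed
   thus False using pi s(2) by blast
  qed
 qed
 also have "... = (\<Sum>s\<in>leg_perms m X L. if spart_comp \<beta> (ppart X s) = \<beta> then p (ppart X s) * t ^ loops \<beta> (ppart X s) else 0)"
  by (rule sum.reindex[unfolded o_def]) (auto intro!: inj_onI ppart_inj dest: perm)
 also have "... = (\<Sum>s\<in>leg_perms m X L. if rename s \<beta> = \<beta> then p (ppart X s) else 0)"
  by (rule sum.cong[OF refl]) (use spart_comp_ppart_right[OF perm b P'(9)] in simp)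
 finally show ?thesis .
qed

definition leg_lift :: "nat => nat set => 'k leg list => (nat => nat => nat) => nat => nat" where
 "leg_lift m X L \<sigma> x = (if x \<in> X then leg_pt L (fam_perm \<sigma> (the_inv_into ({..<length L} \<times> {1..m}) (leg_pt L) x)) else x)"

lemma leg_lift:
 assumes d: "distinct (leg_points m L)" and X: "X = set (leg_points m L)"
  and \<sigma>: "\<sigma> \<in> {..<length L} \<rightarrow>\<^sub>E Sym m"
 shows "\<And>i a. i < length L ==> a \<in> {1..m} ==> leg_lift m X L \<sigma> (fst (L ! i) a) = fst (L ! i) (\<sigma> i a)"
  and "leg_lift m X L \<sigma> permutes X" and "leg_lift m X L \<sigma> \<in> leg_perms m X L"
proof -
 let ?Z = "{..<length L} \<times> {1..m}"
 note bij = leg_pt_bij[OF d, folded X]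
 have inj: "inj_on (leg_pt L) ?Z" using bij by (simp add: bij_betw_def)
 have im: "leg_pt L ` ?Z = X" using bij by (simp add: bij_betw_def)
 have perm: "\<sigma> i permutes {1..m}" if "i < length L" for i using PiE_mem[OF \<sigma>, of i] that by (simp add: Sym_def)
 show val: "leg_lift m X L \<sigma> (fst (L ! i) a) = fst (L ! i) (\<sigma> i a)" if "i < length L" "a \<in> {1..m}" for i a
 proof -
  have z: "(i, a) \<in> ?Z" using that by simp
  have "fst (L ! i) a \<in> X" using im z by force
  moreover have "the_inv_into ?Z (leg_pt L) (fst (L ! i) a) = (i, a)" using the_inv_into_f_f[OF inj z] by simp
  ultimately show ?thesis by (simp add: leg_lift_def)
 qed
 have xE: "\<exists>i a. i < length L \<and> a \<in> {1..m} \<and> x = fst (L ! i) a" if "x \<in> X" for x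
 proof -
  obtain z where z: "z \<in> ?Z" "x = leg_pt L z" using \<open>x \<in> X\<close> unfolding im[symmetric] by blast
  obtain i a where "z = (i, a)" by (cases z)
  thus ?thesis using z by (intro exI[of _ i] exI[of _ a]) simp
 qed
 have ptX: "fst (L ! i) a \<in> X" if "i < length L" "a \<in> {1..m}" for i a using im that by force
 have mem: "\<sigma> i a \<in> {1..m}" if "i < length L" "a \<in> {1..m}" for i a using permutes_in_image[OF perm[OF that(1)]] that(2) by blast
 show p: "leg_lift m X L \<sigma> permutes X"
 proof (rule bij_imp_permutes)
  have i: "inj_on (leg_lift m X L \<sigma>) X"
  proof (rule inj_onI)
   fix x y assume xy: "x \<in> X" "y \<in> X" "leg_lift m X L \<sigma> x = leg_lift m X L \<sigma> y"
   obtain i a where x: "i < length L" "a \<in> {1..m}" "x = fst (L ! i) a" using xE[OF xy(1)] by blast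
   obtain j b where y: "j < length L" "b \<in> {1..m}" "y = fst (L ! j) b" using xE[OF xy(2)] by blast
   have "fst (L ! i) (\<sigma> i a) = fst (L ! j) (\<sigma> j b)" using xy(3) val[OF x(1,2)] val[OF y(1,2)] x(3) y(3) by simp
   hence "i = j \<and> \<sigma> i a = \<sigma> j b" by (rule leg_points_inj[OF d x(1) y(1) mem[OF x(1,2)] mem[OF y(1,2)]])
   thus "x = y" using permutes_inj[OF perm[OF x(1)]] x(3) y(3) by (auto dest: injD)
  qed
  have "leg_lift m X L \<sigma> ` X = X"
  proof (rule endo_inj_surj[OF _ _ i])
   show "leg_lift m X L \<sigma> ` X \<subseteq> X"
   proof
    fix y assume "y \<in> leg_lift m X L \<sigma> ` X"
    then obtain i a where x: "i < length L" "a \<in> {1..m}" "y = leg_lift m X L \<sigma> (fst (L ! i) a)" using xE by blast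
    show "y \<in> X" unfolding x(3) val[OF x(1,2)] by (rule ptX[OF x(1) mem[OF x(1,2)]])
   qed
  qed (simp add: X)
  thus "bij_betw (leg_lift m X L \<sigma>) X X" using i by (simp add: bij_betw_def)
 qed (simp add: leg_lift_def)
 show "leg_lift m X L \<sigma> \<in> leg_perms m X L" unfolding leg_perms_def
 proof (rule CollectI, rule conjI[OF p], rule ballI)
  fix x assume "x \<in> X"
  then obtain i a where x: "i < length L" "a \<in> {1..m}" "x = fst (L ! i) a" using xE by blast
  show "\<exists>l\<in>set L. x \<in> fst l ` {1..m} \<and> leg_lift m X L \<sigma> x \<in> fst l ` {1..m}"
   by (rule bexI[OF _ nth_mem[OF x(1)]]) (use x val[OF x(1,2)] mem[OF x(1,2)] in auto)
 qed
qed

lemma leg_lift_bij: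
 assumes d: "distinct (leg_points m L)" and X: "X = set (leg_points m L)"
 shows "bij_betw (leg_lift m X L) ({..<length L} \<rightarrow>\<^sub>E Sym m) (leg_perms m X L)"
proof (rule bij_betw_imageI)
 note lift = leg_lift[OF d X]
 show "inj_on (leg_lift m X L) ({..<length L} \<rightarrow>\<^sub>E Sym m)"
 proof (rule inj_onI)
  fix \<sigma> \<tau> assume s: "\<sigma> \<in> {..<length L} \<rightarrow>\<^sub>E Sym m" and t: "\<tau> \<in> {..<length L} \<rightarrow>\<^sub>E Sym m"
   and e: "leg_lift m X L \<sigma> = leg_lift m X L \<tau>"
  show "\<sigma> = \<tau>"
  proof (rule PiE_ext[OF s t])
   fix i assume "i \<in> {..<length L}"
   hence i: "i < length L" by simp
   have p: "\<sigma> i permutes {1..m}" "\<tau> i permutes {1..m}" using PiE_mem[OF s, of i] PiE_mem[OF t, of i] i by (auto simp: Sym_def)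
   show "\<sigma> i = \<tau> i"
   proof
    fix a show "\<sigma> i a = \<tau> i a"
    proof (cases "a \<in> {1..m}")
     case True
     have "fst (L ! i) (\<sigma> i a) = fst (L ! i) (\<tau> i a)" using lift(1)[OF s i True] lift(1)[OF t i True] e by simp
     moreover have "\<sigma> i a \<in> {1..m}" "\<tau> i a \<in> {1..m}" using permutes_in_image[OF p(1)] permutes_in_image[OF p(2)] True by blast+
     ultimately show ?thesis using leg_points_inj[OF d i i] by blast
    next
     case False thus ?thesis using p by (simp add: permutes_def)
    qed
   qed
  qed
 qed
 show "leg_lift m X L ` ({..<length L} \<rightarrow>\<^sub>E Sym m) = leg_perms m X L"
 proof (intro equalityI subsetI)
  fix s assume "s \<in> leg_lift m X L ` ({..<length L} \<rightarrow>\<^sub>E Sym m)"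
  thus "s \<in> leg_perms m X L" using lift(3) by blast
 next
  fix s assume s: "s \<in> leg_perms m X L"
  hence sp: "s permutes X" by (simp add: leg_perms_def)
  have ex: "\<exists>b\<in>{1..m}. s (fst (L ! i) a) = fst (L ! i) b" if i: "i < length L" and a: "a \<in> {1..m}" for i a
  proof -
   have "fst (L ! i) a \<in> X" unfolding X by (rule leg_points_mem[OF nth_mem[OF i] a])
   then obtain l where l: "l \<in> set L" "fst (L ! i) a \<in> fst l ` {1..m}" "s (fst (L ! i) a) \<in> fst l ` {1..m}"
    using s unfolding leg_perms_def by blast
   obtain j where j: "j < length L" "L ! j = l" using l(1) by (auto simp: in_set_conv_nth)
   obtain c where c: "c \<in> {1..m}" "fst (L ! i) a = fst (L ! j) c" using l(2) j(2) by blast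
   have "i = j" using leg_points_inj[OF d i j(1) a c] by simp
   thus ?thesis using l(3) j(2) by blast
  qed
  define \<sigma> where "\<sigma> = (\<lambda>i\<in>{..<length L}. %a. if a \<in> {1..m} then SOME b. b \<in> {1..m} \<and> s (fst (L ! i) a) = fst (L ! i) b else a)"
  have sg: "\<sigma> i a \<in> {1..m} \<and> s (fst (L ! i) a) = fst (L ! i) (\<sigma> i a)" if i: "i < length L" and a: "a \<in> {1..m}" for i a
  proof -
   have "\<exists>b. b \<in> {1..m} \<and> s (fst (L ! i) a) = fst (L ! i) b" using ex[OF i a] by blast
   from someI_ex[OF this] show ?thesis using i a by (simp add: \<sigma>_def)
  qed
  have mem: "\<sigma> \<in> {..<length L} \<rightarrow>\<^sub>E Sym m"
  proof (rule PiE_I)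
   fix i assume "i \<in> {..<length L}"
   hence i: "i < length L" by simp
   have inj: "inj_on (\<sigma> i) {1..m}"
   proof (rule inj_onI)
    fix a b assume ab: "a \<in> {1..m}" "b \<in> {1..m}" "\<sigma> i a = \<sigma> i b"
    hence "s (fst (L ! i) a) = s (fst (L ! i) b)" using sg[OF i] by metis
    hence "fst (L ! i) a = fst (L ! i) b" using permutes_inj[OF sp] by (auto dest: injD)
    thus "a = b" using leg_points_inj[OF d i i ab(1,2)] by simp
   qed
   have "\<sigma> i ` {1..m} = {1..m}" by (rule endo_inj_surj[OF _ _ inj]) (use sg[OF i] in auto)
   hence "\<sigma> i permutes {1..m}" by (intro bij_imp_permutes) (use inj i in \<open>auto simp: bij_betw_def \<sigma>_def\<close>)
   thus "\<sigma> i \<in> Sym m" by (simp add: Sym_def)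
  qed (simp add: \<sigma>_def)
  have "leg_lift m X L \<sigma> = s"
  proof
   fix x show "leg_lift m X L \<sigma> x = s x"
   proof (cases "x \<in> X")
    case True
    then obtain l a where la: "l \<in> set L" "a \<in> {1..m}" "x = fst l a" using leg_points_memE[of x m L] X by blast
    then obtain i where i: "i < length L" "L ! i = l" by (auto simp: in_set_conv_nth)
    show ?thesis using lift(1)[OF mem i(1) la(2)] sg[OF i(1) la(2)] la(3) i(2) by simp
   next
    case False thus ?thesis using sp by (simp add: leg_lift_def permutes_def)
   qed
  qed
  thus "s \<in> leg_lift m X L ` ({..<length L} \<rightarrow>\<^sub>E Sym m)" using mem by blast
 qed
qed

lemma leg_lift_value:
 fixes t :: "'k::field"
 assumes P: "leg_obj t m X L p" and \<sigma>: "\<sigma> \<in> {..<length L} \<rightarrow>\<^sub>E Sym m"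
 shows "p (ppart X (leg_lift m X L \<sigma>)) = (\<Prod>i<length L. snd (L ! i) (perm_part m (\<sigma> i)))"
proof -
 note P' = leg_objD[OF P]
 note lift = leg_lift[OF P'(2,1) \<sigma>]
 let ?ss = "map \<sigma> [0..<length L]"
 have "legs_perm m L ?ss (leg_lift m X L \<sigma>)" unfolding legs_perm_def list_all2_conv_all_nth
  using lift(1) PiE_mem[OF \<sigma>] by simp
 hence "p (ppart X (leg_lift m X L \<sigma>)) = prod_list (map2 (%l \<sigma>. snd l (perm_part m \<sigma>)) L ?ss)"
  by (rule P'(8)[OF permutes_imp_bij[OF lift(2)]])
 also have "... = (\<Prod>i<length L. snd (L ! i) (perm_part m (\<sigma> i)))"
  unfolding prod.list_conv_set_nth by (simp add: atLeast0LessThan)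
 finally show ?thesis .
qed

lemma inj_on_image_image:
 assumes "inj_on h Z"
 shows "inj_on (%D. (`) h ` D) (Pow (Pow Z))"
 by (rule inj_on_image_Pow[OF inj_on_image_Pow[OF assms]])

lemma partition_image:
 assumes h: "inj_on h Z" and D: "partition_on Z D"
 shows "partition_on (h ` Z) ((`) h ` D)"
proof -
 have "partition_on (h ` Z) ((`) h ` D - {{}})" by (rule partition_on_inj_image[OF D h])
 moreover have "{} \<notin> (`) h ` D" using partition_onD3[OF D] by auto
 ultimately show ?thesis by simp
qed

text \<open>
Under the bijection of \<open>X\<close> with \<open>k\<close> copies of \<open>{1..m}\<close>, good partitions fixed by the permutation are the stable transversal partitions without singletons.
\<close>
lemma card_good_states:
 assumes d: "distinct (leg_points m L)" and X: "X = set (leg_points m L)"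
  and \<sigma>: "\<sigma> \<in> {..<length L} \<rightarrow>\<^sub>E Sym m"
 shows "card {\<beta>. good_state m X L \<beta> \<and> rename (leg_lift m X L \<sigma>) \<beta> = \<beta>} = card (good_parts {..<length L} {1..m} \<sigma>)"
proof -
 let ?Z = "{..<length L} \<times> {1..m}" and ?s = "leg_lift m X L \<sigma>"
 let ?G = "{\<beta>. good_state m X L \<beta> \<and> rename ?s \<beta> = \<beta>}"
 define h :: "nat \<times> nat => nat + nat" where "h = (%z. Inr (leg_pt L z))"
 note bij = leg_pt_bij[OF d, folded X] and lift = leg_lift[OF d X \<sigma>]
 have inj0: "inj_on (leg_pt L) ?Z" using bij by (simp add: bij_betw_def)
 have inj: "inj_on h ?Z" unfolding h_def by (rule inj_onI) (use inj_onD[OF inj0] in simp)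
 have im0: "leg_pt L ` ?Z = X" using bij by (simp add: bij_betw_def)
 have im: "h ` ?Z = {} <+> X" unfolding h_def Plus_def im0[symmetric] image_image by simp
 have hi: "h (i, a) = Inr (fst (L ! i) a)" for i a by (simp add: h_def)
 have fam: "fam_perm \<sigma> z \<in> ?Z" if z: "z \<in> ?Z" for z
 proof -
  obtain i a where ia: "z = (i, a)" "i < length L" "a \<in> {1..m}" using z by auto
  have p: "\<sigma> i permutes {1..m}" using PiE_mem[OF \<sigma>, of i] ia(2) by (simp add: Sym_def)
  have "\<sigma> i a \<in> {1..m}" using iffD2[OF permutes_in_image[OF p] ia(3)] .
  thus ?thesis using ia by simp
 qed
 have com: "map_sum id ?s (h z) = h (fam_perm \<sigma> z)" if z: "z \<in> ?Z" for z
 proof -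
  obtain i a where ia: "z = (i, a)" "i < length L" "a \<in> {1..m}" using z by auto
  show ?thesis unfolding ia(1) fam_perm_simp hi using lift(1)[OF ia(2,3)] by simp
 qed
 have ren: "rename ?s ((`) h ` D) = (`) h ` ((`) (fam_perm \<sigma>) ` D)" if D: "D \<subseteq> Pow ?Z" for D
 proof -
  have "map_sum id ?s ` h ` B = h ` fam_perm \<sigma> ` B" if "B \<in> D" for B
   unfolding image_image by (rule image_cong[OF refl com]) (use that D in blast)
  thus ?thesis unfolding rename_def by (simp add: image_image cong: image_cong)
 qed
 have inh: "h z \<in> h ` B \<longleftrightarrow> z \<in> B" if "z \<in> ?Z" "B \<subseteq> ?Z" for z B
  by (rule inj_on_image_mem_iff[OF inj that])
 have iff: "good_state m X L ((`) h ` D) \<and> rename ?s ((`) h ` D) = (`) h ` D \<longleftrightarrow> D \<in> good_parts {..<length L} {1..m} \<sigma>"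
  if D: "partition_on ?Z D" for D
 proof -
  have DP: "D \<subseteq> Pow ?Z" using partition_subset[OF D] by blast
  have FP: "(`) (fam_perm \<sigma>) ` D \<subseteq> Pow ?Z" using DP fam by blast
  have 1: "rename ?s ((`) h ` D) = (`) h ` D \<longleftrightarrow> (`) (fam_perm \<sigma>) ` D = D"
   unfolding ren[OF DP]
  proof
   assume e: "(`) h ` (`) (fam_perm \<sigma>) ` D = (`) h ` D"
   show "(`) (fam_perm \<sigma>) ` D = D" by (rule inj_onD[OF inj_on_image_image[OF inj] e]) (use FP DP in blast)+
  qed (simp only:)
  have 2: "(`) h ` D \<in> sparts {} X" using partition_image[OF inj D] unfolding sparts_def im by (rule CollectI)
  have s: "{h z} \<in> (`) h ` D \<longleftrightarrow> {z} \<in> D" if z: "z \<in> ?Z" for z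
  proof
   assume "{h z} \<in> (`) h ` D"
   then obtain B where B: "B \<in> D" "{h z} = h ` B" by blast
   have "h ` {z} = h ` B" using B(2) by simp
   hence "{z} = B" using inj_on_image_eq_iff[OF inj, of "{z}" B] z B(1) DP by blast
   thus "{z} \<in> D" using B(1) by simp
  next
   assume "{z} \<in> D"
   hence "h ` {z} \<in> (`) h ` D" by blast
   thus "{h z} \<in> (`) h ` D" by simp
  qed
  have 3: "(\<forall>x\<in>X. {Inr x} \<notin> (`) h ` D) \<longleftrightarrow> (\<forall>z\<in>?Z. {z} \<notin> D)"
  proof -
   have "(\<forall>x\<in>X. {Inr x} \<notin> (`) h ` D) \<longleftrightarrow> (\<forall>z\<in>?Z. {h z} \<notin> (`) h ` D)" unfolding im0[symmetric] h_def by simp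
   also have "... \<longleftrightarrow> (\<forall>z\<in>?Z. {z} \<notin> D)" by (rule ball_cong[OF refl]) (simp only: s)
   finally show ?thesis .
  qed
  have 4: "(\<forall>B\<in>(`) h ` D. \<forall>l\<in>set L. \<forall>a\<in>{1..m}. \<forall>b\<in>{1..m}. Inr (fst l a) \<in> B \<longrightarrow> Inr (fst l b) \<in> B \<longrightarrow> a = b)
   \<longleftrightarrow> (\<forall>B\<in>D. inj_on fst B)" (is "?l \<longleftrightarrow> ?r")
  proof
   assume L: ?l
   show ?r
   proof (intro ballI inj_onI)
    fix B u v assume B: "B \<in> D" and u: "u \<in> B" and v: "v \<in> B" and e: "fst u = fst v"
    have "u \<in> ?Z" "v \<in> ?Z" using B u v DP by blast+
    then obtain i a b where uv: "u = (i, a)" "v = (i, b)" "i < length L" "a \<in> {1..m}" "b \<in> {1..m}" using e by (cases u, cases v) auto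
    have hu: "Inr (fst (L ! i) a) \<in> h ` B" "Inr (fst (L ! i) b) \<in> h ` B"
     using imageI[OF u, of h] imageI[OF v, of h] unfolding uv(1,2) hi .
    have "a = b" by (rule L[rule_format, OF imageI[OF B] nth_mem[OF uv(3)] uv(4,5) hu])
    thus "u = v" by (simp add: uv)
   qed
  next
   assume R: ?r
   show ?l
   proof (intro ballI impI)
    fix C l a b assume C: "C \<in> (`) h ` D" and l: "l \<in> set L" and a: "a \<in> {1..m}" and b: "b \<in> {1..m}"
     and m: "Inr (fst l a) \<in> C" "Inr (fst l b) \<in> C"
    obtain B where B: "B \<in> D" "C = h ` B" using C by blast
    obtain i where i: "i < length L" "L ! i = l" using l by (auto simp: in_set_conv_nth)
    have z: "(i, a) \<in> ?Z" "(i, b) \<in> ?Z" "B \<subseteq> ?Z" using i a b B(1) DP by auto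
    have "h (i, a) \<in> h ` B" "h (i, b) \<in> h ` B" using m unfolding hi i(2) B(2) .
    hence ab: "(i, a) \<in> B" "(i, b) \<in> B" using inh[OF z(1,3)] inh[OF z(2,3)] by blast+
    have "inj_on fst B" using R B(1) by blast
    from inj_onD[OF this _ ab] show "a = b" by simp
   qed
  qed
  show ?thesis unfolding good_state_def good_parts_def transv_def mem_Collect_eq 1 3 4 using 2 D by blast
 qed
 have "bij_betw (%D. (`) h ` D) (good_parts {..<length L} {1..m} \<sigma>) ?G"
 proof (rule bij_betw_imageI)
  have part: "partition_on ?Z D" if "D \<in> good_parts {..<length L} {1..m} \<sigma>" for D
   using that by (simp add: good_parts_def transv_def)
  have "good_parts {..<length L} {1..m} \<sigma> \<subseteq> Pow (Pow ?Z)" using part partition_subset by blast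
  thus "inj_on (%D. (`) h ` D) (good_parts {..<length L} {1..m} \<sigma>)"
   by (rule inj_on_subset[OF inj_on_image_image[OF inj]])
  show "(%D. (`) h ` D) ` good_parts {..<length L} {1..m} \<sigma> = ?G"
  proof (intro equalityI subsetI)
   fix \<beta> assume "\<beta> \<in> (%D. (`) h ` D) ` good_parts {..<length L} {1..m} \<sigma>"
   then obtain D where D: "D \<in> good_parts {..<length L} {1..m} \<sigma>" "\<beta> = (`) h ` D" by blast
   show "\<beta> \<in> ?G" using iff[OF part[OF D(1)]] D by simp
  next
   fix \<beta> assume b: "\<beta> \<in> ?G"
   hence bs: "partition_on (h ` ?Z) \<beta>" unfolding im by (simp add: good_state_def sparts_def)
   let ?g = "the_inv_into ?Z h"
   define D where "D = (`) ?g ` \<beta>"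
   have "partition_on (?g ` h ` ?Z) D" unfolding D_def
    by (rule partition_image[OF _ bs]) (rule inj_on_the_inv_into[OF inj])
   moreover have "?g ` h ` ?Z = (%z. z) ` ?Z" unfolding image_image by (rule image_cong[OF refl the_inv_into_f_f[OF inj]])
   ultimately have D: "partition_on ?Z D" by (simp only: image_ident)
   have "h ` ?g ` B = B" if "B \<in> \<beta>" for B
   proof -
    have "h (?g u) = u" if "u \<in> B" for u
     by (rule f_the_inv_into_f[OF inj]) (use partition_subset[OF bs \<open>B \<in> \<beta>\<close>] that in blast)
    thus ?thesis unfolding image_image by simp
   qed
   hence e: "(`) h ` D = \<beta>" unfolding D_def image_image by simp
   have "D \<in> good_parts {..<length L} {1..m} \<sigma>" using iff[OF D] b unfolding e by simp
   thus "\<beta> \<in> (%D. (`) h ` D) ` good_parts {..<length L} {1..m} \<sigma>" using e by blast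
  qed
 qed
 from bij_betw_same_card[OF this] show ?thesis by simp
qed

theorem leg_obj_dim:
 fixes t :: "'k::field"
 assumes t: "t \<noteq> 0" and P: "leg_obj t m X L p"
 shows "(of_nat (vector_space.dim scale_mor (Hom (Rep_S t) (Unit (Rep_S t)) ([X], emb p))) :: 'k)
  = (\<Sum>\<sigma>\<in>{..<length L} \<rightarrow>\<^sub>E Sym m. (\<Prod>i<length L. snd (L ! i) (perm_part m (\<sigma> i)))
     * of_nat (card (good_parts {..<length L} {1..m} \<sigma>)))"
proof -
 note P' = leg_objD[OF P]
 let ?G = "{\<beta>. good_state m X L \<beta>}"
 have fS: "finite (sparts {} X)" by (rule finite_sparts) (use P'(9) in auto)
 have G: "?G \<subseteq> sparts {} X" by (auto simp: good_state_def)
 have fG: "finite ?G" by (rule finite_subset[OF G fS])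
 have "(of_nat (vector_space.dim scale_mor (Hom (Rep_S t) (Unit (Rep_S t)) ([X], emb p))) :: 'k)
  = (\<Sum>\<beta>\<in>sparts {} X. comp0 t {} X X p (basis0 \<beta>) \<beta>)" by (rule of_nat_dim_hom[OF P'(9,4)])
 also have "... = (\<Sum>\<beta>\<in>?G. comp0 t {} X X p (basis0 \<beta>) \<beta>)"
  by (rule sum.mono_neutral_right[OF fS G]) (use not_good_state_zero[OF t P] in \<open>simp add: zero_fun_def\<close>)
 also have "... = (\<Sum>\<beta>\<in>?G. \<Sum>s\<in>leg_perms m X L. if rename s \<beta> = \<beta> then p (ppart X s) else 0)"
  by (rule sum.cong[OF refl]) (simp add: good_state_diagonal[OF P])
 also have "... = (\<Sum>s\<in>leg_perms m X L. \<Sum>\<beta>\<in>?G. if rename s \<beta> = \<beta> then p (ppart X s) else 0)" by (rule sum.swap)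
 also have "... = (\<Sum>s\<in>leg_perms m X L. p (ppart X s) * of_nat (card {\<beta>. good_state m X L \<beta> \<and> rename s \<beta> = \<beta>}))"
 proof (rule sum.cong[OF refl])
  fix s
  have "(\<Sum>\<beta>\<in>?G. if rename s \<beta> = \<beta> then p (ppart X s) else 0) = (\<Sum>\<beta>\<in>{\<beta> \<in> ?G. rename s \<beta> = \<beta>}. p (ppart X s))"
   by (rule sum.inter_filter[OF fG, symmetric])
  thus "(\<Sum>\<beta>\<in>?G. if rename s \<beta> = \<beta> then p (ppart X s) else 0) = p (ppart X s) * of_nat (card {\<beta>. good_state m X L \<beta> \<and> rename s \<beta> = \<beta>})"
   by (simp add: mult.commute)
 qed
 also have "... = (\<Sum>\<sigma>\<in>{..<length L} \<rightarrow>\<^sub>E Sym m. p (ppart X (leg_lift m X L \<sigma>)) *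
   of_nat (card {\<beta>. good_state m X L \<beta> \<and> rename (leg_lift m X L \<sigma>) \<beta> = \<beta>}))"
  by (rule sum.reindex_bij_betw[OF leg_lift_bij[OF P'(2,1)], symmetric])
 also have "... = (\<Sum>\<sigma>\<in>{..<length L} \<rightarrow>\<^sub>E Sym m. (\<Prod>i<length L. snd (L ! i) (perm_part m (\<sigma> i)))
     * of_nat (card (good_parts {..<length L} {1..m} \<sigma>)))"
  by (rule sum.cong[OF refl]) (simp only: leg_lift_value[OF P] card_good_states[OF P'(2,1)])
 finally show ?thesis .
qed

section \<open>The ideal of maps through smaller sets\<close>

text \<open>
The map that forgets the point \<open>x\<close>; it and its transpose factor the cut at \<open>x\<close> through \<open>X - {x}\<close>.
\<close>
definition coll :: "nat set => nat => spart" where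
 "coll X x = insert {Inl x} ((%z. {Inl z, Inr z}) ` (X - {x}))"

lemma coll_sparts: "x \<in> X ==> coll X x \<in> sparts X (X - {x})"
 unfolding sparts_def coll_def partition_on_def disjoint_def by auto

lemma saturated_coll:
 assumes "x \<in> X" "S \<subseteq> X" "T \<subseteq> X - {x}"
 shows "saturated (coll X x) (S <+> T) \<longleftrightarrow> T = S - {x}"
proof -
 have "saturated (coll X x) (S <+> T) \<longleftrightarrow> (\<forall>z\<in>X - {x}. z \<in> S \<longleftrightarrow> z \<in> T)"
  unfolding coll_def saturated_insert saturated_pairs by simp
 also have "... \<longleftrightarrow> T = S - {x}" using assms by blast
 finally show ?thesis .
qed

lemma cut_factors:
 assumes x: "x \<in> X" and X: "finite X"
 shows "spart_comp (coll X x) (flip (coll X x)) = cut X x"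
proof -
 note c = coll_sparts[OF x] and c' = flip_sparts[OF coll_sparts[OF x]]
 show ?thesis
 proof (rule partition_eqI_saturated[OF spartsD[OF spart_comp_in_sparts[OF c c']] spartsD[OF cut_sparts[OF x]]])
  fix W assume "W \<subseteq> X <+> X"
  then obtain S U where W: "S \<subseteq> X" "U \<subseteq> X" "W = S <+> U" using Plus_decompose[of W X X] by blast
  have "saturated (spart_comp (coll X x) (flip (coll X x))) (S <+> U) \<longleftrightarrow>
   (\<exists>T\<subseteq>X - {x}. saturated (coll X x) (S <+> T) \<and> saturated (flip (coll X x)) (T <+> U))"
   by (rule saturated_spart_comp[OF c c']) (use X W in auto)
  also have "... \<longleftrightarrow> (\<exists>T\<subseteq>X - {x}. T = S - {x} \<and> T = U - {x})"
   by (simp add: saturated_flip saturated_coll[OF x] W cong: conj_cong)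
  also have "... \<longleftrightarrow> U - {x} = S - {x}" using W(1) by auto
  finally show "saturated (spart_comp (coll X x) (flip (coll X x))) W \<longleftrightarrow> saturated (cut X x) W"
   unfolding W(3) by (simp only: saturated_cut[OF x W(1,2)])
 qed
qed

text \<open>
Cutting off \<open>x\<close> between two merges loses nothing, since \<open>x\<close> remains connected to \<open>y\<close>.  So a merge lies in every ideal that contains a cut.
\<close>
lemma merge_factors:
 assumes x: "x \<in> X" and y: "y \<in> X" and xy: "x \<noteq> y" and X: "finite X"
 shows "spart_comp (spart_comp (merge X x y) (cut X x)) (merge X x y) = merge X x y"
proof -
 note m = merge_sparts[OF x y] and c = cut_sparts[OF x]
 note mc = spart_comp_in_sparts[OF m c]
 show ?thesis
 proof (rule partition_eqI_saturated[OF spartsD[OF spart_comp_in_sparts[OF mc m]] spartsD[OF m]])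
  fix W assume "W \<subseteq> X <+> X"
  then obtain S U where W: "S \<subseteq> X" "U \<subseteq> X" "W = S <+> U" using Plus_decompose[of W X X] by blast
  have mcs: "saturated (spart_comp (merge X x y) (cut X x)) (S <+> T) \<longleftrightarrow> (x \<in> S \<longleftrightarrow> y \<in> S) \<and> T - {x} = S - {x}" if T: "T \<subseteq> X" for T
  proof -
   have "saturated (spart_comp (merge X x y) (cut X x)) (S <+> T) \<longleftrightarrow>
    (\<exists>V\<subseteq>X. saturated (merge X x y) (S <+> V) \<and> saturated (cut X x) (V <+> T))"
    by (rule saturated_spart_comp[OF m c]) (use X W T in auto)
   also have "... \<longleftrightarrow> (\<exists>V\<subseteq>X. (V = S \<and> (x \<in> S \<longleftrightarrow> y \<in> S)) \<and> T - {x} = V - {x})"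
    by (simp add: saturated_merge[OF x y] saturated_cut[OF x] W T cong: conj_cong)
   also have "... \<longleftrightarrow> (x \<in> S \<longleftrightarrow> y \<in> S) \<and> T - {x} = S - {x}" using W(1) by auto
   finally show ?thesis .
  qed
  have "saturated (spart_comp (spart_comp (merge X x y) (cut X x)) (merge X x y)) (S <+> U) \<longleftrightarrow>
   (\<exists>T\<subseteq>X. saturated (spart_comp (merge X x y) (cut X x)) (S <+> T) \<and> saturated (merge X x y) (T <+> U))"
   by (rule saturated_spart_comp[OF mc m]) (use X W in auto)
  also have "... \<longleftrightarrow> (\<exists>T\<subseteq>X. ((x \<in> S \<longleftrightarrow> y \<in> S) \<and> T - {x} = S - {x}) \<and> U = T \<and> (x \<in> T \<longleftrightarrow> y \<in> T))"
   by (simp add: saturated_merge[OF x y] mcs W cong: conj_cong)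
  also have "... \<longleftrightarrow> U = S \<and> (x \<in> S \<longleftrightarrow> y \<in> S)" using W xy by blast
  finally show "saturated (spart_comp (spart_comp (merge X x y) (cut X x)) (merge X x y)) W \<longleftrightarrow> saturated (merge X x y) W"
   unfolding W(3) by (simp only: saturated_merge[OF x y W(1,2)])
 qed
qed

lemma comp0_scale_left: "comp0 t X Y Z (%b. c * g b) f = (%d. c * comp0 t X Y Z g f d)"
 by (rule ext) (auto simp: comp0_def sum_distrib_left mult_ac intro!: sum.cong)

lemma comp0_sum_list_right: "comp0 t X Y Z g (sum_list fs) = sum_list (map (comp0 t X Y Z g) fs)"
 by (induction fs) (simp_all only: list.map sum_list.Nil sum_list.Cons comp0_0_right comp0_add_right)

lemma comp0_sum_list_left: "comp0 t X Y Z (sum_list gs) f = sum_list (map (%g. comp0 t X Y Z g f) gs)"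
 by (induction gs) (simp_all only: list.map sum_list.Nil sum_list.Cons comp0_0_left comp0_add_left)

definition ideal_gens :: "'k::field => nat => 'k mor0 set" where
 "ideal_gens t m = {comp0 t {1..m} Y {1..m} g f | g f Y. finite Y \<and> card Y < m \<and> f \<in> hom0 {1..m} Y \<and> g \<in> hom0 Y {1..m}}"

lemma factoring_ideal_gens: "factoring_ideal t m = {sum_list fs | fs. set fs \<subseteq> ideal_gens t m}"
 unfolding factoring_ideal_def ideal_gens_def ..

lemma ideal_gensE:
 assumes "h \<in> ideal_gens t m"
 obtains g f Y where "h = comp0 t {1..m} Y {1..m} g f" "finite Y" "card Y < m" "f \<in> hom0 {1..m} Y" "g \<in> hom0 Y {1..m}"
 using assms unfolding ideal_gens_def by blast

lemma ideal_gensI: "finite Y ==> card Y < m ==> f \<in> hom0 {1..m} Y ==> g \<in> hom0 Y {1..m} ==> comp0 t {1..m} Y {1..m} g f \<in> ideal_gens t m"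
 unfolding ideal_gens_def by blast

lemma factoring_ideal_gen: "h \<in> ideal_gens t m ==> h \<in> factoring_ideal t m"
 unfolding factoring_ideal_gens by (rule CollectI, rule exI[of _ "[h]"]) simp

lemma sum_list_gens_comp:
 assumes "\<And>h. h \<in> ideal_gens t m ==> F h \<in> ideal_gens t m" "set fs \<subseteq> ideal_gens t m"
 shows "sum_list (map F fs) \<in> factoring_ideal t m"
 unfolding factoring_ideal_gens by (rule CollectI, rule exI[of _ "map F fs"]) (use assms in auto)

lemma factoring_ideal_left:
 assumes "j \<in> factoring_ideal t m"
 shows "endo_comp t m h j \<in> factoring_ideal t m"
proof -
 obtain fs where fs: "j = sum_list fs" "set fs \<subseteq> ideal_gens t m" using assms unfolding factoring_ideal_gens by blast
 show ?thesis unfolding fs(1) comp0_sum_list_right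
 proof (rule sum_list_gens_comp[OF _ fs(2)])
  fix k assume "k \<in> ideal_gens t m"
  then obtain g f Y where k: "k = comp0 t {1..m} Y {1..m} g f" "finite Y" "card Y < m" "f \<in> hom0 {1..m} Y" "g \<in> hom0 Y {1..m}"
   by (rule ideal_gensE)
  have "endo_comp t m h k = comp0 t {1..m} Y {1..m} (comp0 t Y {1..m} {1..m} h g) f"
   unfolding k(1) by (rule comp0_assoc) (use k(2) in simp_all)
  also have "... \<in> ideal_gens t m" by (rule ideal_gensI) (use k in simp_all)
  finally show "endo_comp t m h k \<in> ideal_gens t m" .
 qed
qed

lemma factoring_ideal_right:
 assumes "j \<in> factoring_ideal t m"
 shows "endo_comp t m j h \<in> factoring_ideal t m"
proof -
 obtain fs where fs: "j = sum_list fs" "set fs \<subseteq> ideal_gens t m" using assms unfolding factoring_ideal_gens by blast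
 show ?thesis unfolding fs(1) comp0_sum_list_left
 proof (rule sum_list_gens_comp[OF _ fs(2)])
  fix k assume "k \<in> ideal_gens t m"
  then obtain g f Y where k: "k = comp0 t {1..m} Y {1..m} g f" "finite Y" "card Y < m" "f \<in> hom0 {1..m} Y" "g \<in> hom0 Y {1..m}"
   by (rule ideal_gensE)
  have "endo_comp t m k h = comp0 t {1..m} Y {1..m} g (comp0 t {1..m} {1..m} Y f h)"
   unfolding k(1) by (rule comp0_assoc[symmetric]) (use k(2) in simp_all)
  also have "... \<in> ideal_gens t m" by (rule ideal_gensI) (use k in simp_all)
  finally show "endo_comp t m k h \<in> ideal_gens t m" .
 qed
qed

lemma factoring_ideal_scale:
 assumes "j \<in> factoring_ideal t m"
 shows "(%d. c * j d) \<in> factoring_ideal t m"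
proof -
 obtain fs where fs: "j = sum_list fs" "set fs \<subseteq> ideal_gens t m" using assms unfolding factoring_ideal_gens by blast
 have "(%d. c * sum_list fs d) = sum_list (map (%f d. c * f d) fs)"
  by (induction fs) (auto simp: fun_eq_iff algebra_simps)
 also have "... \<in> factoring_ideal t m"
 proof (rule sum_list_gens_comp[OF _ fs(2)])
  fix k assume "k \<in> ideal_gens t m"
  then obtain g f Y where k: "k = comp0 t {1..m} Y {1..m} g f" "finite Y" "card Y < m" "f \<in> hom0 {1..m} Y" "g \<in> hom0 Y {1..m}"
   by (rule ideal_gensE)
  have "(%d. c * k d) = comp0 t {1..m} Y {1..m} (%b. c * g b) f" unfolding k(1) comp0_scale_left ..
  also have "... \<in> ideal_gens t m" by (rule ideal_gensI) (use k in \<open>simp_all add: hom0_def\<close>)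
  finally show "(%d. c * k d) \<in> ideal_gens t m" .
 qed
 finally show ?thesis unfolding fs(1) .
qed

lemma factoring_ideal_add:
 assumes "j \<in> factoring_ideal t m" "j' \<in> factoring_ideal t m"
 shows "j + j' \<in> factoring_ideal t m"
proof -
 obtain fs gs where fs: "j = sum_list fs" "set fs \<subseteq> ideal_gens t m" "j' = sum_list gs" "set gs \<subseteq> ideal_gens t m"
  using assms unfolding factoring_ideal_gens by blast
 show ?thesis unfolding factoring_ideal_gens by (rule CollectI, rule exI[of _ "fs @ gs"]) (use fs in simp)
qed

lemma factoring_ideal_diff:
 assumes "j \<in> factoring_ideal t m" "j' \<in> factoring_ideal t m"
 shows "j - j' \<in> factoring_ideal t m"
proof -
 have e: "j - j' = j + (%d. (- 1) * j' d)" by (simp add: fun_eq_iff)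
 show ?thesis unfolding e by (rule factoring_ideal_add[OF assms(1) factoring_ideal_scale[OF assms(2)]])
qed

lemma factoring_ideal_hom0: "j \<in> factoring_ideal t m ==> j \<in> hom0 {1..m} {1..m}"
proof -
 assume "j \<in> factoring_ideal t m"
 then obtain fs where fs: "j = sum_list fs" "set fs \<subseteq> ideal_gens t m" unfolding factoring_ideal_gens by blast
 have "sum_list fs \<in> hom0 {1..m} {1..m}" using fs(2)
 proof (induction fs)
  case (Cons k fs)
  obtain g f Y where "k = comp0 t {1..m} Y {1..m} g f" by (rule ideal_gensE[of k t m]) (use Cons.prems in auto)
  hence "k \<in> hom0 {1..m} {1..m}" by simp
  thus ?case using Cons by (simp add: hom0_def)
 qed (simp add: hom0_def)
 thus ?thesis by (simp only: fs(1))
qed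

lemma cut_in_ideal:
 assumes t: "t \<noteq> 0" and x: "x \<in> {1..m}"
 shows "basis0 (cut {1..m} x) \<in> factoring_ideal t m"
proof -
 let ?M = "{1..m}" and ?c = "coll {1..m} x"
 note c = coll_sparts[OF x] and c' = flip_sparts[OF coll_sparts[OF x]]
 have f: "finite ?M" "finite (?M - {x})" by simp_all
 let ?l = "loops ?c (flip ?c)"
 have "card (?M - {x}) < m" using x by (subst card_Diff_singleton) auto
 hence j: "comp0 t ?M (?M - {x}) ?M (basis0 (flip ?c)) (basis0 ?c) \<in> factoring_ideal t m"
  by (intro factoring_ideal_gen ideal_gensI basis0_in[OF c] basis0_in[OF c']) simp_all
 have e: "comp0 t ?M (?M - {x}) ?M (basis0 (flip ?c)) (basis0 ?c) = (%d. t ^ ?l * basis0 (cut ?M x) d)"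
  by (rule ext) (simp only: comp0_basis_basis[OF c c' f(1,2,1)] cut_factors[OF x f(1)])
 have "(%d. inverse (t ^ ?l) * (t ^ ?l * basis0 (cut ?M x) d)) \<in> factoring_ideal t m"
  using factoring_ideal_scale[OF j, of "inverse (t ^ ?l)"] unfolding e .
 moreover have "(%d. inverse (t ^ ?l) * (t ^ ?l * basis0 (cut ?M x) d)) = basis0 (cut ?M x)"
  using t by (simp add: field_simps)
 ultimately show ?thesis by simp
qed

lemma merge_in_ideal:
 assumes t: "t \<noteq> 0" and x: "x \<in> {1..m}" and y: "y \<in> {1..m}" and xy: "x \<noteq> y"
 shows "basis0 (merge {1..m} x y) \<in> factoring_ideal t m"
proof -
 let ?M = "{1..m}" let ?g = "merge ?M x y" and ?c = "cut ?M x"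
 note m = merge_sparts[OF x y] and c = cut_sparts[OF x]
 note mc = spart_comp_in_sparts[OF m c]
 have f: "finite ?M" by simp
 let ?u = "t ^ loops ?g ?c" and ?v = "t ^ loops (spart_comp ?g ?c) ?g"
 have j: "comp0 t ?M ?M ?M (basis0 ?g) (comp0 t ?M ?M ?M (basis0 ?c) (basis0 ?g)) \<in> factoring_ideal t m"
  by (intro factoring_ideal_left factoring_ideal_right cut_in_ideal[OF t x])
 have "comp0 t ?M ?M ?M (basis0 ?c) (basis0 ?g) = (%d. ?u * basis0 (spart_comp ?g ?c) d)"
  by (rule ext) (simp only: comp0_basis_basis[OF m c f f f])
 moreover have "comp0 t ?M ?M ?M (basis0 ?g) (%d. ?u * basis0 (spart_comp ?g ?c) d) = (%d. ?u * (?v * basis0 ?g d))"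
 proof
  fix d
  have "comp0 t ?M ?M ?M (basis0 ?g) (%d. ?u * basis0 (spart_comp ?g ?c) d) d = ?u * comp0 t ?M ?M ?M (basis0 ?g) (basis0 (spart_comp ?g ?c)) d"
   by (auto simp: comp0_def sum_distrib_left mult_ac intro!: sum.cong)
  thus "comp0 t ?M ?M ?M (basis0 ?g) (%d. ?u * basis0 (spart_comp ?g ?c) d) d = ?u * (?v * basis0 ?g d)"
   by (simp only: comp0_basis_basis[OF mc m f f f] merge_factors[OF x y xy f])
 qed
 ultimately have e: "comp0 t ?M ?M ?M (basis0 ?g) (comp0 t ?M ?M ?M (basis0 ?c) (basis0 ?g)) = (%d. ?u * (?v * basis0 ?g d))" by simp
 have "(%d. inverse (?u * ?v) * (?u * (?v * basis0 ?g d))) \<in> factoring_ideal t m"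
  using factoring_ideal_scale[OF j, of "inverse (?u * ?v)"] unfolding e .
 moreover have "(%d. inverse (?u * ?v) * (?u * (?v * basis0 ?g d))) = basis0 ?g"
  using t by (simp add: field_simps)
 ultimately show ?thesis by simp
qed

lemma perm_part_ppart: "perm_part m \<sigma> = ppart {1..m} \<sigma>" by (simp add: perm_part_def ppart_def)

text \<open>
For each subset \<open>S\<close> of \<open>X\<close> some subset of \<open>Y\<close> links \<open>S\<close> to \<open>s ` S\<close>.  If the same subset served \<open>S\<close> and \<open>S'\<close>, then
\<open>S\<close> would be linked to \<open>s ` S'\<close>.  Hence \<open>Y\<close> has at least as many subsets as \<open>X\<close>.
\<close>
lemma perm_not_factoring:
 assumes s: "s permutes X" and X: "finite X" and Y: "finite Y" "card Y < card X"
  and a: "a \<in> sparts X Y" and b: "b \<in> sparts Y X"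
 shows "spart_comp a b \<noteq> ppart X s"
proof
 assume e: "spart_comp a b = ppart X s"
 have bij: "bij_betw s X X" by (rule permutes_imp_bij[OF s])
 have sS: "s ` S \<subseteq> X" if "S \<subseteq> X" for S using that permutes_image[OF s] by blast
 have sat: "saturated (ppart X s) (S <+> U) \<longleftrightarrow> U = s ` S" if "S \<subseteq> X" "U \<subseteq> X" for S U
  using sat_mat_ppart[OF bij that] by (simp only: sat_mat_def of_bool_eq_iff)
 have comp: "saturated (ppart X s) (S <+> U) \<longleftrightarrow> (\<exists>T\<subseteq>Y. saturated a (S <+> T) \<and> saturated b (T <+> U))" if "S \<subseteq> X" "U \<subseteq> X" for S U
  using saturated_spart_comp[OF a b X Y(1) X that] by (simp only: e)
 have "\<exists>T\<subseteq>Y. saturated a (S <+> T) \<and> saturated b (T <+> s ` S)" if S: "S \<in> Pow X" for S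
  using comp[of S "s ` S"] sat[of S "s ` S"] S sS[of S] by simp
 then obtain T where T: "\<And>S. S \<in> Pow X ==> T S \<subseteq> Y \<and> saturated a (S <+> T S) \<and> saturated b (T S <+> s ` S)" by metis
 have "inj_on T (Pow X)"
 proof (rule inj_onI)
  fix S S' assume S: "S \<in> Pow X" "S' \<in> Pow X" "T S = T S'"
  have sub: "S \<subseteq> X" "S' \<subseteq> X" using S(1,2) by blast+
  have "\<exists>V\<subseteq>Y. saturated a (S <+> V) \<and> saturated b (V <+> s ` S')"
   using T[OF S(1)] T[OF S(2)] unfolding S(3) by (intro exI[of _ "T S'"] conjI) simp_all
  from iffD1[OF sat[OF sub(1) sS[OF sub(2)]] iffD2[OF comp[OF sub(1) sS[OF sub(2)]] this]]
  have "s ` S' = s ` S" .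
  thus "S = S'" using permutes_inj[OF s] by (simp add: inj_image_eq_iff)
 qed
 hence "card (Pow X) \<le> card (Pow Y)" by (rule card_inj_on_le) (use T Y in auto)
 thus False using X Y by (simp add: card_Pow)
qed

lemma factoring_ideal_perm:
 assumes "j \<in> factoring_ideal t m" and s: "\<sigma> \<in> Sym m"
 shows "j (perm_part m \<sigma>) = 0"
proof -
 obtain fs where fs: "j = sum_list fs" "set fs \<subseteq> ideal_gens t m" using assms(1) unfolding factoring_ideal_gens by blast
 have "sum_list fs (perm_part m \<sigma>) = 0" using fs(2)
 proof (induction fs)
  case (Cons k fs)
  obtain g f Y where k: "k = comp0 t {1..m} Y {1..m} g f" "finite Y" "card Y < m"
   by (rule ideal_gensE[of k t m]) (use Cons.prems in auto)
  have "spart_comp a b \<noteq> ppart {1..m} \<sigma>" if "a \<in> sparts {1..m} Y" "b \<in> sparts Y {1..m}" for a b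
   by (rule perm_not_factoring[OF _ _ k(2) _ that]) (use s k in \<open>simp_all add: Sym_def\<close>)
  hence "k (perm_part m \<sigma>) = 0" unfolding k(1) comp0_def perm_part_ppart by (intro sum.neutral ballI) simp
  thus ?case using Cons by simp
 qed simp
 thus ?thesis by (simp only: fs(1))
qed

section \<open>Mixed tensor powers of the simple object\<close>

lemma perm_part_sparts: "\<sigma> \<in> Sym m ==> perm_part m \<sigma> \<in> sparts {1..m} {1..m}"
 unfolding perm_part_ppart Sym_def by (rule ppart_sparts) (simp add: permutes_imp_bij)

lemma perm_part_inj: "\<sigma> \<in> Sym m ==> \<tau> \<in> Sym m ==> perm_part m \<sigma> = perm_part m \<tau> \<longleftrightarrow> \<sigma> = \<tau>"
 unfolding perm_part_ppart Sym_def using ppart_inj[of \<sigma> "{1..m}" \<tau>] by auto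

lemma perm_part_comp:
 assumes "\<sigma> \<in> Sym m" "\<tau> \<in> Sym m"
 shows "spart_comp (perm_part m \<tau>) (perm_part m \<sigma>) = perm_part m (\<sigma> o \<tau>)" "loops (perm_part m \<tau>) (perm_part m \<sigma>) = 0"
proof -
 have s: "\<sigma> permutes {1..m}" using assms(1) by (simp add: Sym_def)
 note r = spart_comp_ppart_right[OF s perm_part_sparts[OF assms(2)]]
 have "rename \<sigma> (perm_part m \<tau>) = perm_part m (\<sigma> o \<tau>)"
  unfolding rename_def perm_part_def image_image by simp
 thus "spart_comp (perm_part m \<tau>) (perm_part m \<sigma>) = perm_part m (\<sigma> o \<tau>)" "loops (perm_part m \<tau>) (perm_part m \<sigma>) = 0"
  using r unfolding perm_part_ppart[of m \<sigma>] by simp_all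
qed

lemma galg_to_end_perm: "\<sigma> \<in> Sym m ==> galg_to_end m c (perm_part m \<sigma>) = c \<sigma>"
proof -
 assume s: "\<sigma> \<in> Sym m"
 have "galg_to_end m c (perm_part m \<sigma>) = (\<Sum>\<tau>\<in>Sym m. if \<tau> = \<sigma> then c \<sigma> else 0)"
  unfolding galg_to_end_def by (rule sum.cong[OF refl]) (auto simp: basis0_def perm_part_inj s)
 also have "... = c \<sigma>" using s by (simp add: finite_Sym)
 finally show ?thesis .
qed

lemma galg_to_end_outside: "\<alpha> \<notin> perm_part m ` Sym m ==> galg_to_end m c \<alpha> = 0"
 unfolding galg_to_end_def by (rule sum.neutral) (auto simp: basis0_def)

lemma sum_galg_to_end:
 assumes "\<And>\<alpha>. \<alpha> \<in> sparts {1..m} {1..m} ==> galg_to_end m c \<alpha> = 0 ==> F \<alpha> = 0"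
 shows "(\<Sum>\<alpha>\<in>sparts {1..m} {1..m}. F \<alpha>) = (\<Sum>\<sigma>\<in>Sym m. F (perm_part m \<sigma>))"
proof -
 have fin: "finite (sparts {1..m} {1..m})" by (rule finite_sparts) simp_all
 have "(\<Sum>\<alpha>\<in>sparts {1..m} {1..m}. F \<alpha>) = (\<Sum>\<alpha>\<in>perm_part m ` Sym m. F \<alpha>)"
  by (rule sum.mono_neutral_right[OF fin]) (use perm_part_sparts galg_to_end_outside assms in blast)+
 also have "... = (\<Sum>\<sigma>\<in>Sym m. F (perm_part m \<sigma>))"
  by (rule sum.reindex[unfolded o_def]) (auto intro!: inj_onI simp: perm_part_inj)
 finally show ?thesis .
qed

text \<open>The group algebra sits multiplicatively in the endomorphism algebra, with no power of \<open>t\<close>.\<close>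
lemma galg_to_end_mult:
 "endo_comp t m (galg_to_end m a) (galg_to_end m b) = galg_to_end m (gmult m a b)"
proof
 fix \<delta>
 let ?S = "sparts {1..m} {1..m}"
 let ?F = "%\<alpha> \<beta>. if spart_comp \<alpha> \<beta> = \<delta> then galg_to_end m a \<beta> * galg_to_end m b \<alpha> * t ^ loops \<alpha> \<beta> else 0"
 have "endo_comp t m (galg_to_end m a) (galg_to_end m b) \<delta> = (\<Sum>\<alpha>\<in>?S. \<Sum>\<beta>\<in>?S. ?F \<alpha> \<beta>)"
  by (simp only: comp0_def)
 also have "... = (\<Sum>\<tau>\<in>Sym m. \<Sum>\<beta>\<in>?S. ?F (perm_part m \<tau>) \<beta>)"
  by (rule sum_galg_to_end[where c = b]) (rule sum.neutral, simp)
 also have "... = (\<Sum>\<tau>\<in>Sym m. \<Sum>\<sigma>\<in>Sym m. ?F (perm_part m \<tau>) (perm_part m \<sigma>))"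
  by (intro sum.cong refl sum_galg_to_end[where c = a]) simp
 also have "... = (\<Sum>\<tau>\<in>Sym m. \<Sum>\<sigma>\<in>Sym m. a \<sigma> * b \<tau> * basis0 (perm_part m (\<sigma> o \<tau>)) \<delta>)"
  by (intro sum.cong refl) (auto simp: perm_part_comp galg_to_end_perm basis0_def)
 also have "... = (\<Sum>\<sigma>\<in>Sym m. \<Sum>\<tau>\<in>Sym m. a \<sigma> * b \<tau> * basis0 (perm_part m (\<sigma> o \<tau>)) \<delta>)" by (rule sum.swap)
 also have "... = (\<Sum>\<sigma>\<in>Sym m. \<Sum>\<rho>\<in>Sym m. a \<sigma> * b (inv \<sigma> o \<rho>) * basis0 (perm_part m \<rho>) \<delta>)"
 proof (rule sum.cong[OF refl])
  fix \<sigma> assume s: "\<sigma> \<in> Sym m"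
  have i: "inv \<sigma> o (\<sigma> o \<tau>) = \<tau>" for \<tau> :: "nat => nat"
   using s by (simp add: Sym_def fun_eq_iff permutes_inverses)
  show "(\<Sum>\<tau>\<in>Sym m. a \<sigma> * b \<tau> * basis0 (perm_part m (\<sigma> o \<tau>)) \<delta>) = (\<Sum>\<rho>\<in>Sym m. a \<sigma> * b (inv \<sigma> o \<rho>) * basis0 (perm_part m \<rho>) \<delta>)"
   by (subst sum_Sym_left[OF s, symmetric]) (simp only: i)
 qed
 also have "... = (\<Sum>\<rho>\<in>Sym m. (\<Sum>\<sigma>\<in>Sym m. a \<sigma> * b (inv \<sigma> o \<rho>)) * basis0 (perm_part m \<rho>) \<delta>)"
  by (subst sum.swap) (simp only: sum_distrib_right)
 also have "... = galg_to_end m (gmult m a b) \<delta>"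
  unfolding galg_to_end_def by (rule sum.cong[OF refl]) (simp add: gmult_apply)
 finally show "endo_comp t m (galg_to_end m a) (galg_to_end m b) \<delta> = galg_to_end m (gmult m a b) \<delta>" .
qed

text \<open>
As \<open>1 - e\<close> annihilates the ideal on both sides, so does \<open>c'\<close>.  Writing \<open>c' = c + j\<close> with \<open>j\<close> in the ideal shows that
\<open>c' * c' - c'\<close> lies in the ideal; it is fixed by \<open>e\<close>, which annihilates \<open>c'\<close>, and therefore zero.  The coefficients at
permutations are those of \<open>c\<close> because elements of the ideal have none.
\<close>
lemma lifted_idempotent:
 fixes t :: "'k::field"
 assumes e: "ideal_identity t m e" and c: "idempotent m c"
  and c': "c' \<in> {endo_comp t m f (id0 {1..m} - e) | f. f \<in> hom0 {1..m} {1..m}}"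
  and J: "c' - galg_to_end m c \<in> factoring_ideal t m"
 shows "c' \<in> hom0 {1..m} {1..m}" "endo_comp t m c' c' = c'"
  "\<And>j. j \<in> factoring_ideal t m ==> endo_comp t m c' j = 0"
  "\<And>j. j \<in> factoring_ideal t m ==> endo_comp t m j c' = 0"
  "\<And>\<sigma>. \<sigma> \<in> Sym m ==> c' (perm_part m \<sigma>) = c \<sigma>"
proof -
 let ?M = "{1..m}" and ?g = "galg_to_end m c"
 define C where "C h k = comp0 t ?M ?M ?M h k" for h k
 have assoc: "C h (C k l) = C (C h k) l" for h k l unfolding C_def by (rule comp0_assoc) simp_all
 have right: "j \<in> factoring_ideal t m ==> C j h \<in> factoring_ideal t m" for h j unfolding C_def by (rule factoring_ideal_right)
 have eJ: "e \<in> factoring_ideal t m" and el: "\<And>j. j \<in> factoring_ideal t m ==> C e j = j"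
  and er: "\<And>j. j \<in> factoring_ideal t m ==> C j e = j" using e unfolding ideal_identity_def C_def by blast+
 have idl: "h \<in> hom0 ?M ?M ==> C (id0 ?M) h = h" and idr: "h \<in> hom0 ?M ?M ==> C h (id0 ?M) = h" for h
  unfolding C_def by (rule comp0_id_left comp0_id_right; simp)+
 obtain f where f: "f \<in> hom0 ?M ?M" "c' = C f (id0 ?M - e)" using c' unfolding C_def by blast
 show h: "c' \<in> hom0 ?M ?M" unfolding f(2) C_def by simp
 have cj: "C c' j = 0" if j: "j \<in> factoring_ideal t m" for j
 proof -
  have "C (id0 ?M - e) j = C (id0 ?M) j - C e j" unfolding C_def by (rule comp0_diff_left)
  also have "... = 0" unfolding idl[OF factoring_ideal_hom0[OF j]] el[OF j] by (rule diff_self)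
  finally have "C f (C (id0 ?M - e) j) = 0" unfolding C_def by simp
  thus ?thesis unfolding f(2) by (simp only: assoc)
 qed
 have jc: "C j c' = 0" if j: "j \<in> factoring_ideal t m" for j
 proof -
  have J: "C j f \<in> factoring_ideal t m" by (rule right[OF j])
  have "C j c' = C (C j f) (id0 ?M - e)" unfolding f(2) by (rule assoc)
  also have "... = C (C j f) (id0 ?M) - C (C j f) e" unfolding C_def by (rule comp0_diff_right)
  also have "... = 0" unfolding idr[OF factoring_ideal_hom0[OF J]] er[OF J] by (rule diff_self)
  finally show ?thesis .
 qed
 show "\<And>j. j \<in> factoring_ideal t m ==> comp0 t ?M ?M ?M c' j = 0" using cj unfolding C_def .
 show "\<And>j. j \<in> factoring_ideal t m ==> comp0 t ?M ?M ?M j c' = 0" using jc unfolding C_def .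
 \<comment> \<open>The component of the idempotent in the ideal.\<close>
 define j where "j = c' - ?g"
 have j: "j \<in> factoring_ideal t m" and cg: "c' = ?g + j" using J by (simp_all add: j_def)
 have gg: "C ?g ?g = ?g" unfolding C_def galg_to_end_mult using c by (simp add: idempotent_def)
 have add: "C h (k + l) = C h k + C h l" "C (k + l) h = C k h + C l h" for h k l
  unfolding C_def by (rule comp0_add_right comp0_add_left)+
 have "C c' c' = C c' ?g + C c' j" by (subst (2) cg) (rule add(1))
 also have "... = C (?g + j) ?g" by (simp only: cj[OF j] add_0_right cg[symmetric])
 also have "... = ?g + C j ?g" by (simp only: add(2) gg)
 finally have "C c' c' - c' = C j ?g - j" by (simp add: j_def)
 hence d: "C c' c' - c' \<in> factoring_ideal t m" using factoring_ideal_diff[OF right[OF j] j] by simp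
 have "C c' c' - c' = C e (C c' c' - c')" using el[OF d] by simp
 also have "... = C (C e c') c' - C e c'" unfolding assoc[symmetric] unfolding C_def by (rule comp0_diff_right)
 also have "... = 0" by (simp only: jc[OF eJ]) (simp add: C_def)
 finally show "comp0 t ?M ?M ?M c' c' = c'" unfolding C_def by simp
 fix \<sigma> assume s: "\<sigma> \<in> Sym m"
 have "c' (perm_part m \<sigma>) = ?g (perm_part m \<sigma>) + j (perm_part m \<sigma>)" by (subst cg) simp
 thus "c' (perm_part m \<sigma>) = c \<sigma>" by (simp only: factoring_ideal_perm[OF j s] galg_to_end_perm[OF s] add_0_right)
qed

lemma flip_perm_part: "\<sigma> \<in> Sym m ==> flip (perm_part m \<sigma>) = perm_part m (inv \<sigma>)"
proof -
 assume "\<sigma> \<in> Sym m"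
 hence s: "\<sigma> permutes {1..m}" by (simp add: Sym_def)
 have "perm_part m (inv \<sigma>) = (%i. {Inl i, Inr (inv \<sigma> i)}) ` \<sigma> ` {1..m}" unfolding perm_part_def permutes_image[OF s] ..
 also have "... = (%i. {Inl (\<sigma> i), Inr i}) ` {1..m}" unfolding image_image by (simp only: permutes_inverses[OF s])
 also have "... = flip (perm_part m \<sigma>)" unfolding flip_def perm_part_def image_image by (simp add: insert_commute)
 finally show ?thesis by simp
qed

lemma flip_cut: "x \<in> X ==> flip (cut X x) = cut X x"
proof -
 assume x: "x \<in> X"
 show ?thesis
 proof (rule partition_eqI_saturated[OF spartsD[OF flip_sparts[OF cut_sparts[OF x]]] spartsD[OF cut_sparts[OF x]]])
  fix W assume "W \<subseteq> X <+> X"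
  then obtain S U where W: "S \<subseteq> X" "U \<subseteq> X" "W = S <+> U" using Plus_decompose[of W X X] by blast
  show "saturated (flip (cut X x)) W \<longleftrightarrow> saturated (cut X x) W"
   unfolding W(3) saturated_flip saturated_cut[OF x W(1,2)] saturated_cut[OF x W(2,1)] by auto
 qed
qed

lemma flip_merge: "x \<in> X ==> y \<in> X ==> flip (merge X x y) = merge X x y"
proof -
 assume x: "x \<in> X" and y: "y \<in> X"
 show ?thesis
 proof (rule partition_eqI_saturated[OF spartsD[OF flip_sparts[OF merge_sparts[OF x y]]] spartsD[OF merge_sparts[OF x y]]])
  fix W assume "W \<subseteq> X <+> X"
  then obtain S U where W: "S \<subseteq> X" "U \<subseteq> X" "W = S <+> U" using Plus_decompose[of W X X] by blast
  show "saturated (flip (merge X x y)) W \<longleftrightarrow> saturated (merge X x y) W"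
   unfolding W(3) saturated_flip saturated_merge[OF x y W(1,2)] saturated_merge[OF x y W(2,1)] by auto
 qed
qed

lemma transpose0_basis: "transpose0 (basis0 \<alpha>) = basis0 (flip \<alpha>)"
 unfolding fun_eq_iff transpose0_flip basis0_def using flip_flip by metis

lemma leg_mor_lifted:
 fixes t :: "'k::field"
 assumes t: "t \<noteq> 0" and h: "c' \<in> hom0 {1..m} {1..m}" and i: "endo_comp t m c' c' = c'"
  and l: "\<And>j. j \<in> factoring_ideal t m ==> endo_comp t m c' j = 0"
  and r: "\<And>j. j \<in> factoring_ideal t m ==> endo_comp t m j c' = 0"
 shows "leg_mor t m c'" "leg_mor t m (transpose0 c')"
proof -
 show "leg_mor t m c'" unfolding leg_mor_def
  by (intro conjI ballI impI h i l cut_in_ideal merge_in_ideal t) assumption+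
 let ?M = "{1..m}"
 have tr: "comp0 t ?M ?M ?M (transpose0 c') (transpose0 k) = transpose0 (comp0 t ?M ?M ?M k c')" for k
  by (rule transpose0_comp[symmetric]) simp_all
 show "leg_mor t m (transpose0 c')" unfolding leg_mor_def
 proof (intro conjI ballI impI)
  show "transpose0 c' \<in> hom0 ?M ?M" by (rule transpose0_in[OF h])
  show "comp0 t ?M ?M ?M (transpose0 c') (transpose0 c') = transpose0 c'" unfolding tr i ..
  fix x assume x: "x \<in> ?M"
  show "comp0 t ?M ?M ?M (transpose0 c') (basis0 (cut ?M x)) = 0"
   using tr[of "basis0 (cut ?M x)"] unfolding transpose0_basis flip_cut[OF x] r[OF cut_in_ideal[OF t x]] transpose0_0 .
  fix y assume y: "y \<in> ?M" and xy: "x \<noteq> y"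
  show "comp0 t ?M ?M ?M (transpose0 c') (basis0 (merge ?M x y)) = 0"
   using tr[of "basis0 (merge ?M x y)"] unfolding transpose0_basis flip_merge[OF x y] r[OF merge_in_ideal[OF t x y xy]] transpose0_0 .
 qed
qed

lemma tensor_pow_legs:
 assumes c: "leg_mor t m c"
 shows "\<exists>X L p. leg_obj t m X L p \<and> tensor_pow (Rep_S t) ([{1..m}], emb c) a = ([X], emb p) \<and> map snd L = replicate a c"
proof (induction a)
 case 0
 show ?case by (rule exI[of _ "{}"], rule exI[of _ "[]"], rule exI[of _ "id0 {}"]) (simp add: leg_obj_unit Unit_emb)
next
 case (Suc a)
 then obtain X L p where X: "leg_obj t m X L p" "tensor_pow (Rep_S t) ([{1..m}], emb c) a = ([X], emb p)" "map snd L = replicate a c" by blast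
 note T = leg_obj_tensor[OF leg_obj_single[OF c] X(1)]
 have "map snd (map (%l. (eL o fst l, snd l)) [(%x. x, c)] @ map (%l. (eR o fst l, snd l)) L) = replicate (Suc a) c"
  using X(3) by (simp add: o_def)
 moreover have "tensor_pow (Rep_S t) ([{1..m}], emb c) (Suc a) = ([dunion {1..m} X], emb (tensor0 {1..m} {1..m} X X c p))"
  by (simp only: tensor_pow.simps X(2) Tensor_emb)
 ultimately show ?case using T by blast
qed

abbreviation mixed_tensor :: "'k::field => 'k rep_obj => nat => nat => 'k rep_obj" where
 "mixed_tensor t x a b \<equiv> Tensor (Rep_S t) (tensor_pow (Rep_S t) x a) (tensor_pow (Rep_S t) (Dual (Rep_S t) x) b)"

lemma mixed_tensor_legs:
 assumes c: "leg_mor t m c" "leg_mor t m (transpose0 c)"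
 defines "x \<equiv> ([{1..m}], emb c)"
 shows "\<exists>X L p. leg_obj t m X L p \<and>
   mixed_tensor t x a b = ([X], emb p) \<and>
   map snd L = replicate a c @ replicate b (transpose0 c)"
proof -
 obtain X L p where X: "leg_obj t m X L p" "tensor_pow (Rep_S t) x a = ([X], emb p)" "map snd L = replicate a c"
  using tensor_pow_legs[OF c(1)] unfolding x_def by blast
 obtain Y K q where Y: "leg_obj t m Y K q" "tensor_pow (Rep_S t) (Dual (Rep_S t) x) b = ([Y], emb q)" "map snd K = replicate b (transpose0 c)"
  using tensor_pow_legs[OF c(2)] unfolding x_def Dual_emb by blast
 note T = leg_obj_tensor[OF X(1) Y(1)]
 show ?thesis by (intro exI conjI, rule T) (simp_all add: X(2,3) Y(2,3) Tensor_emb o_def)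
qed

section \<open>Moments as dimensions\<close>

text \<open>
An isomorphism of left ideals is right multiplication by some \<open>w\<close>, and its inverse by some \<open>v\<close>, with \<open>c = w * v\<close> and \<open>f = v * w\<close>; the class sum is a trace.
\<close>
lemma class_sum_iso_idempotents:
 fixes c f :: "'k::field galg"
 assumes c: "idempotent n c" and f: "idempotent n f" and iso: "module_iso n (left_ideal n c) (left_ideal n f)"
  and s: "s \<in> Sym n"
 shows "class_sum n c s = class_sum n f s"
proof -
 have cc: "c \<in> grp_alg n" "gmult n c c = c" and ff: "f \<in> grp_alg n" "gmult n f f = f"
  using c f by (auto simp: idempotent_def)
 obtain \<phi> where bij: "bij_betw \<phi> (left_ideal n c) (left_ideal n f)"
  and lin: "\<And>a x. a \<in> grp_alg n ==> x \<in> left_ideal n c ==> \<phi> (gmult n a x) = gmult n a (\<phi> x)"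
  using iso unfolding module_iso_def by blast
 have fix_right: "gmult n x c = x" if "x \<in> left_ideal n c" for x
  using that cc(2) by (auto simp: left_ideal_def gmult_assoc)
 have fix_right': "gmult n x f = x" if "x \<in> left_ideal n f" for x
  using that ff(2) by (auto simp: left_ideal_def gmult_assoc)
 have grp: "x \<in> grp_alg n" if "x \<in> left_ideal n d" for x d :: "'k galg" using that by (auto simp: left_ideal_def)
 have cV: "c \<in> left_ideal n c" unfolding left_ideal_def by (rule CollectI, rule exI[of _ c]) (simp add: cc)
 have fW: "f \<in> left_ideal n f" unfolding left_ideal_def by (rule CollectI, rule exI[of _ f]) (simp add: ff)
 define w where "w = \<phi> c"
 have w: "w \<in> left_ideal n f" unfolding w_def using bij_betwE[OF bij] cV by blast
 obtain v where v: "v \<in> left_ideal n c" "\<phi> v = f" using bij fW unfolding bij_betw_def by (metis imageE)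
 have vw: "gmult n v w = f" using lin[OF grp[OF v(1)] cV] fix_right[OF v(1)] v(2) by (simp add: w_def)
 have "\<phi> (gmult n w v) = gmult n w f" using lin[OF grp[OF w] v(1)] v(2) by simp
 hence "\<phi> (gmult n w v) = \<phi> c" using fix_right'[OF w] by (simp add: w_def)
 moreover have "gmult n w v \<in> left_ideal n c"
  using v(1) grp[OF w] unfolding left_ideal_def by (auto simp: gmult_assoc[symmetric])
 ultimately have "gmult n w v = c" using bij cV unfolding bij_betw_def by (auto dest: inj_onD)
 thus ?thesis using class_sum_gmult_commute[OF s, of w v] vw by simp
qed

lemma young_const_nonzero: "(young_const lam :: 'k::field_char_0) \<noteq> 0"
 by (simp add: young_const_of_int young_norm_nonzero)

lemma class_sum_irrep_idempotent:
 fixes c :: "'k::field_char_0 galg"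
 assumes c: "idempotent (sum_list lam) c" and iso: "module_iso (sum_list lam) (left_ideal (sum_list lam) c) (irrep lam)"
  and s: "s \<in> Sym (sum_list lam)"
 shows "class_sum (sum_list lam) c s = class_sum (sum_list lam) (young lam) s / young_const lam"
proof -
 let ?n = "sum_list lam"
 let ?f = "scale_galg (1 / young_const lam) (young lam) :: 'k galg"
 have k: "scale_galg a (scale_galg b x) = scale_galg (a * b) x" for a b :: 'k and x by (simp add: scale_galg_def mult.assoc)
 have one: "scale_galg 1 x = x" for x :: "'k galg" by (simp add: scale_galg_def)
 have f: "idempotent ?n ?f" unfolding idempotent_def
  by (simp add: gmult_scale_left gmult_scale_right young_square k young_const_nonzero)
 have "left_ideal ?n ?f = irrep lam"
 proof (intro equalityI subsetI)
  fix x assume "x \<in> left_ideal ?n ?f"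
  then obtain a where a: "a \<in> grp_alg ?n" "x = gmult ?n a ?f" unfolding left_ideal_def by blast
  have "x = gmult ?n (scale_galg (1 / young_const lam) a) (young lam)" unfolding a(2) by (simp only: gmult_scale_left gmult_scale_right)
  thus "x \<in> irrep lam" unfolding irrep_def left_ideal_def using scale_galg_in[OF a(1)] by blast
 next
  fix x :: "'k galg" assume "x \<in> irrep lam"
  then obtain a where a: "a \<in> grp_alg ?n" "x = gmult ?n a (young lam)" unfolding irrep_def left_ideal_def by blast
  have "x = gmult ?n (scale_galg (young_const lam) a) ?f" unfolding a(2) gmult_scale_left gmult_scale_right k
   by (simp add: young_const_nonzero one)
  thus "x \<in> left_ideal ?n ?f" unfolding left_ideal_def using scale_galg_in[OF a(1)] by blast
 qed
 hence "class_sum ?n c s = class_sum ?n ?f s" using class_sum_iso_idempotents[OF c f _ s] iso by simp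
 thus ?thesis by (simp add: class_sum_scale)
qed

text \<open>
\<open>psi\<close> is invariant under conjugation of the permutation of \<open>{1..m}\<close>, so the coefficients matter only through their class sums.
\<close>
lemma psi_weighted_sum:
 fixes d :: "'k::field_char_0 galg"
 assumes d: "\<And>s. s \<in> Sym (sum_list lam) ==> class_sum (sum_list lam) d s = class_sum (sum_list lam) (young lam) s / young_const lam"
  and g: "g \<in> Sym n"
 shows "(\<Sum>s\<in>Sym (sum_list lam). d s * of_int (psi s {1..sum_list lam} {1..n} g)) = of_int (Theta lam n g) / of_int (young_norm lam)"
proof -
 let ?m = "sum_list lam"
 let ?F = "%s. of_int (psi s {1..?m} {1..n} g) :: 'k"
 have F: "?F (\<tau> o s o inv \<tau>) = ?F s" if "s \<in> Sym ?m" "\<tau> \<in> Sym ?m" for s \<tau>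
  using psi_conj_left[of "{1..?m}" s \<tau> g n] that g by (simp add: Sym_def)
 have "fact ?m * (\<Sum>s\<in>Sym ?m. d s * ?F s) = (\<Sum>s\<in>Sym ?m. class_sum ?m d s * ?F s)"
  by (rule sum_class_function[symmetric]) (rule F)
 also have "... = (\<Sum>s\<in>Sym ?m. class_sum ?m (young lam) s * ?F s) / young_const lam"
  unfolding sum_divide_distrib by (rule sum.cong[OF refl]) (simp only: d times_divide_eq_left)
 also have "(\<Sum>s\<in>Sym ?m. class_sum ?m (young lam) s * ?F s) = fact ?m * (\<Sum>s\<in>Sym ?m. young lam s * ?F s)"
  by (rule sum_class_function) (rule F)
 finally have "fact ?m * (\<Sum>s\<in>Sym ?m. d s * ?F s) = fact ?m * ((\<Sum>s\<in>Sym ?m. young lam s * ?F s) / young_const lam)" by simp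
 from iffD1[OF mult_left_cancel[OF fact_nonzero] this]
 have "(\<Sum>s\<in>Sym ?m. d s * ?F s) = (\<Sum>s\<in>Sym ?m. young lam s * ?F s) / young_const lam" .
 also have "(\<Sum>s\<in>Sym ?m. young lam s * ?F s) = of_int (Theta lam n g)"
  unfolding Theta_def young_of_int by (simp only: of_int_sum of_int_mult)
 finally show ?thesis by (simp only: young_const_of_int)
qed

text \<open>
After \<open>sum_prod_psi\<close> the sum over families \<open>s\<close> factors into a product over \<open>i\<close>, and each factor is \<open>psi_weighted_sum\<close>.
\<close>
lemma weighted_good_parts:
 fixes d :: "nat => 'k::field_char_0 galg"
 assumes d: "\<And>i s. i < k ==> s \<in> Sym (sum_list lam) ==> class_sum (sum_list lam) (d i) s = class_sum (sum_list lam) (young lam) s / young_const lam"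
  and n: "k * sum_list lam \<le> n"
 shows "fact n * (\<Sum>s\<in>{..<k} \<rightarrow>\<^sub>E Sym (sum_list lam). (\<Prod>i<k. d i (s i)) * of_nat (card (good_parts {..<k} {1..sum_list lam} s)))
  = of_int (\<Sum>g\<in>Sym n. Theta lam n g ^ k) / of_int (young_norm lam) ^ k"
proof -
 let ?m = "sum_list lam" let ?P = "{..<k} \<rightarrow>\<^sub>E Sym ?m"
 let ?psi = "%s g. of_int (psi s {1..?m} {1..n} g) :: 'k"
 have gp: "fact n * of_nat (card (good_parts {..<k} {1..?m} s)) = (\<Sum>g\<in>Sym n. \<Prod>i<k. ?psi (s i) g)" if s: "s \<in> ?P" for s
 proof -
  have "s i permutes {1..?m}" if "i \<in> {..<k}" for i using PiE_mem[OF s that] by (simp add: Sym_def)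
  hence "(\<Sum>g\<in>Sym n. \<Prod>i<k. psi (s i) {1..?m} {1..n} g) = fact n * int (card (good_parts {..<k} {1..?m} s))"
   by (intro sum_prod_psi) (use n in simp_all)
  from arg_cong[OF this, of "of_int :: int => 'k"] show ?thesis by (simp add: of_int_sum of_int_prod)
 qed
 have "fact n * (\<Sum>s\<in>?P. (\<Prod>i<k. d i (s i)) * of_nat (card (good_parts {..<k} {1..?m} s)))
  = (\<Sum>s\<in>?P. (\<Prod>i<k. d i (s i)) * (fact n * of_nat (card (good_parts {..<k} {1..?m} s))))"
  unfolding sum_distrib_left by (rule sum.cong[OF refl]) (rule mult.left_commute)
 also have "... = (\<Sum>s\<in>?P. \<Sum>g\<in>Sym n. \<Prod>i<k. d i (s i) * ?psi (s i) g)"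
  by (rule sum.cong[OF refl]) (simp only: gp sum_distrib_left prod.distrib)
 also have "... = (\<Sum>g\<in>Sym n. \<Sum>s\<in>?P. \<Prod>i<k. d i (s i) * ?psi (s i) g)" by (rule sum.swap)
 also have "... = (\<Sum>g\<in>Sym n. \<Prod>i<k. \<Sum>s\<in>Sym ?m. d i s * ?psi s g)"
  by (rule sum.cong[OF refl], rule prod_sum_PiE[symmetric]) (simp_all add: finite_Sym)
 also have "... = (\<Sum>g\<in>Sym n. \<Prod>i<k. of_int (Theta lam n g) / of_int (young_norm lam))"
 proof (intro sum.cong prod.cong refl)
  fix g i assume g: "g \<in> Sym n" and i: "i \<in> {..<k}"
  show "(\<Sum>s\<in>Sym ?m. d i s * ?psi s g) = of_int (Theta lam n g) / of_int (young_norm lam)"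
   by (rule psi_weighted_sum[OF _ g], rule d) (use i in simp_all)
 qed
 also have "... = of_int (\<Sum>g\<in>Sym n. Theta lam n g ^ k) / of_int (young_norm lam) ^ k"
  by (simp add: power_divide sum_divide_distrib of_int_sum)
 finally show ?thesis .
qed

text \<open>
The legs of \<open>x\<close> carry \<open>c\<close>, those of its dual \<open>c\<close> composed with inversion; both have the class sum of the normalised Young symmetrizer.  The identity between integers is obtained in the field of definition, of characteristic zero.
\<close>
theorem mixed_tensor_dim:
 fixes t :: "'k::field_char_0"
 assumes t: "t \<noteq> 0" and x: "is_simple_obj t lam x"
 shows "x \<in> Obj (Rep_S t)"
  and "\<exists>D :: nat. dim_hom_unit t (mixed_tensor t x a b) = of_nat D \<and>
   (\<forall>n\<ge>(a + b) * sum_list lam. fact n * int D * young_norm lam ^ (a + b) = (\<Sum>g\<in>Sym n. Theta lam n g ^ (a + b)))"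
proof -
 let ?m = "sum_list lam"
 obtain e c c' where e: "ideal_identity t ?m e" and pc: "primitive_idempotent ?m c"
  and iso: "module_iso ?m (left_ideal ?m c) (irrep lam)"
  and c': "c' \<in> {comp0 t {1..?m} {1..?m} {1..?m} f (id0 {1..?m} - e) | f. f \<in> hom0 {1..?m} {1..?m}}"
  and J: "c' - galg_to_end ?m c \<in> factoring_ideal t ?m" and x': "x = ([{1..?m}], emb c')"
  using x unfolding is_simple_obj_def Let_def emb_def by blast
 have c: "idempotent ?m c" using pc by (simp add: primitive_idempotent_def)
 note L = lifted_idempotent[OF e c c' J]
 note leg = leg_mor_lifted[OF t L(1-4)]
 show "x \<in> Obj (Rep_S t)" unfolding x' by (rule Obj_emb) (use L(1,2) in simp_all)
 obtain X K p where X: "leg_obj t ?m X K p"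
  "mixed_tensor t x a b = ([X], emb p)"
  "map snd K = replicate a c' @ replicate b (transpose0 c')"
  using mixed_tensor_legs[OF leg, of a b] unfolding x' by blast
 let ?k = "a + b"
 have k: "length K = ?k" using arg_cong[OF X(3), of length] by simp
 define D where "D = vector_space.dim scale_mor (Hom (Rep_S t) (Unit (Rep_S t)) ([X], emb p))"
 define d where "d i s = snd (K ! i) (perm_part ?m s)" for i s
 have cs: "class_sum ?m (d i) s = class_sum ?m (young lam) s / young_const lam" if i: "i < ?k" and s: "s \<in> Sym ?m" for i s
 proof -
  have snd: "snd (K ! i) = (if i < a then c' else transpose0 c')"
   using arg_cong[OF X(3), of "%l. l ! i"] i k by (simp add: nth_append)
  show ?thesis
  proof (cases "i < a")
   case True
   have "class_sum ?m (d i) s = class_sum ?m c s"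
    unfolding class_sum_def d_def snd by (rule sum.cong[OF refl]) (use True s L(5) in simp)
   thus ?thesis by (simp only: class_sum_irrep_idempotent[OF c iso s])
  next
   case False
   have "class_sum ?m (d i) s = class_sum ?m c (inv s)"
    unfolding class_sum_def
   proof (rule sum.cong[OF refl])
    fix \<tau> assume t: "\<tau> \<in> Sym ?m"
    let ?r = "\<tau> o s o inv \<tau>"
    have r: "?r \<in> Sym ?m" using s t by simp
    have i: "inv ?r = \<tau> o inv s o inv \<tau>" using s t by (simp add: Sym_inv_comp[where n = ?m] comp_assoc)
    have "d i ?r = c' (perm_part ?m (inv ?r))" unfolding d_def snd using False by (simp add: transpose0_flip flip_perm_part[OF r])
    also have "... = c (inv ?r)" by (rule L(5)) (rule inv_Sym[OF r])
    finally show "d i ?r = c (\<tau> o inv s o inv \<tau>)" by (simp only: i)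
   qed
   thus ?thesis by (simp only: class_sum_irrep_idempotent[OF c iso inv_Sym[OF s]] class_sum_young_inv[OF s])
  qed
 qed
 have dim: "(of_nat D :: 'k) = (\<Sum>s\<in>{..<?k} \<rightarrow>\<^sub>E Sym ?m. (\<Prod>i<?k. d i (s i)) * of_nat (card (good_parts {..<?k} {1..?m} s)))"
  unfolding D_def d_def using leg_obj_dim[OF t X(1)] unfolding k .
 have "fact n * int D * young_norm lam ^ ?k = (\<Sum>g\<in>Sym n. Theta lam n g ^ ?k)" if n: "n \<ge> ?k * ?m" for n
 proof -
  have "fact n * (of_nat D :: 'k) = of_int (\<Sum>g\<in>Sym n. Theta lam n g ^ ?k) / of_int (young_norm lam) ^ ?k"
   unfolding dim by (rule weighted_good_parts[OF cs n])
  hence "(of_int (fact n * int D * young_norm lam ^ ?k) :: 'k) = of_int (\<Sum>g\<in>Sym n. Theta lam n g ^ ?k)"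
   by (simp add: young_norm_nonzero field_simps)
  thus ?thesis by (simp only: of_int_eq_iff)
 qed
 moreover have "dim_hom_unit t ([X], emb p) = of_nat D" by (simp add: dim_hom_unit_def D_def)
 ultimately show "\<exists>D :: nat. dim_hom_unit t (mixed_tensor t x a b) = of_nat D \<and>
   (\<forall>n\<ge>(a + b) * sum_list lam. fact n * int D * young_norm lam ^ (a + b) = (\<Sum>g\<in>Sym n. Theta lam n g ^ (a + b)))"
  unfolding X(2) by blast
qed

section \<open>The limit law\<close>

instance fract :: ("{idom, ring_char_0}") field_char_0
proof
 show "inj (of_nat :: nat => 'a fract)"
  by (rule injI) (simp add: of_nat_fract eq_fract)
qed

lemma indeterminate_nonzero: "indeterminate \<noteq> 0"
 by (simp add: indeterminate_def Zero_fract_def eq_fract)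

text \<open>The polynomial in cycle numbers that computes the characters of the padded shapes for large \<open>n\<close>.\<close>
definition cycle_poly :: "nat list => (nat => nat) => real" where
 "cycle_poly lam k = real_of_int (\<Sum>\<sigma>\<in>Sym (sum_list lam). young_int lam \<sigma> * psi_count \<sigma> {1..sum_list lam} k) / real_of_int (young_norm lam)"

lemma cycle_poly_Theta:
 assumes g: "g \<in> Sym n"
 shows "cycle_poly lam (cyc_count (sum_list lam) n g) = real_of_int (Theta lam n g) / real_of_int (young_norm lam)"
proof -
 let ?m = "sum_list lam"
 have "psi_count \<sigma> {1..?m} (cyc_count ?m n g) = psi \<sigma> {1..?m} {1..n} g" if "\<sigma> \<in> Sym ?m" for \<sigma>
  by (rule psi_eq_count[symmetric]) (use that g in \<open>auto simp: Sym_def cyc_count_def\<close>)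
 hence "(\<Sum>\<sigma>\<in>Sym ?m. young_int lam \<sigma> * psi_count \<sigma> {1..?m} (cyc_count ?m n g)) = Theta lam n g"
  unfolding Theta_def by (intro sum.cong refl) (simp only:)
 thus ?thesis by (simp only: cycle_poly_def)
qed

definition cycle_law :: "nat => nat => (nat => nat) pmf" where
 "cycle_law m n = map_pmf (cyc_count m n) (pmf_of_set (Sym n))"

definition poisson_law :: "nat => (nat => nat) pmf" where
 "poisson_law m = Pi_pmf {1..m} 0 (%d. poisson_pmf (1 / real d))"

lemma Sym_nonempty: "Sym n \<noteq> {}"
 using id_Sym by blast

lemma expectation_cycle_law:
 fixes h :: "(nat => nat) => real"
 shows "(\<integral>k. h k \<partial>cycle_law m n) = (\<Sum>g\<in>Sym n. h (cyc_count m n g)) / fact n"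
 unfolding cycle_law_def by (simp add: integral_pmf_of_set[OF Sym_nonempty finite_Sym] card_Sym)

lemma finite_cycle_law: "finite (set_pmf (cycle_law m n))"
 unfolding cycle_law_def by (simp add: set_pmf_of_set[OF Sym_nonempty finite_Sym] finite_Sym)

lemma cycle_law_limit: "(%n. pmf (cycle_law m n) k) \<longlonglongrightarrow> pmf (poisson_law m) k"
proof (cases "\<forall>d. d \<notin> {1..m} \<longrightarrow> k d = 0")
 case True
 have "pmf (cycle_law m n) k = real (card {g \<in> Sym n. \<forall>d\<in>{1..m}. ncyc g {1..n} d = k d}) / fact n" for n
 proof -
  have e: "cyc_count m n g = k \<longleftrightarrow> (\<forall>d\<in>{1..m}. ncyc g {1..n} d = k d)" for g
   unfolding cyc_count_def fun_eq_iff using True by metis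
  have "pmf (cycle_law m n) k = measure (pmf_of_set (Sym n)) (cyc_count m n -` {k})"
   by (simp only: cycle_law_def pmf_map)
  also have "... = real (card (Sym n \<inter> (cyc_count m n -` {k}))) / real (card (Sym n))"
   by (rule measure_pmf_of_set[OF Sym_nonempty finite_Sym])
  also have "Sym n \<inter> (cyc_count m n -` {k}) = {g \<in> Sym n. \<forall>d\<in>{1..m}. ncyc g {1..n} d = k d}"
   unfolding vimage_def singleton_iff e by blast
  finally show ?thesis by (simp only: card_Sym of_nat_fact)
 qed
 moreover have "pmf (poisson_law m) k = (\<Prod>d\<in>{1..m}. pmf (poisson_pmf (1 / real d)) (k d))"
  unfolding poisson_law_def by (rule pmf_Pi') (use True in simp_all)
 ultimately show ?thesis using cycle_count_limit[of m k] by (simp only:)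
next
 case False
 then obtain d where d: "d \<notin> {1..m}" "k d \<noteq> 0" by blast
 have "k \<notin> set_pmf (cycle_law m n)" for n
  unfolding cycle_law_def using d by (auto simp: cyc_count_def split: if_splits)
 hence "pmf (cycle_law m n) k = 0" for n by (simp only: pmf_eq_0_set_pmf simp_thms)
 moreover have "pmf (poisson_law m) k = 0"
  unfolding poisson_law_def by (rule pmf_Pi_outside) (use d in auto)
 ultimately show ?thesis by simp
qed

text \<open>
The mean of a power of \<open>cycle_poly\<close> is eventually equal to the dimension of invariants; applied to twice the exponent, this bounds the second moments and justifies passing to the limit.
\<close>
lemma spectral_moments:
 fixes lam :: "nat list" and x :: "complex poly fract rep_obj"
 assumes x: "is_simple_obj indeterminate lam x"
 defines "m \<equiv> sum_list lam"
 shows "integrable (poisson_law m) (%k. cycle_poly lam k ^ (a + b))"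
  and "dim_hom_unit indeterminate (mixed_tensor indeterminate x a b)
     = complex_of_real (\<integral>k. cycle_poly lam k ^ (a + b) \<partial>poisson_law m)"
proof -
 note dim = mixed_tensor_dim(2)[OF indeterminate_nonzero x]
 have moment: "(\<integral>k. cycle_poly lam k ^ j \<partial>cycle_law m n) = real D"
  if "fact n * int D * young_norm lam ^ j = (\<Sum>g\<in>Sym n. Theta lam n g ^ j)" for j n D
 proof -
  have "(\<integral>k. cycle_poly lam k ^ j \<partial>cycle_law m n) = (\<Sum>g\<in>Sym n. (real_of_int (Theta lam n g) / real_of_int (young_norm lam)) ^ j) / fact n"
   unfolding expectation_cycle_law m_def by (simp add: cycle_poly_Theta)
  also have "... = real_of_int (\<Sum>g\<in>Sym n. Theta lam n g ^ j) / (real_of_int (young_norm lam) ^ j * fact n)"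
   by (simp add: power_divide sum_divide_distrib[symmetric] of_int_sum)
  also have "... = real D" unfolding that[symmetric] by (simp add: young_norm_nonzero)
  finally show ?thesis .
 qed
 let ?f = "%k. cycle_poly lam k ^ (a + b)"
 obtain D where D: "dim_hom_unit indeterminate (mixed_tensor indeterminate x a b) = of_nat D"
   "\<And>n. n \<ge> (a + b) * m ==> fact n * int D * young_norm lam ^ (a + b) = (\<Sum>g\<in>Sym n. Theta lam n g ^ (a + b))"
  using dim[of a b] unfolding m_def by blast
 obtain D2 where D2: "\<And>n. n \<ge> ((a + b) * 2 + 0) * m ==>
   fact n * int D2 * young_norm lam ^ ((a + b) * 2 + 0) = (\<Sum>g\<in>Sym n. Theta lam n g ^ ((a + b) * 2 + 0))"
  using dim[of "(a + b) * 2" 0] unfolding m_def by blast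
 have sq: "eventually (%n. (\<integral>k. (?f k)\<^sup>2 \<partial>cycle_law m n) \<le> real D2) sequentially"
 proof (rule eventually_sequentiallyI)
  fix n assume "n \<ge> ((a + b) * 2 + 0) * m"
  from moment[OF D2[OF this]] show "(\<integral>k. (?f k)\<^sup>2 \<partial>cycle_law m n) \<le> real D2"
   by (simp only: add_0_right power_mult)
 qed
 show "integrable (poisson_law m) ?f"
  by (rule pmf_tendsto_bounded_second_moment(1)[OF cycle_law_limit finite_cycle_law sq])
 have lim: "(%n. \<integral>k. ?f k \<partial>cycle_law m n) \<longlonglongrightarrow> (\<integral>k. ?f k \<partial>poisson_law m)"
  by (rule pmf_tendsto_bounded_second_moment(2)[OF cycle_law_limit finite_cycle_law sq])
 have "eventually (%n. (\<integral>k. ?f k \<partial>cycle_law m n) = real D) sequentially"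
  by (rule eventually_sequentiallyI[of "(a + b) * m"]) (rule moment[OF D(2)])
 hence "(%n. \<integral>k. ?f k \<partial>cycle_law m n) \<longlonglongrightarrow> real D" by (rule tendsto_eventually)
 hence "(\<integral>k. ?f k \<partial>poisson_law m) = real D" using lim LIMSEQ_unique by blast
 thus "dim_hom_unit indeterminate (mixed_tensor indeterminate x a b)
     = complex_of_real (\<integral>k. ?f k \<partial>poisson_law m)" unfolding D(1) by simp
qed

lemma irr_char_cycle_poly:
 assumes g: "g \<in> Sym n" and n: "n \<ge> 2 * sum_list lam"
 shows "irr_char (padded lam n) g = complex_of_real (cycle_poly lam (cyc_count (sum_list lam) n g))"
proof -
 have "l \<le> n - sum_list lam" if "l \<in> set lam" for l using member_le_sum_list[OF that] n by linarith
 thus ?thesis unfolding cycle_poly_Theta[OF g] by (rule irr_char_padded[OF _ n g])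
qed

theorem theorem1p5:
  fixes m :: nat and lam :: "nat list" and x :: "complex poly fract rep_obj"
  assumes "m \<ge> 1" and "int_partition lam m"
    and "is_simple_obj indeterminate lam x"
  shows "\<exists>\<mu>. spectral_measure (Rep_S indeterminate) (dim_hom_unit indeterminate) x \<mu> \<and>
             converges_in_law
               (\<lambda>n. distr (measure_pmf (pmf_of_set (Sym n))) borel (irr_char (padded lam n))) \<mu>"
proof (intro exI conjI)
 have m: "sum_list lam = m" using assms(2) by (simp add: int_partition_def)
 let ?q = "%k. complex_of_real (cycle_poly lam k)"
 let ?\<mu> = "distr (measure_pmf (poisson_law m)) borel ?q"
 note moments = spectral_moments[OF assms(3), unfolded m]
 show "spectral_measure (Rep_S indeterminate) (dim_hom_unit indeterminate) x ?\<mu>"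
  unfolding spectral_measure_def
 proof (intro conjI allI)
  show "x \<in> Obj (Rep_S indeterminate)" by (rule mixed_tensor_dim(1)[OF indeterminate_nonzero assms(3)])
  show "sets ?\<mu> = sets borel" by simp
  fix a b :: nat
  have e: "?q k ^ a * cnj (?q k) ^ b = complex_of_real (cycle_poly lam k ^ (a + b))" for k
   by (simp add: power_add)
  have meas: "?q \<in> measurable (measure_pmf (poisson_law m)) borel" by simp
  have mz: "(%z::complex. z ^ a * cnj z ^ b) \<in> borel_measurable borel"
   by (intro borel_measurable_continuous_onI continuous_intros)
  show "integrable ?\<mu> (%z. z ^ a * cnj z ^ b)"
   unfolding integrable_distr_eq[OF meas mz] e by (rule integrable_of_real) (rule moments(1))
  show "(\<integral>z. z ^ a * cnj z ^ b \<partial>?\<mu>) = dim_hom_unit indeterminate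
    (mixed_tensor indeterminate x a b)"
   unfolding integral_distr[OF meas mz] e moments(2) by (rule integral_complex_of_real)
 qed
 show "converges_in_law (%n. distr (measure_pmf (pmf_of_set (Sym n))) borel (irr_char (padded lam n))) ?\<mu>"
  unfolding converges_in_law_def
 proof (intro allI impI)
  fix f :: "complex => real" assume f: "continuous_on UNIV f \<and> bounded (range f)"
  then obtain B where B: "\<And>z. \<bar>f z\<bar> \<le> B" unfolding bounded_iff by auto
  have fm: "f \<in> borel_measurable borel" using f by (intro borel_measurable_continuous_onI) simp
  have "(%n. \<integral>k. f (?q k) \<partial>cycle_law m n) \<longlonglongrightarrow> (\<integral>k. f (?q k) \<partial>poisson_law m)"
   by (rule pmf_tendsto_bounded[OF cycle_law_limit]) (rule B)
  moreover have "(\<integral>k. f (?q k) \<partial>poisson_law m) = (\<integral>z. f z \<partial>?\<mu>)"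
   by (rule integral_distr[OF _ fm, symmetric]) simp
  moreover have "eventually (%n. (\<integral>k. f (?q k) \<partial>cycle_law m n)
   = (\<integral>z. f z \<partial>distr (measure_pmf (pmf_of_set (Sym n))) borel (irr_char (padded lam n)))) sequentially"
  proof (rule eventually_sequentiallyI)
   fix n assume n: "n \<ge> 2 * sum_list lam"
   have "(\<integral>z. f z \<partial>distr (measure_pmf (pmf_of_set (Sym n))) borel (irr_char (padded lam n)))
    = (\<integral>g. f (irr_char (padded lam n) g) \<partial>pmf_of_set (Sym n))"
    by (rule integral_distr[OF _ fm]) simp
   also have "... = (\<Sum>g\<in>Sym n. f (irr_char (padded lam n) g)) / fact n"
    by (simp add: integral_pmf_of_set[OF Sym_nonempty finite_Sym] card_Sym)
   also have "... = (\<Sum>g\<in>Sym n. f (?q (cyc_count m n g))) / fact n"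
    using irr_char_cycle_poly[OF _ n] by (simp add: m)
   also have "... = (\<integral>k. f (?q k) \<partial>cycle_law m n)" by (rule expectation_cycle_law[symmetric])
   finally show "(\<integral>k. f (?q k) \<partial>cycle_law m n)
   = (\<integral>z. f z \<partial>distr (measure_pmf (pmf_of_set (Sym n))) borel (irr_char (padded lam n)))" ..
  qed
  ultimately show "(%n. \<integral>z. f z \<partial>distr (measure_pmf (pmf_of_set (Sym n))) borel (irr_char (padded lam n)))
   \<longlonglongrightarrow> (\<integral>z. f z \<partial>?\<mu>)" by (simp only: Lim_transform_eventually)
 qed
qed

end
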